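(* Let $M,N\ge 1$ and $U=U_q(\mathcal{L}\mathfrak{sl}(M,N))$. Let $U^{\pm}$ be the subalgebra of $U$ generated by the $X_{i,n}^{\pm}$ ($1\le i\le M+N-1$, $n\in\mathbb{Z}$), and $U^0$ the subalgebra generated by the $K_i^{\pm1},h_{i,s}$ ($1\le i\le M+N-1$, $s\in\mathbb{Z}_{\neq0}$). Then: (a) the multiplication map $U^-\otimes U^0\otimes U^+\to U$, $a\otimes b\otimes c\mapsto abc$, is an isomorphism of vector superspaces; (b) $U^{+}$ (resp. $U^-$) is isomorphic to the superalgebra with generators $X_{i,n}^{+}$ (resp. $X_{i,n}^-$), $1\le i\le M+N-1$, $n\in\mathbb{Z}$ (with $X_{M,n}^{\pm}$ odd and the others even), and the following relations taken with upper sign $+$ (resp. with lower sign $-$), for all $i,j$ and all $m,n,k,u\in\mathbb{Z}$: $$[X_{i,m}^{\pm},X_{j,n}^{\pm}]=0\quad\text{if } c_{i,j}=0,$$ $$X_{i,m+1}^{\pm}X_{j,n}^{\pm}-q^{\pm c_{i,j}}X_{j,n}^{\pm}X_{i,m+1}^{\pm}=q^{\pm c_{i,j}}X_{i,m}^{\pm}X_{j,n+1}^{\pm}-X_{j,n+1}^{\pm}X_{i,m}^{\pm}\quad\text{if } c_{i,j}\neq0,$$ $$[X_{i,m}^{\pm},[X_{i,n}^{\pm},X_{j,k}^{\pm}]_{q^{-1}}]_q+[X_{i,n}^{\pm},[X_{i,m}^{\pm},X_{j,k}^{\pm}]_{q^{-1}}]_q=0\quad\text{if } c_{i,j}=\pm1,\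 i\neq M,$$ and, when $M,N>1$, $$[[[X_{M-1,m}^{\pm},X_{M,n}^{\pm}]_{q^{-1}},X_{M+1,k}^{\pm}]_q,X_{M,u}^{\pm}]+[[[X_{M-1,m}^{\pm},X_{M,u}^{\pm}]_{q^{-1}},X_{M+1,k}^{\pm}]_q,X_{M,n}^{\pm}]=0;$$ (c) $U^0$ is the algebra of Laurent polynomials $$U^0\cong\mathbb{C}[h_{i,s}: s\in\mathbb{Z}_{\neq0},1\le i\le M+N-1][K_i,K_i^{-1}:1\le i\le M+N-1].$$
   Context: The ground field is $\mathbb{C}$, $q\in\mathbb{C}\setminus\{0\}$ is not a root of unity, $M,N\ge1$ are integers. A superalgebra is an associative unital algebra with a compatible $\mathbb{Z}_2$-grading; for homogeneous $a,b$ put $[a,b]_u=ab-(-1)^{|a||b|}u\,ba$ and $[a,b]=[a,b]_1$. Put $[n]_p=\frac{p^n-p^{-n}}{p-p^{-1}}$. Let $l_i=1$ for $1\le i\le M$, $l_i=-1$ for $M+1\le i\le M+N$, $q_i=q^{l_i}$, $(\epsilon_i,\epsilon_j)=l_i\delta_{i,j}$ on $\bigoplus_{i=1}^{M+N}\mathbb{Z}\epsilon_i$, and $c_{i,j}=(\epsilon_i-\epsilon_{i+1},\epsilon_j-\epsilon_{j+1})$ for $1\le i,j\le M+N-1$. $U_q(\mathcal{L}\mathfrak{sl}(M,N))$ is the superalgebra with generators $X_{i,n}^{\pm},K_i^{\pm1},h_{i,s}$ ($1\le i\le M+N-1$, $n\in\mathbb{Z}$, $s\in\mathbb{Z}_{\ne0}$),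 $X_{M,n}^{\pm}$ odd and all other generators even, and relations (all admissible indices): 1. $K_iK_i^{-1}=K_i^{-1}K_i=1$, $[K_i,K_j]=[K_i,h_{j,s}]=[h_{i,s},h_{j,t}]=0$; 2. $K_iX_{j,n}^{\pm}K_i^{-1}=q^{\pm c_{i,j}}X_{j,n}^{\pm}$, $[h_{i,s},X_{j,n}^{\pm}]=\pm\frac{[sl_ic_{i,j}]_{q_i}}{s}X_{j,n+s}^{\pm}$; 3. $[X_{i,m}^+,X_{j,n}^-]=\delta_{i,j}\frac{\phi_{i,m+n}^+-\phi_{i,m+n}^-}{q_i-q_i^{-1}}$, where $\sum_{n\in\mathbb{Z}}\phi_{i,n}^{\pm}z^n=K_i^{\pm1}\exp(\pm(q_i-q_i^{-1})\sum_{s>0}h_{i,\pm s}z^{\pm s})$ (a power series in $z^{\pm1}$); 4. the relations displayed in part (b) of the claim, both with the sign $+$ and with the sign $-$. *)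

theory Defs
  imports
    Complex_Main
    "HOL-Library.Z2"
    "HOL-Library.Poly_Mapping"
    "HOL-Computational_Algebra.Formal_Power_Series"
    "HOL-Algebra.QuotRing"
    "HOL-Algebra.Module"
begin

section \<open>Complex superspaces and superalgebras\<close>

text \<open>
  A record with a complex scalar multiplication and a family of homogeneous parts indexed by
  the field \<^typ>\<open>bit\<close> with two elements.  As for modules in HOL-Algebra, the
  multiplicative fields are meaningless where only the vector superspace matters.
\<close>

record 'a superalg = "(complex, 'a) module" +
  homog :: "bit \<Rightarrow> 'a set"

definition linear_iso ::
    "(complex, 'a, 'm) module_scheme \<Rightarrow> (complex, 'b, 'n) module_scheme \<Rightarrow> ('a \<Rightarrow> 'b) set"
  where "linear_iso V W = {f. bij_betw f (carrier V) (carrier W) \<and>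
    (\<forall>x\<in>carrier V. \<forall>y\<in>carrier V. f (x \<oplus>\<^bsub>V\<^esub> y) = f x \<oplus>\<^bsub>W\<^esub> f y) \<and>
    (\<forall>c. \<forall>x\<in>carrier V. f (c \<odot>\<^bsub>V\<^esub> x) = c \<odot>\<^bsub>W\<^esub> f x)}"

definition superspace_iso ::
    "('a, 'm) superalg_scheme \<Rightarrow> ('b, 'n) superalg_scheme \<Rightarrow> ('a \<Rightarrow> 'b) set"
  where "superspace_iso V W = {f \<in> linear_iso V W. \<forall>d. f ` homog V d = homog W d}"

definition algebra_iso ::
    "(complex, 'a, 'm) module_scheme \<Rightarrow> (complex, 'b, 'n) module_scheme \<Rightarrow> ('a \<Rightarrow> 'b) set"
  where "algebra_iso A B = ring_iso A B \<inter> linear_iso A B"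

definition superalgebra_iso ::
    "('a, 'm) superalg_scheme \<Rightarrow> ('b, 'n) superalg_scheme \<Rightarrow> ('a \<Rightarrow> 'b) set"
  where "superalgebra_iso A B = ring_iso A B \<inter> superspace_iso A B"

text \<open>The quotient by \<open>I\<close>: a two-sided ideal, or just a subspace if the ring
  multiplication is irrelevant.  It extends \<^const>\<open>FactRing\<close>.\<close>

definition quot_superalg :: "'a superalg \<Rightarrow> 'a set \<Rightarrow> 'a set superalg"
  where "quot_superalg A I =
    \<lparr>carrier = a_rcosets\<^bsub>A\<^esub> I, mult = rcoset_mult A I, one = I +>\<^bsub>A\<^esub> \<one>\<^bsub>A\<^esub>,
     zero = I, add = set_add A, smult = (\<lambda>c X. \<Union>x\<in>X. I +>\<^bsub>A\<^esub> (c \<odot>\<^bsub>A\<^esub> x)),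
     homog = (\<lambda>d. (\<lambda>x. I +>\<^bsub>A\<^esub> x) ` homog A d)\<rparr>"

definition is_subalgebra :: "'a superalg \<Rightarrow> 'a set \<Rightarrow> bool"
  where "is_subalgebra A B \<longleftrightarrow> B \<subseteq> carrier A \<and> \<zero>\<^bsub>A\<^esub> \<in> B \<and> \<one>\<^bsub>A\<^esub> \<in> B \<and>
    (\<forall>x\<in>B. \<forall>y\<in>B. x \<oplus>\<^bsub>A\<^esub> y \<in> B \<and> x \<otimes>\<^bsub>A\<^esub> y \<in> B) \<and> (\<forall>c. \<forall>x\<in>B. c \<odot>\<^bsub>A\<^esub> x \<in> B)"

definition generated_subalgebra :: "'a superalg \<Rightarrow> 'a set \<Rightarrow> 'a superalg"
  where "generated_subalgebra A S = (let B = \<Inter>{B. is_subalgebra A B \<and> S \<subseteq> B} in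
    A\<lparr>carrier := B, homog := (\<lambda>d. homog A d \<inter> B)\<rparr>)"


section \<open>Free superalgebras and presentations\<close>

datatype 'g word = Word (letters: "'g list")

instantiation word :: (type) monoid_add
begin

definition zero_word :: "'a word"
  where "zero_word = Word []"

definition plus_word :: "'a word \<Rightarrow> 'a word \<Rightarrow> 'a word"
  where "plus_word v w = Word (letters v @ letters w)"

instance
  by standard (auto simp: zero_word_def plus_word_def)

end

text \<open>By the previous instance this is the monoid algebra of the free monoid, that is, the free
  associative unital algebra on the elements of \<open>'g\<close>.\<close>

type_synonym 'g falg = "'g word \<Rightarrow>\<^sub>0 complex"

definition pm_scale :: "complex \<Rightarrow> ('k \<Rightarrow>\<^sub>0 complex) \<Rightarrow> ('k \<Rightarrow>\<^sub>0 complex)"  (infixr \<open>\<star>\<close> 75)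
  where "c \<star> p = Poly_Mapping.map ((*) c) p"

lemma lookup_pm_scale [simp]: "Poly_Mapping.lookup (c \<star> p) k = c * Poly_Mapping.lookup p k"
  by (simp add: pm_scale_def Poly_Mapping.map.rep_eq when_def)

interpretation pmap: vector_space pm_scale
  by standard (auto intro!: poly_mapping_eqI simp: lookup_add algebra_simps)

definition gen :: "'g \<Rightarrow> 'g falg"
  where "gen g = Poly_Mapping.single (Word [g]) 1"

definition fhomog :: "('g \<Rightarrow> bit) \<Rightarrow> bit \<Rightarrow> 'g falg set"
  where "fhomog par d = {p. \<forall>w\<in>Poly_Mapping.keys p. sum_list (map par (letters w)) = d}"

definition free_superalg :: "'g set \<Rightarrow> ('g \<Rightarrow> bit) \<Rightarrow> 'g falg superalg"
  where "free_superalg G par = (let C = {p. \<forall>w\<in>Poly_Mapping.keys p. set (letters w) \<subseteq> G} in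
    \<lparr>carrier = C, mult = (*), one = 1, zero = 0, add = (+), smult = (\<star>),
     homog = (\<lambda>d. fhomog par d \<inter> C)\<rparr>)"

definition presented :: "'g set \<Rightarrow> ('g \<Rightarrow> bit) \<Rightarrow> 'g falg set \<Rightarrow> 'g falg set superalg"
  where "presented G par R = quot_superalg (free_superalg G par) (Idl\<^bsub>free_superalg G par\<^esub> R)"

definition presented_class :: "'g set \<Rightarrow> ('g \<Rightarrow> bit) \<Rightarrow> 'g falg set \<Rightarrow> 'g falg \<Rightarrow> 'g falg set"
  where "presented_class G par R x =
    (Idl\<^bsub>free_superalg G par\<^esub> R) +>\<^bsub>free_superalg G par\<^esub> x"

text \<open>\<^const>\<open>genideal\<close> is an intersection of ideals in the sense of HOL-Algebra, which
  exist only in rings.\<close>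

lemma ring_free_superalg: "ring (free_superalg G par)"
proof -
  define C where "C = {p :: 'a falg. \<forall>w\<in>Poly_Mapping.keys p. set (letters w) \<subseteq> G}"
  have add: "p + r \<in> C" if "p \<in> C" "r \<in> C" for p r
    using that Poly_Mapping.keys_add[of p r] by (auto simp: C_def)
  have neg: "- p \<in> C" if "p \<in> C" for p
    using that by (auto simp: C_def)
  have one: "1 \<in> C"
    by (auto simp: C_def zero_word_def split: if_splits)
  have mult: "p * r \<in> C" if "p \<in> C" "r \<in> C" for p r
  proof -
    have "set (letters w) \<subseteq> G" if w: "w \<in> Poly_Mapping.keys (p * r)" for w
    proof -
      from w keys_mult[of p r] obtain u v
        where "w = u + v" "u \<in> Poly_Mapping.keys p" "v \<in> Poly_Mapping.keys r"
        by blast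
      then show ?thesis
        using \<open>p \<in> C\<close> \<open>r \<in> C\<close> by (auto simp: C_def plus_word_def)
    qed
    then show ?thesis by (simp add: C_def)
  qed
  have zero: "0 \<in> C" by (simp add: C_def)
  show ?thesis
    unfolding free_superalg_def Let_def C_def[symmetric]
    by (intro ringI abelian_groupI monoidI)
      (auto simp: add mult one zero algebra_simps intro: bexI[OF _ neg])
qed

text \<open>The supercommutator of homogeneous elements of a free superalgebra with weight \<open>u\<close>.\<close>

definition sbr :: "('g \<Rightarrow> bit) \<Rightarrow> complex \<Rightarrow> 'g falg \<Rightarrow> 'g falg \<Rightarrow> 'g falg"
  where "sbr par u a b =
    a * b - ((if a \<in> fhomog par 1 \<and> b \<in> fhomog par 1 then - 1 else 1) * u) \<star> (b * a)"


section \<open>Tensor products of superspaces\<close>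

text \<open>The superspace spanned by the symbols in \<open>B\<close>, subject to no relation.  The spans of the
  \<open>H d\<close> need not form a grading here; they are used only for their images in
  the tensor product.\<close>

definition free_superspace :: "'k set \<Rightarrow> (bit \<Rightarrow> 'k set) \<Rightarrow> ('k \<Rightarrow>\<^sub>0 complex) superalg"
  where "free_superspace B H =
    \<lparr>carrier = {p. Poly_Mapping.keys p \<subseteq> B}, mult = undefined, one = undefined,
     zero = 0, add = (+), smult = (\<star>), homog = (\<lambda>d. {p. Poly_Mapping.keys p \<subseteq> H d})\<rparr>"

definition tensor_free ::
    "'a superalg \<Rightarrow> 'b superalg \<Rightarrow> ('a \<times> 'b \<Rightarrow>\<^sub>0 complex) superalg"
  where "tensor_free V W = free_superspace (carrier V \<times> carrier W)
    (\<lambda>d. \<Union>{homog V a \<times> homog W b | a b. a + b = d})"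

definition tensor_relators :: "'a superalg \<Rightarrow> 'b superalg \<Rightarrow> ('a \<times> 'b \<Rightarrow>\<^sub>0 complex) set"
  where "tensor_relators V W = (let s = (\<lambda>v w. Poly_Mapping.single (v, w) (1::complex)) in
    {s (v \<oplus>\<^bsub>V\<^esub> v') w - s v w - s v' w | v v' w.
       v \<in> carrier V \<and> v' \<in> carrier V \<and> w \<in> carrier W} \<union>
    {s v (w \<oplus>\<^bsub>W\<^esub> w') - s v w - s v w' | v w w'.
       v \<in> carrier V \<and> w \<in> carrier W \<and> w' \<in> carrier W} \<union>
    {s (c \<odot>\<^bsub>V\<^esub> v) w - c \<star> s v w | c v w. v \<in> carrier V \<and> w \<in> carrier W} \<union>
    {s v (c \<odot>\<^bsub>W\<^esub> w) - c \<star> s v w | c v w. v \<in> carrier V \<and> w \<in> carrier W})"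

definition tensor :: "'a superalg \<Rightarrow> 'b superalg \<Rightarrow> ('a \<times> 'b \<Rightarrow>\<^sub>0 complex) set superalg"
  where "tensor V W = quot_superalg (tensor_free V W) (pmap.span (tensor_relators V W))"

definition pure_tensor ::
    "'a superalg \<Rightarrow> 'b superalg \<Rightarrow> 'a \<Rightarrow> 'b \<Rightarrow> ('a \<times> 'b \<Rightarrow>\<^sub>0 complex) set"
  where "pure_tensor V W v w =
    pmap.span (tensor_relators V W) +>\<^bsub>tensor_free V W\<^esub> Poly_Mapping.single (v, w) 1"


section \<open>The quantum loop superalgebra of sl(M,N)\<close>

definition qnum :: "complex \<Rightarrow> int \<Rightarrow> complex"
  where "qnum p n = (p powi n - p powi (- n)) / (p - inverse p)"

definition lsgn :: "nat \<Rightarrow> nat \<Rightarrow> int"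
  where "lsgn M i = (if i \<le> M then 1 else - 1)"

definition qi :: "nat \<Rightarrow> complex \<Rightarrow> nat \<Rightarrow> complex"
  where "qi M q i = q powi lsgn M i"

definition weight_form :: "nat \<Rightarrow> nat \<Rightarrow> (nat \<Rightarrow>\<^sub>0 int) \<Rightarrow> (nat \<Rightarrow>\<^sub>0 int) \<Rightarrow> int"
  where "weight_form M N x y =
    (\<Sum>k=1..M+N. lsgn M k * Poly_Mapping.lookup x k * Poly_Mapping.lookup y k)"

definition simple_root :: "nat \<Rightarrow> (nat \<Rightarrow>\<^sub>0 int)"
  where "simple_root i = Poly_Mapping.single i 1 - Poly_Mapping.single (i + 1) 1"

definition cartan :: "nat \<Rightarrow> nat \<Rightarrow> nat \<Rightarrow> nat \<Rightarrow> int"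
  where "cartan M N i j = weight_form M N (simple_root i) (simple_root j)"

definition nodes :: "nat \<Rightarrow> nat \<Rightarrow> nat set"
  where "nodes M N = {1..M + N - 1}"

datatype sign = Plus | Minus

fun sgnv :: "sign \<Rightarrow> int"
  where "sgnv Plus = 1" | "sgnv Minus = - 1"

text \<open>\<open>KG Plus i\<close> and \<open>KG Minus i\<close> are the generators $K_i$ and $K_i^{-1}$.\<close>

datatype lgen = XG sign nat int | KG sign nat | HG nat int

definition gens :: "nat \<Rightarrow> nat \<Rightarrow> lgen set"
  where "gens M N = {XG e i n | e i n. i \<in> nodes M N} \<union> {KG e i | e i. i \<in> nodes M N} \<union>
    {HG i s | i s. i \<in> nodes M N \<and> s \<noteq> 0}"

fun gpar :: "nat \<Rightarrow> lgen \<Rightarrow> bit"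
  where
    "gpar M (XG e i n) = (if i = M then 1 else 0)"
  | "gpar M (KG e i) = 0"
  | "gpar M (HG i s) = 0"

abbreviation Xg where "Xg e i n \<equiv> gen (XG e i n)"
abbreviation Kg where "Kg e i \<equiv> gen (KG e i)"
abbreviation Hg where "Hg i s \<equiv> gen (HG i s)"

text \<open>The exponential of a power series over the (noncommutative) free algebra, for a series with
  vanishing constant term.\<close>

definition falg_exp :: "'g falg fps \<Rightarrow> 'g falg fps"
  where "falg_exp A = fps_compose (Abs_fps (\<lambda>k. Poly_Mapping.single 0 (1 / fact k))) A"

text \<open>The superscript \<open>Plus\<close> gives a power series in $z$ and \<open>Minus\<close> one
  in $z^{-1}$; in both cases the formal variable of \<^typ>\<open>'a fps\<close> stands for $z^{\pm 1}$ and
  \<open>phi M q e i n\<close> is the coefficient of $z^n$.  It is a lift to the free algebra, where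
  the \<open>h\<close> do not commute; only its class modulo the relations matters.\<close>

definition phi :: "nat \<Rightarrow> complex \<Rightarrow> sign \<Rightarrow> nat \<Rightarrow> int \<Rightarrow> lgen falg"
  where "phi M q e i n = (if sgnv e * n < 0 then 0 else
    Kg e i * fps_nth (falg_exp (Abs_fps (\<lambda>s. if s = 0 then 0
        else (of_int (sgnv e) * (qi M q i - inverse (qi M q i))) \<star> Hg i (sgnv e * int s))))
      (nat (sgnv e * n)))"

text \<open>The relations among the currents of a fixed sign, for an arbitrary family
  \<open>x i n\<close> of generators of some free superalgebra with parities \<open>par\<close>.  Every relation,
  here and below, is represented by the difference of its two sides.\<close>

definition current_rels ::
    "nat \<Rightarrow> nat \<Rightarrow> complex \<Rightarrow> ('g \<Rightarrow> bit) \<Rightarrow> sign \<Rightarrow> (nat \<Rightarrow> int \<Rightarrow> 'g falg) \<Rightarrow> 'g falg set"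
  where "current_rels M N q par e x =
    {sbr par 1 (x i m) (x j n) | i j m n.
       i \<in> nodes M N \<and> j \<in> nodes M N \<and> cartan M N i j = 0} \<union>
    {(x i (m + 1) * x j n - (q powi (sgnv e * cartan M N i j)) \<star> (x j n * x i (m + 1)))
       - ((q powi (sgnv e * cartan M N i j)) \<star> (x i m * x j (n + 1)) - x j (n + 1) * x i m) | i j m n.
       i \<in> nodes M N \<and> j \<in> nodes M N \<and> cartan M N i j \<noteq> 0} \<union>
    {sbr par q (x i m) (sbr par (inverse q) (x i n) (x j k))
       + sbr par q (x i n) (sbr par (inverse q) (x i m) (x j k)) | i j m n k.
       i \<in> nodes M N \<and> j \<in> nodes M N \<and> cartan M N i j \<in> {1, - 1} \<and> i \<noteq> M} \<union>
    {sbr par 1 (sbr par q (sbr par (inverse q) (x (M - 1) m) (x M n)) (x (M + 1) k)) (x M u)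
       + sbr par 1 (sbr par q (sbr par (inverse q) (x (M - 1) m) (x M u)) (x (M + 1) k)) (x M n)
       | m n k u. M > 1 \<and> N > 1}"

definition loop_rels :: "nat \<Rightarrow> nat \<Rightarrow> complex \<Rightarrow> lgen falg set"
  where "loop_rels M N q =
    {Kg e i * Kg e' i - 1 | e e' i. i \<in> nodes M N \<and> e \<noteq> e'} \<union>
    {sbr (gpar M) 1 (Kg Plus i) (Kg Plus j) | i j. i \<in> nodes M N \<and> j \<in> nodes M N} \<union>
    {sbr (gpar M) 1 (Kg Plus i) (Hg j s) | i j s. i \<in> nodes M N \<and> j \<in> nodes M N \<and> s \<noteq> 0} \<union>
    {sbr (gpar M) 1 (Hg i s) (Hg j t) | i j s t.
       i \<in> nodes M N \<and> j \<in> nodes M N \<and> s \<noteq> 0 \<and> t \<noteq> 0} \<union>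
    {Kg Plus i * Xg e j n * Kg Minus i - (q powi (sgnv e * cartan M N i j)) \<star> Xg e j n | e i j n.
       i \<in> nodes M N \<and> j \<in> nodes M N} \<union>
    {sbr (gpar M) 1 (Hg i s) (Xg e j n)
       - (of_int (sgnv e) * qnum (qi M q i) (s * lsgn M i * cartan M N i j) / of_int s)
         \<star> Xg e j (n + s) | e i j n s.
       i \<in> nodes M N \<and> j \<in> nodes M N \<and> s \<noteq> 0} \<union>
    {sbr (gpar M) 1 (Xg Plus i m) (Xg Minus j n)
       - (if i = j then (1 / (qi M q i - inverse (qi M q i)))
                          \<star> (phi M q Plus i (m + n) - phi M q Minus i (m + n)) else 0) | i j m n.
       i \<in> nodes M N \<and> j \<in> nodes M N} \<union>
    (\<Union>e. current_rels M N q (gpar M) e (Xg e))"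

definition Uq :: "nat \<Rightarrow> nat \<Rightarrow> complex \<Rightarrow> lgen falg set superalg"
  where "Uq M N q = presented (gens M N) (gpar M) (loop_rels M N q)"

definition Uq_gen :: "nat \<Rightarrow> nat \<Rightarrow> complex \<Rightarrow> lgen \<Rightarrow> lgen falg set"
  where "Uq_gen M N q g = presented_class (gens M N) (gpar M) (loop_rels M N q) (gen g)"

definition Uq_pm :: "nat \<Rightarrow> nat \<Rightarrow> complex \<Rightarrow> sign \<Rightarrow> lgen falg set superalg"
  where "Uq_pm M N q e =
    generated_subalgebra (Uq M N q) {Uq_gen M N q (XG e i n) | i n. i \<in> nodes M N}"

definition Uq_0 :: "nat \<Rightarrow> nat \<Rightarrow> complex \<Rightarrow> lgen falg set superalg"
  where "Uq_0 M N q = generated_subalgebra (Uq M N q)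
    ({Uq_gen M N q (KG e i) | e i. i \<in> nodes M N} \<union>
     {Uq_gen M N q (HG i s) | i s. i \<in> nodes M N \<and> s \<noteq> 0})"

text \<open>The superalgebra presented by the currents of one sign alone; the generator indexed by
  \<open>(i, n)\<close> is $X_{i,n}^{\pm}$.\<close>

definition hgens :: "nat \<Rightarrow> nat \<Rightarrow> (nat \<times> int) set"
  where "hgens M N = nodes M N \<times> UNIV"

definition hpar :: "nat \<Rightarrow> nat \<times> int \<Rightarrow> bit"
  where "hpar M = (\<lambda>(i, n). if i = M then 1 else 0)"

definition half_rels :: "nat \<Rightarrow> nat \<Rightarrow> complex \<Rightarrow> sign \<Rightarrow> (nat \<times> int) falg set"
  where "half_rels M N q e = current_rels M N q (hpar M) e (\<lambda>i n. gen (i, n))"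

definition half_alg :: "nat \<Rightarrow> nat \<Rightarrow> complex \<Rightarrow> sign \<Rightarrow> (nat \<times> int) falg set superalg"
  where "half_alg M N q e = presented (hgens M N) (hpar M) (half_rels M N q e)"

definition half_gen :: "nat \<Rightarrow> nat \<Rightarrow> complex \<Rightarrow> sign \<Rightarrow> nat \<Rightarrow> int \<Rightarrow> (nat \<times> int) falg set"
  where "half_gen M N q e i n = presented_class (hgens M N) (hpar M) (half_rels M N q e) (gen (i, n))"

text \<open>Laurent polynomials in the \<open>K\<close> with coefficients in the polynomial ring in the
  \<open>h\<close>: outer keys are exponents of the \<open>K\<close>, inner keys those of the \<open>h\<close>.\<close>

type_synonym laurent = "(nat \<Rightarrow>\<^sub>0 int) \<Rightarrow>\<^sub>0 ((nat \<times> int) \<Rightarrow>\<^sub>0 nat) \<Rightarrow>\<^sub>0 complex"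

definition laurent_alg :: "nat \<Rightarrow> nat \<Rightarrow> (complex, laurent) module"
  where "laurent_alg M N =
    \<lparr>carrier = {p. \<forall>k\<in>Poly_Mapping.keys p. Poly_Mapping.keys k \<subseteq> nodes M N \<and>
        (\<forall>w\<in>Poly_Mapping.keys (Poly_Mapping.lookup p k).
           Poly_Mapping.keys w \<subseteq> nodes M N \<times> (UNIV - {0}))},
     mult = (*), one = 1, zero = 0, add = (+),
     smult = (\<lambda>c p. Poly_Mapping.single 0 (Poly_Mapping.single 0 c) * p)\<rparr>"

definition laurent_K :: "sign \<Rightarrow> nat \<Rightarrow> laurent"
  where "laurent_K e i = Poly_Mapping.single (Poly_Mapping.single i (sgnv e)) 1"

definition laurent_h :: "nat \<Rightarrow> int \<Rightarrow> laurent"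
  where "laurent_h i s = Poly_Mapping.single 0 (Poly_Mapping.single (Poly_Mapping.single (i, s) 1) 1)"

end

theory Submission
  imports Defs
begin

text \<open>
  Let \<open>V\<close> be the free module over the Laurent polynomials in the \<open>K\<close> and \<open>h\<close> with basis all words.
  The free algebra acts on \<open>V\<close>: the \<open>X\<^sup>-\<close> by left multiplication, \<open>K\<close> and \<open>h\<close> by multiplication
  composed with an automorphism or corrected by a derivation of the words, and \<open>X\<^sup>+\<close> by prepending a
  letter to words that do not start with some \<open>X\<^sup>-\<close> and by the commutation relation to the others.
  Let \<open>W\<close> be the two-sided submodule generated by the relations among the currents of one sign.  All
  defining relations map \<open>V\<close> into \<open>W\<close>; for the relations among the \<open>X\<^sup>+\<close> (and dually, for the stability
  of \<open>W\<close> under the \<open>X\<^sup>+\<close>) the point is that the supercommutator of each of them with any current of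
  the opposite sign is a consequence of the quadratic relations, after clearing denominators.
  Hence \<open>p\<close> in the ideal of relations satisfies \<open>p \<cdot> 1 \<in> W\<close>, and reading this off for
  words in one kind of generators yields the presentations of the halves and the freeness of the
  Cartan part.  Normally ordered words span by straightening; that the spanning is
  without further relations also follows from \<open>p \<cdot> 1 \<in> W\<close>, once the Cartan part has been moved across the
  letters \<open>X\<^sup>+\<close>.
\<close>

text \<open>The obstacle is the compatibility of the higher relations with the opposite currents.
  Crossing such a relation with an opposite current replaces one of its letters by the commutator
  series \<open>g\<close>, which is infinite in both directions, and for such series a factor
  \<open>1 - s z / x\<close> cannot be cancelled: the delta series is annihilated by it. But
  \<open>g\<close> is a multiple of the difference of two one-sided series satisfying the same
  exchange relation, the expressions are linear in the series, and for a one-sided series the factor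
  can be cancelled. What is left after multiplying by the factors is a combination of quadratic
  relations, so these must be settled before the higher ones.

  The same crossing argument is used for the two signs with opposite aims. Negative currents act by
  left multiplication, so negative relations map everything into \<open>W\<close> at once, and
  crossing shows that positive currents preserve \<open>W\<close>. This stability is then an
  ingredient in proving that the positive relations map everything into \<open>W\<close>. Laurent
  polynomials as coefficients let the Cartan part survive in the module without any
  collapse.\<close>

abbreviation (input) "lk \<equiv> Poly_Mapping.lookup"
abbreviation (input) "sgl \<equiv> Poly_Mapping.single"
abbreviation (input) "pkeys \<equiv> Poly_Mapping.keys"

section \<open>Finitely supported functions, linear extension and free algebras\<close>

lemma pm_sum_single: "(p :: 'k \<Rightarrow>\<^sub>0 'c::comm_monoid_add) = (\<Sum>k\<in>pkeys p. sgl k (lk p k))"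
proof (rule poly_mapping_eqI)
  fix k
  show "lk p k = lk (\<Sum>k\<in>pkeys p. sgl k (lk p k)) k"
    by (simp add: lookup_sum lookup_single when_def in_keys_iff if_distrib cong: if_cong)
qed

lemma pm_induct_on [consumes 1, case_names zero single add]:
  fixes p :: "'k \<Rightarrow>\<^sub>0 'c::comm_monoid_add"
  assumes "pkeys p \<subseteq> S" and z: "P 0" and s: "\<And>k c. k \<in> S \<Longrightarrow> P (sgl k c)"
    and a: "\<And>p r. pkeys p \<subseteq> S \<Longrightarrow> pkeys r \<subseteq> S \<Longrightarrow> P p \<Longrightarrow> P r \<Longrightarrow> P (p + r)"
  shows "P p"
proof -
  have "pkeys (\<Sum>k\<in>A. sgl k (lk p k)) \<subseteq> S \<and> P (\<Sum>k\<in>A. sgl k (lk p k))" if "finite A" "A \<subseteq> S" for A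
    using that
  proof (induction rule: finite_induct)
    case empty
    then show ?case by (simp add: z)
  next
    case (insert k A)
    have 1: "pkeys (sgl k (lk p k)) \<subseteq> S" using insert.prems by (simp split: if_splits)
    have 2: "pkeys (sgl k (lk p k) + (\<Sum>k\<in>A. sgl k (lk p k))) \<subseteq> S"
      using 1 insert Poly_Mapping.keys_add[of "sgl k (lk p k)" "\<Sum>k\<in>A. sgl k (lk p k)"] by blast
    show ?case using insert 1 2 a s by (simp add: insert)
  qed
  from this[of "pkeys p"] assms(1) show ?thesis using pm_sum_single[of p] by simp
qed

lemma pm_induct [case_names zero single add]:
  fixes p :: "'k \<Rightarrow>\<^sub>0 'c::comm_monoid_add"
  assumes "P 0" "\<And>k c. P (sgl k c)" "\<And>p r. P p \<Longrightarrow> P r \<Longrightarrow> P (p + r)"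
  shows "P p"
  by (rule pm_induct_on[of p UNIV]) (use assms in auto)

text \<open>The scaling of the target is an argument because one type carries several module
  structures: \<open>vmod\<close> is scaled both by complex numbers and by Laurent
  polynomials.\<close>

definition lext :: "('c::zero \<Rightarrow> 'b \<Rightarrow> 'b::comm_monoid_add) \<Rightarrow> ('k \<Rightarrow> 'b) \<Rightarrow> ('k \<Rightarrow>\<^sub>0 'c) \<Rightarrow> 'b"
  where "lext sc f p = (\<Sum>k\<in>pkeys p. sc (lk p k) (f k))"

context Modules.module
begin

lemma lext_superset:
  assumes "finite A" "pkeys p \<subseteq> A"
  shows "lext scale f p = (\<Sum>k\<in>A. scale (lk p k) (f k))"
  unfolding lext_def by (rule sum.mono_neutral_left) (use assms in \<open>auto simp: in_keys_iff\<close>)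

lemma lext_zero [simp]: "lext scale f 0 = 0"
  by (simp add: lext_def)

lemma lext_add: "lext scale f (p + r) = lext scale f p + lext scale f r"
proof -
  let ?A = "pkeys p \<union> pkeys r"
  have "lext scale f (p + r) = (\<Sum>k\<in>?A. scale (lk (p + r) k) (f k))"
    using Poly_Mapping.keys_add[of p r] by (intro lext_superset) auto
  also have "\<dots> = (\<Sum>k\<in>?A. scale (lk p k) (f k)) + (\<Sum>k\<in>?A. scale (lk r k) (f k))"
    by (simp add: lookup_add scale_left_distrib sum.distrib)
  also have "\<dots> = lext scale f p + lext scale f r"
    by (intro arg_cong2[where f = "(+)"] lext_superset[symmetric]) auto
  finally show ?thesis .
qed

lemma lext_single [simp]: "lext scale f (sgl k c) = scale c (f k)"
  by (simp add: lext_def)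

lemma lext_uminus: "lext scale f (- p) = - lext scale f p"
  using lext_add[where f = f and p = p and r = "- p"] by (simp add: minus_unique)

lemma lext_diff: "lext scale f (p - r) = lext scale f p - lext scale f r"
  using lext_add[where f = f and p = p and r = "- r"] by (simp add: lext_uminus)

lemma lext_sum: "lext scale f (sum g A) = (\<Sum>x\<in>A. lext scale f (g x))"
  by (induction A rule: infinite_finite_induct) (auto simp: lext_add)

lemma lext_cong: "(\<And>k. k \<in> pkeys p \<Longrightarrow> f k = g k) \<Longrightarrow> lext scale f p = lext scale g p"
  by (simp add: lext_def)

end

lemma (in vector_space) module_scale: "Modules.module scale" ..

text \<open>\<open>pm_scale\<close> over an arbitrary commutative ring; the module
  \<open>vmod\<close> has Laurent polynomials as coefficients.\<close>

definition pscale :: "'c::comm_ring_1 \<Rightarrow> ('k \<Rightarrow>\<^sub>0 'c) \<Rightarrow> ('k \<Rightarrow>\<^sub>0 'c)"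
  where "pscale c p = Poly_Mapping.map ((*) c) p"

lemma lookup_pscale [simp]: "lk (pscale c p) k = c * lk p k"
  by (simp add: pscale_def Poly_Mapping.map.rep_eq when_def)

lemma pm_scale_pscale: "pm_scale = pscale"
  by (rule ext)+ (simp add: pscale_def pm_scale_def)

global_interpretation pmod: Modules.module "pscale :: 'c::comm_ring_1 \<Rightarrow> ('k \<Rightarrow>\<^sub>0 'c) \<Rightarrow> _"
  by standard (auto intro!: poly_mapping_eqI simp: lookup_add algebra_simps)

lemma pscale_single [simp]: "pscale c (sgl k d) = sgl k (c * d)"
  by (rule poly_mapping_eqI) (simp add: lookup_single when_def)

lemma pm_scale_single [simp]: "c \<star> sgl k d = sgl k (c * d)"
  by (simp add: pm_scale_pscale)

lemma pscale_mult_left: "pscale c p * r = pscale c (p * r)"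
  for r :: "'k::monoid_add \<Rightarrow>\<^sub>0 'c::comm_ring_1"
  by (simp add: pscale_def mult_map_scale_conv_mult mult.assoc)

lemma single_0_central: "sgl 0 c * p = p * sgl 0 c"
  for p :: "'k::monoid_add \<Rightarrow>\<^sub>0 'c::comm_ring_1"
  by (induction p rule: pm_induct) (auto simp: mult_single distrib_left distrib_right mult.commute)

lemma pscale_mult_right: "p * pscale c r = pscale c (p * r)"
  for r :: "'k::monoid_add \<Rightarrow>\<^sub>0 'c::comm_ring_1"
  by (simp add: pscale_def mult_map_scale_conv_mult) (metis mult.assoc single_0_central)

lemma pscale_linear_ext:
  assumes "Modules.module sc"
  shows "lext sc f (pscale c p) = sc c (lext sc f p)"
proof -
  interpret Modules.module sc by fact
  show ?thesis
    by (induction p rule: pm_induct) (auto simp: lext_add scale_right_distrib pmod.scale_right_distrib)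
qed

lemma lext_pm_scale: "Modules.module sc \<Longrightarrow> lext sc f (c \<star> p) = sc c (lext sc f p)"
  by (simp add: pm_scale_pscale pscale_linear_ext)

text \<open>One development serves the free algebra, the Laurent polynomials, the words with Laurent
  coefficients and their endomorphisms; relations are stated once and transported by
  \<open>eval\<close>.\<close>

locale calg = vector_space scale for scale :: "complex \<Rightarrow> 'a::ring_1 \<Rightarrow> 'a" +
  assumes scale_mult_left: "scale c x * y = scale c (x * y)"
    and scale_mult_right: "x * scale c y = scale c (x * y)"

text \<open>The universal property of the free algebra: the homomorphism determined by the images
  \<open>lt\<close> of the generators.\<close>

definition eval :: "(complex \<Rightarrow> 'a \<Rightarrow> 'a::ring_1) \<Rightarrow> ('g \<Rightarrow> 'a) \<Rightarrow> 'g falg \<Rightarrow> 'a"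
  where "eval sc lt = lext sc (\<lambda>w. prod_list (map lt (letters w)))"

interpretation falg: calg "pm_scale :: complex \<Rightarrow> 'g falg \<Rightarrow> 'g falg"
  by standard (auto simp: pm_scale_pscale pscale_mult_left pscale_mult_right)

text \<open>Unlike \<open>gen\<close>, available over any coefficient semiring, so that
  \<open>falg\<close> and \<open>vmod\<close> share one notation for words.\<close>

definition wd :: "'g list \<Rightarrow> ('g word \<Rightarrow>\<^sub>0 'c::semiring_1)"
  where "wd xs = sgl (Word xs) 1"

lemma wd_Nil [simp]: "wd [] = 1"
  by (simp add: wd_def zero_word_def[symmetric])

lemma wd_append: "wd (xs @ ys) = wd xs * wd ys"
  by (simp add: wd_def mult_single plus_word_def)

lemma wd_Cons: "wd (x # xs) = wd [x] * wd xs"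
  using wd_append[of "[x]" xs] by simp

lemma gen_wd: "gen g = wd [g]"
  by (simp add: gen_def wd_def)

lemma falg_induct_on [consumes 1, case_names zero wd add]:
  fixes p :: "'g word \<Rightarrow>\<^sub>0 'c::comm_ring_1"
  assumes "\<forall>w\<in>pkeys p. set (letters w) \<subseteq> S" and z: "P 0"
    and s: "\<And>xs c. set xs \<subseteq> S \<Longrightarrow> P (pscale c (wd xs))"
    and a: "\<And>p r. \<forall>w\<in>pkeys p. set (letters w) \<subseteq> S \<Longrightarrow>
      \<forall>w\<in>pkeys r. set (letters w) \<subseteq> S \<Longrightarrow> P p \<Longrightarrow> P r \<Longrightarrow> P (p + r)"
  shows "P p"
proof (rule pm_induct_on[of p "{w. set (letters w) \<subseteq> S}"])
  show "P (sgl w c)" if "w \<in> {w. set (letters w) \<subseteq> S}" for w c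
    using s[of "letters w" c] that by (simp add: wd_def)
qed (use assms(1) z a in \<open>auto simp: subset_iff\<close>)

lemma falg_induct [case_names zero wd add]:
  fixes p :: "'g word \<Rightarrow>\<^sub>0 'c::comm_ring_1"
  assumes "P 0" "\<And>xs c. P (pscale c (wd xs))" "\<And>p r. P p \<Longrightarrow> P r \<Longrightarrow> P (p + r)"
  shows "P p"
  by (rule falg_induct_on[of p UNIV]) (use assms in auto)

context calg
begin

lemma eval_zero [simp]: "eval scale lt 0 = 0"
  by (simp add: eval_def)

lemma eval_add: "eval scale lt (p + r) = eval scale lt p + eval scale lt r"
  by (simp add: eval_def lext_add)

lemma eval_uminus: "eval scale lt (- p) = - eval scale lt p"
  by (simp add: eval_def lext_uminus)

lemma eval_diff: "eval scale lt (p - r) = eval scale lt p - eval scale lt r"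
  by (simp add: eval_def lext_diff)

lemma eval_sum: "eval scale lt (sum g A) = (\<Sum>x\<in>A. eval scale lt (g x))"
  by (simp add: eval_def lext_sum)

lemma eval_scale: "eval scale lt (c \<star> p) = scale c (eval scale lt p)"
  by (simp add: eval_def lext_pm_scale module_scale)

lemma eval_wd [simp]: "eval scale lt (wd xs) = prod_list (map lt xs)"
  by (simp add: eval_def wd_def)

lemma eval_gen [simp]: "eval scale lt (gen g) = lt g"
  by (simp add: gen_wd)

lemma eval_one [simp]: "eval scale lt 1 = 1"
  using eval_wd[of lt "[]"] by simp

lemma eval_mult: "eval scale lt (p * r) = eval scale lt p * eval scale lt r"
proof (induction p rule: falg_induct)
  case (wd xs c)
  show ?case
  proof (induction r rule: falg_induct)
    case (wd ys d)
    show ?case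
      by (simp add: pm_scale_pscale[symmetric] falg.scale_mult_left falg.scale_mult_right eval_scale
          wd_append[symmetric] scale_mult_left scale_mult_right mult.commute)
  qed (auto simp: distrib_left eval_add)
qed (auto simp: distrib_right eval_add)

lemma eval_power: "eval scale lt (p ^ n) = eval scale lt p ^ n"
  by (induction n) (auto simp: eval_mult)

lemma eval_cong:
  assumes "\<And>w g. w \<in> pkeys p \<Longrightarrow> g \<in> set (letters w) \<Longrightarrow> lt g = lt' g"
  shows "eval scale lt p = eval scale lt' p"
  unfolding eval_def
proof (rule lext_cong)
  fix w assume "w \<in> pkeys p"
  then have "map lt (letters w) = map lt' (letters w)" using assms by (intro map_cong) auto
  then show "prod_list (map lt (letters w)) = prod_list (map lt' (letters w))" by (rule arg_cong)
qed

lemmas eval_simps = eval_add eval_diff eval_uminus eval_scale eval_mult eval_power eval_sum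

section \<open>Moving a Cartan series across two currents\<close>

notation scale (infixr \<open>\<cdot>\<close> 75)

lemmas alg = mult.assoc distrib_left distrib_right left_diff_distrib right_diff_distrib
  scale_mult_left scale_mult_right scale_right_distrib scale_left_distrib
  scale_right_diff_distrib scale_left_diff_distrib

text \<open>On the coefficients of a series in \<open>z\<close>, \<open>x\<close>, \<open>y\<close> this is multiplication by
  \<open>(1 - s z / x) (1 - t z / y)\<close>.  It clears the denominators that arise when a Cartan series is
  moved across two currents.\<close>

definition D2 :: "complex \<Rightarrow> complex \<Rightarrow> (int \<Rightarrow> int \<Rightarrow> int \<Rightarrow> 'a) \<Rightarrow> int \<Rightarrow> int \<Rightarrow> int \<Rightarrow> 'a"
  where "D2 s t F N m n = F N m n - s \<cdot> F (N - 1) (m + 1) n - t \<cdot> F (N - 1) m (n + 1)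
    + (s * t) \<cdot> F (N - 2) (m + 1) (n + 1)"

text \<open>The coefficients of \<open>(w - s z) f(z) u(w) = (s w - z) u(w) f(z)\<close>.\<close>

definition PX :: "(int \<Rightarrow> 'a) \<Rightarrow> complex \<Rightarrow> (int \<Rightarrow> 'a) \<Rightarrow> bool"
  where "PX f s u \<longleftrightarrow> (\<forall>N m. f N * u m - s \<cdot> (f (N - 1) * u (m + 1))
    = s \<cdot> (u m * f N) - u (m + 1) * f (N - 1))"

lemma PXD:
  assumes "PX f s u"
  shows "f N * u m = s \<cdot> (u m * f N) - u (m + 1) * f (N - 1) + s \<cdot> (f (N - 1) * u (m + 1))"
  using assms unfolding PX_def by (metis diff_add_cancel)

lemma PX_mult_left:
  assumes "PX f s u" "\<And>N. f N * c = c * f N"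
  shows "PX f s (\<lambda>m. c * u m)"
  unfolding PX_def
proof (intro allI)
  fix N m
  have "f N * (c * u m) = c * (f N * u m)" for N m
    by (metis assms(2) mult.assoc)
  then show "f N * (c * u m) - s \<cdot> (f (N - 1) * (c * u (m + 1))) =
      s \<cdot> (c * u m * f N) - c * u (m + 1) * f (N - 1)"
    by (simp add: PXD[OF assms(1), of N m] alg)
qed

lemma PX_mult_right:
  assumes "PX f s u" "\<And>N. f N * c = c * f N"
  shows "PX f s (\<lambda>m. u m * c)"
  unfolding PX_def
proof (intro allI)
  fix N m
  have 1: "f N * (u m * c) = (f N * u m) * c" for N m
    by (simp add: mult.assoc)
  show "f N * (u m * c) - s \<cdot> (f (N - 1) * (u (m + 1) * c)) =
      s \<cdot> (u m * c * f N) - u (m + 1) * c * f (N - 1)"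
    unfolding 1 by (simp add: PXD[OF assms(1), of N m] alg assms(2))
qed

lemma D2_add: "D2 s t (\<lambda>N m n. F N m n + G N m n) N m n = D2 s t F N m n + D2 s t G N m n"
  by (simp add: D2_def algebra_simps)

lemma D2_diff: "D2 s t (\<lambda>N m n. F N m n - G N m n) N m n = D2 s t F N m n - D2 s t G N m n"
  by (simp add: D2_def algebra_simps)

lemma D2_scale: "D2 s t (\<lambda>N m n. c \<cdot> F N m n) N m n = c \<cdot> D2 s t F N m n"
  by (simp add: D2_def algebra_simps)

text \<open>Once the series is pushed to the far right, all products have one shape and identities
  become comparisons of coefficients. Here only the factor of \<open>D2\<close> belonging to
  \<open>v\<close> is used up; the other survives as a shift of \<open>u\<close>.\<close>

lemma D2_mid:
  assumes "PX f t v"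
  shows "D2 s t (\<lambda>N m n. u m * f N * v n) N m n =
     t \<cdot> (u m * v n * f N) - u m * v (n + 1) * f (N - 1) - (s * t) \<cdot> (u (m + 1) * v n * f (N - 1))
     + s \<cdot> (u (m + 1) * v (n + 1) * f (N - 2))"
  unfolding D2_def mult.assoc
  by (subst PXD[OF assms, of N n], subst PXD[OF assms, of "N - 1" n]) (simp add: alg)

lemma D2_left:
  assumes "PX f s u" "PX f t v"
  shows "D2 s t (\<lambda>N m n. f N * u m * v n) N m n =
     (s * t) \<cdot> (u m * v n * f N) - s \<cdot> (u m * v (n + 1) * f (N - 1)) - t \<cdot> (u (m + 1) * v n * f (N - 1))
     + u (m + 1) * v (n + 1) * f (N - 2)"
proof -
  have "D2 s t (\<lambda>N m n. f N * u m * v n) N m n =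
      s \<cdot> (u m * f N * v n) - u (m + 1) * f (N - 1) * v n
      - (s * t) \<cdot> (u m * f (N - 1) * v (n + 1)) + t \<cdot> (u (m + 1) * f (N - 2) * v (n + 1))"
    unfolding D2_def PXD[OF assms(1), of N m] PXD[OF assms(1), of "N - 1" m]
    by (simp add: alg mult.commute)
  also have "\<dots> = (s * t) \<cdot> (u m * v n * f N) - s \<cdot> (u m * v (n + 1) * f (N - 1)) - t \<cdot> (u (m + 1) * v n * f (N - 1))
     + u (m + 1) * v (n + 1) * f (N - 2)"
    unfolding mult.assoc
    by (subst PXD[OF assms(2), of N n], subst PXD[OF assms(2), of "N - 1" n])
      (simp add: alg)
  finally show ?thesis .
qed

lemma D2_swap: "D2 s t (\<lambda>N m n. F N m n) N m n = D2 t s (\<lambda>N n m. F N m n) N n m"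
  by (simp add: D2_def algebra_simps)

text \<open>By the symmetry of \<open>D2\<close>, the same normal form when the current indexed by
  \<open>n\<close> stands first.\<close>

lemma D2_mid':
  assumes "PX f s u"
  shows "D2 s t (\<lambda>N m n. v n * f N * u m) N m n =
     s \<cdot> (v n * u m * f N) - v n * u (m + 1) * f (N - 1) - (t * s) \<cdot> (v (n + 1) * u m * f (N - 1))
     + t \<cdot> (v (n + 1) * u (m + 1) * f (N - 2))"
  by (subst D2_swap) (rule D2_mid[OF assms])

lemma D2_left':
  assumes "PX f s u" "PX f t v"
  shows "D2 s t (\<lambda>N m n. f N * v n * u m) N m n =
     (t * s) \<cdot> (v n * u m * f N) - t \<cdot> (v n * u (m + 1) * f (N - 1)) - s \<cdot> (v (n + 1) * u m * f (N - 1))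
     + v (n + 1) * u (m + 1) * f (N - 2)"
  by (subst D2_swap) (rule D2_left[OF assms(2,1)])


lemma inverse_pair_simps:
  fixes p r :: complex
  assumes "p * r = 1"
  shows "p * r = 1" "r * p = 1" "p * (r * x) = x" "r * (p * x) = x"
  using assms by (simp_all add: mult.commute mult.assoc[symmetric])

text \<open>The expression is the Serre relation with one of its two equal letters turned into a
  series; \<open>p * p\<close> and \<open>r\<close> are the exchange constants of a node with itself
  and with a neighbour. Clearing the denominators cancels everything except one quadratic relation
  between \<open>x\<close> and \<open>y\<close>.\<close>

lemma D2_serre_x:
  assumes pr: "p * r = 1" and x: "PX f (p * p) x" and y: "PX f r y"
  shows "D2 (p * p) r (\<lambda>N m k. f N * x m * y k + x m * f N * y k - (p + r) \<cdot> (f N * y k * x m)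
      - (p + r) \<cdot> (x m * y k * f N) + y k * f N * x m + y k * x m * f N) N m k
    = ((p + r) * (p * p - 1)) \<cdot> ((x (m + 1) * y k - r \<cdot> (y k * x (m + 1))
      - (r \<cdot> (x m * y (k + 1)) - y (k + 1) * x m)) * f (N - 1))"
  unfolding D2_add D2_diff D2_scale D2_left[OF x y] D2_mid[OF y] D2_left'[OF x y] D2_mid'[OF x]
  unfolding D2_def
  by (simp add: alg inverse_pair_simps[OF pr] mult.commute[of "_::complex"] mult.left_commute[of "_::complex"] ring_distribs)

text \<open>Here the letter of the neighbouring node became the series, and what survives is a
  quadratic relation of \<open>x\<close> with itself.\<close>

lemma D2_serre_y:
  assumes pr: "p * r = 1" and x: "PX f r x"
  shows "D2 r r (\<lambda>N m n. x m * x n * f N + x n * x m * f N - (p + r) \<cdot> (x m * f N * x n)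
      - (p + r) \<cdot> (x n * f N * x m) + f N * x m * x n + f N * x n * x m) N m n
    = (r * r * r * (1 - p * p)) \<cdot> ((x (m + 1) * x n - (p * p) \<cdot> (x n * x (m + 1))
      - ((p * p) \<cdot> (x m * x (n + 1)) - x (n + 1) * x m)) * f (N - 1))"
  unfolding D2_add D2_diff D2_scale D2_left[OF x x] D2_mid[OF x] D2_left'[OF x x] D2_mid'[OF x]
  unfolding D2_def
  by (simp add: alg inverse_pair_simps[OF pr] mult.commute[of "_::complex"] mult.left_commute[of "_::complex"] ring_distribs)


text \<open>The quartic relation with one of its two even currents turned into a series, which
  commutes with the other even current \<open>c\<close>. What remains is generated by the quadratic
  relations \<open>Q\<close> of \<open>b\<close> with \<open>c\<close> and the anticommutators
  \<open>A\<close> of the odd currents.\<close>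

lemma D2_quartic_even:
  assumes pr: "p * r = 1" and b: "PX f r b" and c: "\<And>N k. f N * c k = c k * f N"
    and Q: "Q = (\<lambda>m. b (m + 1) * c k - p \<cdot> (c k * b (m + 1)) - (p \<cdot> (b m * c (k + 1)) - c (k + 1) * b m))"
    and A: "A = (\<lambda>m n. b m * b n + b n * b m)"
  shows "D2 r r (\<lambda>N m n. f N * b m * (c k * b n) + f N * b n * (c k * b m)
        + (c k * b m) * f N * b n + (c k * b n) * f N * b m + b n * f N * (b m * c k) + b m * f N * (b n * c k)
        + b n * (c k * b m) * f N + b m * (c k * b n) * f N
        - (p + r) \<cdot> ((b m * c k) * f N * b n) - (p + r) \<cdot> ((b n * c k) * f N * b m)) N m n
    = (1 - r * r) \<cdot> ((- (r \<cdot> (Q m * b n + Q n * b m)) - b m * Q n - b n * Q m) * f (N - 1))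
      + (c k * (r \<cdot> (A m n * f N) - A (m + 1) n * f (N - 1) - A m (n + 1) * f (N - 1)
          + r \<cdot> (A (m + 1) (n + 1) * f (N - 2)))
        + (r - r * r * r) \<cdot> (c (k + 1) * A m n * f (N - 1)))
      + (r \<cdot> (A m n * c k * f N) - (r * r) \<cdot> ((A (m + 1) n + A m (n + 1)) * c k * f (N - 1))
          + r \<cdot> (A (m + 1) (n + 1) * c k * f (N - 2)) - (p - r) \<cdot> (A m n * c (k + 1) * f (N - 1)))"
proof -
  have cb: "PX f r (\<lambda>m. c k * b m)" and bc: "PX f r (\<lambda>m. b m * c k)"
    using b c by (simp_all add: PX_mult_left PX_mult_right)
  show ?thesis
    unfolding D2_add D2_diff D2_scale D2_left[OF b cb] D2_left'[OF cb b] D2_mid[OF b] D2_mid'[OF b]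
      D2_mid'[OF bc] D2_mid[OF bc] A Q
    unfolding D2_def
    by (simp add: alg inverse_pair_simps[OF pr] mult.commute[of "_::complex"] mult.left_commute[of "_::complex"] ring_distribs)
qed

text \<open>The quartic relation with one odd current turned into a series, which commutes with the
  odd currents because the diagonal entry there is zero. What remains involves the quadratic
  relations \<open>Qa\<close>, \<open>Qc\<close> of the odd current with its two neighbours and the
  commutators \<open>Z\<close> of these neighbours.\<close>

lemma D2_quartic_odd:
  assumes pr: "p * r = 1" and a: "PX f r a" and c: "PX f p c" and b: "\<And>N n. f N * b n = b n * f N"
    and Qa: "Qa = a (m + 1) * b n - r \<cdot> (b n * a (m + 1)) - (r \<cdot> (a m * b (n + 1)) - b (n + 1) * a m)"
    and Qc: "Qc = b (n + 1) * c k - p \<cdot> (c k * b (n + 1)) - (p \<cdot> (b n * c (k + 1)) - c (k + 1) * b n)"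
    and Z: "Z = (\<lambda>m k. a m * c k - c k * a m)"
  shows "D2 r p (\<lambda>N m k. a m * (b n * c k) * f N - a m * f N * (c k * b n) + c k * (b n * a m) * f N
        - c k * f N * (a m * b n) - f N * a m * (b n * c k) + (b n * a m) * f N * c k
        - f N * c k * (b n * a m) + (b n * c k) * f N * a m - (p + r) \<cdot> (b n * a m * c k * f N)
        + (p + r) \<cdot> (f N * a m * (c k * b n))) N m k
    = (p - r) \<cdot> ((Qa * c k - p \<cdot> (c k * Qa) + r \<cdot> (a m * Qc) - Qc * a m) * f (N - 1))
      + (r \<cdot> (Z m k * b n * f N) - Z m (k + 1) * b n * f (N - 1) - (p * p) \<cdot> (Z (m + 1) k * b n * f (N - 1))
         + p \<cdot> (Z (m + 1) (k + 1) * b n * f (N - 2)) + (p - r) \<cdot> (Z m k * b (n + 1) * f (N - 1)))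
      + (- (r \<cdot> (b n * Z m k * f N)) + b n * Z (m + 1) k * f (N - 1) + (p * p) \<cdot> (b n * Z m (k + 1) * f (N - 1))
         - p \<cdot> (b n * Z (m + 1) (k + 1) * f (N - 2)) - (p - r) \<cdot> (b (n + 1) * Z m k * f (N - 1)))"
proof -
  have 1: "PX f p (\<lambda>m. c m * b n)" "PX f p (\<lambda>m. b n * c m)" "PX f r (\<lambda>m. a m * b n)" "PX f r (\<lambda>m. b n * a m)"
    using a c b by (simp_all add: PX_mult_left PX_mult_right)
  show ?thesis
    unfolding D2_add D2_diff D2_scale D2_left[OF a 1(1)] D2_left[OF a 1(2)] D2_left'[OF 1(4) c]
      D2_mid[OF 1(1)] D2_mid[OF c] D2_mid'[OF 1(3)] D2_mid'[OF a] Qa Qc Z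
    unfolding D2_def
    by (simp add: alg inverse_pair_simps[OF pr] mult.commute[of "_::complex"] mult.left_commute[of "_::complex"] ring_distribs)
qed

text \<open>The recursion determines a whole line \<open>N + m = const\<close> from one entry, so
  vanishing at one end spreads along it; towards smaller \<open>N\<close> this uses that
  \<open>s\<close> is invertible. The bound is essential: \<open>s powi N\<close> on a single such
  line satisfies the recursion.\<close>

lemma shift_zero:
  assumes "subspace J" "s \<noteq> 0"
    and step: "\<And>N m. F N m - s \<cdot> F (N - 1) (m + 1) \<in> J"
    and bd: "(\<exists>B. \<forall>N<B. \<forall>m. F N m \<in> J) \<or> (\<exists>B. \<forall>N>B. \<forall>m. F N m \<in> J)"
  shows "F (N :: int) (m :: int) \<in> J"
  using bd
proof
  assume "\<exists>B. \<forall>N<B. \<forall>m. F N m \<in> J"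
  then obtain B where B: "\<And>N m. N < B \<Longrightarrow> F N m \<in> J" by blast
  have "F (B - 1 + int k) m \<in> J" for k m
  proof (induction k arbitrary: m)
    case (Suc k)
    have "(F (B - 1 + int (Suc k)) m - s \<cdot> F (B - 1 + int k) (m + 1)) + s \<cdot> F (B - 1 + int k) (m + 1) \<in> J"
      using step[of "B - 1 + int (Suc k)" m] Suc[of "m + 1"] assms(1)
      by (intro subspace_add subspace_scale) (auto simp: algebra_simps)
    then show ?case by simp
  qed (use B in auto)
  from this[of "nat (N - (B - 1))"] B[of N m] show ?thesis by (cases "N < B") auto
next
  assume "\<exists>B. \<forall>N>B. \<forall>m. F N m \<in> J"
  then obtain B where B: "\<And>N m. N > B \<Longrightarrow> F N m \<in> J" by blast
  have "F (B + 1 - int k) m \<in> J" for k m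
  proof (induction k arbitrary: m)
    case (Suc k)
    have "F (B + 1 - int k) (m - 1) - (F (B + 1 - int k) (m - 1) - s \<cdot> F (B + 1 - int (Suc k)) m) \<in> J"
      by (rule subspace_diff[OF assms(1) Suc[of "m - 1"]])
        (use step[of "B + 1 - int k" "m - 1"] in \<open>simp add: algebra_simps\<close>)
    then have "s \<cdot> F (B + 1 - int (Suc k)) m \<in> J" by simp
    from subspace_scale[OF assms(1) this, of "inverse s"] show ?case using \<open>s \<noteq> 0\<close> by simp
  qed (use B in auto)
  from this[of "nat (B + 1 - N)"] B[of N m] show ?thesis by (cases "N > B") auto
qed

text \<open>\<open>D2\<close> is a composition of two first-order operators of the kind in
  \<open>shift_zero\<close>; they are cancelled one after the other.\<close>

lemma D2_zero:
  assumes J: "subspace J" and s: "s \<noteq> 0" and t: "t \<noteq> 0"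
    and step: "\<And>N m n. D2 s t F N m n \<in> J"
    and bd: "(\<exists>B. \<forall>N<B. \<forall>m n. F N m n \<in> J) \<or> (\<exists>B. \<forall>N>B. \<forall>m n. F N m n \<in> J)"
  shows "F N m n \<in> J"
proof -
  \<comment> \<open>Only the factor with \<open>t\<close> has been applied to \<open>F\<close>;
    applying the factor with \<open>s\<close> to \<open>G\<close> gives \<open>D2\<close>.\<close>
  define G where "G = (\<lambda>N m n. F N m n - t \<cdot> F (N - 1) m (n + 1))"
  have bdG: "(\<exists>B. \<forall>N<B. \<forall>m. G N m n \<in> J) \<or> (\<exists>B. \<forall>N>B. \<forall>m. G N m n \<in> J)" for n
    using bd
  proof
    assume "\<exists>B. \<forall>N<B. \<forall>m n. F N m n \<in> J"
    then obtain B where "\<And>N m n. N < B \<Longrightarrow> F N m n \<in> J" by blast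
    then have "\<forall>N<B. \<forall>m. G N m n \<in> J"
      unfolding G_def using J by (auto intro!: subspace_diff subspace_scale)
    then show ?thesis by blast
  next
    assume "\<exists>B. \<forall>N>B. \<forall>m n. F N m n \<in> J"
    then obtain B where "\<And>N m n. N > B \<Longrightarrow> F N m n \<in> J" by blast
    then have "\<forall>N>B+1. \<forall>m. G N m n \<in> J"
      unfolding G_def using J by (auto intro!: subspace_diff subspace_scale)
    then show ?thesis by blast
  qed
  have "G N m n - s \<cdot> G (N - 1) (m + 1) n = D2 s t F N m n" for N m n
    by (simp add: G_def D2_def algebra_simps)
  then have "G N m n \<in> J" for N m n
    using shift_zero[OF J s, where F = "\<lambda>N m. G N m n"] step bdG[of n] by simp
  then have "F N m n - t \<cdot> F (N - 1) m (n + 1) \<in> J" for N m n by (simp add: G_def)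
  then show ?thesis
    using shift_zero[OF J t, where F = "\<lambda>N n. F N m n"] bd by blast
qed

end

section \<open>Entries of the Cartan matrix around the odd node\<close>

lemma cartan_eq:
  assumes "i \<in> nodes M N"
  shows "cartan M N i j = lsgn M i * (of_bool (i = j) - of_bool (i = j + 1))
    - lsgn M (i + 1) * (of_bool (i + 1 = j) - of_bool (i = j))"
proof -
  have *: "Poly_Mapping.lookup (simple_root l) k = of_bool (k = l) - of_bool (k = l + 1)" for l k
    by (auto simp: simple_root_def lookup_minus lookup_single when_def)
  have "cartan M N i j = (\<Sum>k\<in>{1..M+N}. (if k = i then lsgn M k * (of_bool (k = j) - of_bool (k = j + 1)) else 0)
      - (if k = i + 1 then lsgn M k * (of_bool (k = j) - of_bool (k = j + 1)) else 0))"
    unfolding cartan_def weight_form_def * by (intro sum.cong) (auto simp: algebra_simps)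
  also have "\<dots> = lsgn M i * (of_bool (i = j) - of_bool (i = j + 1))
    - lsgn M (i + 1) * (of_bool (i + 1 = j) - of_bool (i + 1 = j + 1))"
    using assms unfolding sum_subtractf by (subst (1 2) sum.delta) (auto simp: nodes_def)
  finally show ?thesis by simp
qed

lemma cartan_sym: "cartan M N i j = cartan M N j i"
  unfolding cartan_def weight_form_def by (intro sum.cong) auto

text \<open>Away from the odd node \<open>lsgn M i = lsgn M (i + 1)\<close>, so the diagonal entry
  is \<open>2 * lsgn M i\<close> and an entry of absolute value one can only belong to a
  neighbour.\<close>

lemma cartan_serre:
  assumes "i \<in> nodes M N" "cartan M N i j \<in> {1, -1}" "i \<noteq> M"
  shows "cartan M N i i = 2 * lsgn M i" "cartan M N i j = - lsgn M i" "i \<noteq> j"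
  using assms by (auto simp: cartan_eq[OF assms(1)] lsgn_def of_bool_def split: if_splits)

lemma cartan_MM: "M \<in> nodes M N \<Longrightarrow> cartan M N M M = 0"
  by (simp add: cartan_eq lsgn_def)

text \<open>The signature changes at the odd node, so this node pairs with its two neighbours with
  opposite signs. This makes the two exchange constants in the quartic relation inverse to each
  other.\<close>

lemma cartan_near_M:
  assumes "M > 1" "N > 1"
  shows "cartan M N (M - 1) M = -1" "cartan M N M (M - 1) = -1" "cartan M N M (M + 1) = 1"
    "cartan M N (M + 1) M = 1" "cartan M N (M - 1) (M + 1) = 0" "cartan M N (M + 1) (M - 1) = 0"
    "M - 1 \<in> nodes M N" "M \<in> nodes M N" "M + 1 \<in> nodes M N"
proof -
  show n: "M - 1 \<in> nodes M N" "M \<in> nodes M N" "M + 1 \<in> nodes M N"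
    using assms by (auto simp: nodes_def)
  show "cartan M N M (M - 1) = -1" "cartan M N M (M + 1) = 1" "cartan M N (M + 1) (M - 1) = 0"
    using assms unfolding cartan_eq[OF n(2)] cartan_eq[OF n(3)] by (auto simp: lsgn_def)
  then show "cartan M N (M - 1) M = -1" "cartan M N (M + 1) M = 1" "cartan M N (M - 1) (M + 1) = 0"
    by (simp_all only: cartan_sym[of M N _ M] cartan_sym[of M N "M - 1" "M + 1"])
qed

text \<open>The sign of the super commutation rule as a number, since the endomorphism ring in which
  it is used carries no grading.\<close>

definition xsign :: "nat \<Rightarrow> nat \<Rightarrow> nat \<Rightarrow> complex"
  where "xsign M i j = (if i = M \<and> j = M then - 1 else 1)"

section \<open>The current relations in an algebra without grading\<close>

context calg
begin

text \<open>The sign is absorbed into \<open>u\<close>. The outermost bracket of the quartic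
  relation joins two odd elements and therefore has \<open>u = -1\<close>.\<close>

definition ubr :: "complex \<Rightarrow> 'a \<Rightarrow> 'a \<Rightarrow> 'a"
  where "ubr u a b = a * b - u \<cdot> (b * a)"

definition rel_comm :: "nat \<Rightarrow> (nat \<Rightarrow> int \<Rightarrow> 'a) \<Rightarrow> nat \<Rightarrow> nat \<Rightarrow> int \<Rightarrow> int \<Rightarrow> 'a"
  where "rel_comm M x i j m n = x i m * x j n - xsign M i j \<cdot> (x j n * x i m)"

definition rel_quad :: "complex \<Rightarrow> (nat \<Rightarrow> int \<Rightarrow> 'a) \<Rightarrow> nat \<Rightarrow> nat \<Rightarrow> int \<Rightarrow> int \<Rightarrow> 'a"
  where "rel_quad t x i j m n = (x i (m + 1) * x j n - t \<cdot> (x j n * x i (m + 1)))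
       - (t \<cdot> (x i m * x j (n + 1)) - x j (n + 1) * x i m)"

definition rel_serre :: "complex \<Rightarrow> (nat \<Rightarrow> int \<Rightarrow> 'a) \<Rightarrow> nat \<Rightarrow> nat \<Rightarrow> int \<Rightarrow> int \<Rightarrow> int \<Rightarrow> 'a"
  where "rel_serre q x i j m n k = ubr q (x i m) (ubr (inverse q) (x i n) (x j k))
       + ubr q (x i n) (ubr (inverse q) (x i m) (x j k))"

definition rel_quartic :: "complex \<Rightarrow> nat \<Rightarrow> (nat \<Rightarrow> int \<Rightarrow> 'a) \<Rightarrow> int \<Rightarrow> int \<Rightarrow> int \<Rightarrow> int \<Rightarrow> 'a"
  where "rel_quartic q M x m n k u =
     ubr (-1) (ubr q (ubr (inverse q) (x (M - 1) m) (x M n)) (x (M + 1) k)) (x M u)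
       + ubr (-1) (ubr q (ubr (inverse q) (x (M - 1) m) (x M u)) (x (M + 1) k)) (x M n)"

text \<open>The separation from \<open>higher_rels\<close> follows the logic of the proof: the
  higher relations are controlled by the quadratic ones.\<close>

definition quad_rels :: "nat \<Rightarrow> nat \<Rightarrow> complex \<Rightarrow> sign \<Rightarrow> (nat \<Rightarrow> int \<Rightarrow> 'a) \<Rightarrow> 'a set"
  where "quad_rels M N q e x =
    {rel_comm M x i j m n | i j m n. i \<in> nodes M N \<and> j \<in> nodes M N \<and> cartan M N i j = 0} \<union>
    {rel_quad (q powi (sgnv e * cartan M N i j)) x i j m n | i j m n.
       i \<in> nodes M N \<and> j \<in> nodes M N \<and> cartan M N i j \<noteq> 0}"

definition higher_rels :: "nat \<Rightarrow> nat \<Rightarrow> complex \<Rightarrow> (nat \<Rightarrow> int \<Rightarrow> 'a) \<Rightarrow> 'a set"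
  where "higher_rels M N q x =
    {rel_serre q x i j m n k | i j m n k.
       i \<in> nodes M N \<and> j \<in> nodes M N \<and> cartan M N i j \<in> {1, - 1} \<and> i \<noteq> M} \<union>
    {rel_quartic q M x m n k u | m n k u. M > 1 \<and> N > 1}"

text \<open>The quartic relation up to consequences of quadratic ones, arranged to be symmetric in
  its two odd letters and, up to the commutator of \<open>a\<close> and \<open>c\<close>, in
  \<open>a\<close> and \<open>c\<close>. Only two kinds of families are then needed when a letter is
  replaced by a series.\<close>

definition quartic_sym where
  "quartic_sym s a b c m n k u = a m * (b n * (c k * b u)) + a m * (b u * (c k * b n)) + c k * (b n * (a m * b u))
    + c k * (b u * (a m * b n)) + b u * (a m * (b n * c k)) + b n * (a m * (b u * c k))
    + b u * (c k * (b n * a m)) + b n * (c k * (b u * a m))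
    - s \<cdot> (b n * (a m * (c k * b u))) - s \<cdot> (b u * (a m * (c k * b n)))"

lemma rel_serre_eq:
  "rel_serre q x i j m n k = x i m * (x i n * x j k) + x i n * (x i m * x j k)
    - (q + inverse q) \<cdot> (x i m * (x j k * x i n)) - (q + inverse q) \<cdot> (x i n * (x j k * x i m))
    + x j k * (x i m * x i n) + x j k * (x i n * x i m)" if "q \<noteq> 0"
  using that by (simp add: rel_serre_def ubr_def alg algebra_simps)

text \<open>The correction terms contain as a factor an anticommutator of odd currents or the
  commutator of the two even ones, hence a quadratic relation.\<close>

lemma rel_quartic_eq:
  assumes "q \<noteq> 0" "M > 0"
  shows "rel_quartic q M x m n k u = quartic_sym (q + inverse q) (x (M - 1)) (x M) (x (M + 1)) m n k u
     - q \<cdot> (x (M + 1) k * (x (M - 1) m * rel_comm M x M M n u))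
     - inverse q \<cdot> (rel_comm M x M M n u * x (M - 1) m * x (M + 1) k)
     + q \<cdot> (x M n * (rel_comm M x (M - 1) (M + 1) m k * x M u) + x M u * (rel_comm M x (M - 1) (M + 1) m k * x M n))"
  using assms by (simp add: rel_quartic_def quartic_sym_def rel_comm_def xsign_def ubr_def alg; simp add: algebra_simps)

text \<open>Passing an opposite current through a relation replaces one letter at a time by a Cartan
  series. The four families are what this leaves of the Serre and the quartic relation, for a
  general series \<open>f\<close>.\<close>

definition serre_x_family where
  "serre_x_family c a b f N m k = f N * a m * b k + a m * f N * b k - c \<cdot> (f N * b k * a m)
      - c \<cdot> (a m * b k * f N) + b k * f N * a m + b k * a m * f N"

definition serre_y_family where
  "serre_y_family c a f N m n = a m * a n * f N + a n * a m * f N - c \<cdot> (a m * f N * a n)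
      - c \<cdot> (a n * f N * a m) + f N * a m * a n + f N * a n * a m"

definition even_family where
  "even_family c b a k f N m n = f N * b m * (a k * b n) + f N * b n * (a k * b m)
        + (a k * b m) * f N * b n + (a k * b n) * f N * b m + b n * f N * (b m * a k) + b m * f N * (b n * a k)
        + b n * (a k * b m) * f N + b m * (a k * b n) * f N
        - c \<cdot> ((b m * a k) * f N * b n) - c \<cdot> ((b n * a k) * f N * b m)"

definition odd_family where
  "odd_family s a b c n f N m k = a m * (b n * c k) * f N - a m * f N * (c k * b n) + c k * (b n * a m) * f N
        - c k * f N * (a m * b n) - f N * a m * (b n * c k) + (b n * a m) * f N * c k
        - f N * c k * (b n * a m) + (b n * c k) * f N * a m - s \<cdot> (b n * a m * c k * f N)
        + s \<cdot> (f N * a m * (c k * b n))"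

lemmas family_defs = serre_x_family_def serre_y_family_def even_family_def odd_family_def

text \<open>Linearity in the series reduces the two-sided series \<open>g\<close> to the two
  one-sided ones.\<close>

lemma family_diff:
  "serre_x_family s a b (\<lambda>n. c \<cdot> (u n - v n)) N m k
    = c \<cdot> (serre_x_family s a b u N m k - serre_x_family s a b v N m k)"
  "serre_y_family s a (\<lambda>n. c \<cdot> (u n - v n)) N m n
    = c \<cdot> (serre_y_family s a u N m n - serre_y_family s a v N m n)"
  "even_family s b a' k (\<lambda>n. c \<cdot> (u n - v n)) N m n
    = c \<cdot> (even_family s b a' k u N m n - even_family s b a' k v N m n)"
  "odd_family s a b c' n (\<lambda>n. c \<cdot> (u n - v n)) N m k
    = c \<cdot> (odd_family s a b c' n u N m k - odd_family s a b c' n v N m k)"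
  unfolding family_defs by (simp add: alg; simp add: algebra_simps)+

end

section \<open>Crossing relations with currents of the opposite sign\<close>

lemma xsign_nonzero [simp]: "xsign M i j \<noteq> 0"
  by (simp add: xsign_def)

lemma xsign_sq: "xsign M i j * xsign M i j = 1" "xsign M i j = xsign M j i"
  by (auto simp: xsign_def)

text \<open>Currents \<open>x\<close> of sign \<open>e\<close>, opposite currents \<open>y\<close>,
  their commutator \<open>g\<close> and the Cartan series \<open>f\<close>, abstracted so that one
  argument covers both signs. The constants \<open>\<kappa> i\<close> absorb the sign that appears
  when the two families exchange roles.\<close>

locale current_pair = calg +
  fixes M N :: nat and q :: complex and e :: sign and x y :: "nat \<Rightarrow> int \<Rightarrow> 'a"
    and f :: "sign \<Rightarrow> nat \<Rightarrow> int \<Rightarrow> 'a" and \<kappa> :: "nat \<Rightarrow> complex" and g :: "nat \<Rightarrow> int \<Rightarrow> 'a"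
  assumes q0: "q \<noteq> 0"
    and cross: "i \<in> nodes M N \<Longrightarrow> j \<in> nodes M N \<Longrightarrow>
      x i m * y j n = xsign M i j \<cdot> (y j n * x i m) + (if i = j then g i (m + n) else 0)"
    and PXf: "i \<in> nodes M N \<Longrightarrow> j \<in> nodes M N \<Longrightarrow> PX (f d i) (q powi (sgnv e * cartan M N i j)) (x j)"
    and bounded: "n < 0 \<Longrightarrow> f Plus i n = 0" "n > 0 \<Longrightarrow> f Minus i n = 0"
    and g_def: "g i n = \<kappa> i \<cdot> (f Plus i n - f Minus i n)"
begin

abbreviation "t i j \<equiv> q powi (sgnv e * cartan M N i j)"

text \<open>For a zero entry \<open>PX\<close> says that the commutator is annihilated by a factor
  with \<open>s = 1\<close>; since the series is one-sided this factor can be cancelled.\<close>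

lemma f_comm:
  assumes "i \<in> nodes M N" "j \<in> nodes M N" "cartan M N i j = 0"
  shows "f d i n * x j m = x j m * f d i n"
proof -
  have "f d i n * x j m - x j m * f d i n \<in> {0}"
  proof (rule shift_zero[where s = 1 and F = "\<lambda>n m. f d i n * x j m - x j m * f d i n"])
    show "f d i n * x j m - x j m * f d i n
        - 1 \<cdot> (f d i (n - 1) * x j (m + 1) - x j (m + 1) * f d i (n - 1)) \<in> {0}" for n m
      using PXf[OF assms(1,2), of d, unfolded PX_def, rule_format, of n m] assms(3)
      by (simp add: algebra_simps)
    show "(\<exists>B. \<forall>n<B. \<forall>m. f d i n * x j m - x j m * f d i n \<in> {0}) \<or>
        (\<exists>B. \<forall>n>B. \<forall>m. f d i n * x j m - x j m * f d i n \<in> {0})"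
      using bounded[of _ i] by (cases d) (auto intro!: exI[of _ 0])
  qed (auto simp: subspace_def)
  then show ?thesis by simp
qed

lemma g_comm:
  assumes "i \<in> nodes M N" "j \<in> nodes M N" "cartan M N i j = 0"
  shows "g i n * x j m = x j m * g i n"
  using f_comm[OF assms] by (simp add: g_def alg algebra_simps)

lemma g_PX:
  assumes "i \<in> nodes M N" "j \<in> nodes M N"
  shows "g i n * x j m - t i j \<cdot> (g i (n - 1) * x j (m + 1))
    - (t i j \<cdot> (x j m * g i n) - x j (m + 1) * g i (n - 1)) = 0"
proof -
  have "f d i n * x j m - t i j \<cdot> (f d i (n - 1) * x j (m + 1))
    = t i j \<cdot> (x j m * f d i n) - x j (m + 1) * f d i (n - 1)" for d
    using PXf[OF assms] by (simp add: PX_def)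
  from this[of Plus] this[of Minus]
  have "\<kappa> i \<cdot> ((f Plus i n * x j m - t i j \<cdot> (f Plus i (n - 1) * x j (m + 1)))
    - (f Minus i n * x j m - t i j \<cdot> (f Minus i (n - 1) * x j (m + 1)))) =
    \<kappa> i \<cdot> ((t i j \<cdot> (x j m * f Plus i n) - x j (m + 1) * f Plus i (n - 1))
    - (t i j \<cdot> (x j m * f Minus i n) - x j (m + 1) * f Minus i (n - 1)))" by simp
  then show ?thesis
    by (simp add: g_def alg algebra_simps)
qed

definition D :: "nat \<Rightarrow> nat \<Rightarrow> int \<Rightarrow> 'a"
  where "D i j n = (if i = j then g i n else 0)"

text \<open>The form with a tail \<open>z\<close> makes the crossing applicable inside
  right-associated products.\<close>

lemma cross_rules:
  assumes "i \<in> nodes M N" "j \<in> nodes M N"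
  shows "x i m * y j n = xsign M i j \<cdot> (y j n * x i m) + D i j (m + n)"
    and "x i m * (y j n * z) = xsign M i j \<cdot> (y j n * (x i m * z)) + D i j (m + n) * z"
  by (simp_all add: mult.assoc[symmetric] cross[OF assms] distrib_right scale_mult_left D_def)

lemma cross_comm:
  assumes c: "i \<in> nodes M N" "j \<in> nodes M N" "cartan M N i j = 0" and l: "l \<in> nodes M N"
  shows "rel_comm M x i j m n * y l p - (xsign M i l * xsign M j l) \<cdot> (y l p * rel_comm M x i j m n) = 0"
proof -
  note cr = cross_rules[OF c(1) l] cross_rules[OF c(2) l]
  have "rel_comm M x i j m n * y l p - (xsign M i l * xsign M j l) \<cdot> (y l p * rel_comm M x i j m n) =
    xsign M j l \<cdot> (D i l (m + p) * x j n) + x i m * D j l (n + p)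
    - xsign M i j \<cdot> (xsign M i l \<cdot> (D j l (n + p) * x i m) + x j n * D i l (m + p))"
    by (simp add: rel_comm_def cr alg; simp add: algebra_simps)
  also have "\<dots> = 0"
  proof -
    have "D i l k * x j n = x j n * D i l k" "D j l k * x i m = x i m * D j l k" for k
      using g_comm[OF c] g_comm[OF c(2,1)] c(3) cartan_sym[of M N i j] by (auto simp: D_def)
    moreover have "l = i \<Longrightarrow> xsign M j l = xsign M i j"
      "l = j \<Longrightarrow> xsign M i j * xsign M i l = 1"
      by (auto simp: xsign_def)
    ultimately show ?thesis
      by (cases "l = i"; cases "l = j") (simp_all add: D_def scale_right_distrib)
  qed
  finally show ?thesis .
qed

text \<open>No ideal is involved: replacing a letter by \<open>g\<close> turns a quadratic relation
  into the exchange relation of \<open>g\<close> with the other current, or, for a zero entry, into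
  their commutator, and both vanish identically.\<close>

lemma cross_quad:
  assumes "R \<in> quad_rels M N q e x" and l: "l \<in> nodes M N"
  shows "\<exists>s. s \<noteq> 0 \<and> R * y l p = s \<cdot> (y l p * R)"
proof -
  consider (c) i j m n where "i \<in> nodes M N" "j \<in> nodes M N" "cartan M N i j = 0"
      "R = rel_comm M x i j m n"
    | (q) i j m n where "i \<in> nodes M N" "j \<in> nodes M N" "cartan M N i j \<noteq> 0"
      "R = rel_quad (t i j) x i j m n"
    using assms(1) unfolding quad_rels_def by blast
  then show ?thesis
  proof cases
    case c
    from cross_comm[OF c(1-3) l, of m n p] show ?thesis unfolding c(4) by (intro exI[of _ "xsign M i l * xsign M j l"]) auto
  next
    case q
    note cr = cross_rules[OF q(1) l] cross_rules[OF q(2) l]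
    \<comment> \<open>A nonzero entry excludes that both nodes are the odd one, whose diagonal entry
      is zero.\<close>
    have x1: "xsign M i j = 1" "xsign M j i = 1"
      using q cartan_MM[of M N] by (auto simp: xsign_def)
    have 1: "g i (m + 1 + p) * x j n - t i j \<cdot> (g i (m + p) * x j (n + 1))
        - (t i j \<cdot> (x j n * g i (m + 1 + p)) - x j (n + 1) * g i (m + p)) = 0"
      using g_PX[OF q(1,2), of "m + 1 + p" n] by (simp add: algebra_simps)
    have 2: "g j (n + 1 + p) * x i m - t i j \<cdot> (g j (n + p) * x i (m + 1))
        - (t i j \<cdot> (x i m * g j (n + 1 + p)) - x i (m + 1) * g j (n + p)) = 0"
      using g_PX[OF q(2,1), of "n + 1 + p" m] cartan_sym[of M N i j] by (simp add: algebra_simps)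
    have "R * y l p - (xsign M i l * xsign M j l) \<cdot> (y l p * R) =
      xsign M j l \<cdot> (D i l (m + 1 + p) * x j n) - t i j \<cdot> (x j n * D i l (m + 1 + p))
        - t i j \<cdot> (xsign M j l \<cdot> (D i l (m + p) * x j (n + 1))) + x j (n + 1) * D i l (m + p)
      + (x i (m + 1) * D j l (n + p) - t i j \<cdot> (xsign M i l \<cdot> (D j l (n + p) * x i (m + 1)))
        - t i j \<cdot> (x i m * D j l (n + 1 + p)) + xsign M i l \<cdot> (D j l (n + 1 + p) * x i m))"
      by (simp add: q(4) rel_quad_def cr alg; simp add: algebra_simps)
    also have "xsign M j l \<cdot> (D i l (m + 1 + p) * x j n) - t i j \<cdot> (x j n * D i l (m + 1 + p))
        - t i j \<cdot> (xsign M j l \<cdot> (D i l (m + p) * x j (n + 1))) + x j (n + 1) * D i l (m + p) = 0"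
      using 1 x1 by (cases "l = i") (simp_all add: D_def algebra_simps)
    also have "x i (m + 1) * D j l (n + p) - t i j \<cdot> (xsign M i l \<cdot> (D j l (n + p) * x i (m + 1)))
        - t i j \<cdot> (x i m * D j l (n + 1 + p)) + xsign M i l \<cdot> (D j l (n + 1 + p) * x i m) = 0"
      using 2 x1 by (cases "l = j") (simp_all add: D_def algebra_simps)
    finally have "R * y l p - (xsign M i l * xsign M j l) \<cdot> (y l p * R) = 0" by simp
    then show ?thesis by (intro exI[of _ "xsign M i l * xsign M j l"]) auto
  qed
qed


end

text \<open>\<open>J\<close> is a right ideal, stable on the left under \<open>x\<close> and
  \<open>g\<close>. Left stability under the opposite currents cannot be assumed: for
  \<open>e = Minus\<close> it is among the things to be derived.\<close>

locale current_pair_ideal = current_pair +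
  fixes J :: "'a set"
  assumes J: "subspace J"
    and J_right: "T \<in> J \<Longrightarrow> T * S \<in> J"
    and J_left: "T \<in> J \<Longrightarrow> i \<in> nodes M N \<Longrightarrow> x i m * T \<in> J"
    and J_left_g: "T \<in> J \<Longrightarrow> i \<in> nodes M N \<Longrightarrow> g i m * T \<in> J"
    and J_quad: "quad_rels M N q e x \<subseteq> J"
begin

lemmas J_intros = subspace_add[OF J] subspace_diff[OF J] subspace_scale[OF J] subspace_neg[OF J] J_right J_left

lemma J_comm: "i \<in> nodes M N \<Longrightarrow> j \<in> nodes M N \<Longrightarrow> cartan M N i j = 0 \<Longrightarrow> rel_comm M x i j m n \<in> J"
  using J_quad unfolding quad_rels_def by blast

lemma J_rel_quad: "i \<in> nodes M N \<Longrightarrow> j \<in> nodes M N \<Longrightarrow> cartan M N i j \<noteq> 0 \<Longrightarrow> rel_quad (t i j) x i j m n \<in> J"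
  using J_quad unfolding quad_rels_def by blast

lemma powi_pair:
  "q powi (- n) * q powi n = 1" "q powi n * q powi (- n) = 1" "q powi (2 * n) = q powi n * q powi n"
  using q0 power_int_add[of q n n] by (simp_all add: power_int_minus)

lemma bounded_J:
  assumes "\<And>n. f d i n = 0 \<Longrightarrow> \<forall>m k. F n m k \<in> J"
  shows "(\<exists>B. \<forall>n<B. \<forall>m k. F n m k \<in> J) \<or> (\<exists>B. \<forall>n>B. \<forall>m k. F n m k \<in> J)"
  using bounded[of _ i] assms by (cases d) (metis, metis)

text \<open>Clearing denominators puts the family into \<open>J\<close>, and the one-sidedness of
  \<open>f d i\<close> removes the clearing factors again. The next three lemmas follow the same
  pattern.\<close>

lemma serre_x_J:
  assumes ij: "i \<in> nodes M N" "j \<in> nodes M N" "cartan M N i j \<in> {1, - 1}" "i \<noteq> M"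
  shows "serre_x_family (q + inverse q) (x i) (x j) (f d i) n m k \<in> J"
proof -
  define p where "p = q powi (sgnv e * lsgn M i)"
  define r where "r = q powi (- (sgnv e * lsgn M i))"
  have pr: "p * r = 1" using powi_pair by (simp add: p_def r_def)
  \<comment> \<open>\<open>p\<close> is \<open>q\<close> or its inverse, depending on the sign and
    on the side of the odd node; the sum is the same.\<close>
  have c: "q + inverse q = p + r"
    by (cases e) (auto simp: p_def r_def lsgn_def power_int_minus add.commute)
  have ti: "t i i = p * p" "t i j = r"
    using powi_pair(3)[of "sgnv e * lsgn M i"] cartan_serre[OF ij(1,3,4)]
    by (simp_all add: p_def r_def mult.left_commute)
  have x: "PX (f d i) (p * p) (x i)" and y: "PX (f d i) r (x j)"
    using PXf[OF ij(1,1), of d] PXf[OF ij(1,2), of d] ti by simp_all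
  have nz: "p * p \<noteq> 0" "r \<noteq> 0" using pr by auto
  show ?thesis
    unfolding c
  proof (rule D2_zero[OF J nz])
    show "D2 (p * p) r (serre_x_family (p + r) (x i) (x j) (f d i)) n m k \<in> J" for n m k
      unfolding serre_x_family_def[abs_def] D2_serre_x[OF pr x y]
      using J_rel_quad[OF ij(1,2), of m k] ij(3)
      by (intro subspace_scale[OF J] J_right) (auto simp: rel_quad_def ti)
  qed (rule bounded_J[of d i], use subspace_0[OF J] in \<open>simp add: serre_x_family_def\<close>)
qed

lemma serre_y_J:
  assumes ij: "i \<in> nodes M N" "j \<in> nodes M N" "cartan M N i j \<in> {1, - 1}" "i \<noteq> M"
  shows "serre_y_family (q + inverse q) (x i) (f d j) n m k \<in> J"
proof -
  define p where "p = q powi (sgnv e * lsgn M i)"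
  define r where "r = q powi (- (sgnv e * lsgn M i))"
  have pr: "p * r = 1" using powi_pair by (simp add: p_def r_def)
  have c: "q + inverse q = p + r"
    by (cases e) (auto simp: p_def r_def lsgn_def power_int_minus add.commute)
  have ti: "t i i = p * p" "t i j = r" "t j i = r"
    using powi_pair(3)[of "sgnv e * lsgn M i"] cartan_serre[OF ij(1,3,4)] cartan_sym[of M N i j]
    by (simp_all add: p_def r_def mult.left_commute)
  have x: "PX (f d j) r (x i)"
    using PXf[OF ij(2,1), of d] ti by simp
  have nz: "r \<noteq> 0" using pr by auto
  have cii: "cartan M N i i \<noteq> 0"
    using cartan_serre[OF ij(1,3,4)] by (simp add: lsgn_def)
  show ?thesis
    unfolding c
  proof (rule D2_zero[OF J nz nz])
    show "D2 r r (serre_y_family (p + r) (x i) (f d j)) n m k \<in> J" for n m k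
      unfolding serre_y_family_def[abs_def] D2_serre_y[OF pr x]
      using J_rel_quad[OF ij(1,1) cii, of m k]
      by (intro subspace_scale[OF J] J_right) (auto simp: rel_quad_def ti)
  qed (rule bounded_J[of d j], use subspace_0[OF J] in \<open>simp add: serre_y_family_def\<close>)
qed

lemma even_J:
  assumes MN: "M > 1" "N > 1" and al: "(a, c) = (M - 1, M + 1) \<or> (a, c) = (M + 1, M - 1)"
  shows "even_family (q + inverse q) (x M) (x c) k (f d a) n m u \<in> J"
proof -
  note nM = cartan_near_M[OF MN]
  \<comment> \<open>The two even nodes pair with the odd one with opposite signs, so
    \<open>r\<close> and \<open>p\<close> are inverse for either choice of
    \<open>(a, c)\<close>.\<close>
  define r where "r = t a M"
  define p where "p = t M c"
  have pr: "p * r = 1" and c: "q + inverse q = p + r"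
    using al nM q0 by (cases e; auto simp: p_def r_def power_int_minus add.commute)+
  have ac: "a \<in> nodes M N" "c \<in> nodes M N" "cartan M N a c = 0" "cartan M N M c \<noteq> 0" using al nM by auto
  have b: "PX (f d a) r (x M)"
    using PXf[OF ac(1) nM(8), of d] by (simp add: r_def)
  have nz: "r \<noteq> 0" using pr by auto
  define A where "A = (\<lambda>m n. x M m * x M n + x M n * x M m)"
  have A: "A m n \<in> J" for m n
    using J_comm[OF nM(8,8) cartan_MM[OF nM(8)], of m n] by (simp add: A_def rel_comm_def xsign_def)
  define Q where "Q = (\<lambda>m. x M (m + 1) * x c k - p \<cdot> (x c k * x M (m + 1))
     - (p \<cdot> (x M m * x c (k + 1)) - x c (k + 1) * x M m))"
  have Q: "Q m \<in> J" for m
    using J_rel_quad[OF nM(8) ac(2,4), of m k] by (simp add: Q_def rel_quad_def p_def)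
  show ?thesis
    unfolding c
  proof (rule D2_zero[OF J nz nz])
    show "D2 r r (even_family (p + r) (x M) (x c) k (f d a)) n m u \<in> J" for n m u
      unfolding even_family_def[abs_def] D2_quartic_even[OF pr b f_comm[OF ac(1-3)] Q_def A_def]
      by (intro J_intros A Q ac nM)
  qed (rule bounded_J[of d a], use subspace_0[OF J] in \<open>simp add: even_family_def\<close>)
qed

lemma odd_J:
  assumes MN: "M > 1" "N > 1"
  shows "odd_family (q + inverse q) (x (M - 1)) (x M) (x (M + 1)) u (f d M) n m k \<in> J"
proof -
  note nM = cartan_near_M[OF MN]
  define r where "r = t (M - 1) M"
  define p where "p = t M (M + 1)"
  have pr: "p * r = 1" and c: "q + inverse q = p + r"
    using nM q0 by (cases e; auto simp: p_def r_def power_int_minus add.commute)+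
  have a: "PX (f d M) r (x (M - 1))" and c': "PX (f d M) p (x (M + 1))"
    using PXf[OF nM(8,7), of d] PXf[OF nM(8,9), of d] nM by (simp_all add: r_def p_def)
  have nz: "r \<noteq> 0" "p \<noteq> 0" using pr by auto
  define Z where "Z = (\<lambda>m k. x (M - 1) m * x (M + 1) k - x (M + 1) k * x (M - 1) m)"
  have Z: "Z m k \<in> J" for m k
    using J_comm[OF nM(7,9,5), of m k] by (simp add: Z_def rel_comm_def xsign_def)
  define Qa where "Qa = (\<lambda>m. x (M - 1) (m + 1) * x M u - r \<cdot> (x M u * x (M - 1) (m + 1))
     - (r \<cdot> (x (M - 1) m * x M (u + 1)) - x M (u + 1) * x (M - 1) m))"
  have Qa: "Qa m \<in> J" for m
    using J_rel_quad[OF nM(7,8), of m u] nM by (simp add: Qa_def rel_quad_def r_def)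
  define Qc where "Qc = (\<lambda>k. x M (u + 1) * x (M + 1) k - p \<cdot> (x (M + 1) k * x M (u + 1))
     - (p \<cdot> (x M u * x (M + 1) (k + 1)) - x (M + 1) (k + 1) * x M u))"
  have Qc: "Qc k \<in> J" for k
    using J_rel_quad[OF nM(8,9), of u k] nM by (simp add: Qc_def rel_quad_def p_def)
  show ?thesis
    unfolding c
  proof (rule D2_zero[OF J nz])
    show "D2 r p (odd_family (p + r) (x (M - 1)) (x M) (x (M + 1)) u (f d M)) n m k \<in> J" for n m k
      unfolding odd_family_def[abs_def]
        D2_quartic_odd[OF pr a c' f_comm[OF nM(8,8) cartan_MM[OF nM(8)]] fun_cong[OF Qa_def] fun_cong[OF Qc_def] Z_def]
      by (intro J_intros Z Qa Qc nM)
  qed (rule bounded_J[of d M], use subspace_0[OF J] in \<open>simp add: odd_family_def\<close>)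
qed

lemma families_g_J:
  assumes "i \<in> nodes M N" "j \<in> nodes M N" "cartan M N i j \<in> {1, - 1}" "i \<noteq> M"
  shows "serre_x_family (q + inverse q) (x i) (x j) (g i) n m k \<in> J"
    "serre_y_family (q + inverse q) (x i) (g j) n m k \<in> J"
  using serre_x_J[OF assms] serre_y_J[OF assms]
  unfolding g_def[abs_def] family_diff by (auto intro!: subspace_scale[OF J] subspace_diff[OF J])

lemma families_g_J':
  assumes "M > 1" "N > 1"
  shows "even_family (q + inverse q) (x M) (x (M + 1)) k (g (M - 1)) n m u \<in> J"
    "even_family (q + inverse q) (x M) (x (M - 1)) k (g (M + 1)) n m u \<in> J"
    "odd_family (q + inverse q) (x (M - 1)) (x M) (x (M + 1)) u (g M) n m k \<in> J"
  using even_J[OF assms, of "M - 1" "M + 1"] even_J[OF assms, of "M + 1" "M - 1"] odd_J[OF assms]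
  unfolding g_def[abs_def] family_diff by (auto intro!: J_intros)


text \<open>Membership in \<open>J\<close> is part of the notion because crossing a product leaves
  terms in which the other factor became \<open>g\<close>; they are harmless exactly because the
  factor \<open>T\<close> lies in \<open>J\<close>.\<close>

definition scomm_J :: "complex \<Rightarrow> nat \<Rightarrow> int \<Rightarrow> 'a \<Rightarrow> bool"
  where "scomm_J s l p T \<longleftrightarrow> T \<in> J \<and> T * y l p - s \<cdot> (y l p * T) \<in> J"

lemma scomm_J_left:
  assumes "scomm_J s l p T" "i \<in> nodes M N" "l \<in> nodes M N"
  shows "scomm_J (xsign M i l * s) l p (x i m * T)"
proof -
  have "x i m * T * y l p - (xsign M i l * s) \<cdot> (y l p * (x i m * T))
    = x i m * (T * y l p - s \<cdot> (y l p * T)) + s \<cdot> (D i l (m + p) * T)"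
    by (simp add: cross_rules[OF assms(2,3)] alg mult.commute[of s "xsign M i l"])
  also have "D i l (m + p) * T \<in> J"
    using assms J_left_g subspace_0[OF J] by (simp add: D_def scomm_J_def)
  then have "x i m * (T * y l p - s \<cdot> (y l p * T)) + s \<cdot> (D i l (m + p) * T) \<in> J"
    using assms by (intro subspace_add[OF J] subspace_scale[OF J] J_left) (auto simp: scomm_J_def)
  finally show ?thesis using assms J_left by (simp add: scomm_J_def)
qed

lemma scomm_J_right:
  assumes "scomm_J s l p T" "i \<in> nodes M N" "l \<in> nodes M N"
  shows "scomm_J (xsign M i l * s) l p (T * x i m)"
proof -
  have "T * x i m * y l p - (xsign M i l * s) \<cdot> (y l p * (T * x i m))
    = xsign M i l \<cdot> ((T * y l p - s \<cdot> (y l p * T)) * x i m) + T * D i l (m + p)"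
    by (simp add: cross_rules[OF assms(2,3)] alg)
  also have "\<dots> \<in> J"
    using assms by (intro subspace_add[OF J] subspace_scale[OF J] J_right) (auto simp: scomm_J_def)
  finally show ?thesis using assms J_right by (simp add: scomm_J_def)
qed

lemma scomm_J_add: "scomm_J s l p T \<Longrightarrow> scomm_J s l p T' \<Longrightarrow> scomm_J s l p (T + T')"
  using subspace_add[OF J, of "T * y l p - s \<cdot> (y l p * T)" "T' * y l p - s \<cdot> (y l p * T')"] subspace_add[OF J, of T T']
  by (simp add: scomm_J_def alg algebra_simps)

lemma scomm_J_scale: "scomm_J s l p T \<Longrightarrow> scomm_J s l p (c \<cdot> T)"
  using subspace_scale[OF J, of "T * y l p - s \<cdot> (y l p * T)" c] subspace_scale[OF J, of T c]
  by (simp add: scomm_J_def alg mult.commute[of c s])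

lemma scomm_J_comm:
  assumes "i \<in> nodes M N" "j \<in> nodes M N" "cartan M N i j = 0" "l \<in> nodes M N"
  shows "scomm_J (xsign M i l * xsign M j l) l p (rel_comm M x i j m n)"
  using cross_comm[OF assms] J_comm[OF assms(1-3)] subspace_0[OF J] by (simp add: scomm_J_def)

text \<open>The opposite current leaves a series only at letters of its own node. If this is
  \<open>i\<close>, each of the two equal letters contributes a family of the first kind; if it is
  \<open>j\<close>, one family of the second kind appears; otherwise nothing remains.\<close>

lemma cross_serre:
  assumes ij: "i \<in> nodes M N" "j \<in> nodes M N" "cartan M N i j \<in> {1, - 1}" "i \<noteq> M" and l: "l \<in> nodes M N"
  shows "\<exists>s. s \<noteq> 0 \<and> rel_serre q x i j m n k * y l p - s \<cdot> (y l p * rel_serre q x i j m n k) \<in> J"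
proof -
  have ne: "i \<noteq> j" and x1: "xsign M i l = 1"
    using cartan_serre[OF ij(1,3,4)] ij(4) by (auto simp: xsign_def)
  note fam = families_g_J[OF ij]
  define a where "a = x i"
  define b where "b = x j"
  define Y where "Y = y l p"
  define s where "s = xsign M j l"
  have ra: "a m * Y = Y * a m + D i l (m + p)" "a m * (Y * z) = Y * (a m * z) + D i l (m + p) * z" for m z
    using cross_rules[OF ij(1) l] x1 by (simp_all add: a_def Y_def)
  have rb: "b m * Y = s \<cdot> (Y * b m) + D j l (m + p)" "b m * (Y * z) = s \<cdot> (Y * (b m * z)) + D j l (m + p) * z" for m z
    using cross_rules[OF ij(2) l] by (simp_all add: b_def Y_def s_def)
  have D: "D i l (m + p) = 0 \<or> s = 1 \<and> l = i \<and> D j l (k + p) = 0" for m k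
    using ne ij(4) by (auto simp: D_def s_def xsign_def)
  consider "l = i" | "l = j" | "l \<noteq> i" "l \<noteq> j" by blast
  then have "rel_serre q x i j m n k * Y - s \<cdot> (Y * rel_serre q x i j m n k) \<in> J"
  proof cases
    case 1
    have D: "D i l r = g i r" "D j l r = 0" "s = 1" for r
      using 1 ne ij(4) by (auto simp: D_def s_def xsign_def)
    have "rel_serre q x i j m n k * Y - s \<cdot> (Y * rel_serre q x i j m n k)
      = serre_x_family (q + inverse q) a b (g i) (m + p) n k + serre_x_family (q + inverse q) a b (g i) (n + p) m k"
      unfolding rel_serre_eq[OF q0] a_def[symmetric] b_def[symmetric] serre_x_family_def
      by (simp add: ra rb D mult.assoc alg; simp add: algebra_simps)
    then show ?thesis using fam by (simp add: a_def b_def subspace_add[OF J])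
  next
    case 2
    have D: "D j l r = g j r" "D i l r = 0" for r
      using 2 ne by (auto simp: D_def)
    have "rel_serre q x i j m n k * Y - s \<cdot> (Y * rel_serre q x i j m n k)
      = serre_y_family (q + inverse q) a (g j) (k + p) m n"
      unfolding rel_serre_eq[OF q0] a_def[symmetric] b_def[symmetric] serre_y_family_def
      by (simp add: ra rb D mult.assoc alg; simp add: algebra_simps)
    then show ?thesis using fam by (simp add: a_def)
  next
    case 3
    have D: "D j l r = 0" "D i l r = 0" for r
      using 3 by (auto simp: D_def)
    have "rel_serre q x i j m n k * Y - s \<cdot> (Y * rel_serre q x i j m n k) = 0"
      unfolding rel_serre_eq[OF q0] a_def[symmetric] b_def[symmetric]
      by (simp add: ra rb D mult.assoc alg; simp add: algebra_simps)
    then show ?thesis using subspace_0[OF J] by simp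
  qed
  moreover have "s \<noteq> 0" by (simp add: s_def)
  ultimately show ?thesis unfolding Y_def by blast
qed

text \<open>The symmetric part yields even or odd families, and the corrections, having a quadratic
  relation as a factor, are handled by \<open>scomm_J\<close>. The scalar is one because the
  relation contains two odd letters.\<close>

lemma cross_quartic:
  assumes MN: "M > 1" "N > 1" and l: "l \<in> nodes M N"
  shows "\<exists>s. s \<noteq> 0 \<and> rel_quartic q M x m n k u * y l p - s \<cdot> (y l p * rel_quartic q M x m n k u) \<in> J"
proof -
  note nM = cartan_near_M[OF MN]
  note fam = families_g_J'[OF MN]
  define a where "a = x (M - 1)"
  define b where "b = x M"
  define c where "c = x (M + 1)"
  define Y where "Y = y l p"
  define Da where "Da = D (M - 1) l"
  define Db where "Db = D M l"
  define Dc where "Dc = D (M + 1) l"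
  define ga where "ga = g (M - 1)"
  define gc where "gc = g (M + 1)"
  define S where "S = quartic_sym (q + inverse q) a b c m n k u"
  have x1: "xsign M (M - 1) l = 1" "xsign M (M + 1) l = 1" using MN by (auto simp: xsign_def)
  have xM: "xsign M M l = (if l = M then -1 else 1)" by (auto simp: xsign_def)
  have ra: "a m * Y = Y * a m + Da (m + p)" "a m * (Y * z) = Y * (a m * z) + Da (m + p) * z" for m z
    using cross_rules[OF nM(7) l] x1 by (simp_all add: a_def Y_def Da_def)
  have rc: "c m * Y = Y * c m + Dc (m + p)" "c m * (Y * z) = Y * (c m * z) + Dc (m + p) * z" for m z
    using cross_rules[OF nM(9) l] x1 by (simp_all add: c_def Y_def Dc_def)
  have rb: "b m * Y = (if l = M then -1 else 1) \<cdot> (Y * b m) + Db (m + p)"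
     "b m * (Y * z) = (if l = M then -1 else 1) \<cdot> (Y * (b m * z)) + Db (m + p) * z" for m z
    using cross_rules[OF nM(8) l] unfolding b_def Y_def Db_def xM by blast+
  consider "l = M - 1" | "l = M + 1" | "l = M" | "l \<noteq> M - 1" "l \<noteq> M" "l \<noteq> M + 1" by blast
  then have S: "S * Y - Y * S \<in> J"
  proof cases
    case 1
    have D: "Da r = ga r" "Dc r = 0" "Db r = 0" "l \<noteq> M" for r
      using 1 MN by (auto simp: D_def Da_def Db_def Dc_def ga_def gc_def)
    \<comment> \<open>In its last two terms the even family has the series to the right of the other
      even current; moving it there uses that the two even nodes are orthogonal.\<close>
    have gcc: "ga r * c k = c k * ga r" "ga r * (c k * z) = c k * (ga r * z)" for r z
      using g_comm[OF nM(7,9,5)] by (simp_all add: c_def ga_def mult.assoc[symmetric])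
    have "S * Y - Y * S = even_family (q + inverse q) b c k (ga) (m + p) n u"
      unfolding S_def quartic_sym_def even_family_def
      by (simp add: ra rb rc D gcc mult.assoc alg; simp add: algebra_simps)
    then show ?thesis using fam by (simp add: b_def c_def ga_def)
  next
    case 2
    have D: "Dc r = gc r" "Da r = 0" "Db r = 0" "l \<noteq> M" for r
      using 2 MN by (auto simp: D_def Da_def Db_def Dc_def ga_def gc_def)
    have "S * Y - Y * S = even_family (q + inverse q) b a m (gc) (k + p) n u"
      unfolding S_def quartic_sym_def even_family_def
      by (simp add: ra rb rc D mult.assoc alg; simp add: algebra_simps)
    then show ?thesis using fam by (simp add: b_def a_def gc_def)
  next
    case 3
    have D: "Db r = g M r" "Da r = 0" "Dc r = 0" for r
      using 3 MN by (auto simp: D_def Da_def Db_def Dc_def ga_def gc_def)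
    have "S * Y - Y * S = odd_family (q + inverse q) a b c n (g M) (u + p) m k
      + odd_family (q + inverse q) a b c u (g M) (n + p) m k"
      unfolding S_def quartic_sym_def odd_family_def
      by (simp add: ra rb rc D 3 mult.assoc alg; simp add: algebra_simps)
    then show ?thesis using fam by (simp add: a_def b_def c_def subspace_add[OF J])
  next
    case 4
    have D: "Db r = 0" "Da r = 0" "Dc r = 0" for r
      using 4 by (auto simp: D_def Da_def Db_def Dc_def ga_def gc_def)
    have "S * Y - Y * S = 0"
      unfolding S_def quartic_sym_def
      by (simp add: ra rb rc D 4 mult.assoc alg)
    then show ?thesis using subspace_0[OF J] by simp
  qed
  \<comment> \<open>The corrections of \<open>rel_quartic_eq\<close>; modulo \<open>J\<close> each
    summand commutes with the opposite current.\<close>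
  define X where "X = (- q) \<cdot> (c k * (a m * rel_comm M x M M n u))
     + (- inverse q) \<cdot> (rel_comm M x M M n u * a m * c k)
     + q \<cdot> (b n * (rel_comm M x (M - 1) (M + 1) m k * b u) + b u * (rel_comm M x (M - 1) (M + 1) m k * b n))"
  have A: "scomm_J 1 l p (rel_comm M x M M n u)"
    using scomm_J_comm[OF nM(8,8) cartan_MM[OF nM(8)] l, of p n u] xsign_sq[of M M l] by simp
  have Z: "scomm_J 1 l p (rel_comm M x (M - 1) (M + 1) m k)"
    using scomm_J_comm[OF nM(7,9,5) l, of p m k] x1 by simp
  have Zb: "scomm_J 1 l p (b n' * (rel_comm M x (M - 1) (M + 1) m k * b u'))" for n' u'
    using scomm_J_left[OF scomm_J_right[OF Z nM(8) l] nM(8) l] xsign_sq[of M M l] by (simp add: b_def)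
  have "scomm_J 1 l p (c k * (a m * rel_comm M x M M n u))"
    using scomm_J_left[OF scomm_J_left[OF A nM(7) l] nM(9) l] x1 by (simp add: a_def c_def)
  moreover have "scomm_J 1 l p (rel_comm M x M M n u * a m * c k)"
    using scomm_J_right[OF scomm_J_right[OF A nM(7) l] nM(9) l] x1 by (simp add: a_def c_def)
  ultimately have "scomm_J 1 l p X"
    unfolding X_def by (intro scomm_J_add scomm_J_scale Zb)
  then have "X * Y - Y * X \<in> J" by (simp add: scomm_J_def Y_def)
  moreover have R: "rel_quartic q M x m n k u = S + X"
    using MN by (simp add: rel_quartic_eq[OF q0] S_def X_def a_def b_def c_def)
  ultimately have "rel_quartic q M x m n k u * Y - 1 \<cdot> (Y * rel_quartic q M x m n k u) \<in> J"
    using subspace_add[OF J S, of "X * Y - Y * X"] by (simp add: R distrib_left distrib_right algebra_simps)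
  then show ?thesis unfolding Y_def by (intro exI[of _ 1]) simp
qed

theorem cross_higher:
  assumes "R \<in> higher_rels M N q x" "l \<in> nodes M N"
  shows "\<exists>s. s \<noteq> 0 \<and> R * y l p - s \<cdot> (y l p * R) \<in> J"
  using assms(1) cross_serre[OF _ _ _ _ assms(2)] cross_quartic[OF _ _ assms(2)]
  unfolding higher_rels_def by blast

end

subsection \<open>Parity\<close>

lemma fhomog_zero [simp]: "0 \<in> fhomog par d"
  by (simp add: fhomog_def)

lemma fhomog_add: "a \<in> fhomog par d \<Longrightarrow> b \<in> fhomog par d \<Longrightarrow> a + b \<in> fhomog par d"
  using Poly_Mapping.keys_add[of a b] by (auto simp: fhomog_def)

lemma fhomog_uminus: "a \<in> fhomog par d \<Longrightarrow> - a \<in> fhomog par d"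
  by (simp add: fhomog_def)

lemma fhomog_diff: "a \<in> fhomog par d \<Longrightarrow> b \<in> fhomog par d \<Longrightarrow> a - b \<in> fhomog par d"
  using fhomog_add[of a par d "- b"] by (simp add: fhomog_uminus)

lemma fhomog_scale: "a \<in> fhomog par d \<Longrightarrow> c \<star> a \<in> fhomog par d"
  by (auto simp: fhomog_def in_keys_iff)

lemma fhomog_mult: "a \<in> fhomog par d \<Longrightarrow> b \<in> fhomog par d' \<Longrightarrow> a * b \<in> fhomog par (d + d')"
proof -
  assume a: "a \<in> fhomog par d" and b: "b \<in> fhomog par d'"
  have "sum_list (map par (letters w)) = d + d'" if "w \<in> pkeys (a * b)" for w
  proof -
    from that keys_mult[of a b] obtain u v where "w = u + v" "u \<in> pkeys a" "v \<in> pkeys b" by blast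
    then show ?thesis using a b by (auto simp: fhomog_def plus_word_def)
  qed
  then show ?thesis by (auto simp: fhomog_def)
qed

lemma fhomog_wd: "wd xs \<in> fhomog par (sum_list (map par xs))"
  by (auto simp: fhomog_def wd_def split: if_splits)

lemma fhomog_one: "1 \<in> fhomog par 0"
  using fhomog_wd[of "[]" par] by simp

lemma fhomog_gen: "gen g \<in> fhomog par (par g)"
  by (simp add: fhomog_def gen_def)

lemma fhomog_gen_iff: "gen g \<in> fhomog par d \<longleftrightarrow> par g = d"
  by (auto simp: fhomog_def gen_def)

text \<open>\<open>sbr\<close> reads its sign off from membership in \<open>fhomog\<close>.
  Generators of even nodes are not odd, so brackets with them carry no sign; in the outermost
  quartic bracket both entries are shown to be odd.\<close>

lemma current_rels_eq:
  assumes x: "\<And>i n. x i n = gen (G i n)" and par: "\<And>i n. par (G i n) = (if i = M then 1 else 0)"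
    and "M > 0"
  shows "current_rels M N q par e x = falg.quad_rels M N q e x \<union> falg.higher_rels M N q x"
proof -
  have odd: "x i n \<in> fhomog par 1 \<longleftrightarrow> i = M" for i n
    by (simp add: x par fhomog_gen_iff)
  have hom: "x i n \<in> fhomog par (if i = M then 1 else 0)" for i n
    by (simp add: x par fhomog_gen_iff)
  have comm: "sbr par 1 (x i m) (x j n) = falg.rel_comm M x i j m n" for i j m n
    by (simp add: sbr_def odd falg.rel_comm_def xsign_def)
  have ubr: "sbr par u (x i m) b = falg.ubr u (x i m) b" "sbr par u b (x i m) = falg.ubr u b (x i m)"
    if "i \<noteq> M" for u i m b
    using that by (simp_all add: sbr_def odd falg.ubr_def)
  have serre: "sbr par q (x i m) (sbr par (inverse q) (x i n) (x j k))
       + sbr par q (x i n) (sbr par (inverse q) (x i m) (x j k)) = falg.rel_serre q x i j m n k"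
    if "i \<noteq> M" for i j m n k
    using that by (simp add: ubr falg.rel_serre_def)
  have quartic: "sbr par 1 (sbr par q (sbr par (inverse q) (x (M - 1) m) (x M n)) (x (M + 1) k)) (x M u)
       + sbr par 1 (sbr par q (sbr par (inverse q) (x (M - 1) m) (x M u)) (x (M + 1) k)) (x M n)
      = falg.rel_quartic q M x m n k u" for m n k u
  proof -
    have "falg.ubr q (falg.ubr (inverse q) (x (M - 1) m) (x M n)) (x (M + 1) k) \<in> fhomog par 1" for n
    proof -
      have ub: "falg.ubr c a b \<in> fhomog par (d + d')" if "a \<in> fhomog par d" "b \<in> fhomog par d'" for a b c d d'
        unfolding falg.ubr_def
        using fhomog_mult[OF that] fhomog_mult[OF that(2,1)] unfolding add.commute[of d' d]
        by (intro fhomog_diff fhomog_scale)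
      show ?thesis
        using ub[OF ub, of "x (M - 1) m" 0 "x M n" 1 "x (M + 1) k" 0] \<open>M > 0\<close>
        by (simp add: x par fhomog_gen_iff)
    qed
    then have "sbr par 1 (falg.ubr q (falg.ubr (inverse q) (x (M - 1) m) (x M n)) (x (M + 1) k)) (x M u)
      = falg.ubr (-1) (falg.ubr q (falg.ubr (inverse q) (x (M - 1) m) (x M n)) (x (M + 1) k)) (x M u)" for n u
      unfolding sbr_def[of par 1] by (simp add: odd falg.ubr_def[of "-1"])
    then show ?thesis
      using \<open>M > 0\<close> by (simp add: ubr falg.rel_quartic_def)
  qed
  have "{sbr par q (x i m) (sbr par (inverse q) (x i n) (x j k))
       + sbr par q (x i n) (sbr par (inverse q) (x i m) (x j k)) | i j m n k.
       i \<in> nodes M N \<and> j \<in> nodes M N \<and> cartan M N i j \<in> {1, - 1} \<and> i \<noteq> M}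
    = {falg.rel_serre q x i j m n k | i j m n k.
       i \<in> nodes M N \<and> j \<in> nodes M N \<and> cartan M N i j \<in> {1, - 1} \<and> i \<noteq> M}"
    using serre by (intro Collect_cong) metis
  then show ?thesis
    unfolding current_rels_def falg.quad_rels_def falg.higher_rels_def falg.rel_quad_def comm quartic
    by (simp only: Un_assoc)
qed

text \<open>The coefficients of \<open>(1 - v z) / (1 - u z)\<close>.\<close>

definition gco :: "complex \<Rightarrow> complex \<Rightarrow> nat \<Rightarrow> complex"
  where "gco u v n = (if n = 0 then 1 else u ^ n - v * u ^ (n - 1))"

text \<open>The logarithmic derivative of \<open>(1 - v z) / (1 - u z)\<close>, multiplied by
  \<open>z\<close>, has the coefficients \<open>u ^ s - v ^ s\<close>.\<close>

lemma gco_rec: "of_nat n * gco u v n = (\<Sum>s=0..n. (u ^ s - v ^ s) * gco u v (n - s))"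
proof -
  have P: "(\<Sum>j<Suc n. u ^ (Suc n - j) * gco u v j) = of_nat (Suc n) * u ^ Suc n - of_nat n * v * u ^ n" for n
  proof (induction n)
    case (Suc n)
    have "(\<Sum>j<Suc (Suc n). u ^ (Suc (Suc n) - j) * gco u v j)
      = u * (\<Sum>j<Suc n. u ^ (Suc n - j) * gco u v j) + u * gco u v (Suc n)"
      by (simp add: sum_distrib_left Suc_diff_le algebra_simps)
    then show ?case unfolding Suc by (simp add: gco_def algebra_simps)
  qed (simp add: gco_def)
  have Q: "(\<Sum>j<Suc n. v ^ (Suc n - j) * gco u v j) = v * u ^ n" for n
  proof (induction n)
    case (Suc n)
    have "(\<Sum>j<Suc (Suc n). v ^ (Suc (Suc n) - j) * gco u v j)
      = v * (\<Sum>j<Suc n. v ^ (Suc n - j) * gco u v j) + v * gco u v (Suc n)"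
      by (simp add: sum_distrib_left Suc_diff_le algebra_simps)
    then show ?case unfolding Suc by (simp add: gco_def algebra_simps)
  qed (simp add: gco_def)
  show ?thesis
  proof (cases n)
    case (Suc m)
    have "(\<Sum>s=0..n. (u ^ s - v ^ s) * gco u v (n - s)) = (\<Sum>j=0..n. (u ^ (n - j) - v ^ (n - j)) * gco u v j)"
      by (subst sum.atLeastAtMost_rev) (auto intro!: sum.cong)
    also have "\<dots> = (\<Sum>j<n. (u ^ (n - j) - v ^ (n - j)) * gco u v j)"
      by (simp add: atLeast0AtMost lessThan_Suc_atMost[symmetric])
    also have "\<dots> = of_nat (Suc m) * u ^ Suc m - of_nat m * v * u ^ m - v * u ^ m"
      using P[of m] Q[of m] by (simp add: Suc left_diff_distrib sum_subtractf)
    also have "\<dots> = of_nat n * gco u v n" by (simp add: Suc gco_def algebra_simps)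
    finally show ?thesis by simp
  qed simp
qed

context calg
begin

lemma eval_rels:
  "eval scale lt ` falg.quad_rels M N q e x = quad_rels M N q e (\<lambda>i n. eval scale lt (x i n))"
  "eval scale lt ` falg.higher_rels M N q x = higher_rels M N q (\<lambda>i n. eval scale lt (x i n))"
proof -
  have u: "eval scale lt (falg.ubr c a b) = ubr c (eval scale lt a) (eval scale lt b)" for c a b
    by (simp add: falg.ubr_def ubr_def eval_simps)
  have "eval scale lt (falg.rel_comm M x i j m n) = rel_comm M (\<lambda>i n. eval scale lt (x i n)) i j m n"
    "eval scale lt (falg.rel_quad c x i j m n) = rel_quad c (\<lambda>i n. eval scale lt (x i n)) i j m n"
    "eval scale lt (falg.rel_serre q x i j m n k) = rel_serre q (\<lambda>i n. eval scale lt (x i n)) i j m n k"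
    "eval scale lt (falg.rel_quartic q M x m n k u) = rel_quartic q M (\<lambda>i n. eval scale lt (x i n)) m n k u" for i j m n k u c
    by (simp_all add: falg.rel_comm_def rel_comm_def falg.rel_quad_def rel_quad_def
        falg.rel_serre_def rel_serre_def falg.rel_quartic_def rel_quartic_def u eval_simps)
  note * = this
  show "eval scale lt ` falg.quad_rels M N q e x = quad_rels M N q e (\<lambda>i n. eval scale lt (x i n))"
    unfolding falg.quad_rels_def quad_rels_def image_Un *[symmetric] by blast
  show "eval scale lt ` falg.higher_rels M N q x = higher_rels M N q (\<lambda>i n. eval scale lt (x i n))"
    unfolding falg.higher_rels_def higher_rels_def image_Un *[symmetric] by blast
qed

subsection \<open>Exponentials\<close>

text \<open>The Euler operator \<open>z d/dz\<close>; as it preserves degrees, the coefficient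
  identities below involve no shift.\<close>

definition fps_theta :: "'a fps \<Rightarrow> 'a fps"
  where "fps_theta F = Abs_fps (\<lambda>n. of_nat n * fps_nth F n)"

lemma fps_theta_mult: "fps_theta (F * G) = fps_theta F * G + F * fps_theta G"
proof (rule fps_ext)
  fix n
  have "of_nat n * (\<Sum>i=0..n. fps_nth F i * fps_nth G (n - i))
    = (\<Sum>i=0..n. of_nat i * fps_nth F i * fps_nth G (n - i) + fps_nth F i * (of_nat (n - i) * fps_nth G (n - i)))"
    unfolding sum_distrib_left
  proof (intro sum.cong refl)
    fix i assume "i \<in> {0..n}"
    then have "of_nat n = (of_nat i + of_nat (n - i) :: 'a)" by (simp flip: of_nat_add)
    then show "of_nat n * (fps_nth F i * fps_nth G (n - i))
      = of_nat i * fps_nth F i * fps_nth G (n - i) + fps_nth F i * (of_nat (n - i) * fps_nth G (n - i))"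
      by (metis (no_types) distrib_right mult.assoc mult_of_nat_commute)
  qed
  then show "fps_nth (fps_theta (F * G)) n = fps_nth (fps_theta F * G + F * fps_theta G) n"
    by (simp add: fps_theta_def fps_mult_nth sum.distrib)
qed

lemma fps_theta_power:
  assumes "F * fps_theta F = fps_theta F * F"
  shows "fps_theta (F ^ Suc k) = of_nat (Suc k) * (fps_theta F * F ^ k)"
proof (induction k)
  case (Suc k)
  have "F * F ^ k = F ^ k * F" by (metis power_commutes)
  have "fps_theta (F ^ Suc (Suc k)) = fps_theta F * F ^ Suc k + F * fps_theta (F ^ Suc k)"
    by (subst power_Suc) (rule fps_theta_mult)
  also have "F * fps_theta (F ^ Suc k) = of_nat (Suc k) * (F * (fps_theta F * F ^ k))"
    unfolding Suc by (metis mult.assoc mult_of_nat_commute)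
  also have "F * (fps_theta F * F ^ k) = fps_theta F * F ^ Suc k"
    by (simp add: mult.assoc[symmetric] assms)
  finally show ?case by (simp add: distrib_right)
qed (simp add: fps_theta_def fps_eq_iff)

lemma fps_power_low:
  assumes "fps_nth F 0 = 0" "n < k"
  shows "fps_nth (F ^ k) n = 0"
  using assms(2)
proof (induction k arbitrary: n)
  case (Suc k)
  have "fps_nth F i * fps_nth (F ^ k) (n - i) = 0" if "i \<le> n" for i
    using Suc that assms(1) by (cases "i = 0") auto
  then show ?case by (simp add: fps_mult_nth)
qed simp

text \<open>A coefficient of the exponential of the series \<open>A\<close>. The sum stops at
  \<open>n\<close> because for \<open>A 0 = 0\<close> higher powers start beyond degree
  \<open>n\<close>.\<close>

definition expc :: "(nat \<Rightarrow> 'a) \<Rightarrow> nat \<Rightarrow> 'a"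
  where "expc A n = (\<Sum>k=0..n. (1 / fact k) \<cdot> fps_nth (Abs_fps A ^ k) n)"

lemma scale_of_nat: "of_nat n * x = of_nat n \<cdot> x"
  by (induction n) (auto simp: algebra_simps)

lemma expc_0: "A 0 = 0 \<Longrightarrow> expc A 0 = 1"
  by (simp add: expc_def)

text \<open>For commuting coefficients the exponential \<open>E\<close> of \<open>F\<close>
  satisfies \<open>fps_theta E = fps_theta F * E\<close>; this is the comparison in degree
  \<open>n\<close>.\<close>

lemma expc_rec:
  assumes A0: "A 0 = 0" and comm: "\<And>s t. A s * A t = A t * A s"
  shows "of_nat n \<cdot> expc A n = (\<Sum>s=0..n. of_nat s \<cdot> (A s * expc A (n - s)))"
proof -
  define F where "F = Abs_fps A"
  have F0: "fps_nth F 0 = 0" by (simp add: F_def A0)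
  have cF: "F * fps_theta F = fps_theta F * F"
  proof (rule fps_ext)
    fix n
    have "fps_nth (F * fps_theta F) n = (\<Sum>i=0..n. A i * (of_nat (n - i) * A (n - i)))"
      by (simp add: fps_mult_nth fps_theta_def F_def)
    also have "\<dots> = (\<Sum>i=0..n. A (n - i) * (of_nat i * A i))"
      by (subst sum.atLeastAtMost_rev) (auto intro!: sum.cong)
    also have "\<dots> = (\<Sum>i=0..n. of_nat i * A i * A (n - i))"
      by (intro sum.cong refl) (metis comm mult.assoc mult_of_nat_commute)
    finally show "fps_nth (F * fps_theta F) n = fps_nth (fps_theta F * F) n"
      by (simp add: fps_mult_nth fps_theta_def F_def)
  qed
  have E: "expc A m = (\<Sum>k=0..K. (1 / fact k) \<cdot> fps_nth (F ^ k) m)" if "m \<le> K" for m K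
    unfolding expc_def F_def[symmetric]
    using that fps_power_low[OF F0] by (intro sum.mono_neutral_left) auto
  have "of_nat n \<cdot> expc A n = (\<Sum>k=0..Suc n. (1 / fact k) \<cdot> fps_nth (fps_theta (F ^ k)) n)"
    unfolding E[of n "Suc n", simplified]
    by (simp add: scale_sum_right fps_theta_def scale_of_nat algebra_simps)
  also have "\<dots> = (\<Sum>k=0..n. (1 / fact (Suc k)) \<cdot> fps_nth (fps_theta (F ^ Suc k)) n)"
    by (subst sum.atLeast0_atMost_Suc_shift) (simp add: fps_theta_def)
  also have "\<dots> = (\<Sum>k=0..n. (1 / fact k) \<cdot> fps_nth (fps_theta F * F ^ k) n)"
  proof (intro sum.cong refl)
    fix k
    have "fps_nth (of_nat m * G) n = of_nat m \<cdot> fps_nth G n" for m G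
      by (simp add: fps_of_nat[symmetric] scale_of_nat)
    then show "(1 / fact (Suc k)) \<cdot> fps_nth (fps_theta (F ^ Suc k)) n = (1 / fact k) \<cdot> fps_nth (fps_theta F * F ^ k) n"
      unfolding fps_theta_power[OF cF] by (simp del: of_nat_Suc)
  qed
  also have "\<dots> = (\<Sum>k=0..n. \<Sum>s=0..n. (1 / fact k) \<cdot> (of_nat s \<cdot> (A s * fps_nth (F ^ k) (n - s))))"
    by (simp add: fps_mult_nth fps_theta_def F_def scale_sum_right scale_of_nat scale_mult_left)
  also have "\<dots> = (\<Sum>s=0..n. of_nat s \<cdot> (A s * expc A (n - s)))"
    unfolding E[OF diff_le_self]
    by (subst sum.swap) (simp add: scale_sum_right sum_distrib_left scale_mult_right mult.commute)
  finally show ?thesis .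
qed


text \<open>Conjugating a current by the exponential multiplies it by
  \<open>(1 - v z) / (1 - u z)\<close>, because the assumption \<open>X\<close> says that the
  exponent acts by the logarithm of this function. The induction matches the recursions
  \<open>expc_rec\<close> and \<open>gco_rec\<close> and divides by \<open>n\<close>.\<close>

lemma expc_shift:
  assumes A0: "A 0 = 0" and comm: "\<And>s t. A s * A t = A t * A s"
    and X: "\<And>s m. of_nat s \<cdot> (A s * X m) = of_nat s \<cdot> (X m * A s) + (u ^ s - v ^ s) \<cdot> X (m + d * int s)"
  shows "expc A n * X m = (\<Sum>k=0..n. gco u v k \<cdot> (X (m + d * int k) * expc A (n - k)))"
proof (induction n arbitrary: m rule: less_induct)
  case (less n)
  show ?case
  proof (cases "n = 0")
    case True
    then show ?thesis by (simp add: expc_0[of A, OF A0] gco_def)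
  next
    case False
    have "of_nat n \<cdot> (expc A n * X m) = (\<Sum>s=0..n. of_nat s \<cdot> (A s * (expc A (n - s) * X m)))"
      unfolding scale_mult_left[symmetric] expc_rec[of A, OF A0 comm]
      by (simp add: sum_distrib_right scale_mult_left mult.assoc)
    also have "\<dots> = (\<Sum>s=0..n. \<Sum>k=0..n-s. of_nat s \<cdot> (gco u v k \<cdot> (A s * X (m + d * int k) * expc A (n - s - k))))"
    proof (intro sum.cong refl)
      fix s assume "s \<in> {0..n}"
      show "of_nat s \<cdot> (A s * (expc A (n - s) * X m))
        = (\<Sum>k=0..n-s. of_nat s \<cdot> (gco u v k \<cdot> (A s * X (m + d * int k) * expc A (n - s - k))))"
      proof (cases "s = 0")
        case False
        then show ?thesis using less[of "n - s" m] \<open>n \<noteq> 0\<close>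
          by (simp add: sum_distrib_left scale_mult_right mult.assoc scale_sum_right)
      qed simp
    qed
    also have "\<dots> = (\<Sum>s=0..n. \<Sum>k=0..n-s. gco u v k \<cdot> (X (m + d * int k) * (of_nat s \<cdot> (A s * expc A (n - k - s))))
        + ((u ^ s - v ^ s) * gco u v k) \<cdot> (X (m + d * int (k + s)) * expc A (n - (k + s))))"
    proof (intro sum.cong refl)
      fix s k assume "s \<in> {0..n}" "k \<in> {0..n - s}"
      have "of_nat s \<cdot> (gco u v k \<cdot> (A s * X (m + d * int k) * expc A (n - s - k)))
        = gco u v k \<cdot> ((of_nat s \<cdot> (A s * X (m + d * int k))) * expc A (n - s - k))"
        by (simp add: scale_mult_left mult.commute)
      also have "\<dots> = gco u v k \<cdot> (X (m + d * int k) * (of_nat s \<cdot> (A s * expc A (n - k - s))))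
        + ((u ^ s - v ^ s) * gco u v k) \<cdot> (X (m + d * int (k + s)) * expc A (n - (k + s)))"
        unfolding X
        by (simp add: distrib_right scale_right_distrib scale_mult_left scale_mult_right mult.assoc
            add.assoc distrib_left diff_commute mult.commute add.commute add.left_commute)
      finally show "of_nat s \<cdot> (gco u v k \<cdot> (A s * X (m + d * int k) * expc A (n - s - k)))
        = gco u v k \<cdot> (X (m + d * int k) * (of_nat s \<cdot> (A s * expc A (n - k - s))))
        + ((u ^ s - v ^ s) * gco u v k) \<cdot> (X (m + d * int (k + s)) * expc A (n - (k + s)))" .
    qed
    also have "\<dots> = (\<Sum>s=0..n. \<Sum>k=0..n-s. gco u v k \<cdot> (X (m + d * int k) * (of_nat s \<cdot> (A s * expc A (n - k - s)))))
        + (\<Sum>s=0..n. \<Sum>k=0..n-s. ((u ^ s - v ^ s) * gco u v k) \<cdot> (X (m + d * int (k + s)) * expc A (n - (k + s))))"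
      by (simp add: sum.distrib)
    also have "(\<Sum>s=0..n. \<Sum>k=0..n-s. gco u v k \<cdot> (X (m + d * int k) * (of_nat s \<cdot> (A s * expc A (n - k - s)))))
      = (\<Sum>k=0..n. \<Sum>s=0..n-k. gco u v k \<cdot> (X (m + d * int k) * (of_nat s \<cdot> (A s * expc A (n - k - s)))))"
      unfolding atLeast0AtMost
      by (subst (1 2) sum.Sigma) (auto intro!: sum.reindex_bij_witness[of _ prod.swap prod.swap])
    also have "\<dots> = (\<Sum>k=0..n. (of_nat (n - k) * gco u v k) \<cdot> (X (m + d * int k) * expc A (n - k)))"
      unfolding sum_distrib_left[symmetric] scale_sum_right[symmetric] expc_rec[of A, OF A0 comm, symmetric]
      by (simp add: scale_mult_right mult.commute)
    \<comment> \<open>Collecting by the total shift \<open>r = k + s\<close> makes the inner sum the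
      right-hand side of \<open>gco_rec\<close>.\<close>
    also have "(\<Sum>s=0..n. \<Sum>k=0..n-s. ((u ^ s - v ^ s) * gco u v k) \<cdot> (X (m + d * int (k + s)) * expc A (n - (k + s))))
      = (\<Sum>r=0..n. \<Sum>s=0..r. ((u ^ s - v ^ s) * gco u v (r - s)) \<cdot> (X (m + d * int r) * expc A (n - r)))"
      unfolding atLeast0AtMost
      by (subst (1 2) sum.Sigma)
        (auto intro!: sum.reindex_bij_witness[of _ "\<lambda>(r, s). (s, r - s)" "\<lambda>(s, k). (s + k, s)"] simp: algebra_simps)
    also have "\<dots> = (\<Sum>r=0..n. (of_nat r * gco u v r) \<cdot> (X (m + d * int r) * expc A (n - r)))"
      unfolding gco_rec scale_sum_left ..
    also have "(\<Sum>k=0..n. (of_nat (n - k) * gco u v k) \<cdot> (X (m + d * int k) * expc A (n - k))) + \<dots>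
      = (\<Sum>k=0..n. of_nat n \<cdot> (gco u v k \<cdot> (X (m + d * int k) * expc A (n - k))))"
      unfolding sum.distrib[symmetric] scale_left_distrib[symmetric]
    proof (intro sum.cong refl)
      fix k assume "k \<in> {0..n}"
      then have "of_nat (n - k) * gco u v k + of_nat k * gco u v k = of_nat n * gco u v k"
        by (simp flip: distrib_right of_nat_add)
      then show "(of_nat (n - k) * gco u v k + of_nat k * gco u v k) \<cdot> (X (m + d * int k) * expc A (n - k))
        = of_nat n \<cdot> (gco u v k \<cdot> (X (m + d * int k) * expc A (n - k)))" by simp
    qed
    finally have "of_nat n \<cdot> (expc A n * X m)
      = of_nat n \<cdot> (\<Sum>k=0..n. gco u v k \<cdot> (X (m + d * int k) * expc A (n - k)))"
      by (simp add: scale_sum_right)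
    then show ?thesis using \<open>n \<noteq> 0\<close> by (subst (asm) scale_left_imp_eq[of "of_nat n"]) auto
  qed
qed

text \<open>Multiplication by \<open>1 - u z\<close> clears the denominator of the rational factor
  and leaves its numerator \<open>1 - v z\<close>.\<close>

lemma expc_PX:
  assumes A0: "A 0 = 0" and comm: "\<And>s t. A s * A t = A t * A s"
    and X: "\<And>s m. of_nat s \<cdot> (A s * X m) = of_nat s \<cdot> (X m * A s) + (u ^ s - v ^ s) \<cdot> X (m + d * int s)"
  shows "expc A (Suc n) * X m - u \<cdot> (expc A n * X (m + d))
    = X m * expc A (Suc n) - v \<cdot> (X (m + d) * expc A n)"
proof -
  have "expc A (Suc n) * X m = X m * expc A (Suc n)
      + (\<Sum>k=0..n. gco u v (Suc k) \<cdot> (X (m + d + d * int k) * expc A (n - k)))"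
    unfolding expc_shift[of A, OF A0 comm X] sum.atLeast0_atMost_Suc_shift
    by (simp add: gco_def[of _ _ 0] algebra_simps)
  moreover have "u \<cdot> (expc A n * X (m + d)) = (\<Sum>k=0..n. (u * gco u v k) \<cdot> (X (m + d + d * int k) * expc A (n - k)))"
    unfolding expc_shift[of A, OF A0 comm X] by (simp add: scale_sum_right)
  moreover have "(\<Sum>k=0..n. gco u v (Suc k) \<cdot> (X (m + d + d * int k) * expc A (n - k)))
      - (\<Sum>k=0..n. (u * gco u v k) \<cdot> (X (m + d + d * int k) * expc A (n - k)))
    = (\<Sum>k=0..n. if k = 0 then - (v \<cdot> (X (m + d) * expc A n)) else 0)"
    unfolding sum_subtractf[symmetric] scale_left_diff_distrib[symmetric]
  proof (intro sum.cong refl)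
    fix k
    show "(gco u v (Suc k) - u * gco u v k) \<cdot> (X (m + d + d * int k) * expc A (n - k)) =
         (if k = 0 then - (v \<cdot> (X (m + d) * expc A n)) else 0)"
      by (cases k) (auto simp: gco_def algebra_simps)
  qed
  ultimately show ?thesis by (simp add: algebra_simps)
qed

definition phi_elt :: "sign \<Rightarrow> 'a \<Rightarrow> (nat \<Rightarrow> 'a) \<Rightarrow> int \<Rightarrow> 'a"
  where "phi_elt d K A n = (if sgnv d * n < 0 then 0 else K * expc A (nat (sgnv d * n)))"

text \<open>The prefactor \<open>K\<close> contributes \<open>u\<close>, which with
  \<open>u * v = 1\<close> turns \<open>expc_PX\<close> into the symmetric exchange relation. For
  \<open>d = Minus\<close> the series runs in the inverse variable, so \<open>n\<close> is negated
  and the relation is rescaled by \<open>v\<close>.\<close>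

lemma phi_elt_PX:
  assumes A0: "A 0 = 0" and comm: "\<And>s t. A s * A t = A t * A s" and uv: "u * v = 1"
    and X: "\<And>s m. of_nat s \<cdot> (A s * X m) = of_nat s \<cdot> (X m * A s) + (u ^ s - v ^ s) \<cdot> X (m + sgnv d * int s)"
    and K: "\<And>m. K * X m = u \<cdot> (X m * K)"
  shows "PX (phi_elt d K A) (if d = Plus then u else v) X"
proof -
  define \<phi> where "\<phi> n = (if n < 0 then 0 else K * expc A (nat n))" for n :: int
  have main: "\<phi> n * X m - u \<cdot> (\<phi> (n - 1) * X (m + sgnv d)) = u \<cdot> (X m * \<phi> n) - X (m + sgnv d) * \<phi> (n - 1)" for n m
  proof -
    consider "n < 0" | "n = 0" | k where "n = int (Suc k)"
      by (metis linorder_neqE_linordered_idom not0_implies_Suc nonneg_int_cases of_nat_0 order_less_imp_le)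
    then show ?thesis
    proof cases
      case 3
      have KX: "K * (X m * z) = u \<cdot> (X m * (K * z))" for m z
        by (simp add: mult.assoc[symmetric] K scale_mult_left)
      have "K * (expc A (Suc k) * X m - u \<cdot> (expc A k * X (m + sgnv d)))
        = K * (X m * expc A (Suc k) - v \<cdot> (X (m + sgnv d) * expc A k))"
        by (subst expc_PX[of A X u v "sgnv d", OF A0 comm X]) auto
      then show ?thesis
        by (simp add: \<phi>_def 3 nat_add_distrib right_diff_distrib scale_mult_right KX mult.assoc scale_right_diff_distrib
            inverse_pair_simps[OF uv])
    qed (auto simp: \<phi>_def expc_0[of A, OF A0] K)
  qed
  show ?thesis
  proof (cases d)
    case Plus
    then have "phi_elt d K A = \<phi>" by (simp add: fun_eq_iff phi_elt_def \<phi>_def)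
    then show ?thesis using main Plus by (simp add: PX_def)
  next
    case Minus
    then have *: "phi_elt d K A n = \<phi> (- n)" for n by (simp add: phi_elt_def \<phi>_def)
    show ?thesis
      unfolding PX_def
    proof (intro allI)
      fix n m
      have "v \<cdot> (\<phi> (1 - n) * X (m + 1) - u \<cdot> (\<phi> (- n) * X m))
        = v \<cdot> (u \<cdot> (X (m + 1) * \<phi> (1 - n)) - X m * \<phi> (- n))"
        using main[of "1 - n" "m + 1"] Minus by simp
      then show "phi_elt d K A n * X m - (if d = Plus then u else v) \<cdot> (phi_elt d K A (n - 1) * X (m + 1)) =
          (if d = Plus then u else v) \<cdot> (X m * phi_elt d K A n) - X (m + 1) * phi_elt d K A (n - 1)"
        unfolding * using Minus uv by (simp add: scale_right_diff_distrib inverse_pair_simps[OF uv] algebra_simps)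
    qed
  qed
qed

lemma eval_falg_exp:
  "eval scale lt (fps_nth (falg_exp (Abs_fps A)) n) = expc (\<lambda>s. eval scale lt (A s)) n"
proof -
  have *: "eval scale lt (fps_nth (Abs_fps A ^ k) n) = fps_nth (Abs_fps (\<lambda>s. eval scale lt (A s)) ^ k) n" for k n
    by (induction k arbitrary: n) (auto simp: fps_mult_nth eval_simps)
  have "fps_nth (falg_exp (Abs_fps A)) n = (\<Sum>k=0..n. (1 / fact k) \<star> fps_nth (Abs_fps A ^ k) n)"
    by (simp add: falg_exp_def fps_compose_nth pm_scale_pscale pscale_def mult_map_scale_conv_mult)
  then show ?thesis by (simp add: expc_def eval_simps *)
qed

lemma eval_phi:
  "eval scale lt (phi M q d i n) = phi_elt d (lt (KG d i))
    (\<lambda>s. if s = 0 then 0 else (of_int (sgnv d) * (qi M q i - inverse (qi M q i))) \<cdot> lt (HG i (sgnv d * int s))) n"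
  by (auto simp: phi_def phi_elt_def eval_simps eval_falg_exp intro!: arg_cong2[where f = "(*)"]
      arg_cong2[where f = expc])

end

subsection \<open>The module\<close>

type_synonym vmod = "lgen word \<Rightarrow>\<^sub>0 laurent"

definition lconst :: "complex \<Rightarrow> laurent"
  where "lconst c = sgl 0 (sgl 0 c)"

definition lscale :: "complex \<Rightarrow> laurent \<Rightarrow> laurent"
  where "lscale c l = lconst c * l"

definition vscale :: "complex \<Rightarrow> vmod \<Rightarrow> vmod"
  where "vscale c v = pscale (lconst c) v"

lemma lconst_simps [simp]: "lconst 0 = 0" "lconst 1 = 1"
  by (simp_all add: lconst_def)

lemma lconst_hom: "lconst (a + b) = lconst a + lconst b" "lconst (a * b) = lconst a * lconst b"
  by (simp_all add: lconst_def single_add mult_single)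

global_interpretation lcal: calg lscale
  by standard (auto simp: lscale_def lconst_hom algebra_simps)

global_interpretation vcal: calg vscale
  by standard (auto simp: vscale_def lconst_hom algebra_simps pscale_mult_left pscale_mult_right
      pmod.scale_left_distrib pmod.scale_right_distrib)

lemma vscale_pscale: "vscale c (pscale l v) = pscale l (vscale c v)"
  by (simp add: vscale_def mult.commute)

text \<open>Endomorphisms linear over the Laurent polynomials form a type, so that they become a
  ring in which \<open>eval\<close> and the abstract relations apply.\<close>

typedef lend = "{T :: vmod \<Rightarrow> vmod. (\<forall>v w. T (v + w) = T v + T w) \<and> (\<forall>l v. T (pscale l v) = pscale l (T v))}"
  morphisms app Lend
  by (rule exI[of _ "\<lambda>v. v"]) auto

lemma app_add: "app T (v + w) = app T v + app T w" and app_pscale: "app T (pscale l v) = pscale l (app T v)"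
  using app[of T] by blast+

lemma app_zero [simp]: "app T 0 = 0"
  using app_pscale[of T 0 0] by simp

lemma app_uminus: "app T (- v) = - app T v"
  using app_add[of T v "- v"] by (simp add: minus_unique)

lemma app_diff: "app T (v - w) = app T v - app T w"
  using app_add[of T v "- w"] by (simp add: app_uminus)

lemma app_vscale: "app T (vscale c v) = vscale c (app T v)"
  by (simp add: vscale_def app_pscale)

lemma lend_eqI:
  assumes "\<And>xs. app S (wd xs) = app T (wd xs)"
  shows "S = T"
proof -
  have "app S v = app T v" for v
    by (induction v rule: falg_induct) (auto simp: app_add app_pscale assms)
  then show ?thesis by (simp add: app_inject[symmetric] fun_eq_iff)
qed

instantiation lend :: ring_1
begin

definition zero_lend :: lend where "0 = Lend (\<lambda>v. 0)"
definition one_lend :: lend where "1 = Lend (\<lambda>v. v)"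
definition plus_lend :: "lend \<Rightarrow> lend \<Rightarrow> lend" where "S + T = Lend (\<lambda>v. app S v + app T v)"
definition uminus_lend :: "lend \<Rightarrow> lend" where "- T = Lend (\<lambda>v. - app T v)"
definition minus_lend :: "lend \<Rightarrow> lend \<Rightarrow> lend" where "S - T = Lend (\<lambda>v. app S v - app T v)"
definition times_lend :: "lend \<Rightarrow> lend \<Rightarrow> lend" where "S * T = Lend (\<lambda>v. app S (app T v))"

lemma app_ring:
  "app 0 v = 0" "app 1 v = v" "app (S + T) v = app S v + app T v" "app (- T) v = - app T v"
  "app (S - T) v = app S v - app T v" "app (S * T) v = app S (app T v)"
  unfolding zero_lend_def one_lend_def plus_lend_def uminus_lend_def minus_lend_def times_lend_def
  by (subst Lend_inverse; simp add: app_add app_pscale pmod.scale_right_distrib pmod.scale_right_diff_distrib)+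

instance
proof
  show "(0 :: lend) \<noteq> 1"
  proof
    assume "(0 :: lend) = 1"
    then have "app 0 1 = app 1 (1 :: vmod)" by simp
    then show False by (simp add: app_ring)
  qed
qed (rule lend_eqI; simp add: app_ring app_add algebra_simps)+

end

definition escale :: "complex \<Rightarrow> lend \<Rightarrow> lend"
  where "escale c T = Lend (\<lambda>v. vscale c (app T v))"

lemma app_escale: "app (escale c T) v = vscale c (app T v)"
  unfolding escale_def
  by (subst Lend_inverse) (simp_all add: app_add app_pscale vcal.scale_right_distrib vscale_pscale)

lemmas app_simps = app_ring app_escale app_add app_diff app_uminus app_pscale app_vscale

global_interpretation ecal: calg escale
  by standard (rule lend_eqI; simp add: app_simps vcal.scale_right_distrib vcal.scale_left_distrib)+

definition wext :: "(lgen list \<Rightarrow> vmod) \<Rightarrow> lend"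
  where "wext f = Lend (lext pscale (\<lambda>w. f (letters w)))"

lemma app_wext: "app (wext f) = lext pscale (\<lambda>w. f (letters w))"
  unfolding wext_def
  by (rule Lend_inverse) (simp add: pmod.lext_add pscale_linear_ext pmod.module_axioms)

lemma app_wext_wd [simp]: "app (wext f) (wd xs) = f xs"
  by (simp add: app_wext wd_def)

definition lmul :: "vmod \<Rightarrow> lend"
  where "lmul u = Lend (\<lambda>v. u * v)"

definition smul :: "laurent \<Rightarrow> lend"
  where "smul l = Lend (pscale l)"

lemma app_lmul: "app (lmul u) v = u * v"
  unfolding lmul_def by (subst Lend_inverse) (simp_all add: distrib_left pscale_mult_right)

lemma app_smul: "app (smul l) v = pscale l v"
  unfolding smul_def by (subst Lend_inverse) (simp_all add: pmod.scale_right_distrib mult.commute)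

lemma vmod_bilinear_eqI:
  fixes u v :: vmod
  assumes "\<And>xs ys. F (wd xs) (wd ys) = G (wd xs) (wd ys)"
    and "\<And>u u' v. F (u + u') v = F u v + F u' v" "\<And>u u' v. G (u + u') v = G u v + G u' v"
    and "\<And>u v v'. F u (v + v') = F u v + F u v'" "\<And>u v v'. G u (v + v') = G u v + G u v'"
    and "\<And>l u v. F (pscale l u) v = pscale l (F u v)" "\<And>l u v. G (pscale l u) v = pscale l (G u v)"
    and "\<And>l u v. F u (pscale l v) = pscale l (F u v)" "\<And>l u v. G u (pscale l v) = pscale l (G u v)"
  shows "F u v = (G u v :: vmod)"
proof (induction u rule: falg_induct)
  case zero
  then show ?case using assms(6,7)[of 0 0 v] by simp
next
  case (wd xs c)
  have "F (wd xs) v = G (wd xs) v"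
  proof (induction v rule: falg_induct)
    case zero
    then show ?case using assms(8,9)[of "wd xs" 0 0] by simp
  qed (simp_all add: assms)
  then show ?case by (simp add: assms)
qed (simp add: assms)

section \<open>Operators of the Cartan part\<close>

locale sl_params =
  fixes M N :: nat and q :: complex
  assumes M1: "M \<ge> 1" and N1: "N \<ge> 1" and q0: "q \<noteq> 0" and not_root: "\<And>n::nat. n > 0 \<Longrightarrow> q ^ n \<noteq> 1"
begin

text \<open>The structure constant, up to the sign of the current, for the action of
  \<open>h\<close> with index \<open>(i, s)\<close> on currents of node \<open>j\<close>.\<close>

definition hcoef :: "nat \<Rightarrow> nat \<Rightarrow> int \<Rightarrow> complex"
  where "hcoef i j s = qnum (qi M q i) (s * lsgn M i * cartan M N i j) / of_int s"

text \<open>The function \<open>c\<close> weights the letters \<open>X\<^sup>+\<close> and \<open>X\<^sup>-\<close>.  The adjoint action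
  of the Cartan part is \<open>c = sgnv\<close>; the other weights serve to move the Cartan part across
  the letters \<open>X\<^sup>+\<close> only.\<close>

fun derl :: "(sign \<Rightarrow> int) \<Rightarrow> nat \<Rightarrow> int \<Rightarrow> lgen \<Rightarrow> vmod"
  where "derl c j s (XG e i n) = vscale (of_int (c e) * hcoef j i s) (wd [XG e i (n + s)])"
  | "derl c j s _ = 0"

primrec derw :: "(sign \<Rightarrow> int) \<Rightarrow> nat \<Rightarrow> int \<Rightarrow> lgen list \<Rightarrow> vmod"
  where "derw c j s [] = 0"
  | "derw c j s (g # w) = derl c j s g * wd w + wd [g] * derw c j s w"

fun sigl :: "(sign \<Rightarrow> int) \<Rightarrow> nat \<Rightarrow> lgen \<Rightarrow> int"
  where "sigl c j (XG e i n) = c e * cartan M N j i"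
  | "sigl c j _ = 0"

definition sigw :: "(sign \<Rightarrow> int) \<Rightarrow> sign \<Rightarrow> nat \<Rightarrow> lgen list \<Rightarrow> complex"
  where "sigw c d j w = q powi (sgnv d * sum_list (map (sigl c j) w))"

definition Der where "Der c j s = wext (derw c j s)"
definition Sig where "Sig c d j = wext (\<lambda>w. vscale (sigw c d j w) (wd w))"

text \<open>The Laurent coefficient is thought of as standing to the right of the word, so a Cartan
  element acts by being carried across the word.\<close>

definition Hop :: "(sign \<Rightarrow> int) \<Rightarrow> nat \<Rightarrow> int \<Rightarrow> lend"
  where "Hop c j s = smul (laurent_h j s) + Der c j s"

definition Kop :: "(sign \<Rightarrow> int) \<Rightarrow> sign \<Rightarrow> nat \<Rightarrow> lend"
  where "Kop c d j = smul (laurent_K d j) * Sig c d j"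

lemma derw_append: "derw c j s (u @ v) = derw c j s u * wd v + wd u * derw c j s v"
proof (induction u)
  case (Cons g u)
  then show ?case
    by (simp add: wd_Cons[of g u] wd_append distrib_left distrib_right mult.assoc)
qed simp

lemma Der_mult: "app (Der c j s) (u * v) = app (Der c j s) u * v + u * app (Der c j s) v"
proof (rule vmod_bilinear_eqI[where F = "\<lambda>u v. app (Der c j s) (u * v)"])
  show "app (Der c j s) (wd xs * wd ys) = app (Der c j s) (wd xs) * wd ys + wd xs * app (Der c j s) (wd ys)" for xs ys
    unfolding wd_append[symmetric] by (simp add: Der_def derw_append)
qed (simp_all add: app_simps distrib_left distrib_right pscale_mult_left pscale_mult_right
    pmod.scale_right_distrib add_ac)

lemma sigw_append: "sigw c d j (u @ v) = sigw c d j u * sigw c d j v"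
  using q0 by (simp add: sigw_def distrib_left power_int_add)

lemma Sig_mult: "app (Sig c d j) (u * v) = app (Sig c d j) u * app (Sig c d j) v"
proof (rule vmod_bilinear_eqI[where F = "\<lambda>u v. app (Sig c d j) (u * v)"])
  show "app (Sig c d j) (wd xs * wd ys) = app (Sig c d j) (wd xs) * app (Sig c d j) (wd ys)" for xs ys
    unfolding wd_append[symmetric]
    by (simp add: Sig_def sigw_append) (simp add: wd_append vcal.scale_mult_left vcal.scale_mult_right mult.commute)
qed (simp_all add: app_simps distrib_left distrib_right pscale_mult_left pscale_mult_right)

lemma Der_one [simp]: "app (Der c j s) 1 = 0"
  using app_wext_wd[of "derw c j s" "[]"] by (simp add: Der_def)

lemma Sig_one [simp]: "app (Sig c d j) 1 = 1"
  using app_wext_wd[of "\<lambda>w. vscale (sigw c d j w) (wd w)" "[]"] by (simp add: Sig_def sigw_def)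

lemma Der_gen: "app (Der c j s) (wd [g]) = derl c j s g"
  by (simp add: Der_def)

lemma Sig_wd: "app (Sig c d j) (wd w) = vscale (sigw c d j w) (wd w)"
  by (simp add: Sig_def)

text \<open>By the Leibniz rule letters suffice, and on a letter both derivations shift the index
  and multiply by a scalar.\<close>

lemma Der_commute: "Der c j s * Der c' j' s' = Der c' j' s' * Der c j s"
proof (rule lend_eqI)
  fix xs
  have l: "app (Der c j s) (app (Der c' j' s') (wd [g])) = app (Der c' j' s') (app (Der c j s) (wd [g]))" for g
    by (cases g) (simp_all add: Der_gen app_vscale mult_ac add_ac)
  show "app (Der c j s * Der c' j' s') (wd xs) = app (Der c' j' s' * Der c j s) (wd xs)"
  proof (induction xs)
    case (Cons g xs)
    then show ?case using l[of g]
      by (simp add: wd_Cons[of g xs] app_simps Der_mult)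
  qed (simp add: app_simps)
qed

lemma Sig_commute: "Sig c d j * Sig c' d' j' = Sig c' d' j' * Sig c d j"
  by (rule lend_eqI) (simp add: app_simps Sig_wd mult.commute)

lemma Der_Sig_commute: "Der c j s * Sig c' d' j' = Sig c' d' j' * Der c j s"
proof (rule lend_eqI)
  fix xs
  have l: "app (Der c j s) (app (Sig c' d' j') (wd [g])) = app (Sig c' d' j') (app (Der c j s) (wd [g]))" for g
    by (cases g) (simp_all add: Der_gen app_vscale Sig_wd sigw_def mult_ac)
  show "app (Der c j s * Sig c' d' j') (wd xs) = app (Sig c' d' j' * Der c j s) (wd xs)"
  proof (induction xs)
    case (Cons g xs)
    then show ?case using l[of g]
      by (simp add: wd_Cons[of g xs] app_simps Der_mult Sig_mult)
  qed (simp add: app_simps)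
qed

lemma smul_central: "smul l * T = T * smul l"
  by (rule lend_eqI) (simp add: app_simps app_smul)

lemma smul_mult: "smul l * smul l' = smul (l * l')" and smul_one: "smul 1 = 1"
  by (rule lend_eqI, simp add: app_simps app_smul mult.commute)+

lemma Sig_inverse: "d \<noteq> d' \<Longrightarrow> Sig c d j * Sig c d' j = 1"
proof (rule lend_eqI)
  fix xs assume "d \<noteq> d'"
  then have "sgnv d' = - sgnv d" by (cases d; cases d') auto
  then have "sigw c d j xs * sigw c d' j xs = 1" "sigw c d' j xs * sigw c d j xs = 1"
    using q0 by (simp_all add: sigw_def power_int_minus)
  then show "app (Sig c d j * Sig c d' j) (wd xs) = app 1 (wd xs)"
    by (simp add: app_simps Sig_wd)
qed

lemma laurent_K_inverse: "d \<noteq> d' \<Longrightarrow> laurent_K d j * laurent_K d' j = 1"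
  using single_add[of j "1 :: int" "- 1", symmetric] single_add[of j "- 1 :: int" 1, symmetric]
  by (cases d; cases d') (simp_all add: laurent_K_def mult_single)

lemma Kop_inverse:
  assumes "d \<noteq> d'"
  shows "Kop c d j * Kop c d' j = 1"
proof -
  have "Kop c d j * Kop c d' j = smul (laurent_K d j) * (Sig c d j * smul (laurent_K d' j)) * Sig c d' j"
    by (simp only: Kop_def mult.assoc)
  also have "\<dots> = smul (laurent_K d j) * smul (laurent_K d' j) * (Sig c d j * Sig c d' j)"
    unfolding smul_central[of _ "Sig c d j", symmetric] by (simp only: mult.assoc)
  finally show ?thesis
    by (simp add: smul_mult laurent_K_inverse[OF assms] smul_one Sig_inverse[OF assms])
qed

lemma cartan_ops_commute:
  "Hop c j s * Hop c' j' s' = Hop c' j' s' * Hop c j s"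
  "Kop c d j * Hop c' j' s' = Hop c' j' s' * Kop c d j"
  "Kop c d j * Kop c' d' j' = Kop c' d' j' * Kop c d j"
proof -
  show "Hop c j s * Hop c' j' s' = Hop c' j' s' * Hop c j s"
    by (simp add: Hop_def distrib_left distrib_right Der_commute[of c j s c' j' s'] smul_central[of _ "Der _ _ _"]
        smul_mult mult.commute[of "laurent_h j s"])
  have 1: "smul l * S * T = T * (smul l * S)" if "S * T = T * S" for S T l
  proof -
    have "smul l * S * T = smul l * T * S" by (simp only: mult.assoc that)
    also have "\<dots> = T * smul l * S" by (simp only: smul_central[of l T])
    finally show ?thesis by (simp only: mult.assoc)
  qed
  have 2: "Sig c d j * Hop c' j' s' = Hop c' j' s' * Sig c d j" for c d j
    by (simp add: Hop_def distrib_left distrib_right Der_Sig_commute[of c' j' s' c d j] smul_central[of _ "Sig _ _ _"])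
  show "Kop c d j * Hop c' j' s' = Hop c' j' s' * Kop c d j"
    unfolding Kop_def by (rule 1[OF 2])
  have "Sig c d j * Kop c' d' j' = Kop c' d' j' * Sig c d j"
    using 1[of "Sig c' d' j'" "Sig c d j" "laurent_K d' j'"] Sig_commute by (simp add: Kop_def)
  then show "Kop c d j * Kop c' d' j' = Kop c' d' j' * Kop c d j"
    unfolding Kop_def[of c d j] by (rule 1)
qed

lemma Hop_lmul: "Hop c j s * lmul u = lmul u * Hop c j s + lmul (app (Der c j s) u)"
  by (rule lend_eqI) (simp add: app_simps Hop_def app_lmul app_smul Der_mult pscale_mult_right distrib_left)

lemma Kop_lmul: "Kop c d j * lmul u = lmul (app (Sig c d j) u) * Kop c d j"
  by (rule lend_eqI) (simp add: app_simps Kop_def app_lmul app_smul Sig_mult pscale_mult_right)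

lemma lmul_vscale: "lmul (vscale c u) = escale c (lmul u)"
  by (rule lend_eqI) (simp add: app_simps app_lmul vcal.scale_mult_left)

lemma lmul_hom: "lmul (u * v) = lmul u * lmul v" "lmul (u + v) = lmul u + lmul v" "lmul 1 = 1"
  by (rule lend_eqI, simp add: app_simps app_lmul mult.assoc distrib_right)+

end

context calg
begin

lemma phi_elt_commute:
  assumes "T * K = K * T" "\<And>s. T * A s = A s * T"
  shows "T * phi_elt d K A n = phi_elt d K A n * T"
proof -
  have 1: "T * fps_nth (Abs_fps A ^ k) m = fps_nth (Abs_fps A ^ k) m * T" for k m
  proof (induction k arbitrary: m)
    case (Suc k)
    have "T * (A i * fps_nth (Abs_fps A ^ k) (m - i)) = A i * fps_nth (Abs_fps A ^ k) (m - i) * T" for i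
      by (simp only: mult.assoc Suc[symmetric]) (simp only: mult.assoc[symmetric] assms(2))
    then show ?case
      by (simp add: fps_mult_nth sum_distrib_left sum_distrib_right)
  qed simp
  have "T * expc A m = expc A m * T" for m
    unfolding expc_def sum_distrib_left sum_distrib_right
    by (intro sum.cong refl) (simp add: scale_mult_left scale_mult_right 1)
  then have "T * (K * expc A m) = K * expc A m * T" for m
    by (simp only: mult.assoc[symmetric] assms(1)) (simp only: mult.assoc)
  then show ?thesis by (simp add: phi_elt_def)
qed

text \<open>Used for three kinds of closed sets: operators preserving a submodule, polynomials in
  given letters, and even elements.\<close>

lemma phi_elt_closed:
  assumes S: "subspace S" "1 \<in> S" "\<And>a b. a \<in> S \<Longrightarrow> b \<in> S \<Longrightarrow> a * b \<in> S" and "K \<in> S" "\<And>s. A s \<in> S"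
  shows "phi_elt d K A n \<in> S"
proof -
  have "fps_nth (Abs_fps A ^ k) m \<in> S" for k m
    by (induction k arbitrary: m) (auto simp: fps_mult_nth S(2) subspace_0[OF S(1)] intro!: subspace_sum[OF S(1)] S(3) assms(5))
  then show ?thesis
    by (auto simp: phi_elt_def expc_def intro!: S(3) assms(4) subspace_sum[OF S(1)] subspace_scale[OF S(1)] subspace_0[OF S(1)])
qed

end

section \<open>Operators of the currents\<close>

context sl_params
begin

definition phiop :: "sign \<Rightarrow> nat \<Rightarrow> int \<Rightarrow> lend"
  where "phiop d i n = ecal.phi_elt d (Kop sgnv d i)
    (\<lambda>s. if s = 0 then 0 else escale (of_int (sgnv d) * (qi M q i - inverse (qi M q i))) (Hop sgnv i (sgnv d * int s))) n"

definition gop :: "nat \<Rightarrow> int \<Rightarrow> lend"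
  where "gop i n = escale (1 / (qi M q i - inverse (qi M q i))) (phiop Plus i n - phiop Minus i n)"

fun xpw :: "nat \<Rightarrow> int \<Rightarrow> lgen list \<Rightarrow> vmod"
  where "xpw i n (XG Minus j m # w) = vscale (xsign M i j) (wd [XG Minus j m] * xpw i n w)
      + (if i = j then app (gop i (n + m)) (wd w) else 0)"
  | "xpw i n w = wd (XG Plus i n # w)"

definition Xp :: "nat \<Rightarrow> int \<Rightarrow> lend"
  where "Xp i n = wext (xpw i n)"

definition Ym :: "nat \<Rightarrow> int \<Rightarrow> lend"
  where "Ym i n = lmul (wd [XG Minus i n])"

text \<open>True by construction, since \<open>Ym\<close> prepends the very letter on which
  \<open>xpw\<close> recurses.\<close>

lemma cross_XY: "Xp i n * Ym j m = escale (xsign M i j) (Ym j m * Xp i n) + (if i = j then gop i (n + m) else 0)"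
  by (rule lend_eqI) (simp add: app_simps Ym_def app_lmul wd_Cons[symmetric] Xp_def)

definition is_minus :: "lgen list \<Rightarrow> bool"
  where "is_minus w \<longleftrightarrow> (\<exists>i n w'. w = XG Minus i n # w')"

lemma Xp_not_minus: "\<not> is_minus w \<Longrightarrow> app (Xp i n) (wd w) = wd [XG Plus i n] * wd w"
  using app_wext_wd[of "xpw i n" w] app_wext_wd[of "xpw i n" "[]"] wd_Cons[of "XG Plus i n" w]
  by (cases "(i, n, w)" rule: xpw.cases) (auto simp: Xp_def is_minus_def)

lemma Xp_letter:
  assumes "\<not> is_minus [g]"
  shows "app (Xp i n) (wd [g] * v) = wd [XG Plus i n] * (wd [g] * v)"
proof (induction v rule: falg_induct)
  case (wd xs c)
  have "\<not> is_minus (g # xs)" using assms by (auto simp: is_minus_def)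
  then show ?case
    using Xp_not_minus[of "g # xs"] by (simp add: app_simps pscale_mult_right wd_Cons[of g xs])
qed (simp_all add: app_simps distrib_left)

lemma word_induct [case_names not_minus minus]:
  assumes "\<And>w. \<not> is_minus w \<Longrightarrow> P w" "\<And>i n w. P w \<Longrightarrow> P (XG Minus i n # w)"
  shows "P w"
proof (induction w)
  case (Cons g w)
  then show ?case using assms by (cases "is_minus (g # w)") (auto simp: is_minus_def)
qed (use assms in \<open>auto simp: is_minus_def\<close>)

lemma gop_commute:
  "Hop sgnv j s * gop i n = gop i n * Hop sgnv j s" "Kop sgnv d j * gop i n = gop i n * Kop sgnv d j"
proof -
  have "Hop sgnv j s * phiop d' i n = phiop d' i n * Hop sgnv j s"
    "Kop sgnv d j * phiop d' i n = phiop d' i n * Kop sgnv d j" for d'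
    unfolding phiop_def
    by (rule ecal.phi_elt_commute;
        auto simp: ecal.scale_mult_left ecal.scale_mult_right cartan_ops_commute)+
  then show "Hop sgnv j s * gop i n = gop i n * Hop sgnv j s" "Kop sgnv d j * gop i n = gop i n * Kop sgnv d j"
    by (simp_all add: gop_def ecal.scale_mult_left ecal.scale_mult_right right_diff_distrib left_diff_distrib)
qed

lemma Hop_Ym: "Hop sgnv j s * Ym i n = Ym i n * Hop sgnv j s + escale (- hcoef j i s) (Ym i (n + s))"
  unfolding Ym_def Hop_lmul using lmul_vscale[of "- hcoef j i s"] by (simp add: Der_gen)

lemma Kop_Ym: "Kop sgnv d j * Ym i n = escale (q powi (- (sgnv d * cartan M N j i))) (Ym i n * Kop sgnv d j)"
  unfolding Ym_def Kop_lmul by (simp add: Sig_wd lmul_vscale sigw_def ecal.scale_mult_left)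

text \<open>Reduces an operator identity to words without a leading negative letter, where
  \<open>Xp\<close> merely prepends. It is applied to the defect \<open>E\<close> of the expected
  commutation rule between a Cartan operator and \<open>Xp\<close>.\<close>

lemma kill_words:
  assumes "\<And>i n. \<exists>c. E * Ym i n = escale c (Ym i n * E)" "\<And>w. \<not> is_minus w \<Longrightarrow> app E (wd w) = 0"
  shows "E = 0"
proof (rule lend_eqI)
  fix w
  show "app E (wd w) = app 0 (wd w)"
  proof (induction w rule: word_induct)
    case (minus i n w)
    obtain c where c: "E * Ym i n = escale c (Ym i n * E)" using assms(1) by blast
    have "app E (wd (XG Minus i n # w)) = app (E * Ym i n) (wd w)"
      by (simp add: app_simps Ym_def app_lmul wd_Cons[of _ w])
    then show ?case using minus by (simp add: c app_simps)
  qed (simp add: assms app_simps)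
qed

lemma Kop_wd: "app (Kop c d j) (wd w) = pscale (laurent_K d j) (vscale (sigw c d j w) (wd w))"
  by (simp add: Kop_def app_simps app_smul Sig_wd vscale_pscale)

lemma Hop_wd: "app (Hop c j s) (wd w) = pscale (laurent_h j s) (wd w) + app (Der c j s) (wd w)"
  by (simp add: Hop_def app_simps app_smul)

lemma Kop_Xp: "Kop sgnv d j * Xp i n = escale (q powi (sgnv d * cartan M N j i)) (Xp i n * Kop sgnv d j)"
proof -
  define b where "b = q powi (sgnv d * cartan M N j i)"
  define K where "K = Kop sgnv d j"
  define E where "E = K * Xp i n - escale b (Xp i n * K)"
  have "E = 0"
  proof (rule kill_words)
    fix l m
    define a where "a = q powi (- (sgnv d * cartan M N j l))"
    define Y where "Y = Ym l m"
    have KY: "K * Y = escale a (Y * K)" "K * (Y * Z) = escale a (Y * (K * Z))" for Z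
      using Kop_Ym[of d j l m]
      by (simp_all add: K_def Y_def a_def mult.assoc[symmetric] ecal.scale_mult_left)
    define X where "X = Xp i n"
    define D where "D = (if i = l then gop i (n + m) else 0)"
    have XY: "X * Y = escale (xsign M i l) (Y * X) + D"
      "X * (Y * Z) = escale (xsign M i l) (Y * (X * Z)) + D * Z" for Z
      using cross_XY by (simp_all add: X_def D_def Y_def mult.assoc[symmetric] distrib_right ecal.scale_mult_left)
    have g: "K * D = D * K" by (simp add: K_def D_def gop_commute)
    \<comment> \<open>If \<open>D\<close> is nonzero then \<open>i = l\<close>, and the weights of
      two opposite currents of one node cancel.\<close>
    have ab: "escale (a * b) (D * K) = D * K"
      using q0 by (simp add: a_def b_def D_def power_int_minus)
    have "E * Y = escale (a * xsign M i l) (Y * E)"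
      unfolding E_def X_def[symmetric]
      by (simp add: ecal.alg KY XY g) (simp add: ac_simps ab)
    then show "\<exists>c. E * Ym l m = escale c (Ym l m * E)" unfolding Y_def by blast
  next
    fix w assume w: "\<not> is_minus w"
    then show "app E (wd w) = 0"
      using q0
      by (simp add: E_def K_def b_def app_simps Xp_not_minus Kop_wd)
        (simp add: wd_Cons[symmetric] Kop_wd sigw_def distrib_left power_int_add mult.commute vscale_pscale)
  qed
  then show ?thesis by (simp add: E_def K_def b_def)
qed

lemma Hop_Xp: "Hop sgnv j s * Xp i n = Xp i n * Hop sgnv j s + escale (hcoef j i s) (Xp i (n + s))"
proof -
  let ?h = "hcoef j i s"
  define H where "H = Hop sgnv j s"
  define E where "E = H * Xp i n - Xp i n * H - escale ?h (Xp i (n + s))"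
  have "E = 0"
  proof (rule kill_words)
    fix l m
    define Y where "Y = Ym l m"
    define Y' where "Y' = Ym l (m + s)"
    have HY: "H * Y = Y * H - escale (hcoef j l s) Y'" "H * (Y * Z) = Y * (H * Z) - escale (hcoef j l s) (Y' * Z)" for Z
      using Hop_Ym[of j s l m]
      by (simp_all add: H_def Y_def Y'_def mult.assoc[symmetric] left_diff_distrib ecal.scale_mult_left)
    define D where "D = (\<lambda>k. if i = l then gop i (k + m) else 0)"
    have XY: "Xp i k * Y = escale (xsign M i l) (Y * Xp i k) + D k"
      "Xp i k * Y' = escale (xsign M i l) (Y' * Xp i k) + D (k + s)" for k
      using cross_XY by (simp_all add: Y_def Y'_def D_def ac_simps)
    have XYZ: "Xp i k * (Y * Z) = escale (xsign M i l) (Y * (Xp i k * Z)) + D k * Z" for k Z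
      by (simp add: mult.assoc[symmetric] XY distrib_right ecal.scale_mult_left)
    \<comment> \<open>\<open>D\<close> vanishes unless \<open>i = l\<close>, so both structure
      constants agree in front of it and the shifts of the two currents cancel.\<close>
    have g: "H * D k = D k * H" "escale (hcoef j l s) (D k) = escale (hcoef j i s) (D k)" for k
      by (simp_all add: H_def D_def gop_commute)
    have "E * Y = escale (xsign M i l) (Y * E)"
      unfolding E_def by (simp add: ecal.alg HY XY XYZ g) (simp add: algebra_simps)
    then show "\<exists>c. E * Ym l m = escale c (Ym l m * E)" unfolding Y_def by blast
  next
    fix w assume w: "\<not> is_minus w"
    have n: "\<not> is_minus [XG Plus i n]" by (simp add: is_minus_def)
    \<comment> \<open>The derivation shifts indices but keeps signs of letters, so it produces only
      words without a leading negative letter.\<close>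
    have D: "app (Xp i n) (app (Der sgnv j s) (wd w)) = wd [XG Plus i n] * app (Der sgnv j s) (wd w)"
    proof (cases w)
      case Nil
      then show ?thesis by simp
    next
      case (Cons g w')
      have ng: "\<not> is_minus [g]" using w Cons by (auto simp: is_minus_def)
      have "app (Xp i n) (derl sgnv j s g * v) = wd [XG Plus i n] * (derl sgnv j s g * v)" for v
      proof (cases g)
        case (XG e k m)
        then have "e = Plus" using ng by (cases e) (auto simp: is_minus_def)
        then have "\<not> is_minus [XG e k (m + s)]" by (simp add: is_minus_def)
        then show ?thesis using XG by (simp add: app_simps vcal.scale_mult_left vcal.scale_mult_right Xp_letter)
      qed auto
      then show ?thesis
        using Xp_letter[OF ng] unfolding Cons wd_Cons[of g w'] Der_mult
        by (simp add: app_simps distrib_left Der_gen)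
    qed
    show "app E (wd w) = 0"
      using w by (simp add: E_def H_def app_simps Xp_not_minus Hop_wd D)
        (simp add: Hop_def app_simps app_smul Der_mult Der_gen vcal.scale_mult_left)
  qed
  then show ?thesis by (simp add: E_def H_def algebra_simps)
qed

lemma qi_power: "qi M q i powi (s * lsgn M i * k) = q powi (s * k)"
proof -
  have "lsgn M i * (s * lsgn M i * k) = s * k" by (simp add: lsgn_def)
  then show ?thesis unfolding qi_def power_int_mult[symmetric] by (rule arg_cong)
qed

text \<open>Otherwise \<open>q ^ 2 = 1\<close>; this is where the assumption on roots of unity
  enters.\<close>

lemma qi_diff_nonzero: "qi M q i - inverse (qi M q i) \<noteq> 0"
proof
  assume "qi M q i - inverse (qi M q i) = 0"
  then have "q ^ 2 = 1"
    using q0 by (auto simp: qi_def lsgn_def power2_eq_square field_simps split: if_splits)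
  then show False using not_root[of 2] by simp
qed

text \<open>Puts the quantum number into the form \<open>u ^ s - v ^ s\<close> required by the
  exponential; the sign \<open>lsgn M i\<close> cancels against the one in
  \<open>qi\<close>.\<close>

lemma hcoef_eq: "(qi M q i - inverse (qi M q i)) * (of_int s * hcoef i j s) = q powi (s * cartan M N i j) - q powi (- (s * cartan M N i j))"
proof (cases "s = 0")
  case False
  then show ?thesis
    using qi_diff_nonzero[of i] qi_power[of i s] qi_power[of i "- s"] by (simp add: hcoef_def qnum_def)
qed simp

text \<open>Stated for any family on which the Cartan operators have the expected weights, so that
  it covers \<open>Ym\<close> and \<open>Xp\<close> alike.\<close>

lemma phiop_PX:
  assumes H: "\<And>s m. Hop sgnv i s * X m = X m * Hop sgnv i s + escale (of_int (sgnv e) * hcoef i j s) (X (m + s))"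
    and K: "\<And>d m. Kop sgnv d i * X m = escale (q powi (sgnv d * sgnv e * cartan M N i j)) (X m * Kop sgnv d i)"
  shows "ecal.PX (phiop d i) (q powi (sgnv e * cartan M N i j)) X"
proof -
  \<comment> \<open>\<open>u\<close> depends on \<open>d\<close>, but the choice between
    \<open>u\<close> and \<open>v\<close> in \<open>phi_elt_PX\<close> undoes this, so both
    one-sided series have the same exchange constant.\<close>
  define u where "u = q powi (sgnv d * sgnv e * cartan M N i j)"
  define v where "v = q powi (- (sgnv d * sgnv e * cartan M N i j))"
  define A where "A = (\<lambda>s. if s = 0 then 0 else escale (of_int (sgnv d) * (qi M q i - inverse (qi M q i))) (Hop sgnv i (sgnv d * int s)))"
  have "ecal.PX (ecal.phi_elt d (Kop sgnv d i) A) (if d = Plus then u else v) X"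
  proof (rule ecal.phi_elt_PX)
    show "u * v = 1" using q0 by (simp add: u_def v_def power_int_minus)
    show "A s * A t = A t * A s" for s t
      by (simp add: A_def ecal.scale_mult_left ecal.scale_mult_right cartan_ops_commute mult.commute)
    show "escale (of_nat s) (A s * X m) = escale (of_nat s) (X m * A s) + escale (u ^ s - v ^ s) (X (m + sgnv d * int s))" for s m
    proof (cases "s = 0")
      case False
      have "of_nat s * of_int (sgnv d) * (qi M q i - inverse (qi M q i)) * (of_int (sgnv e) * hcoef i j (sgnv d * int s))
        = of_int (sgnv e) * ((qi M q i - inverse (qi M q i)) * (of_int (sgnv d * int s) * hcoef i j (sgnv d * int s)))"
        by simp
      also have "\<dots> = u ^ s - v ^ s"
        unfolding hcoef_eq
        by (cases e; cases d) (simp_all add: u_def v_def power_int_mult[symmetric] mult.commute flip: power_int_of_nat)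
      finally show ?thesis
        using False by (simp add: A_def ecal.scale_mult_left ecal.scale_mult_right H ecal.scale_right_distrib mult.assoc)
    qed simp
  qed (simp_all add: A_def K u_def)
  moreover have "(if d = Plus then u else v) = q powi (sgnv e * cartan M N i j)"
    by (cases d) (auto simp: u_def v_def)
  ultimately show ?thesis by (simp add: phiop_def[abs_def] A_def)
qed

lemma phiop_bounded: "n < 0 \<Longrightarrow> phiop Plus i n = 0" "n > 0 \<Longrightarrow> phiop Minus i n = 0"
  by (simp_all add: phiop_def ecal.phi_elt_def)

text \<open>Solving the crossing rule for the product in the other order multiplies
  \<open>gop\<close> by \<open>- xsign M i i\<close>, the sign carried by the constants.\<close>

lemma current_pair_minus:
  "current_pair escale M N q Minus Ym Xp phiop (\<lambda>i. - xsign M i i / (qi M q i - inverse (qi M q i)))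
    (\<lambda>i n. escale (- xsign M i i) (gop i n))"
proof (unfold_locales, goal_cases)
  case (2 i j m n)
  show ?case
    using cross_XY[of j n i m] xsign_sq(1)[of M i j]
    by (auto simp: ecal.scale_right_distrib xsign_sq(2)[of M j i] add.commute[of n m])
next
  case (3 i j d)
  show ?case
    by (rule phiop_PX) (auto simp: Hop_Ym Kop_Ym)
qed (auto simp: q0 phiop_bounded gop_def)

lemma current_pair_plus:
  "current_pair escale M N q Plus Xp Ym phiop (\<lambda>i. 1 / (qi M q i - inverse (qi M q i))) gop"
proof (unfold_locales, goal_cases)
  case (3 i j d)
  show ?case
    by (rule phiop_PX) (auto simp: Hop_Xp Kop_Xp)
qed (auto simp: q0 phiop_bounded gop_def cross_XY)

end

section \<open>The relations under derivations and automorphisms\<close>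

context calg
begin

lemma ubr_linear:
  "ubr u (a + a') b = ubr u a b + ubr u a' b" "ubr u a (b + b') = ubr u a b + ubr u a b'"
  "ubr u (c \<cdot> a) b = c \<cdot> ubr u a b" "ubr u a (c \<cdot> b) = c \<cdot> ubr u a b"
  by (simp add: ubr_def alg; simp add: algebra_simps)+

text \<open>The relations are multihomogeneous in the two arguments of the currents, so that an
  automorphism scaling the currents scales them, and a derivation shifting the currents
  permutes them.\<close>

lemma derivation_rels:
  assumes x: "\<And>i n. \<delta> (x i n) = a i \<cdot> x i (n + s)"
    and add: "\<And>u v. \<delta> (u + v) = \<delta> u + \<delta> v" and scal: "\<And>c u. \<delta> (c \<cdot> u) = c \<cdot> \<delta> u"
    and leib: "\<And>u v. \<delta> (u * v) = \<delta> u * v + u * \<delta> v"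
  shows "\<delta> (rel_comm M x i j m n) = a i \<cdot> rel_comm M x i j (m + s) n + a j \<cdot> rel_comm M x i j m (n + s)"
    and "\<delta> (rel_quad t x i j m n) = a i \<cdot> rel_quad t x i j (m + s) n + a j \<cdot> rel_quad t x i j m (n + s)"
    and "\<delta> (rel_serre q x i j m n k) = a i \<cdot> rel_serre q x i j (m + s) n k + a i \<cdot> rel_serre q x i j m (n + s) k
      + a j \<cdot> rel_serre q x i j m n (k + s)"
    and "\<delta> (rel_quartic q M x m n k u) = a (M - 1) \<cdot> rel_quartic q M x (m + s) n k u
      + a M \<cdot> rel_quartic q M x m (n + s) k u + a (M + 1) \<cdot> rel_quartic q M x m n (k + s) u
      + a M \<cdot> rel_quartic q M x m n k (u + s)"
proof -
  have diff: "\<delta> (u - v) = \<delta> u - \<delta> v" for u v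
    using add[of "u - v" v] by (simp add: algebra_simps)
  have ub: "\<delta> (ubr c u v) = ubr c (\<delta> u) v + ubr c u (\<delta> v)" for c u v
    by (simp add: ubr_def diff scal leib alg; simp add: algebra_simps)
  show "\<delta> (rel_comm M x i j m n) = a i \<cdot> rel_comm M x i j (m + s) n + a j \<cdot> rel_comm M x i j m (n + s)"
    by (simp add: rel_comm_def diff scal leib x alg; simp add: algebra_simps)
  show "\<delta> (rel_quad t x i j m n) = a i \<cdot> rel_quad t x i j (m + s) n + a j \<cdot> rel_quad t x i j m (n + s)"
    by (simp add: rel_quad_def diff scal leib x alg add.commute[of _ s] add.left_commute[of _ s] add.assoc;
      simp add: algebra_simps)
  show "\<delta> (rel_serre q x i j m n k) = a i \<cdot> rel_serre q x i j (m + s) n k + a i \<cdot> rel_serre q x i j m (n + s) k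
      + a j \<cdot> rel_serre q x i j m n (k + s)"
    by (simp add: rel_serre_def add ub x ubr_linear; simp add: algebra_simps)
  show "\<delta> (rel_quartic q M x m n k u) = a (M - 1) \<cdot> rel_quartic q M x (m + s) n k u
      + a M \<cdot> rel_quartic q M x m (n + s) k u + a (M + 1) \<cdot> rel_quartic q M x m n (k + s) u
      + a M \<cdot> rel_quartic q M x m n k (u + s)"
    by (simp add: rel_quartic_def add ub x ubr_linear; simp add: algebra_simps)
qed

lemma automorphism_rels:
  assumes x: "\<And>i n. \<sigma> (x i n) = b i \<cdot> x i n"
    and add: "\<And>u v. \<sigma> (u + v) = \<sigma> u + \<sigma> v" and scal: "\<And>c u. \<sigma> (c \<cdot> u) = c \<cdot> \<sigma> u"
    and mul: "\<And>u v. \<sigma> (u * v) = \<sigma> u * \<sigma> v"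
  shows "\<sigma> (rel_comm M x i j m n) = (b i * b j) \<cdot> rel_comm M x i j m n"
    and "\<sigma> (rel_quad t x i j m n) = (b i * b j) \<cdot> rel_quad t x i j m n"
    and "\<sigma> (rel_serre q x i j m n k) = (b i * b i * b j) \<cdot> rel_serre q x i j m n k"
    and "\<sigma> (rel_quartic q M x m n k u) = (b (M - 1) * b M * b (M + 1) * b M) \<cdot> rel_quartic q M x m n k u"
proof -
  have diff: "\<sigma> (u - v) = \<sigma> u - \<sigma> v" for u v
    using add[of "u - v" v] by (simp add: algebra_simps)
  have ub: "\<sigma> (ubr c u v) = ubr c (\<sigma> u) (\<sigma> v)" for c u v
    by (simp add: ubr_def diff scal mul)
  show "\<sigma> (rel_comm M x i j m n) = (b i * b j) \<cdot> rel_comm M x i j m n"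
    by (simp add: rel_comm_def diff scal mul x alg ac_simps)
  show "\<sigma> (rel_quad t x i j m n) = (b i * b j) \<cdot> rel_quad t x i j m n"
    by (simp add: rel_quad_def diff scal mul x alg ac_simps)
  show "\<sigma> (rel_serre q x i j m n k) = (b i * b i * b j) \<cdot> rel_serre q x i j m n k"
    by (simp add: rel_serre_def add ub x ubr_linear scale_right_distrib ac_simps)
  show "\<sigma> (rel_quartic q M x m n k u) = (b (M - 1) * b M * b (M + 1) * b M) \<cdot> rel_quartic q M x m n k u"
    by (simp add: rel_quartic_def add ub x ubr_linear scale_right_distrib ac_simps)
qed

end

text \<open>Nonemptiness matters twice: a product starting with such an element has a first letter
  in \<open>S\<close>, and such elements have no constant term.\<close>

definition wpos :: "'g set \<Rightarrow> 'g falg set"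
  where "wpos S = {p. \<forall>w\<in>pkeys p. letters w \<noteq> [] \<and> set (letters w) \<subseteq> S}"

lemma wpos_intros:
  "0 \<in> wpos S" "g \<in> S \<Longrightarrow> gen g \<in> wpos S"
  "a \<in> wpos S \<Longrightarrow> b \<in> wpos S \<Longrightarrow> a + b \<in> wpos S" "a \<in> wpos S \<Longrightarrow> b \<in> wpos S \<Longrightarrow> a - b \<in> wpos S"
  "a \<in> wpos S \<Longrightarrow> c \<star> a \<in> wpos S"
proof -
  show "0 \<in> wpos S" by (simp add: wpos_def)
  show "g \<in> S \<Longrightarrow> gen g \<in> wpos S" by (simp add: wpos_def gen_def)
  show a: "a \<in> wpos S \<Longrightarrow> b \<in> wpos S \<Longrightarrow> a + b \<in> wpos S" for a b
    using Poly_Mapping.keys_add[of a b] unfolding wpos_def by blast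
  show c: "a \<in> wpos S \<Longrightarrow> c \<star> a \<in> wpos S" for a c
    by (auto simp: wpos_def in_keys_iff)
  show "a \<in> wpos S \<Longrightarrow> b \<in> wpos S \<Longrightarrow> a - b \<in> wpos S"
    using a[of a "(-1) \<star> b"] c[of b "-1"] by simp
qed

lemma wpos_mult:
  assumes "a \<in> wpos S" "b \<in> wpos S"
  shows "a * b \<in> wpos S"
proof -
  have "letters w \<noteq> [] \<and> set (letters w) \<subseteq> S" if "w \<in> pkeys (a * b)" for w
  proof -
    from that keys_mult[of a b] obtain u v where "w = u + v" "u \<in> pkeys a" "v \<in> pkeys b" by blast
    then show ?thesis using assms by (auto simp: wpos_def plus_word_def)
  qed
  then show ?thesis by (simp add: wpos_def)
qed

lemma rels_wpos:
  assumes x: "\<And>i n. i \<in> nodes M N \<Longrightarrow> x i n \<in> wpos S"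
  shows "falg.quad_rels M N q e x \<union> falg.higher_rels M N q x \<subseteq> wpos S"
proof -
  have ub: "falg.ubr c a b \<in> wpos S" if "a \<in> wpos S" "b \<in> wpos S" for a b c
    unfolding falg.ubr_def using that by (intro wpos_intros wpos_mult)
  have 1: "falg.rel_comm M x i j m n \<in> wpos S" "falg.rel_quad t x i j m n \<in> wpos S"
    "falg.rel_serre q x i j m n k \<in> wpos S" if "i \<in> nodes M N" "j \<in> nodes M N" for i j m n k t
    unfolding falg.rel_comm_def falg.rel_quad_def falg.rel_serre_def
    using that by (intro wpos_intros wpos_mult ub x; simp)+
  have 2: "falg.rel_quartic q M x m n k u \<in> wpos S" if "M > 1" "N > 1" for m n k u
    unfolding falg.rel_quartic_def using cartan_near_M[OF that] by (intro wpos_intros wpos_mult ub x)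
  show ?thesis unfolding falg.quad_rels_def falg.higher_rels_def using 1 2 by blast
qed

lemma (in calg) prod_list_hom: "prod_list (map (\<lambda>g. f [g]) xs) = f xs"
  if "f [] = 1" "\<And>u v. f (u @ v) = f u * f v"
proof (induction xs)
  case (Cons g xs)
  then show ?case using that(2)[of "[g]" xs] by simp
qed (simp add: that)

lemma loop_rels_cases [consumes 1, case_names KK' KK KH HH KX HX XX current]:
  assumes "R \<in> loop_rels M N q"
  obtains
    e e' i where "i \<in> nodes M N" "e \<noteq> e'" "R = Kg e i * Kg e' i - 1"
  | i j where "i \<in> nodes M N" "j \<in> nodes M N" "R = sbr (gpar M) 1 (Kg Plus i) (Kg Plus j)"
  | i j s where "i \<in> nodes M N" "j \<in> nodes M N" "s \<noteq> 0" "R = sbr (gpar M) 1 (Kg Plus i) (Hg j s)"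
  | i j s t where "i \<in> nodes M N" "j \<in> nodes M N" "s \<noteq> 0" "t \<noteq> 0" "R = sbr (gpar M) 1 (Hg i s) (Hg j t)"
  | e i j n where "i \<in> nodes M N" "j \<in> nodes M N"
      "R = Kg Plus i * Xg e j n * Kg Minus i - (q powi (sgnv e * cartan M N i j)) \<star> Xg e j n"
  | e i j n s where "i \<in> nodes M N" "j \<in> nodes M N" "s \<noteq> 0" "R = sbr (gpar M) 1 (Hg i s) (Xg e j n)
       - (of_int (sgnv e) * qnum (qi M q i) (s * lsgn M i * cartan M N i j) / of_int s) \<star> Xg e j (n + s)"
  | i j m n where "i \<in> nodes M N" "j \<in> nodes M N" "R = sbr (gpar M) 1 (Xg Plus i m) (Xg Minus j n)
       - (if i = j then (1 / (qi M q i - inverse (qi M q i)))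
          \<star> (phi M q Plus i (m + n) - phi M q Minus i (m + n)) else 0)"
  | e where "R \<in> current_rels M N q (gpar M) e (Xg e)"
  using assms unfolding loop_rels_def
  by (elim UnE UN_E CollectE exE conjE) (rule that; assumption)+

section \<open>The submodule of relations and the action modulo it\<close>

context sl_params
begin

text \<open>The free algebra inside \<open>vmod\<close>, as the elements with complex
  coefficients.\<close>

definition emb :: "lgen falg \<Rightarrow> vmod"
  where "emb = eval vscale (\<lambda>g. wd [g])"

lemma emb_wd [simp]: "emb (wd xs) = wd xs"
  by (simp add: emb_def vcal.prod_list_hom[where f = wd] wd_append)

lemmas emb_simps = vcal.eval_simps[where lt = "\<lambda>g. wd [g]", folded emb_def]

abbreviation "CR e \<equiv> current_rels M N q (gpar M) e (Xg e)"
abbreviation "XE e \<equiv> {XG e i n | i n. i \<in> nodes M N}"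

lemma CR_eq: "CR e = falg.quad_rels M N q e (Xg e) \<union> falg.higher_rels M N q (Xg e)"
  using M1 by (intro current_rels_eq[where G = "XG e"]) auto

lemma CR_wpos: "CR e \<subseteq> wpos (XE e)"
  unfolding CR_eq by (intro rels_wpos wpos_intros) blast

lemma emb_CR: "emb ` CR e = vcal.quad_rels M N q e (\<lambda>i n. wd [XG e i n]) \<union> vcal.higher_rels M N q (\<lambda>i n. wd [XG e i n])"
  unfolding CR_eq image_Un emb_def vcal.eval_rels vcal.eval_gen ..

text \<open>Two-sided for concatenation, hence stable under \<open>Ym\<close> at once. Both signs
  are generated together; the projections used later separate them.\<close>

inductive_set W :: "vmod set"
  where W_zero: "0 \<in> W"
  | W_base: "R \<in> CR e \<Longrightarrow> pscale l (wd u * emb R * wd v) \<in> W"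
  | W_add: "a \<in> W \<Longrightarrow> b \<in> W \<Longrightarrow> a + b \<in> W"

lemma W_pscale: "z \<in> W \<Longrightarrow> pscale l z \<in> W"
proof (induction rule: W.induct)
  case (W_base R e k u v)
  then show ?case using W.W_base[of R e "l * k" u v] by simp
qed (auto simp: pmod.scale_right_distrib intro: W.intros)

lemma W_vscale: "z \<in> W \<Longrightarrow> vscale c z \<in> W"
  by (simp add: vscale_def W_pscale)

lemma W_subspace: "vcal.subspace W"
  unfolding vcal.subspace_def using W_zero W_add W_vscale by blast

lemmas W_intros = W_zero W_add vcal.subspace_diff[OF W_subspace] W_pscale W_vscale

lemma W_mult_left: "z \<in> W \<Longrightarrow> a * z \<in> W"
proof (induction rule: W.induct)
  case (W_base R e l u v)
  show ?case
  proof (induction a rule: falg_induct)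
    case (wd xs c)
    have "pscale c (wd xs) * pscale l (wd u * emb R * wd v) = pscale (c * l) (wd (xs @ u) * emb R * wd v)"
      by (simp add: pscale_mult_left pscale_mult_right wd_append mult.assoc mult.commute[of l c])
    then show ?case using W.W_base[OF W_base] by simp
  qed (auto simp: distrib_right intro: W_intros)
qed (auto simp: distrib_left intro: W_intros)

lemma W_mult_right: "z \<in> W \<Longrightarrow> z * a \<in> W"
proof (induction rule: W.induct)
  case (W_base R e l u v)
  show ?case
  proof (induction a rule: falg_induct)
    case (wd xs c)
    have "pscale l (wd u * emb R * wd v) * pscale c (wd xs) = pscale (c * l) (wd u * emb R * wd (v @ xs))"
      by (simp add: pscale_mult_left pscale_mult_right wd_append mult.assoc mult.commute[of l c])
    then show ?case using W.W_base[OF W_base] by simp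
  qed (auto simp: distrib_left intro: W_intros)
qed (auto simp: distrib_right intro: W_intros)

lemma W_rel: "R \<in> CR e \<Longrightarrow> emb R \<in> W"
  using W_base[of R e 1 "[]" "[]"] by simp

lemma W_rels: "vcal.quad_rels M N q e (\<lambda>i n. wd [XG e i n]) \<subseteq> W" "vcal.higher_rels M N q (\<lambda>i n. wd [XG e i n]) \<subseteq> W"
  using W_rel[of _ e] unfolding atomize_conj Un_subset_iff[symmetric] emb_CR[symmetric] by blast

lemma W_closed:
  assumes "\<And>R e u v. R \<in> CR e \<Longrightarrow> app T (wd u * emb R * wd v) \<in> W" "z \<in> W"
  shows "app T z \<in> W"
  using assms(2) by (induction rule: W.induct) (auto simp: app_simps intro: W_intros assms(1))

text \<open>The operators that descend to the quotient by \<open>W\<close>; those in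
  \<open>J\<close> below descend to zero.\<close>

definition Wst :: "lend set"
  where "Wst = {T. \<forall>z\<in>W. app T z \<in> W}"

lemma Wst_subspace: "ecal.subspace Wst"
  by (auto simp: ecal.subspace_def Wst_def app_simps intro: W_intros)

lemma Wst_mult: "S \<in> Wst \<Longrightarrow> T \<in> Wst \<Longrightarrow> S * T \<in> Wst" and Wst_one: "1 \<in> Wst"
  by (auto simp: Wst_def app_simps)

lemma Wst_lmul: "lmul a \<in> Wst" and Wst_smul: "smul l \<in> Wst"
  by (auto simp: Wst_def app_lmul app_smul W_mult_left W_pscale)

text \<open>By \<open>derivation_rels\<close> a relation is sent to a combination of relations of
  the same type with shifted indices.\<close>

lemma Wst_Der: "Der c j s \<in> Wst"
proof -
  have rel: "app (Der c j s) (emb R) \<in> W" if R: "R \<in> CR e" for R e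
  proof -
    define x where "x = (\<lambda>i n. wd [XG e i n] :: vmod)"
    note d = vcal.derivation_rels[where \<delta> = "app (Der c j s)" and x = x and a = "\<lambda>i. of_int (c e) * hcoef j i s" and s = s,
        OF _ app_add app_vscale Der_mult]
    note W' = W_rels[of e, folded x_def]
    have x: "app (Der c j s) (x i n) = vscale (of_int (c e) * hcoef j i s) (x i (n + s))" for i n
      by (simp add: x_def Der_gen)
    have "emb R \<in> vcal.quad_rels M N q e x \<union> vcal.higher_rels M N q x"
      using R emb_CR[of e] unfolding x_def by blast
    then consider (c) i j' m n where "i \<in> nodes M N" "j' \<in> nodes M N" "cartan M N i j' = 0" "emb R = vcal.rel_comm M x i j' m n"
      | (q) i j' m n where "i \<in> nodes M N" "j' \<in> nodes M N" "cartan M N i j' \<noteq> 0"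
        "emb R = vcal.rel_quad (q powi (sgnv e * cartan M N i j')) x i j' m n"
      | (s) i j' m n k where "i \<in> nodes M N" "j' \<in> nodes M N" "cartan M N i j' \<in> {1, -1}" "i \<noteq> M" "emb R = vcal.rel_serre q x i j' m n k"
      | (r) m n k u where "M > 1" "N > 1" "emb R = vcal.rel_quartic q M x m n k u"
      unfolding vcal.quad_rels_def vcal.higher_rels_def by blast
    then show ?thesis
    proof cases
      case c
      then have "vcal.rel_comm M x i j' m n \<in> W" for m n using W'(1) unfolding vcal.quad_rels_def by blast
      then show ?thesis unfolding c d(1)[OF x] by (intro W_intros)
    next
      case q
      then have "vcal.rel_quad (q powi (sgnv e * cartan M N i j')) x i j' m n \<in> W" for m n
        using W'(1) unfolding vcal.quad_rels_def by blast
      then show ?thesis unfolding q d(2)[OF x] by (intro W_intros)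
    next
      case s
      then have "vcal.rel_serre q x i j' m n k \<in> W" for m n k using W'(2) unfolding vcal.higher_rels_def by blast
      then show ?thesis unfolding s d(3)[OF x] by (intro W_intros)
    next
      case r
      then have "vcal.rel_quartic q M x m n k u \<in> W" for m n k u using W'(2) unfolding vcal.higher_rels_def by blast
      then show ?thesis unfolding r d(4)[OF x] by (intro W_intros)
    qed
  qed
  have "app (Der c j s) (wd u * emb R * wd v) \<in> W" if R: "R \<in> CR e" for R e u v
    unfolding Der_mult
    by (intro W_intros W_mult_left[OF W_rel[OF R]] W_mult_left[OF rel[OF R]] W_mult_right | simp only: distrib_right)+
  then show ?thesis unfolding Wst_def using W_closed by blast
qed

lemma Wst_Sig: "Sig c d j \<in> Wst"
proof -
  have rel: "app (Sig c d j) (emb R) \<in> W" if R: "R \<in> CR e" for R e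
  proof -
    define x where "x = (\<lambda>i n. wd [XG e i n] :: vmod)"
    note d = vcal.automorphism_rels[where \<sigma> = "app (Sig c d j)" and x = x and b = "\<lambda>i. q powi (sgnv d * (c e * cartan M N j i))",
        OF _ app_add app_vscale Sig_mult]
    have x: "app (Sig c d j) (x i n) = vscale (q powi (sgnv d * (c e * cartan M N j i))) (x i n)" for i n
      by (simp add: x_def Sig_wd sigw_def)
    have "emb R \<in> vcal.quad_rels M N q e x \<union> vcal.higher_rels M N q x"
      using R emb_CR[of e] unfolding x_def by blast
    then have "\<exists>b. app (Sig c d j) (emb R) = vscale b (emb R)"
      unfolding vcal.quad_rels_def vcal.higher_rels_def using d[OF x] by auto
    then show ?thesis using W_rel[OF R] W_vscale by auto
  qed
  have "app (Sig c d j) (wd u * emb R * wd v) \<in> W" if R: "R \<in> CR e" for R e u v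
    unfolding Sig_mult by (intro W_mult_left[OF rel[OF R]] W_mult_right)
  then show ?thesis unfolding Wst_def using W_closed by blast
qed

lemma Wst_Hop: "Hop c j s \<in> Wst" and Wst_Kop: "Kop c d j \<in> Wst"
  unfolding Hop_def Kop_def
  by (intro ecal.subspace_add[OF Wst_subspace] Wst_mult Wst_smul Wst_Der Wst_Sig)+

lemma Wst_gop: "gop i n \<in> Wst"
proof -
  have "phiop d i n \<in> Wst" for d
    unfolding phiop_def
    by (rule ecal.phi_elt_closed)
      (auto intro: Wst_subspace Wst_one Wst_mult Wst_Kop Wst_Hop ecal.subspace_scale[OF Wst_subspace] ecal.subspace_0[OF Wst_subspace])
  then show ?thesis
    unfolding gop_def by (intro ecal.subspace_scale[OF Wst_subspace] ecal.subspace_diff[OF Wst_subspace])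
qed

definition J :: "lend set"
  where "J = {T. \<forall>v. app T v \<in> W}"

lemma J_subspace: "ecal.subspace J"
  by (auto simp: ecal.subspace_def J_def app_simps intro: W_intros)

lemma J_right: "T \<in> J \<Longrightarrow> T * S \<in> J" and J_left: "T \<in> J \<Longrightarrow> S \<in> Wst \<Longrightarrow> S * T \<in> J"
  by (auto simp: J_def Wst_def app_simps)

primrec alet :: "lgen \<Rightarrow> lend"
  where "alet (XG e i n) = (case e of Plus \<Rightarrow> Xp i n | Minus \<Rightarrow> Ym i n)"
  | "alet (KG e i) = Kop sgnv e i"
  | "alet (HG i s) = Hop sgnv i s"

definition act :: "lgen falg \<Rightarrow> lend"
  where "act = eval escale alet"

lemmas act_simps = ecal.eval_simps[where lt = alet, folded act_def]

lemma act_gen [simp]: "act (gen g) = alet g" and act_one [simp]: "act 1 = 1" and act_zero [simp]: "act 0 = 0"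
  by (simp_all add: act_def)

lemma act_CR: "act ` CR e = ecal.quad_rels M N q e (\<lambda>i n. alet (XG e i n)) \<union> ecal.higher_rels M N q (\<lambda>i n. alet (XG e i n))"
  unfolding CR_eq image_Un act_def ecal.eval_rels ecal.eval_gen ..

lemma act_minus:
  assumes "p \<in> wpos (XE Minus)"
  shows "act p = lmul (emb p)"
proof -
  have "eval escale alet p = eval escale (\<lambda>g. lmul (wd [g])) p"
    using assms by (intro ecal.eval_cong) (force simp: wpos_def Ym_def)
  moreover have "eval escale (\<lambda>g. lmul (wd [g])) p = lmul (emb p)"
  proof (induction p rule: falg_induct)
    case zero
    have "lmul 0 = 0" by (rule lend_eqI) (simp add: app_lmul app_simps)
    then show ?case by (simp add: emb_def)
  next
    case (wd xs c)
    have "prod_list (map (\<lambda>g. lmul (wd [g])) xs) = lmul (wd xs)"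
      by (rule ecal.prod_list_hom) (simp_all add: lmul_hom wd_append)
    then show ?case
      by (simp add: pm_scale_pscale[symmetric] ecal.eval_scale emb_simps lmul_vscale)
  qed (simp add: ecal.eval_add emb_simps lmul_hom)
  ultimately show ?thesis by (simp add: act_def)
qed

text \<open>A negative relation acts as left multiplication by an element of \<open>W\<close>, and
  \<open>W\<close> is stable under right multiplication.\<close>

lemma act_rel_minus:
  assumes "R \<in> CR Minus"
  shows "act R \<in> J"
proof -
  have "app (act R) v \<in> W" for v
    using assms CR_wpos by (subst act_minus) (auto simp: app_lmul intro: W_mult_right W_rel)
  then show ?thesis by (simp add: J_def)
qed

text \<open>Requires only that concatenation and the Cartan operators preserve \<open>W\<close>,
  which is available before anything is known about \<open>Xp\<close>.\<close>

lemma ideal_minus: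
  "current_pair_ideal escale M N q Minus Ym Xp phiop (\<lambda>i. - xsign M i i / (qi M q i - inverse (qi M q i)))
    (\<lambda>i n. escale (- xsign M i i) (gop i n)) J"
proof -
  interpret current_pair escale M N q Minus Ym Xp phiop "\<lambda>i. - xsign M i i / (qi M q i - inverse (qi M q i))"
    "\<lambda>i n. escale (- xsign M i i) (gop i n)" by (rule current_pair_minus)
  show ?thesis
  proof unfold_locales
    show "ecal.quad_rels M N q Minus Ym \<subseteq> J"
    proof -
      have "act ` CR Minus \<subseteq> J" using act_rel_minus by blast
      then show ?thesis unfolding act_CR by simp
    qed
    show "Ym i m * T \<in> J" if "T \<in> J" "i \<in> nodes M N" for T i m
      unfolding Ym_def by (rule J_left[OF that(1) Wst_lmul])
    show "escale (- xsign M i i) (gop i m) * T \<in> J" if "T \<in> J" "i \<in> nodes M N" for T i m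
      by (rule J_left[OF that(1) ecal.subspace_scale[OF Wst_subspace Wst_gop]])
  qed (rule J_subspace, rule J_right)
qed

text \<open>With \<open>T = act R\<close> and \<open>X = Xp i n\<close>, crossing puts
  \<open>T X - s X T\<close> into \<open>J\<close>. As \<open>J\<close> is a right ideal containing
  \<open>T\<close>, it contains \<open>T X\<close>, and the nonzero \<open>s\<close> can be divided
  out.\<close>

lemma rel_minus_Xp:
  assumes R: "R \<in> CR Minus" and i: "i \<in> nodes M N"
  shows "Xp i n * act R \<in> J"
proof -
  interpret current_pair_ideal escale M N q Minus Ym Xp phiop "\<lambda>i. - xsign M i i / (qi M q i - inverse (qi M q i))"
    "\<lambda>i n. escale (- xsign M i i) (gop i n)" J by (rule ideal_minus)
  have "act R \<in> ecal.quad_rels M N q Minus Ym \<union> ecal.higher_rels M N q Ym"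
    using R act_CR[of Minus] by auto
  moreover have "\<exists>s. s \<noteq> 0 \<and> act R * Xp i n - escale s (Xp i n * act R) \<in> J"
    if quad: "act R \<in> ecal.quad_rels M N q Minus Ym"
  proof -
    obtain s where "s \<noteq> 0" "act R * Xp i n = escale s (Xp i n * act R)"
      using cross_quad[OF quad i] by blast
    then show ?thesis using ecal.subspace_0[OF J_subspace] by (intro exI[of _ s]) simp
  qed
  ultimately have "\<exists>s. s \<noteq> 0 \<and> act R * Xp i n - escale s (Xp i n * act R) \<in> J"
    using cross_higher[OF _ i] by blast
  then obtain s where s: "s \<noteq> 0" "act R * Xp i n - escale s (Xp i n * act R) \<in> J" by blast
  have "act R * Xp i n - (act R * Xp i n - escale s (Xp i n * act R)) \<in> J"
    by (intro ecal.subspace_diff[OF J_subspace] s J_right act_rel_minus[OF R])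
  then have "escale s (Xp i n * act R) \<in> J" by simp
  from ecal.subspace_scale[OF J_subspace this, of "inverse s"] show ?thesis using s by simp
qed

text \<open>Every word of \<open>p\<close> is nonempty and starts with a positive letter, so
  \<open>Xp\<close> only prepends.\<close>

lemma Xp_plus:
  assumes "p \<in> wpos (XE Plus)"
  shows "app (Xp i n) (emb p * z) = wd [XG Plus i n] * (emb p * z)"
proof -
  have "pkeys p \<subseteq> {w. letters w \<noteq> [] \<and> set (letters w) \<subseteq> XE Plus}" using assms by (auto simp: wpos_def)
  then show ?thesis
  proof (induction p rule: pm_induct_on)
    case (single w c)
    then obtain g w' where w: "letters w = g # w'" "g \<in> XE Plus" by (cases "letters w") auto
    have "sgl w c = c \<star> wd (g # w')" using w by (cases w) (simp add: wd_def)
    moreover have "\<not> is_minus [g]" using w by (auto simp: is_minus_def)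
    ultimately show ?case
      by (simp add: emb_simps wd_Cons[of g w'] vcal.scale_mult_left app_simps mult.assoc Xp_letter vcal.scale_mult_right)
  qed (simp_all add: emb_simps emb_def distrib_right distrib_left app_simps vcal.eval_add)
qed

text \<open>Induction on the leading negative letters of the left factor \<open>u\<close>. When they
  are exhausted, either \<open>Xp\<close> prepends, or \<open>u\<close> is empty and a negative
  relation comes first, which is the case of \<open>rel_minus_Xp\<close>.\<close>

lemma Wst_Xp:
  assumes i: "i \<in> nodes M N"
  shows "Xp i n \<in> Wst"
proof -
  have "app (Xp i n) (wd u * emb R * wd v) \<in> W" if R: "R \<in> CR e" for R e u v
  proof (induction u rule: word_induct)
    case (not_minus u)
    show ?case
    proof (cases u)
      case Nil
      show ?thesis
      proof (cases e)
        case Plus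
        then have "app (Xp i n) (emb R * wd v) = wd [XG Plus i n] * (emb R * wd v)"
          using R CR_wpos[of Plus] by (intro Xp_plus) auto
        then show ?thesis using Nil by (simp add: W_mult_left W_mult_right W_rel[OF R])
      next
        case Minus
        then have "app (Xp i n) (emb R * wd v) = app (Xp i n * act R) (wd v)"
          using R CR_wpos[of Minus] by (simp add: act_minus subsetD app_simps app_lmul)
        then show ?thesis using Nil rel_minus_Xp[OF _ i] R Minus by (simp add: J_def)
      qed
    next
      case (Cons g u')
      then have "\<not> is_minus [g]" using not_minus by (auto simp: is_minus_def)
      then show ?thesis
        unfolding Cons wd_Cons[of g u'] mult.assoc
        by (simp add: Xp_letter W_mult_left W_mult_right W_rel[OF R])
    qed
  next
    case (minus j m u)
    let ?z = "wd u * emb R * wd v"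
    have z: "?z \<in> W" by (intro W_mult_left[OF W_rel[OF R]] W_mult_right)
    have "app (Xp i n) (wd (XG Minus j m # u) * emb R * wd v) = app (Xp i n * Ym j m) ?z"
      by (simp add: app_simps Ym_def app_lmul wd_Cons[of _ u] mult.assoc)
    also have "\<dots> \<in> W"
      using minus Wst_gop z unfolding cross_XY
      by (auto simp: app_simps Ym_def app_lmul Wst_def intro!: W_intros W_mult_left)
    finally show ?case .
  qed
  then show ?thesis unfolding Wst_def using W_closed by blast
qed

lemma act_plus_word:
  assumes "set xs \<subseteq> XE Plus" "\<not> is_minus w"
  shows "app (act (wd xs)) (wd w) = wd (xs @ w)"
  using assms(1)
proof (induction xs)
  case (Cons g xs)
  then obtain i n where g: "g = XG Plus i n" by auto
  have "\<not> is_minus (xs @ w)" using Cons.prems assms(2) by (cases xs) (auto simp: is_minus_def)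
  moreover have "act (wd (g # xs)) = Xp i n * act (wd xs)"
    by (subst wd_Cons) (simp add: act_simps g gen_wd[symmetric])
  ultimately show ?case using Cons by (simp add: app_simps Xp_not_minus g wd_Cons[of _ "xs @ w"])
qed (simp add: app_simps)

lemma act_plus:
  assumes "p \<in> wpos (XE Plus)" "\<not> is_minus w"
  shows "app (act p) (wd w) = emb p * wd w"
proof -
  have "\<forall>w\<in>pkeys p. set (letters w) \<subseteq> XE Plus" using assms(1) by (auto simp: wpos_def)
  then show ?thesis
  proof (induction p rule: falg_induct_on)
    case (wd xs c)
    then show ?case using act_plus_word[OF wd assms(2)]
      by (simp add: pm_scale_pscale[symmetric] act_simps emb_simps app_simps wd_append vcal.scale_mult_left)
  qed (simp_all add: act_simps emb_simps app_simps distrib_right act_def emb_def ecal.eval_add vcal.eval_add)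
qed

text \<open>Words may contain negative letters of nodes outside the range, where the crossing
  results say nothing; there the currents commute because the nodes differ and the outside one is
  not odd.\<close>

lemma act_plus_Ym_outside:
  assumes "p \<in> wpos (XE Plus)" "j \<notin> nodes M N"
  shows "act p * Ym j m = Ym j m * act p"
proof -
  have jM: "j \<noteq> M" using assms(2) M1 N1 by (auto simp: nodes_def)
  have "\<forall>w\<in>pkeys p. set (letters w) \<subseteq> XE Plus" using assms(1) by (auto simp: wpos_def)
  then show ?thesis
  proof (induction p rule: falg_induct_on)
    case (wd xs c)
    have "act (wd xs) * Ym j m = Ym j m * act (wd xs)"
      using wd
    proof (induction xs)
      case (Cons g xs)
      then obtain i n where g: "g = XG Plus i n" "i \<in> nodes M N" by auto
      then have "Xp i n * Ym j m = Ym j m * Xp i n"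
        using jM assms(2) by (auto simp: cross_XY xsign_def)
      moreover have "act (wd (g # xs)) = Xp i n * act (wd xs)"
        by (subst wd_Cons) (simp add: act_simps g gen_wd[symmetric])
      moreover have "act (wd xs) * Ym j m = Ym j m * act (wd xs)" using Cons by simp
      ultimately show ?case by (simp only: mult.assoc) (simp only: mult.assoc[symmetric])
    qed simp
    then show ?case
      by (simp add: pm_scale_pscale[symmetric] act_simps ecal.scale_mult_left ecal.scale_mult_right)
  qed (simp_all add: act_simps distrib_left distrib_right act_def ecal.eval_add)
qed

text \<open>On words without a leading negative letter a positive relation acts as left
  multiplication; the commutation hypothesis carries the claim across leading negative
  letters.\<close>

lemma act_plus_J:
  assumes R: "R \<in> CR Plus" and c: "\<And>j m. j \<in> nodes M N \<Longrightarrow> \<exists>s. act R * Ym j m - escale s (Ym j m * act R) \<in> J"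
  shows "act R \<in> J"
proof -
  have pos: "R \<in> wpos (XE Plus)" using R CR_wpos by auto
  have "app (act R) (wd w) \<in> W" for w
  proof (induction w rule: word_induct)
    case (not_minus w)
    then show ?case using act_plus[OF pos] W_mult_right W_rel[OF R] by simp
  next
    case (minus j m w)
    obtain s where "act R * Ym j m - escale s (Ym j m * act R) \<in> J"
      using c[of j m] act_plus_Ym_outside[OF pos, of j m] ecal.subspace_0[OF J_subspace]
      by (cases "j \<in> nodes M N") (auto intro: that[of 1])
    then have "app (act R) (wd [XG Minus j m] * wd w) - vscale s (wd [XG Minus j m] * app (act R) (wd w)) \<in> W"
      by (simp add: J_def app_simps Ym_def app_lmul)
    then have "(app (act R) (wd [XG Minus j m] * wd w) - vscale s (wd [XG Minus j m] * app (act R) (wd w)))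
      + vscale s (wd [XG Minus j m] * app (act R) (wd w)) \<in> W"
      by (intro W_add W_vscale W_mult_left minus)
    then show ?case by (simp add: wd_Cons[of _ w])
  qed
  then have "app (act R) v \<in> W" for v
    by (induction v rule: falg_induct) (auto simp: app_simps intro: W_intros)
  then show ?thesis by (simp add: J_def)
qed

text \<open>Quadratic relations commute with the negative currents exactly up to a scalar, so
  \<open>act_plus_J\<close> settles them before the higher ones are considered.\<close>

lemma ideal_plus:
  "current_pair_ideal escale M N q Plus Xp Ym phiop (\<lambda>i. 1 / (qi M q i - inverse (qi M q i))) gop J"
proof -
  interpret current_pair escale M N q Plus Xp Ym phiop "\<lambda>i. 1 / (qi M q i - inverse (qi M q i))" gop
    by (rule current_pair_plus)
  have quad: "act ` falg.quad_rels M N q Plus (Xg Plus) = ecal.quad_rels M N q Plus Xp"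
    unfolding act_def ecal.eval_rels by simp
  have "act R \<in> J" if R: "R \<in> falg.quad_rels M N q Plus (Xg Plus)" for R
  proof (rule act_plus_J)
    show "R \<in> CR Plus" using R by (simp add: CR_eq)
    show "\<exists>s. act R * Ym j m - escale s (Ym j m * act R) \<in> J" if j: "j \<in> nodes M N" for j m
    proof -
      have "act R \<in> ecal.quad_rels M N q Plus Xp" unfolding quad[symmetric] by (rule imageI[OF R])
      from cross_quad[OF this j, of m] obtain s where "act R * Ym j m = escale s (Ym j m * act R)" by blast
      then show ?thesis using ecal.subspace_0[OF J_subspace] by (intro exI[of _ s]) simp
    qed
  qed
  then have "ecal.quad_rels M N q Plus Xp \<subseteq> J" unfolding quad[symmetric] by (rule image_subsetI)
  then show ?thesis
  proof unfold_locales
    show "Xp i m * T \<in> J" if "T \<in> J" "i \<in> nodes M N" for T i m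
      by (rule J_left[OF that(1) Wst_Xp[OF that(2)]])
    show "gop i m * T \<in> J" if "T \<in> J" "i \<in> nodes M N" for T i m
      by (rule J_left[OF that(1) Wst_gop])
  qed (rule J_subspace, rule J_right)
qed

theorem act_CR_J:
  assumes "R \<in> CR e"
  shows "act R \<in> J"
proof (cases e)
  case Plus
  interpret current_pair_ideal escale M N q Plus Xp Ym phiop "\<lambda>i. 1 / (qi M q i - inverse (qi M q i))" gop J
    by (rule ideal_plus)
  have "act ` falg.higher_rels M N q (Xg Plus) = ecal.higher_rels M N q Xp"
    "act ` falg.quad_rels M N q Plus (Xg Plus) = ecal.quad_rels M N q Plus Xp"
    unfolding act_def ecal.eval_rels by simp_all
  moreover have "R \<in> falg.quad_rels M N q Plus (Xg Plus) \<or> R \<in> falg.higher_rels M N q (Xg Plus)"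
    using assms unfolding Plus CR_eq by (rule UnE) auto
  ultimately consider "act R \<in> ecal.higher_rels M N q Xp" | "act R \<in> ecal.quad_rels M N q Plus Xp"
    by (metis imageI)
  then show ?thesis
  proof cases
    case 1
    have "\<exists>s. act R * Ym j m - escale s (Ym j m * act R) \<in> J" if "j \<in> nodes M N" for j m
      using cross_higher[OF 1 that] by blast
    then show ?thesis using assms Plus by (intro act_plus_J) simp_all
  qed (use J_quad in blast)
qed (use assms act_rel_minus in auto)

lemma sbr_gen: "sbr par u (gen g) (gen h)
   = gen g * gen h - ((if par g = 1 \<and> par h = 1 then - 1 else 1) * u) \<star> (gen h * gen g)"
  by (simp add: sbr_def fhomog_gen_iff)

text \<open>Except for the relations among currents of one sign, which hold modulo \<open>W\<close>,
  every defining relation acts as zero.\<close>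

theorem act_loop_rels:
  assumes "R \<in> loop_rels M N q"
  shows "act R \<in> J"
proof -
  have 0: "act R = 0 \<Longrightarrow> act R \<in> J" for R using ecal.subspace_0[OF J_subspace] by simp
  have phi: "act (phi M q d i n) = phiop d i n" for d i n
    unfolding act_def ecal.eval_phi phiop_def by (simp cong: if_cong)
  from assms show ?thesis
  proof (cases rule: loop_rels_cases)
    case (KK' e e' i)
    then show ?thesis by (intro 0) (simp add: act_simps Kop_inverse)
  next
    case (KK i j)
    then show ?thesis by (intro 0) (simp add: sbr_gen act_simps cartan_ops_commute(3)[of sgnv Plus i])
  next
    case (KH i j s)
    then show ?thesis by (intro 0) (simp add: sbr_gen act_simps cartan_ops_commute(2))
  next
    case (HH i j s t)
    then show ?thesis by (intro 0) (simp add: sbr_gen act_simps cartan_ops_commute(1)[of sgnv i s])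
  next
    case (KX e i j n)
    have "Kop sgnv Plus i * alet (XG e j n) = escale (q powi (sgnv e * cartan M N i j)) (alet (XG e j n) * Kop sgnv Plus i)"
      using Kop_Xp[of Plus i j n] Kop_Ym[of Plus i j n] by (cases e) auto
    moreover have "alet (XG e j n) * Kop sgnv Plus i * Kop sgnv Minus i = alet (XG e j n)"
      by (simp only: mult.assoc) (simp add: Kop_inverse del: alet.simps(1))
    ultimately show ?thesis unfolding KX
      by (intro 0) (simp add: act_simps ecal.scale_mult_left del: alet.simps(1))
  next
    case (HX e i j n s)
    have "Hop sgnv i s * alet (XG e j n) = alet (XG e j n) * Hop sgnv i s
        + escale (of_int (sgnv e) * hcoef i j s) (alet (XG e j (n + s)))"
      using Hop_Xp[of i s j n] Hop_Ym[of i s j n] by (cases e) auto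
    then show ?thesis unfolding HX
      by (intro 0) (simp add: sbr_gen act_simps hcoef_def del: alet.simps(1))
  next
    case (XX i j m n)
    show ?thesis unfolding XX
      using cross_XY[of i m j n]
      by (intro 0) (auto simp: sbr_gen act_simps phi gop_def xsign_def)
  next
    case (current e)
    then show ?thesis by (rule act_CR_J)
  qed
qed

end

subsection \<open>Quotients, presentations and generated subalgebras\<close>

text \<open>Presented algebras and tensor products are both quotients of finitely supported
  functions by a subspace; this is their common part.\<close>

locale lin_quot =
  fixes A :: "('k \<Rightarrow>\<^sub>0 complex) superalg" and I :: "('k \<Rightarrow>\<^sub>0 complex) set"
  assumes add_A: "add A = (+)" and zero_A: "zero A = 0" and smult_A: "smult A = (\<star>)"
    and I: "pmap.subspace I"
begin

abbreviation "Q \<equiv> quot_superalg A I"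
definition "cls x = I +>\<^bsub>A\<^esub> x"

lemma mem_cls: "y \<in> cls x \<longleftrightarrow> y - x \<in> I"
proof -
  have "y \<in> cls x \<longleftrightarrow> (\<exists>h\<in>I. y = h + x)"
    by (auto simp: cls_def a_r_coset_def' add_A)
  also have "\<dots> \<longleftrightarrow> y - x \<in> I" by (metis add_diff_cancel diff_add_cancel)
  finally show ?thesis .
qed

lemma cls_eq: "cls x = cls y \<longleftrightarrow> x - y \<in> I"
proof
  assume "cls x = cls y"
  moreover have "x \<in> cls x" using pmap.subspace_0[OF I] by (simp add: mem_cls)
  ultimately show "x - y \<in> I" by (simp add: mem_cls)
next
  assume xy: "x - y \<in> I"
  have "z - x \<in> I \<longleftrightarrow> z - y \<in> I" for z
    using pmap.subspace_add[OF I xy, of "z - x"] pmap.subspace_diff[OF I _ xy, of "z - y"] by auto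
  then show "cls x = cls y" by (auto simp: mem_cls)
qed

lemma self_cls: "x \<in> cls x"
  using pmap.subspace_0[OF I] by (simp add: mem_cls)

lemma carrier_Q: "carrier Q = cls ` carrier A"
  by (auto simp: quot_superalg_def A_RCOSETS_def' cls_def a_r_coset_def')

lemma add_Q: "cls x \<oplus>\<^bsub>Q\<^esub> cls y = cls (x + y)"
proof -
  have "cls x \<oplus>\<^bsub>Q\<^esub> cls y = {a + b | a b. a \<in> cls x \<and> b \<in> cls y}"
    by (auto simp: quot_superalg_def set_add_def' add_A)
  also have "\<dots> = cls (x + y)"
  proof (intro Set.set_eqI iffI)
    fix z assume "z \<in> {a + b | a b. a \<in> cls x \<and> b \<in> cls y}"
    then obtain a b where "z = a + b" "a - x \<in> I" "b - y \<in> I" by (auto simp: mem_cls)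
    then show "z \<in> cls (x + y)"
      using pmap.subspace_add[OF I, of "a - x" "b - y"] by (simp add: mem_cls algebra_simps)
  next
    fix z assume z: "z \<in> cls (x + y)"
    then have "z - y \<in> cls x" by (simp add: mem_cls algebra_simps)
    then show "z \<in> {a + b | a b. a \<in> cls x \<and> b \<in> cls y}"
      using self_cls[of y] by (intro CollectI exI[of _ "z - y"] exI[of _ y]) simp
  qed
  finally show ?thesis .
qed

lemma smult_Q: "c \<odot>\<^bsub>Q\<^esub> cls x = cls (c \<star> x)"
proof -
  have *: "cls (c \<star> y) = cls (c \<star> x)" if "y \<in> cls x" for y
    using pmap.subspace_scale[OF I, of "y - x" c] that by (simp add: cls_eq mem_cls algebra_simps)
  have "c \<odot>\<^bsub>Q\<^esub> cls x = (\<Union>y\<in>cls x. cls (c \<star> y))"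
    by (simp add: quot_superalg_def cls_def smult_A)
  also have "\<dots> = (\<Union>y\<in>cls x. cls (c \<star> x))" by (intro SUP_cong refl *)
  also have "\<dots> = cls (c \<star> x)" using self_cls[of x] by blast
  finally show ?thesis .
qed

lemma zero_Q: "\<zero>\<^bsub>Q\<^esub> = cls 0"
proof -
  have "cls 0 = I" by (rule Set.set_eqI) (simp add: mem_cls)
  then show ?thesis by (simp add: quot_superalg_def)
qed

lemma homog_Q: "homog Q d = cls ` homog A d"
  by (simp add: quot_superalg_def cls_def)

end

definition fcar :: "'g set \<Rightarrow> 'g falg set"
  where "fcar S = {p. \<forall>w\<in>pkeys p. set (letters w) \<subseteq> S}"

lemma fcar_subspace: "pmap.subspace (fcar S)"
proof -
  have "a + b \<in> fcar S" if "a \<in> fcar S" "b \<in> fcar S" for a b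
    using that Poly_Mapping.keys_add[of a b] unfolding fcar_def by blast
  moreover have "c \<star> a \<in> fcar S" if "a \<in> fcar S" for a c
    using that by (auto simp: fcar_def in_keys_iff)
  moreover have "0 \<in> fcar S" by (simp add: fcar_def)
  ultimately show ?thesis unfolding pmap.subspace_def by blast
qed

lemma fcar_mult: "a \<in> fcar S \<Longrightarrow> b \<in> fcar S \<Longrightarrow> a * b \<in> fcar S"
proof -
  assume ab: "a \<in> fcar S" "b \<in> fcar S"
  have "set (letters w) \<subseteq> S" if "w \<in> pkeys (a * b)" for w
  proof -
    from that keys_mult[of a b] obtain u v where "w = u + v" "u \<in> pkeys a" "v \<in> pkeys b" by blast
    then show ?thesis using ab by (auto simp: fcar_def plus_word_def)
  qed
  then show ?thesis by (simp add: fcar_def)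
qed

lemma fcar_wd: "set xs \<subseteq> S \<Longrightarrow> wd xs \<in> fcar S"
  by (auto simp: fcar_def wd_def split: if_splits)

lemma fcar_one: "1 \<in> fcar S"
  using fcar_wd[of "[]"] by simp

lemma fcar_gen: "g \<in> S \<Longrightarrow> gen g \<in> fcar S"
  by (simp add: gen_wd fcar_wd)

lemma fcar_mono: "S \<subseteq> T \<Longrightarrow> fcar S \<subseteq> fcar T"
  by (auto simp: fcar_def)

lemmas fcar_intros = pmap.subspace_add[OF fcar_subspace] pmap.subspace_diff[OF fcar_subspace]
  pmap.subspace_scale[OF fcar_subspace] pmap.subspace_neg[OF fcar_subspace] pmap.subspace_0[OF fcar_subspace]
  pmap.subspace_sum[OF fcar_subspace] fcar_mult fcar_one fcar_gen

lemma fcar_induct [consumes 1, case_names zero wd add]: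
  assumes "p \<in> fcar S" "P 0" "\<And>xs c. set xs \<subseteq> S \<Longrightarrow> P (c \<star> wd xs)"
    "\<And>p r. p \<in> fcar S \<Longrightarrow> r \<in> fcar S \<Longrightarrow> P p \<Longrightarrow> P r \<Longrightarrow> P (p + r)"
  shows "P p"
proof -
  have "\<forall>w\<in>pkeys p. set (letters w) \<subseteq> S" using assms(1) by (simp add: fcar_def)
  then show ?thesis
  proof (induction p rule: falg_induct_on)
    case (wd xs c)
    then show ?case using assms(3)[of xs c] by (simp add: pm_scale_pscale)
  next
    case (add p r)
    then show ?case by (intro assms(4)) (simp_all add: fcar_def)
  qed (rule assms(2))
qed

lemma free_superalg_simps:
  "carrier (free_superalg G par) = fcar G" "add (free_superalg G par) = (+)" "zero (free_superalg G par) = 0"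
  "smult (free_superalg G par) = (\<star>)" "mult (free_superalg G par) = (*)" "one (free_superalg G par) = 1"
  "homog (free_superalg G par) d = fhomog par d \<inter> fcar G"
  by (simp_all add: free_superalg_def fcar_def Let_def)

locale presentation =
  fixes G :: "'g set" and par :: "'g \<Rightarrow> bit" and R :: "'g falg set"
  assumes R: "R \<subseteq> fcar G"
begin

abbreviation "A \<equiv> free_superalg G par"

text \<open>An explicit form of the generated ideal, giving an induction principle;
  \<open>genideal_eq\<close> identifies the two.\<close>

inductive_set I :: "'g falg set"
  where zero: "0 \<in> I"
  | base: "r \<in> R \<Longrightarrow> u \<in> fcar G \<Longrightarrow> v \<in> fcar G \<Longrightarrow> u * r * v \<in> I"
  | add: "a \<in> I \<Longrightarrow> b \<in> I \<Longrightarrow> a + b \<in> I"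

lemma I_fcar: "x \<in> I \<Longrightarrow> x \<in> fcar G"
  by (induction rule: I.induct) (use R in \<open>auto intro: fcar_intros\<close>)

lemma I_left: "x \<in> I \<Longrightarrow> a \<in> fcar G \<Longrightarrow> a * x \<in> I"
proof (induction rule: I.induct)
  case (base r u v)
  then show ?case using I.base[of r "a * u" v] by (simp add: mult.assoc fcar_mult)
qed (auto simp: distrib_left intro: I.intros)

lemma I_right: "x \<in> I \<Longrightarrow> a \<in> fcar G \<Longrightarrow> x * a \<in> I"
proof (induction rule: I.induct)
  case (base r u v)
  then show ?case using I.base[of r u "v * a"] by (simp add: mult.assoc fcar_mult)
qed (auto simp: distrib_right intro: I.intros)

lemma I_subspace: "pmap.subspace I"
proof -
  have "c \<star> x \<in> I" if "x \<in> I" for c x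
    using I_left[OF that, of "c \<star> 1"] by (simp add: fcar_intros falg.scale_mult_left)
  then show ?thesis unfolding pmap.subspace_def by (auto intro: I.intros)
qed

lemma R_subset_I: "R \<subseteq> I"
  using base[of _ 1 1] by (auto simp: fcar_one)

lemma genideal_eq: "Idl\<^bsub>A\<^esub> R = I"
proof
  interpret A: ring A by (rule ring_free_superalg)
  have neg: "inv\<^bsub>add_monoid A\<^esub> x = - x" if "x \<in> fcar G" for x
  proof -
    have "\<ominus>\<^bsub>A\<^esub> x = - x"
      using that by (intro A.minus_equality) (auto simp: free_superalg_simps fcar_intros)
    then show ?thesis by (simp add: a_inv_def)
  qed
  have "subgroup I (add_monoid A)"
  proof (rule subgroup.intro)
    show "inv\<^bsub>add_monoid A\<^esub> x \<in> I" if "x \<in> I" for x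
      using that neg[OF I_fcar[OF that]] pmap.subspace_neg[OF I_subspace] by simp
  qed (auto simp: free_superalg_simps I_fcar intro: I.intros)
  then have "ideal I A"
    by (intro idealI ring_free_superalg) (auto simp: free_superalg_simps I_left I_right)
  then show "Idl\<^bsub>A\<^esub> R \<subseteq> I" using R_subset_I by (rule A.genideal_minimal)
  have "ideal (Idl\<^bsub>A\<^esub> R) A" using R by (intro A.genideal_ideal) (simp add: free_superalg_simps)
  then interpret L: ideal "Idl\<^bsub>A\<^esub> R" A .
  have RL: "r \<in> Idl\<^bsub>A\<^esub> R" if "r \<in> R" for r
    using A.genideal_self[of R] R that by (auto simp: free_superalg_simps)
  have "x \<in> Idl\<^bsub>A\<^esub> R" if "x \<in> I" for x
    using that
  proof (induction rule: I.induct)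
    case zero
    then show ?case using L.zero_closed by (simp add: free_superalg_simps)
  next
    case (base r u v)
    then show ?case
      using L.I_r_closed[OF L.I_l_closed[OF RL]] by (simp add: free_superalg_simps)
  next
    case (add a b)
    then show ?case using L.a_closed by (simp add: free_superalg_simps)
  qed
  then show "I \<subseteq> Idl\<^bsub>A\<^esub> R" by blast
qed

sublocale lin_quot A I
  by unfold_locales (simp_all add: free_superalg_simps I_subspace)

lemma presented_eq: "presented G par R = Q" "presented_class G par R = cls"
  by (simp_all add: presented_def presented_class_def[abs_def] genideal_eq cls_def[abs_def])

lemma carrier_pres: "carrier Q = cls ` fcar G"
  by (simp add: carrier_Q free_superalg_simps)

lemma mult_pres:
  assumes "x \<in> fcar G" "y \<in> fcar G"
  shows "cls x \<otimes>\<^bsub>Q\<^esub> cls y = cls (x * y)"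
proof -
  have *: "cls (a * b) = cls (x * y)" if "a \<in> cls x" "b \<in> cls y" for a b
  proof -
    have a: "a - x \<in> I" "b - y \<in> I" using that by (simp_all add: mem_cls)
    have "b - y + y \<in> fcar G"
      by (rule pmap.subspace_add[OF fcar_subspace I_fcar[OF a(2)] assms(2)])
    then have "(a - x) * b + x * (b - y) \<in> I"
      using a assms by (intro I.add I_left I_right) auto
    then show ?thesis by (simp add: cls_eq algebra_simps)
  qed
  have "cls x \<otimes>\<^bsub>Q\<^esub> cls y = (\<Union>a\<in>cls x. \<Union>b\<in>cls y. cls (a * b))"
    by (simp add: quot_superalg_def rcoset_mult_def cls_def free_superalg_simps)
  also have "\<dots> = (\<Union>a\<in>cls x. \<Union>b\<in>cls y. cls (x * y))" by (intro SUP_cong refl *)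
  also have "\<dots> = cls (x * y)" using self_cls[of x] self_cls[of y] by blast
  finally show ?thesis .
qed

lemma one_pres: "\<one>\<^bsub>Q\<^esub> = cls 1"
  by (simp add: quot_superalg_def cls_def free_superalg_simps)

lemma homog_pres: "homog Q d = cls ` (fhomog par d \<inter> fcar G)"
  by (simp add: homog_Q free_superalg_simps)

lemma generated_carrier:
  assumes S: "S \<subseteq> G"
  shows "\<Inter>{B. is_subalgebra Q B \<and> (\<lambda>g. cls (gen g)) ` S \<subseteq> B} = cls ` fcar S"
proof
  have sub: "fcar S \<subseteq> fcar G" using S by (rule fcar_mono)
  have "is_subalgebra Q (cls ` fcar S)"
    unfolding is_subalgebra_def
  proof (intro conjI ballI allI)
    show "cls ` fcar S \<subseteq> carrier Q" using sub by (auto simp: carrier_pres)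
    show "\<zero>\<^bsub>Q\<^esub> \<in> cls ` fcar S" by (auto simp: zero_Q intro: fcar_intros)
    show "\<one>\<^bsub>Q\<^esub> \<in> cls ` fcar S" by (auto simp: one_pres intro: fcar_intros)
    fix x y assume "x \<in> cls ` fcar S" "y \<in> cls ` fcar S"
    then obtain a b where ab: "a \<in> fcar S" "b \<in> fcar S" "x = cls a" "y = cls b" by auto
    show "x \<oplus>\<^bsub>Q\<^esub> y \<in> cls ` fcar S" using ab by (auto simp: add_Q intro: fcar_intros)
    have "x \<otimes>\<^bsub>Q\<^esub> y = cls (a * b)" using ab sub mult_pres[of a b] by auto
    then show "x \<otimes>\<^bsub>Q\<^esub> y \<in> cls ` fcar S" using ab fcar_mult[of a S b] by auto
  next
    fix c x assume "x \<in> cls ` fcar S"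
    then show "c \<odot>\<^bsub>Q\<^esub> x \<in> cls ` fcar S" by (auto simp: smult_Q intro: fcar_intros)
  qed
  then show "\<Inter>{B. is_subalgebra Q B \<and> (\<lambda>g. cls (gen g)) ` S \<subseteq> B} \<subseteq> cls ` fcar S"
    by (auto intro: fcar_gen)
  have "cls p \<in> B" if B: "is_subalgebra Q B" "(\<lambda>g. cls (gen g)) ` S \<subseteq> B" and p: "p \<in> fcar S" for p B
    using p
  proof (induction p rule: fcar_induct)
    case zero
    then show ?case using B by (simp add: zero_Q[symmetric] is_subalgebra_def)
  next
    case (wd xs c)
    have "cls (wd xs) \<in> B" using wd
    proof (induction xs)
      case Nil
      then show ?case using B by (simp add: one_pres[symmetric] is_subalgebra_def)
    next
      case (Cons g xs)
      have "cls (gen g) \<otimes>\<^bsub>Q\<^esub> cls (wd xs) \<in> B" using Cons B by (auto simp: is_subalgebra_def)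
      also have "cls (gen g) \<otimes>\<^bsub>Q\<^esub> cls (wd xs) = cls (wd (g # xs))"
        using Cons.prems S by (subst mult_pres) (auto simp: gen_wd wd_append[symmetric] intro!: fcar_wd)
      finally show ?case .
    qed
    then show ?case using B by (simp add: smult_Q[symmetric] is_subalgebra_def)
  next
    case (add p r)
    then show ?case using B by (simp add: add_Q[symmetric] is_subalgebra_def)
  qed
  then show "cls ` fcar S \<subseteq> \<Inter>{B. is_subalgebra Q B \<and> (\<lambda>g. cls (gen g)) ` S \<subseteq> B}" by blast
qed

lemma generated_simps:
  assumes "S \<subseteq> G"
  defines "B \<equiv> generated_subalgebra Q ((\<lambda>g. cls (gen g)) ` S)"
  shows "carrier B = cls ` fcar S" "homog B d = homog Q d \<inter> cls ` fcar S" "mult B = mult Q" "one B = one Q"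
    "zero B = zero Q" "add B = add Q" "smult B = smult Q"
  unfolding B_def generated_subalgebra_def Let_def generated_carrier[OF assms(1)] by simp_all

text \<open>The parity automorphism scales homogeneous relations, so that the ideal is graded.\<close>

lemma homog_component:
  assumes R_hom: "\<And>r. r \<in> R \<Longrightarrow> \<exists>d. r \<in> fhomog par d"
    and "p - p' \<in> I" "p' \<in> fhomog par d" "p \<in> fcar S" "S \<subseteq> G"
  shows "\<exists>p''\<in>fhomog par d \<inter> fcar S. p - p'' \<in> I"
proof -
  define sg where "sg d = (if d = (0 :: bit) then 1 else - 1 :: complex)" for d
  define \<alpha> where "\<alpha> = eval pm_scale (\<lambda>g. sg (par g) \<star> gen g)"
  note \<alpha>_simps = falg.eval_simps[where lt = "\<lambda>g. sg (par g) \<star> gen g", folded \<alpha>_def]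
  have \<alpha>0: "\<alpha> 0 = 0" by (simp add: \<alpha>_def)
  have sg: "sg (a + b) = sg a * sg b" for a b by (cases a; cases b) (auto simp: sg_def)
  have \<alpha>_wd: "\<alpha> (wd xs) = sg (sum_list (map par xs)) \<star> wd xs" for xs
  proof (induction xs)
    case Nil
    then show ?case using falg.eval_wd[of "\<lambda>g. sg (par g) \<star> gen g" "[]"] by (simp add: \<alpha>_def sg_def)
  next
    case (Cons g xs)
    have "\<alpha> (wd [g]) = sg (par g) \<star> wd [g]" by (simp add: gen_wd[symmetric] \<alpha>_def)
    then have "\<alpha> (wd (g # xs)) = (sg (par g) \<star> wd [g]) * (sg (sum_list (map par xs)) \<star> wd xs)"
      unfolding wd_Cons[of g xs] \<alpha>_simps Cons by simp
    also have "\<dots> = (sg (par g) * sg (sum_list (map par xs))) \<star> wd (g # xs)"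
      by (simp add: falg.scale_mult_left falg.scale_mult_right mult.commute wd_Cons[of g xs])
    finally show ?case by (simp only: sg[symmetric] list.map sum_list.Cons)
  qed
  have \<alpha>_hom: "\<alpha> p = sg d \<star> p" if "p \<in> fhomog par d" for p d
  proof -
    have "pkeys p \<subseteq> {w. sum_list (map par (letters w)) = d}" using that by (auto simp: fhomog_def)
    then show ?thesis
    proof (induction p rule: pm_induct_on)
      case (single w c)
      then show ?case using \<alpha>_wd[of "letters w"] \<alpha>_simps(4)[of c "wd (letters w)"]
        by (simp add: wd_def mult.commute)
    qed (simp_all add: \<alpha>_simps pmap.scale_right_distrib \<alpha>0)
  qed
  have \<alpha>_fcar: "\<alpha> p \<in> fcar S" if "p \<in> fcar S" for p S
    using that
  proof (induction p rule: fcar_induct)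
    case (wd xs c)
    then show ?case by (simp add: \<alpha>_simps \<alpha>_wd fcar_intros fcar_wd)
  qed (simp_all add: \<alpha>_simps fcar_intros \<alpha>0)
  have \<alpha>_I: "\<alpha> x \<in> I" if "x \<in> I" for x
    using that
  proof (induction rule: I.induct)
    case zero
    then show ?case by (simp add: \<alpha>0 I.zero)
  next
    case (base r u v)
    then obtain d where "r \<in> fhomog par d" using R_hom by blast
    then show ?case
      using base \<alpha>_fcar I.base[of r "\<alpha> u" "\<alpha> v"]
      by (simp add: \<alpha>_simps \<alpha>_hom falg.scale_mult_left falg.scale_mult_right pmap.subspace_scale[OF I_subspace])
  qed (simp add: \<alpha>_simps I.add)
  \<comment> \<open>The projection to parity \<open>d\<close>: it fixes \<open>p'\<close>, maps
    \<open>I\<close> into itself and introduces no letters outside \<open>S\<close>.\<close>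
  define p'' where "p'' = (1/2) \<star> (p + sg d \<star> \<alpha> p)"
  have "p'' \<in> fhomog par d"
  proof -
    have "(1/2) \<star> (p + sg d \<star> \<alpha> p) \<in> fhomog par d" for p
    proof (induction p rule: falg_induct)
      case (wd xs c)
      have *: "\<alpha> (pscale c (wd xs)) = (c * sg (sum_list (map par xs))) \<star> wd xs"
        using \<alpha>_simps(4)[of c "wd xs"] by (simp add: pm_scale_pscale[symmetric] \<alpha>_wd)
      show ?case
      proof (cases "sum_list (map par xs) = d")
        case True
        then show ?thesis unfolding *
          using fhomog_wd[of xs par] by (intro fhomog_scale fhomog_add) (auto simp: pm_scale_pscale[symmetric] intro: fhomog_scale)
      next
        case False
        then have "sg d * sg (sum_list (map par xs)) = -1" by (cases d) (auto simp: sg_def)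
        then have "pscale c (wd xs) + sg d \<star> \<alpha> (pscale c (wd xs)) = 0"
          unfolding * by (simp add: pm_scale_pscale[symmetric] mult.left_commute)
        then show ?thesis by simp
      qed
    next
      case (add p r)
      from fhomog_add[OF add] show ?case by (simp add: \<alpha>_simps algebra_simps)
    qed (simp add: \<alpha>0)
    then show ?thesis by (simp add: p''_def)
  qed
  moreover have "p'' \<in> fcar S" unfolding p''_def by (intro fcar_intros \<alpha>_fcar assms)
  moreover have "p - p'' \<in> I"
  proof -
    have d: "sg d * sg d = 1" by (simp add: sg_def)
    have "(1/2) \<star> (p - p') - ((1/2) * sg d) \<star> \<alpha> (p - p') \<in> I"
      by (intro pmap.subspace_diff[OF I_subspace] pmap.subspace_scale[OF I_subspace] \<alpha>_I assms)
    also have "(1/2) \<star> (p - p') - ((1/2) * sg d) \<star> \<alpha> (p - p') = (1/2) \<star> p - ((1/2) * sg d) \<star> \<alpha> p"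
      using d by (simp add: \<alpha>_simps \<alpha>_hom[OF assms(3)] algebra_simps)
    also have "\<dots> = p - p''"
    proof -
      have "p = (1/2) \<star> p + (1/2) \<star> p" by (simp add: pmap.scale_left_distrib[symmetric])
      then show ?thesis by (simp add: p''_def algebra_simps)
    qed
    finally show ?thesis .
  qed
  ultimately show ?thesis by blast
qed

end

text \<open>Evaluating the free algebra in itself at its generators is the identity, so
  \<open>phi\<close> is an instance of \<open>phi_elt\<close> and inherits its closure
  properties.\<close>

lemma phi_fcar:
  assumes "i \<in> nodes M N"
  shows "phi M q d i n \<in> fcar ({KG e i | e i. i \<in> nodes M N} \<union> {HG i s | i s. i \<in> nodes M N \<and> s \<noteq> 0})" (is "_ \<in> fcar ?S")
    and "phi M q d i n \<in> fhomog (gpar M) 0"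
proof -
  let ?h = "\<lambda>s. if s = 0 then 0 else (of_int (sgnv d) * (qi M q i - inverse (qi M q i))) \<star> Hg i (sgnv d * int s)"
  have eq: "phi M q d i n = falg.phi_elt d (Kg d i) ?h n"
  proof -
    have "eval pm_scale gen p = p" for p :: "lgen falg"
    proof (induction p rule: falg_induct)
      case (wd xs c)
      have "prod_list (map gen xs) = wd xs" by (induction xs) (simp_all add: gen_wd wd_Cons[of _ "_ # _"] wd_append[symmetric])
      then show ?case by (simp add: pm_scale_pscale[symmetric] falg.eval_scale)
    qed (simp_all add: falg.eval_add)
    then show ?thesis using falg.eval_phi[of gen M q d i n] by simp
  qed
  have d: "sgnv d \<noteq> 0" by (cases d) auto
  show "phi M q d i n \<in> fcar ?S"
    unfolding eq
    by (rule falg.phi_elt_closed[OF fcar_subspace]) (use assms d in \<open>auto intro!: fcar_intros\<close>)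
  have sub: "pmap.subspace (fhomog (gpar M) 0)"
    unfolding pmap.subspace_def by (auto intro: fhomog_add fhomog_scale)
  have mul: "a * b \<in> fhomog (gpar M) 0" if "a \<in> fhomog (gpar M) 0" "b \<in> fhomog (gpar M) 0" for a b
    using fhomog_mult[OF that] by simp
  show "phi M q d i n \<in> fhomog (gpar M) 0"
    unfolding eq
    by (rule falg.phi_elt_closed[OF sub fhomog_one mul]) (auto simp: fhomog_gen_iff intro!: fhomog_scale)
qed

lemma rels_homog:
  assumes x: "\<And>i n. x i n \<in> fhomog par (\<pi> i)"
    and "R \<in> falg.quad_rels M N q e x \<union> falg.higher_rels M N q x"
  shows "\<exists>d. R \<in> fhomog par d"
proof -
  have swap: "b * a \<in> fhomog par (d1 + d2)" if "a \<in> fhomog par d1" "b \<in> fhomog par d2" for a b d1 d2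
    by (subst add.commute) (rule fhomog_mult[OF that(2,1)])
  have ub: "falg.ubr c a b \<in> fhomog par (d1 + d2)" if "a \<in> fhomog par d1" "b \<in> fhomog par d2" for a b c d1 d2
    unfolding falg.ubr_def
    by (rule fhomog_diff[OF fhomog_mult[OF that] fhomog_scale[OF swap[OF that]]])
  have 1: "falg.rel_comm M' x i j m n \<in> fhomog par (\<pi> i + \<pi> j)" for M' i j m n
    unfolding falg.rel_comm_def
    by (rule fhomog_diff[OF fhomog_mult[OF x x] fhomog_scale[OF swap[OF x x]]])
  have 2: "falg.rel_quad t x i j m n \<in> fhomog par (\<pi> i + \<pi> j)" for t i j m n
    unfolding falg.rel_quad_def
    by (rule fhomog_diff[OF fhomog_diff[OF fhomog_mult[OF x x] fhomog_scale[OF swap[OF x x]]]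
        fhomog_diff[OF fhomog_scale[OF fhomog_mult[OF x x]] swap[OF x x]]])
  have 3: "falg.rel_serre q x i j m n k \<in> fhomog par (\<pi> i + (\<pi> i + \<pi> j))" for i j m n k
    unfolding falg.rel_serre_def by (rule fhomog_add[OF ub[OF x ub[OF x x]] ub[OF x ub[OF x x]]])
  have 4: "falg.rel_quartic q M' x m n k u \<in> fhomog par (\<pi> (M' - 1) + \<pi> M' + \<pi> (M' + 1) + \<pi> M')" for M' m n k u
    unfolding falg.rel_quartic_def
    by (rule fhomog_add[OF ub[OF ub[OF ub[OF x x] x] x] ub[OF ub[OF ub[OF x x] x] x]])
  from assms(2) consider (a) i j m n where "R = falg.rel_comm M x i j m n"
    | (b) i j m n where "R = falg.rel_quad (q powi (sgnv e * cartan M N i j)) x i j m n"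
    | (c) i j m n k where "R = falg.rel_serre q x i j m n k"
    | (d) m n k u where "R = falg.rel_quartic q M x m n k u"
    unfolding falg.quad_rels_def falg.higher_rels_def
    by (elim UnE CollectE exE conjE) (rule that; assumption)+
  then show ?thesis
  proof cases
    case a
    show ?thesis unfolding a by (rule exI) (rule 1)
  next
    case b
    show ?thesis unfolding b by (rule exI) (rule 2)
  next
    case c
    show ?thesis unfolding c by (rule exI) (rule 3)
  next
    case d
    show ?thesis unfolding d by (rule exI) (rule 4)
  qed
qed

section \<open>The quantum loop superalgebra as a presentation\<close>

context sl_params
begin

abbreviation "KHS \<equiv> {KG e i | e i. i \<in> nodes M N} \<union> {HG i s | i s. i \<in> nodes M N \<and> s \<noteq> 0}"

lemma gens_eq: "gens M N = XE Plus \<union> XE Minus \<union> KHS"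
  unfolding gens_def by (auto, metis sign.exhaust)

lemma gens_sub: "XE e \<subseteq> gens M N" "KHS \<subseteq> gens M N"
  by (auto simp: gens_def)

lemma fcar_sub: "fcar (XE e) \<subseteq> fcar (gens M N)" "fcar KHS \<subseteq> fcar (gens M N)"
  by (intro fcar_mono gens_sub)+

lemma gen_fcar: "i \<in> nodes M N \<Longrightarrow> Xg e i n \<in> fcar (gens M N)" "i \<in> nodes M N \<Longrightarrow> Kg e i \<in> fcar (gens M N)"
  "i \<in> nodes M N \<Longrightarrow> s \<noteq> 0 \<Longrightarrow> Hg i s \<in> fcar (gens M N)"
  by (auto intro!: fcar_gen simp: gens_def)

lemma wpos_fcar: "wpos S \<subseteq> fcar S"
  by (auto simp: wpos_def fcar_def)

lemma sbr_fcar: "a \<in> fcar S \<Longrightarrow> b \<in> fcar S \<Longrightarrow> sbr par u a b \<in> fcar S"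
  unfolding sbr_def by (intro fcar_intros)

lemma loop_rels_fcar: "loop_rels M N q \<subseteq> fcar (gens M N)"
proof
  fix R assume "R \<in> loop_rels M N q"
  then show "R \<in> fcar (gens M N)"
  proof (cases rule: loop_rels_cases)
    case (XX i j m n)
    have "phi M q d i k \<in> fcar (gens M N)" for d k
      using phi_fcar(1)[OF XX(1)] fcar_sub(2) by blast
    then show ?thesis using XX by (auto intro!: fcar_intros sbr_fcar simp: gens_def)
  next
    case (current e)
    then show ?thesis using CR_wpos wpos_fcar fcar_sub by blast
  qed (auto intro!: fcar_intros sbr_fcar simp: gens_def)
qed

lemma sbr_homog: "sbr par u (gen g) (gen h) \<in> fhomog par (par g + par h)"
proof -
  have "gen h * gen g \<in> fhomog par (par h + par g)" by (intro fhomog_mult fhomog_gen)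
  then show ?thesis
    unfolding sbr_gen add.commute[of "par h" "par g"]
    by (rule fhomog_diff[OF fhomog_mult[OF fhomog_gen fhomog_gen] fhomog_scale])
qed

lemma loop_rels_homog:
  assumes "R \<in> loop_rels M N q"
  shows "\<exists>d. R \<in> fhomog (gpar M) d"
  using assms
proof (cases rule: loop_rels_cases)
  case (KK' e e' i)
  have "Kg e i * Kg e' i \<in> fhomog (gpar M) 0"
    using fhomog_mult[OF fhomog_gen[where par = "gpar M"] fhomog_gen, of "KG e i" "KG e' i"] by simp
  then show ?thesis unfolding KK' by (blast intro: fhomog_diff fhomog_one)
next
  case (KX e i j n)
  have "Kg Plus i * Xg e j n * Kg Minus i \<in> fhomog (gpar M) (gpar M (KG Plus i) + gpar M (XG e j n) + gpar M (KG Minus i))"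
    by (intro fhomog_mult fhomog_gen)
  then have "Kg Plus i * Xg e j n * Kg Minus i \<in> fhomog (gpar M) (gpar M (XG e j n))"
    by (simp only: gpar.simps(2) add_0_left add_0_right)
  then show ?thesis unfolding KX by (blast intro: fhomog_diff fhomog_scale fhomog_gen)
next
  case (HX e i j n s)
  have "Xg e j (n + s) \<in> fhomog (gpar M) (gpar M (HG i s) + gpar M (XG e j n))"
    using fhomog_gen[of "XG e j (n + s)" "gpar M"] by (cases "j = M") simp_all
  then show ?thesis unfolding HX by (blast intro: fhomog_diff fhomog_scale sbr_homog)
next
  case (XX i j m n)
  have "(if i = j then (1 / (qi M q i - inverse (qi M q i))) \<star> (phi M q Plus i (m + n) - phi M q Minus i (m + n)) else 0)
    \<in> fhomog (gpar M) (gpar M (XG Plus i m) + gpar M (XG Minus j n))"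
    using phi_fcar(2)[OF XX(1)] by (auto intro!: fhomog_scale fhomog_diff)
  then show ?thesis unfolding XX by (blast intro: fhomog_diff sbr_homog)
next
  case (current e)
  then show ?thesis unfolding CR_eq
    by (intro rels_homog[where x = "Xg e" and \<pi> = "\<lambda>i. if i = M then 1 else 0"]) (auto simp: fhomog_gen_iff)
qed (blast intro: sbr_homog)+

sublocale U: presentation "gens M N" "gpar M" "loop_rels M N q"
  by unfold_locales (rule loop_rels_fcar)

lemma Uq_eq: "Uq M N q = U.Q" "Uq_gen M N q g = U.cls (gen g)"
  by (simp_all add: Uq_def Uq_gen_def U.presented_eq)

lemma CR_loop_rels: "CR e \<subseteq> loop_rels M N q"
proof
  fix R assume "R \<in> CR e"
  then have "R \<in> (\<Union>e. CR e)" by blast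
  then show "R \<in> loop_rels M N q" unfolding loop_rels_def by (rule UnI2)
qed

lemma act_Wst:
  assumes "p \<in> fcar (gens M N)"
  shows "act p \<in> Wst"
  using assms
proof (induction p rule: fcar_induct)
  case zero
  then show ?case using ecal.subspace_0[OF Wst_subspace] by simp
next
  case (wd xs c)
  have "act (wd xs) \<in> Wst" using wd
  proof (induction xs)
    case (Cons g xs)
    have "alet g \<in> Wst"
      using Cons.prems Wst_Xp Wst_Kop Wst_Hop Wst_lmul by (auto simp: gens_def Ym_def split: sign.split)
    moreover have "act (wd (g # xs)) = alet g * act (wd xs)"
      by (subst wd_Cons) (simp add: act_simps gen_wd[symmetric])
    ultimately show ?case using Cons Wst_mult by simp
  qed (simp add: Wst_one)
  then show ?case by (simp add: act_simps ecal.subspace_scale[OF Wst_subspace])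
qed (simp add: act_simps ecal.subspace_add[OF Wst_subspace])

text \<open>In a generator \<open>u * r * v\<close> of the ideal the middle factor maps everything
  into \<open>W\<close>, and \<open>act u\<close> preserves \<open>W\<close>.\<close>

theorem act_I: "p \<in> U.I \<Longrightarrow> act p \<in> J"
proof (induction rule: U.I.induct)
  case (base r u v)
  then show ?case by (simp add: act_simps J_left J_right act_loop_rels act_Wst)
qed (simp_all add: act_simps ecal.subspace_add[OF J_subspace] ecal.subspace_0[OF J_subspace])

text \<open>Evaluation at the empty word recovers the polynomial, so the action detects relations
  among currents of one sign.\<close>

lemma act_current_one:
  assumes "p \<in> fcar (XE e)"
  shows "app (act p) 1 = emb p"
  using assms
proof (induction p rule: fcar_induct)
  case (wd xs c)
  have "app (act (wd xs)) 1 = wd xs"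
  proof (cases e)
    case Plus
    then show ?thesis using act_plus_word[of xs "[]"] wd by (simp add: is_minus_def)
  next
    case Minus
    have "set xs \<subseteq> XE Minus" using wd Minus by simp
    then show ?thesis
    proof (induction xs)
      case (Cons g xs)
      then obtain i n where g: "g = XG Minus i n" by auto
      have "act (wd (g # xs)) = alet g * act (wd xs)"
        by (subst wd_Cons) (simp add: act_simps gen_wd[symmetric])
      then show ?case using Cons by (simp add: g app_simps Ym_def app_lmul wd_Cons[of _ xs])
    qed (simp add: app_simps)
  qed
  then show ?case by (simp add: act_simps emb_simps app_simps)
qed (simp_all add: act_simps emb_simps app_simps, simp add: emb_def app_simps)

subsection \<open>The halves\<close>

text \<open>Letters outside the chosen half go to zero, which makes \<open>\<rho>\<close> a
  retraction of \<open>\<iota>\<close>.\<close>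

definition hlet :: "sign \<Rightarrow> lgen \<Rightarrow> (nat \<times> int) falg"
  where "hlet e g = (case g of XG e' i n \<Rightarrow> if e' = e \<and> i \<in> nodes M N then gen (i, n) else 0 | _ \<Rightarrow> 0)"

definition \<rho> :: "sign \<Rightarrow> lgen falg \<Rightarrow> (nat \<times> int) falg"
  where "\<rho> e = eval pm_scale (hlet e)"

definition \<iota> :: "sign \<Rightarrow> (nat \<times> int) falg \<Rightarrow> lgen falg"
  where "\<iota> e = eval pm_scale (\<lambda>(i, n). Xg e i n)"

lemmas \<rho>_simps = falg.eval_simps[where lt = "hlet e" for e, folded \<rho>_def]
lemmas \<iota>_simps = falg.eval_simps[where lt = "\<lambda>(i, n). Xg e i n" for e, folded \<iota>_def]

definition c0 :: "laurent \<Rightarrow> complex" where "c0 l = lk (lk l 0) 0"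

lemma c0_lconst: "c0 (l * lconst a) = a * c0 l" "c0 0 = 0" "c0 (l + l') = c0 l + c0 l'"
proof -
  have "lconst a * l = pscale (sgl 0 a) l" by (simp add: lconst_def pscale_def mult_map_scale_conv_mult)
  moreover have "sgl 0 a * x = pscale a x" for x :: "(nat \<times> int \<Rightarrow>\<^sub>0 nat) \<Rightarrow>\<^sub>0 complex"
    by (simp add: pscale_def mult_map_scale_conv_mult)
  ultimately show "c0 (l * lconst a) = a * c0 l" by (simp add: c0_def mult.commute[of l])
qed (simp_all add: c0_def lookup_add)

text \<open>A left inverse of \<open>emb\<close>: each Laurent coefficient is replaced by its
  coefficient at the trivial monomial.\<close>

definition lower :: "vmod \<Rightarrow> lgen falg"
  where "lower v = Poly_Mapping.map c0 v"

lemma lookup_lower: "lk (lower v) w = c0 (lk v w)"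
  by (simp add: lower_def Poly_Mapping.map.rep_eq when_def c0_lconst)

lemma lookup_emb: "lk (emb p) w = lconst (lk p w)"
proof (induction p rule: pm_induct)
  case (single k c)
  have "emb (sgl k c) = emb (c \<star> wd (letters k))" by (simp add: wd_def)
  also have "\<dots> = vscale c (wd (letters k))" by (simp only: emb_simps emb_wd)
  finally show ?case by (simp add: vscale_def wd_def lookup_single when_def)
qed (simp_all add: emb_simps lookup_add lconst_hom, simp add: emb_def)

lemma lower_emb: "lower (pscale l (emb p)) = c0 l \<star> p"
  by (rule poly_mapping_eqI) (simp add: lookup_lower lookup_emb c0_lconst mult.commute)

lemma lower_add: "lower (v + w) = lower v + lower w" and lower_zero: "lower 0 = 0"
  by (rule poly_mapping_eqI, simp add: lookup_lower lookup_add c0_lconst)+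

lemma half_rels_eq: "half_rels M N q e = falg.quad_rels M N q e (\<lambda>i n. gen (i, n)) \<union> falg.higher_rels M N q (\<lambda>i n. gen (i, n))"
  unfolding half_rels_def using M1 by (intro current_rels_eq[where G = Pair]) (auto simp: hpar_def)

lemma half_rels_fcar: "half_rels M N q e \<subseteq> fcar (hgens M N)"
  unfolding half_rels_eq
  by (rule order_trans[OF rels_wpos wpos_fcar]) (auto simp: hgens_def intro!: wpos_intros)

lemma \<iota>_half_rels: "\<iota> e ` half_rels M N q e = CR e"
  unfolding half_rels_eq CR_eq image_Un \<iota>_def falg.eval_rels by simp

lemma \<iota>_wd: "\<iota> e (wd xs) = wd (map (\<lambda>(i, n). XG e i n) xs)"
proof (induction xs)
  case (Cons g xs)
  have "\<iota> e (wd (g # xs)) = \<iota> e (gen g) * \<iota> e (wd xs)"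
    unfolding wd_Cons[of g xs] \<iota>_simps gen_wd ..
  also have "\<iota> e (gen g) = wd [case g of (i, n) \<Rightarrow> XG e i n]"
    by (simp add: \<iota>_def gen_wd[symmetric] split: prod.split)
  finally show ?case unfolding Cons by (simp add: wd_append[symmetric])
qed (simp add: \<iota>_def)

lemma \<iota>_fcar: "\<iota> e ` fcar (hgens M N) = fcar (XE e)"
proof
  have "\<iota> e p \<in> fcar (XE e)" if "p \<in> fcar (hgens M N)" for p
    using that
  proof (induction p rule: fcar_induct)
    case (wd xs c)
    then have "set (map (\<lambda>(i, n). XG e i n) xs) \<subseteq> XE e" by (auto simp: hgens_def)
    then show ?case unfolding \<iota>_simps \<iota>_wd by (intro fcar_intros fcar_wd)
  qed (simp_all add: \<iota>_simps fcar_intros, simp add: \<iota>_def fcar_intros)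
  then show "\<iota> e ` fcar (hgens M N) \<subseteq> fcar (XE e)" by blast
  have "\<exists>p'\<in>fcar (hgens M N). p = \<iota> e p'" if "p \<in> fcar (XE e)" for p
    using that
  proof (induction p rule: fcar_induct)
    case zero
    then show ?case by (intro bexI[of _ 0]) (simp_all add: \<iota>_def fcar_intros)
  next
    case (wd xs c)
    then have "\<exists>ys. set ys \<subseteq> hgens M N \<and> xs = map (\<lambda>(i, n). XG e i n) ys"
    proof (induction xs)
      case (Cons g xs)
      then obtain ys where "set ys \<subseteq> hgens M N" "xs = map (\<lambda>(i, n). XG e i n) ys" by auto
      moreover obtain i n where "g = XG e i n" "i \<in> nodes M N" using Cons.prems by auto
      ultimately show ?case by (intro exI[of _ "(i, n) # ys"]) (auto simp: hgens_def)
    qed simp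
    then obtain ys where "set ys \<subseteq> hgens M N" "xs = map (\<lambda>(i, n). XG e i n) ys" by blast
    then show ?case by (intro bexI[of _ "c \<star> wd ys"]) (simp_all add: \<iota>_simps \<iota>_wd fcar_intros fcar_wd)
  next
    case (add p r)
    then obtain p' r' where "p' \<in> fcar (hgens M N)" "p = \<iota> e p'" "r' \<in> fcar (hgens M N)" "r = \<iota> e r'" by blast
    then show ?case by (intro bexI[of _ "p' + r'"]) (simp_all add: \<iota>_simps fcar_intros)
  qed
  then show "fcar (XE e) \<subseteq> \<iota> e ` fcar (hgens M N)" by blast
qed

lemma \<rho>_wd_Cons: "\<rho> e (wd (g # xs)) = hlet e g * \<rho> e (wd xs)"
  unfolding wd_Cons[of g xs] \<rho>_simps by (simp add: \<rho>_def gen_wd[symmetric])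

lemma \<rho>_one: "\<rho> e 1 = 1" and \<rho>_zero: "\<rho> e 0 = 0" and \<iota>_zero: "\<iota> e 0 = 0" and \<iota>_one: "\<iota> e 1 = 1"
  by (simp_all add: \<rho>_def \<iota>_def)

lemma \<rho>_\<iota>: "p \<in> fcar (hgens M N) \<Longrightarrow> \<rho> e (\<iota> e p) = p"
proof (induction p rule: fcar_induct)
  case (wd xs c)
  have "\<rho> e (wd (map (\<lambda>(i, n). XG e i n) xs)) = wd xs" using wd
  proof (induction xs)
    case (Cons g xs)
    obtain i n where g: "g = (i, n)" by (cases g)
    then have "hlet e (XG e i n) = wd [g]" using Cons.prems by (simp add: hlet_def hgens_def gen_wd)
    then show ?case using Cons by (simp add: g \<rho>_wd_Cons wd_append[symmetric])
  qed (simp add: \<rho>_one)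
  then show ?case by (simp add: \<iota>_simps \<rho>_simps \<iota>_wd)
qed (simp_all add: \<iota>_simps \<rho>_simps \<iota>_zero \<rho>_zero)

lemma \<rho>_fcar: "\<rho> e (wd xs) \<in> fcar (hgens M N)"
proof (induction xs)
  case (Cons g xs)
  have "hlet e g \<in> fcar (hgens M N)"
    by (auto simp: hlet_def hgens_def split: lgen.split intro!: fcar_intros)
  then show ?case unfolding \<rho>_wd_Cons using Cons by (rule fcar_mult)
qed (simp add: \<rho>_one fcar_one)

text \<open>Relations of the opposite sign consist of nonempty words in letters that
  \<open>hlet e\<close> annihilates.\<close>

lemma \<rho>_rels:
  assumes "R \<in> CR e'"
  shows "\<rho> e R \<in> half_rels M N q e \<or> \<rho> e R = 0"
proof (cases "e' = e")
  case True
  then obtain r where "r \<in> half_rels M N q e" "R = \<iota> e r" using assms \<iota>_half_rels[of e] by blast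
  then show ?thesis using \<rho>_\<iota>[of r e] half_rels_fcar[of e] by auto
next
  case False
  have "pkeys R \<subseteq> {w. letters w \<noteq> [] \<and> set (letters w) \<subseteq> XE e'}" using subsetD[OF CR_wpos assms] unfolding wpos_def by blast
  then have "\<rho> e R = 0"
  proof (induction R rule: pm_induct_on)
    case (single w c)
    then obtain g xs where w: "letters w = g # xs" "g \<in> XE e'" by (cases "letters w") auto
    have "hlet e g = 0" using w(2) False by (auto simp: hlet_def)
    moreover have "sgl w c = c \<star> wd (g # xs)" using w(1) by (cases w) (simp add: wd_def)
    ultimately show ?case by (simp add: \<rho>_simps \<rho>_wd_Cons)
  qed (simp_all add: \<rho>_simps \<rho>_zero)
  then show ?thesis by simp
qed

text \<open>Acting on the empty word puts \<open>emb (\<iota> e p)\<close> into \<open>W\<close>;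
  \<open>lower\<close> followed by \<open>\<rho> e\<close> maps \<open>W\<close> into the ideal of
  the half and gives back \<open>p\<close>.\<close>

lemma half_injective:
  assumes p: "p \<in> fcar (hgens M N)" and "\<iota> e p \<in> U.I"
  shows "p \<in> presentation.I (hgens M N) (half_rels M N q e)"
proof -
  interpret H: presentation "hgens M N" "hpar M" "half_rels M N q e"
    by unfold_locales (rule half_rels_fcar)
  have low: "\<rho> e (lower z) \<in> H.I" if "z \<in> W" for z
    using that
  proof (induction rule: W.induct)
    case W_zero
    then show ?case by (simp add: lower_zero \<rho>_zero H.I.zero)
  next
    case (W_base R e' l u v)
    have "wd u * emb R * wd v = emb (wd u * R * wd v)" by (simp add: emb_simps)
    then have "\<rho> e (lower (pscale l (wd u * emb R * wd v))) = c0 l \<star> (\<rho> e (wd u) * \<rho> e R * \<rho> e (wd v))"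
      by (simp only: lower_emb \<rho>_simps)
    moreover have "\<rho> e (wd u) * \<rho> e R * \<rho> e (wd v) \<in> H.I"
      using \<rho>_rels[OF W_base, of e] H.I.base[OF _ \<rho>_fcar \<rho>_fcar] H.I.zero by auto
    ultimately show ?case by (simp only: pmap.subspace_scale[OF H.I_subspace])
  next
    case (W_add a b)
    then show ?case by (simp add: lower_add \<rho>_simps H.I.add)
  qed
  have "\<iota> e p \<in> fcar (XE e)" using p \<iota>_fcar by blast
  then have "emb (\<iota> e p) \<in> W"
    using act_I[OF assms(2)] act_current_one by (metis (no_types) J_def mem_Collect_eq)
  then have "\<rho> e (lower (emb (\<iota> e p))) \<in> H.I" by (rule low)
  moreover have "lower (emb (\<iota> e p)) = \<iota> e p"
    using lower_emb[of 1 "\<iota> e p"] by (simp add: c0_def)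
  ultimately show ?thesis using \<rho>_\<iota>[OF p] by simp
qed

text \<open>A class may be homogeneous through one representative and lie in the subalgebra through
  another; \<open>homog_component\<close> supplies one with both properties.\<close>

lemma graded_cls:
  assumes S: "S \<subseteq> gens M N"
  shows "homog U.Q d \<inter> U.cls ` fcar S = U.cls ` (fhomog (gpar M) d \<inter> fcar S)"
proof
  show "U.cls ` (fhomog (gpar M) d \<inter> fcar S) \<subseteq> homog U.Q d \<inter> U.cls ` fcar S"
    using fcar_mono[OF S] unfolding U.homog_pres by blast
  show "homog U.Q d \<inter> U.cls ` fcar S \<subseteq> U.cls ` (fhomog (gpar M) d \<inter> fcar S)"
  proof
    fix X assume "X \<in> homog U.Q d \<inter> U.cls ` fcar S"
    then obtain p p' where X: "X = U.cls p'" "p' \<in> fhomog (gpar M) d" "X = U.cls p" "p \<in> fcar S"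
      unfolding U.homog_pres by blast
    then have "p - p' \<in> U.I" using U.cls_eq by metis
    from U.homog_component[OF loop_rels_homog this X(2,4) S]
    obtain p'' where "p'' \<in> fhomog (gpar M) d \<inter> fcar S" "p - p'' \<in> U.I" by blast
    moreover from this(2) have "U.cls p = U.cls p''" by (simp only: U.cls_eq)
    ultimately show "X \<in> U.cls ` (fhomog (gpar M) d \<inter> fcar S)" using X(3) by blast
  qed
qed

lemma Uq_pm_eq: "Uq_pm M N q e = generated_subalgebra U.Q ((\<lambda>g. U.cls (gen g)) ` XE e)"
  unfolding Uq_pm_def Uq_eq by (rule arg_cong[where f = "generated_subalgebra U.Q"]) blast

lemma Uq_0_eq: "Uq_0 M N q = generated_subalgebra U.Q ((\<lambda>g. U.cls (gen g)) ` KHS)"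
  unfolding Uq_0_def Uq_eq image_Un
  by (intro arg_cong[where f = "generated_subalgebra U.Q"] arg_cong2[where f = "(\<union>)"]) blast+

lemma pm_simps:
  "carrier (Uq_pm M N q e) = U.cls ` fcar (XE e)" "homog (Uq_pm M N q e) d = U.cls ` (fhomog (gpar M) d \<inter> fcar (XE e))"
  "add (Uq_pm M N q e) = add U.Q" "smult (Uq_pm M N q e) = smult U.Q"
proof -
  note Bs = U.generated_simps[OF gens_sub(1), of e, folded Uq_pm_eq]
  show "carrier (Uq_pm M N q e) = U.cls ` fcar (XE e)" "homog (Uq_pm M N q e) d = U.cls ` (fhomog (gpar M) d \<inter> fcar (XE e))"
    "add (Uq_pm M N q e) = add U.Q" "smult (Uq_pm M N q e) = smult U.Q"
    by (simp_all only: Bs graded_cls[OF gens_sub(1)])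
qed

lemma zero_simps:
  "carrier (Uq_0 M N q) = U.cls ` fcar KHS" "homog (Uq_0 M N q) d = U.cls ` (fhomog (gpar M) d \<inter> fcar KHS)"
  "add (Uq_0 M N q) = add U.Q" "smult (Uq_0 M N q) = smult U.Q"
proof -
  note Bs = U.generated_simps[OF gens_sub(2), folded Uq_0_eq]
  show "carrier (Uq_0 M N q) = U.cls ` fcar KHS" "homog (Uq_0 M N q) d = U.cls ` (fhomog (gpar M) d \<inter> fcar KHS)"
    "add (Uq_0 M N q) = add U.Q" "smult (Uq_0 M N q) = smult U.Q"
    by (simp_all only: Bs graded_cls[OF gens_sub(2)])
qed

theorem half_iso:
  "\<exists>f \<in> superalgebra_iso (half_alg M N q e) (Uq_pm M N q e).
     \<forall>i\<in>nodes M N. \<forall>n. f (half_gen M N q e i n) = Uq_gen M N q (XG e i n)"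
proof -
  interpret H: presentation "hgens M N" "hpar M" "half_rels M N q e"
    by unfold_locales (rule half_rels_fcar)
  have half: "half_alg M N q e = H.Q" "half_gen M N q e i n = H.cls (gen (i, n))" for i n
    by (simp_all add: half_alg_def half_gen_def H.presented_eq)
  note Bs = U.generated_simps[OF gens_sub(1), of e, folded Uq_pm_eq]
  have \<iota>in: "\<iota> e p \<in> fcar (XE e)" "\<iota> e p \<in> fcar (gens M N)" if "p \<in> fcar (hgens M N)" for p
    using that \<iota>_fcar fcar_sub(1) by blast+
  have \<iota>_I: "\<iota> e x \<in> U.I" if "x \<in> H.I" for x
    using that
  proof (induction rule: H.I.induct)
    case zero
    then show ?case by (simp add: \<iota>_zero U.I.zero)
  next
    case (base r u v)
    then have "\<iota> e r \<in> CR e" using \<iota>_half_rels by blast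
    then have "\<iota> e r \<in> loop_rels M N q" by (rule subsetD[OF CR_loop_rels])
    then show ?case unfolding \<iota>_simps using base by (intro U.I.base \<iota>in)
  next
    case (add a b)
    then show ?case by (simp add: \<iota>_simps U.I.add)
  qed
  \<comment> \<open>One direction makes the map below well defined, the other makes it
    injective.\<close>
  have eqiff: "H.cls p = H.cls p' \<longleftrightarrow> U.cls (\<iota> e p) = U.cls (\<iota> e p')"
    if "p \<in> fcar (hgens M N)" "p' \<in> fcar (hgens M N)" for p p'
  proof -
    have d: "p - p' \<in> fcar (hgens M N)" using that by (rule fcar_intros)
    have "p - p' \<in> H.I \<longleftrightarrow> \<iota> e (p - p') \<in> U.I" using half_injective[OF d] \<iota>_I by blast
    then show ?thesis by (simp only: H.cls_eq U.cls_eq \<iota>_simps)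
  qed
  define f where "f X = U.cls (\<iota> e (SOME p. p \<in> fcar (hgens M N) \<and> H.cls p = X))" for X
  have f: "f (H.cls p) = U.cls (\<iota> e p)" if p: "p \<in> fcar (hgens M N)" for p
  proof -
    have "\<exists>p'. p' \<in> fcar (hgens M N) \<and> H.cls p' = H.cls p" using p by blast
    from someI_ex[OF this] show ?thesis unfolding f_def using eqiff[OF _ p] by blast
  qed
  have carr: "carrier H.Q = H.cls ` fcar (hgens M N)" by (rule H.carrier_pres)
  have img: "f ` H.cls ` P = U.cls ` \<iota> e ` P" if "P \<subseteq> fcar (hgens M N)" for P
    unfolding image_image by (rule image_cong[OF refl f]) (rule subsetD[OF that])
  have bij: "bij_betw f (carrier H.Q) (carrier (Uq_pm M N q e))"
    unfolding bij_betw_def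
  proof
    show "inj_on f (carrier H.Q)"
      unfolding carr
    proof (rule inj_onI)
      fix X Y assume "X \<in> H.cls ` fcar (hgens M N)" "Y \<in> H.cls ` fcar (hgens M N)" "f X = f Y"
      then obtain p p' where pp: "p \<in> fcar (hgens M N)" "p' \<in> fcar (hgens M N)" "X = H.cls p" "Y = H.cls p'" "f X = f Y" by blast
      then have "U.cls (\<iota> e p) = U.cls (\<iota> e p')" using f[OF pp(1)] f[OF pp(2)] by (simp only:)
      then show "X = Y" using eqiff[OF pp(1,2)] pp(3,4) by (simp only:)
    qed
    show "f ` carrier H.Q = carrier (Uq_pm M N q e)"
      unfolding carr Bs by (simp only: img[OF subset_refl] \<iota>_fcar)
  qed
  have add: "f (x \<oplus>\<^bsub>H.Q\<^esub> y) = f x \<oplus>\<^bsub>Uq_pm M N q e\<^esub> f y"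
    and mul: "f (x \<otimes>\<^bsub>H.Q\<^esub> y) = f x \<otimes>\<^bsub>Uq_pm M N q e\<^esub> f y"
    if x: "x \<in> carrier H.Q" and y: "y \<in> carrier H.Q" for x y
  proof -
    obtain p where p: "p \<in> fcar (hgens M N)" "x = H.cls p" using x unfolding carr by (rule imageE)
    obtain r where r: "r \<in> fcar (hgens M N)" "y = H.cls r" using y unfolding carr by (rule imageE)
    have "f (H.cls p \<oplus>\<^bsub>H.Q\<^esub> H.cls r) = U.cls (\<iota> e (p + r))"
      using f[OF pmap.subspace_add[OF fcar_subspace p(1) r(1)]] by (simp only: H.add_Q)
    also have "\<dots> = U.cls (\<iota> e p) \<oplus>\<^bsub>Uq_pm M N q e\<^esub> U.cls (\<iota> e r)"
      by (simp only: Bs(6) U.add_Q \<iota>_simps(1))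
    finally show "f (x \<oplus>\<^bsub>H.Q\<^esub> y) = f x \<oplus>\<^bsub>Uq_pm M N q e\<^esub> f y"
      by (simp only: p(2) r(2) f[OF p(1)] f[OF r(1)])
    have "f (H.cls p \<otimes>\<^bsub>H.Q\<^esub> H.cls r) = U.cls (\<iota> e (p * r))"
      using f[OF fcar_mult[OF p(1) r(1)]] by (simp only: H.mult_pres[OF p(1) r(1)])
    also have "\<dots> = U.cls (\<iota> e p) \<otimes>\<^bsub>Uq_pm M N q e\<^esub> U.cls (\<iota> e r)"
      by (simp only: Bs(3) U.mult_pres[OF \<iota>in(2)[OF p(1)] \<iota>in(2)[OF r(1)]] \<iota>_simps(5))
    finally show "f (x \<otimes>\<^bsub>H.Q\<^esub> y) = f x \<otimes>\<^bsub>Uq_pm M N q e\<^esub> f y"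
      by (simp only: p(2) r(2) f[OF p(1)] f[OF r(1)])
  qed
  have scal: "f (c \<odot>\<^bsub>H.Q\<^esub> x) = c \<odot>\<^bsub>Uq_pm M N q e\<^esub> f x" if x: "x \<in> carrier H.Q" for c x
  proof -
    obtain p where p: "p \<in> fcar (hgens M N)" "x = H.cls p" using x unfolding carr by (rule imageE)
    have "c \<star> p \<in> fcar (hgens M N)" using p(1) by (rule pmap.subspace_scale[OF fcar_subspace])
    from f[OF this] show ?thesis
      by (simp only: p(2) H.smult_Q f[OF p(1)] Bs(7) U.smult_Q \<iota>_simps(4))
  qed
  have one: "f \<one>\<^bsub>H.Q\<^esub> = \<one>\<^bsub>Uq_pm M N q e\<^esub>"
    using f[OF fcar_one] by (simp only: H.one_pres Bs(4) U.one_pres \<iota>_one)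
  have hom: "f ` homog H.Q d = homog (Uq_pm M N q e) d" for d
  proof -
    have par: "sum_list (map (gpar M) (map (\<lambda>(i, n). XG e i n) xs)) = sum_list (map (hpar M) xs)" for xs
      by (rule arg_cong[where f = sum_list]) (auto simp: hpar_def)
    \<comment> \<open>Renaming letters is injective on words, so no coefficients merge and parity
      can be read off on either side.\<close>
    have \<iota>_lk: "lk (\<iota> e p) (Word (map (\<lambda>(i, n). XG e i n) xs)) = lk p (Word xs)" for p xs
    proof (induction p rule: falg_induct)
      case (wd ys c)
      have "inj (\<lambda>(i, n). XG e i n)" by (auto intro: injI)
      then have "map (\<lambda>(i, n). XG e i n) ys = map (\<lambda>(i, n). XG e i n) xs \<longleftrightarrow> ys = xs"
        by (rule inj_map_eq_map)
      then show ?case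
        by (simp add: pm_scale_pscale[symmetric] \<iota>_simps \<iota>_wd) (simp add: wd_def lookup_single when_def)
    qed (simp_all add: \<iota>_zero \<iota>_simps lookup_add)
    have "\<iota> e p \<in> fhomog (gpar M) d \<longleftrightarrow> p \<in> fhomog (hpar M) d" for p
    proof
      assume h: "\<iota> e p \<in> fhomog (gpar M) d"
      have "sum_list (map (hpar M) (letters w)) = d" if "w \<in> pkeys p" for w
      proof -
        have "Word (map (\<lambda>(i, n). XG e i n) (letters w)) \<in> pkeys (\<iota> e p)"
          using that \<iota>_lk[of p "letters w"] by (simp add: in_keys_iff)
        then show ?thesis using h par[of "letters w"] unfolding fhomog_def by force
      qed
      then show "p \<in> fhomog (hpar M) d" by (simp add: fhomog_def)
    next
      assume "p \<in> fhomog (hpar M) d"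
      then have "pkeys p \<subseteq> {w. sum_list (map (hpar M) (letters w)) = d}" by (auto simp: fhomog_def)
      then show "\<iota> e p \<in> fhomog (gpar M) d"
      proof (induction p rule: pm_induct_on)
        case (single w c)
        have "\<iota> e (sgl w c) = c \<star> wd (map (\<lambda>(i, n). XG e i n) (letters w))"
          using \<iota>_wd[of e "letters w"] \<iota>_simps(4)[of e c "wd (letters w)"] by (simp add: wd_def)
        then show ?case using fhomog_wd[of "map (\<lambda>(i, n). XG e i n) (letters w)" "gpar M"] single par[of "letters w"]
          by (simp only: fhomog_scale mem_Collect_eq)
      qed (simp_all add: \<iota>_zero \<iota>_simps fhomog_add)
    qed
    then have 1: "\<iota> e ` (fhomog (hpar M) d \<inter> fcar (hgens M N)) = fhomog (gpar M) d \<inter> fcar (XE e)"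
      unfolding \<iota>_fcar[symmetric] by blast
    have 2: "homog U.Q d \<inter> U.cls ` fcar (XE e) = U.cls ` (fhomog (gpar M) d \<inter> fcar (XE e))"
      by (rule graded_cls[OF gens_sub(1)])
    show ?thesis unfolding H.homog_pres Bs 2 1[symmetric] by (rule img) blast
  qed
  have "f \<in> superalgebra_iso H.Q (Uq_pm M N q e)"
    unfolding superalgebra_iso_def superspace_iso_def linear_iso_def ring_iso_def ring_hom_def
    using bij bij_betwE[OF bij] add mul scal one hom by (simp add: Pi_def)
  moreover have "f (H.cls (gen (i, n))) = Uq_gen M N q (XG e i n)" if "i \<in> nodes M N" for i n
  proof -
    have "(i, n) \<in> hgens M N" using that by (simp add: hgens_def)
    from f[OF fcar_gen[OF this]] show ?thesis by (simp add: Uq_eq \<iota>_def)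
  qed
  ultimately show ?thesis unfolding half by (intro bexI[of _ f]) simp_all
qed

end

subsection \<open>The Cartan part\<close>

fun kexp :: "lgen \<Rightarrow> nat \<Rightarrow>\<^sub>0 int"
  where "kexp (KG e i) = sgl i (sgnv e)" | "kexp _ = 0"

fun hexp :: "lgen \<Rightarrow> (nat \<times> int) \<Rightarrow>\<^sub>0 nat"
  where "hexp (HG i s) = sgl (i, s) 1" | "hexp _ = 0"

definition kexps where "kexps w = sum_list (map kexp w)"
definition hexps where "hexps w = sum_list (map hexp w)"

lemma exps_simps [simp]: "kexps [] = 0" "hexps [] = 0" "kexps (g # w) = kexp g + kexps w" "hexps (g # w) = hexp g + hexps w"
  by (simp_all add: kexps_def hexps_def)

lemma exps_append: "kexps (v @ w) = kexps v + kexps w" "hexps (v @ w) = hexps v + hexps w"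
  by (simp_all add: kexps_def hexps_def)

lemma exps_mset:
  assumes "mset v = mset w"
  shows "kexps v = kexps w" "hexps v = hexps w"
proof -
  have "sum_list (map f v) = sum_list (map f w)" for f :: "lgen \<Rightarrow> 'b::comm_monoid_add"
    using assms by (metis mset_map sum_mset_sum_list)
  then show "kexps v = kexps w" "hexps v = hexps w" by (simp_all only: kexps_def hexps_def)
qed

lemma lookup_exps:
  "lk (kexps w) i = int (count (mset w) (KG Plus i)) - int (count (mset w) (KG Minus i))"
  "lk (hexps w) (i, s) = count (mset w) (HG i s)"
proof -
  show "lk (kexps w) i = int (count (mset w) (KG Plus i)) - int (count (mset w) (KG Minus i))"
  proof (induction w)
    case (Cons g w)
    then show ?case
    proof (cases g)
      case (KG e j)
      then show ?thesis using Cons by (cases e) (auto simp: lookup_add lookup_single when_def)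
    qed (auto simp: lookup_add)
  qed simp
  show "lk (hexps w) (i, s) = count (mset w) (HG i s)"
  proof (induction w)
    case (Cons g w)
    then show ?case by (cases g) (auto simp: lookup_add lookup_single when_def)
  qed simp
qed

primrec is_cartan :: "lgen \<Rightarrow> bool"
  where "is_cartan (XG e i n) = False" | "is_cartan (KG e i) = True" | "is_cartan (HG i s) = True"

text \<open>Words in commuting letters \<open>K\<^sub>i\<close>, \<open>K\<^sub>i\<inverse>\<close>, \<open>h\<^sub>i\<^sub>,\<^sub>s\<close> that represent the same
  Laurent monomial are related by transpositions and cancellations.\<close>

lemma cartan_words_congruent:
  fixes rel :: "lgen list \<Rightarrow> lgen list \<Rightarrow> bool"
  assumes refl: "\<And>w. rel w w" and sym: "\<And>v w. rel v w \<Longrightarrow> rel w v" and trans: "\<And>u v w. rel u v \<Longrightarrow> rel v w \<Longrightarrow> rel u w"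
    and cons: "\<And>g v w. g \<in> S \<Longrightarrow> rel v w \<Longrightarrow> rel (g # v) (g # w)"
    and swap: "\<And>g h w. g \<in> S \<Longrightarrow> h \<in> S \<Longrightarrow> set w \<subseteq> S \<Longrightarrow> rel (g # h # w) (h # g # w)"
    and cancel: "\<And>i w. KG Plus i \<in> S \<Longrightarrow> set w \<subseteq> S \<Longrightarrow> rel (KG Plus i # KG Minus i # w) w"
    and S: "\<And>g. g \<in> S \<Longrightarrow> is_cartan g"
    and w: "set v \<subseteq> S" "set w \<subseteq> S" "kexps v = kexps w" "hexps v = hexps w"
  shows "rel v w"
proof -
  have front: "rel (u1 @ g # u2) (g # u1 @ u2)" if "g \<in> S" "set u1 \<subseteq> S" "set u2 \<subseteq> S" for g u1 u2
    using that(2)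
  proof (induction u1)
    case (Cons h u1)
    have h: "h \<in> S" "set u1 \<subseteq> S" using Cons.prems by simp_all
    have s: "set (u1 @ u2) \<subseteq> S" using h that(3) by simp
    show ?case unfolding append_Cons
      by (rule trans[OF cons[OF h(1) Cons.IH[OF h(2)]] swap[OF h(1) that(1) s]])
  next
    case Nil
    show ?case unfolding append_Nil by (rule refl)
  qed
  have perm: "rel u u'" if "mset u = mset u'" "set u \<subseteq> S" for u u'
    using that
  proof (induction u arbitrary: u')
    case (Cons g u)
    have "g \<in> set u'" using mset_eq_setD[OF Cons.prems(1)] by auto
    then obtain u1 u2 where u': "u' = u1 @ g # u2" by (meson split_list)
    have eq: "mset u = mset (u1 @ u2)" using Cons.prems(1) by (simp add: u')
    then have su: "set (u1 @ u2) \<subseteq> S" using Cons.prems(2) set_subset_Cons[of u g] mset_eq_setD[OF eq] by simp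
    have g: "g \<in> S" "set u \<subseteq> S" "set u1 \<subseteq> S" "set u2 \<subseteq> S" using Cons.prems(2) su by simp_all
    show ?case unfolding u'
      by (rule trans[OF cons[OF g(1) Cons.IH[OF eq g(2)]] sym[OF front[OF g(1,3,4)]]])
  next
    case Nil
    then show ?case using refl[of "[]"] by simp
  qed
  have red: "\<exists>u'. rel u u' \<and> set u' \<subseteq> S \<and> length u' < length u \<and> kexps u' = kexps u \<and> hexps u' = hexps u"
    if u: "set u \<subseteq> S" "KG Plus i \<in> set u" "KG Minus i \<in> set u" for u i
  proof -
    obtain u1 u2 where 1: "u = u1 @ KG Plus i # u2" using u(2) by (meson split_list)
    have "KG Minus i \<in> set (u1 @ u2)" using u(3) 1 by auto
    then obtain u3 u4 where 2: "u1 @ u2 = u3 @ KG Minus i # u4" by (meson split_list)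
    have m: "mset u = mset (KG Plus i # KG Minus i # u3 @ u4)"
      using arg_cong[OF 2, of mset] by (simp add: 1)
    have s: "set (u3 @ u4) \<subseteq> S" using u(1) arg_cong[OF 2, of set] by (auto simp: 1)
    have "rel u (KG Plus i # KG Minus i # u3 @ u4)" by (rule perm[OF m u(1)])
    moreover have "rel (KG Plus i # KG Minus i # u3 @ u4) (u3 @ u4)" by (rule cancel[OF subsetD[OF u(1,2)] s])
    ultimately have r: "rel u (u3 @ u4)" by (rule trans)
    have "kexps u = kexps (KG Plus i # KG Minus i # u3 @ u4)" "hexps u = hexps (KG Plus i # KG Minus i # u3 @ u4)"
      by (rule exps_mset[OF m])+
    then have "kexps (u3 @ u4) = kexps u" "hexps (u3 @ u4) = hexps u"
      by (simp_all only: exps_simps kexp.simps hexp.simps sgnv.simps add.assoc[symmetric] single_add[symmetric])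
        simp_all
    moreover have "length (u3 @ u4) < length u" using arg_cong[OF m, of size] by simp
    ultimately show ?thesis using r s by blast
  qed
  show ?thesis
    using w
  proof (induction "length v + length w" arbitrary: v w rule: less_induct)
    case less
    show ?case
    proof (cases "\<exists>i. KG Plus i \<in> set v \<and> KG Minus i \<in> set v")
      case True
      then obtain v' where "rel v v'" "set v' \<subseteq> S" "length v' < length v" "kexps v' = kexps v" "hexps v' = hexps v"
        using red[OF less.prems(1)] by blast
      note v' = this
      have "rel v' w" by (rule less.hyps[OF _ v'(2) less.prems(2)]) (simp_all only: v'(3-5) less.prems add_less_mono1)
      then show ?thesis by (rule trans[OF v'(1)])
    next
      case v: False
      show ?thesis
      proof (cases "\<exists>i. KG Plus i \<in> set w \<and> KG Minus i \<in> set w")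
        case True
        then obtain w' where "rel w w'" "set w' \<subseteq> S" "length w' < length w" "kexps w' = kexps w" "hexps w' = hexps w"
          using red[OF less.prems(2)] by blast
        note w' = this
        have "rel v w'" by (rule less.hyps[OF _ less.prems(1) w'(2)]) (simp_all only: w'(3-5) less.prems nat_add_left_cancel_less)
        then show ?thesis by (rule trans[OF _ sym[OF w'(1)]])
      next
        case w: False
        have "count (mset v) g = count (mset w) g" for g
        proof (cases g)
          case (XG e i n)
          then have "g \<notin> set v" "g \<notin> set w" using less.prems S by force+
          then have "g \<notin># mset v" "g \<notin># mset w" by simp_all
          then have "count (mset v) g = 0" "count (mset w) g = 0" by (simp_all only: not_in_iff)
          then show ?thesis by (simp only:)
        next
          case (KG e i)
          have "int (count (mset v) (KG Plus i)) - int (count (mset v) (KG Minus i))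
            = int (count (mset w) (KG Plus i)) - int (count (mset w) (KG Minus i))"
            using less.prems(3) by (simp flip: lookup_exps(1))
          \<comment> \<open>Neither word contains a cancelling pair, so at each node one of the two
            counts is zero and their difference determines both.\<close>
          moreover have "count (mset v) (KG Plus i) = 0 \<or> count (mset v) (KG Minus i) = 0"
            "count (mset w) (KG Plus i) = 0 \<or> count (mset w) (KG Minus i) = 0"
            unfolding count_eq_zero_iff set_mset_mset using v w by blast+
          ultimately have "count (mset v) (KG Plus i) = count (mset w) (KG Plus i) \<and>
            count (mset v) (KG Minus i) = count (mset w) (KG Minus i)" by linarith
          then show ?thesis using KG by (cases e) (simp_all only:)
        next
          case (HG i s)
          then show ?thesis using less.prems(4) by (simp flip: lookup_exps(2))
        qed
        then have "mset v = mset w" by (rule multiset_eqI)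
        then show ?thesis using less.prems(1) by (rule perm)
      qed
    qed
  qed
qed

primrec llet :: "lgen \<Rightarrow> laurent"
  where "llet (XG e i n) = 0" | "llet (KG e i) = laurent_K e i" | "llet (HG i s) = laurent_h i s"

definition lam :: "lgen falg \<Rightarrow> laurent"
  where "lam = eval lscale llet"

lemmas lam_simps = lcal.eval_simps[where lt = llet, folded lam_def]

lemma lam_gen [simp]: "lam (gen g) = llet g" and lam_one [simp]: "lam 1 = 1" and lam_zero [simp]: "lam 0 = 0"
  by (simp_all add: lam_def)

lemma lam_wd: "(\<forall>g\<in>set xs. is_cartan g) \<Longrightarrow> lam (wd xs) = sgl (kexps xs) (sgl (hexps xs) 1)"
proof (induction xs)
  case (Cons g xs)
  have "lam (wd (g # xs)) = llet g * lam (wd xs)"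
    unfolding wd_Cons[of g xs] lam_simps by (simp add: gen_wd[symmetric])
  then show ?case using Cons by (cases g) (auto simp: laurent_K_def laurent_h_def mult_single)
qed simp

text \<open>Which word is chosen is immaterial by \<open>cartan_words_congruent\<close>; the support
  condition keeps its letters within those occurring in the monomial.\<close>

definition cword :: "(nat \<Rightarrow>\<^sub>0 int) \<Rightarrow> ((nat \<times> int) \<Rightarrow>\<^sub>0 nat) \<Rightarrow> lgen list"
  where "cword k h = (SOME w. kexps w = k \<and> hexps w = h \<and>
     set w \<subseteq> {KG e i | e i. i \<in> pkeys k} \<union> {HG i s | i s. (i, s) \<in> pkeys h})"

lemma kword_ex: "\<exists>w. kexps w = k \<and> hexps w = 0 \<and> set w \<subseteq> {KG e i | e i. i \<in> pkeys k}"
proof -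
  have "\<exists>w. kexps w = k \<and> hexps w = 0 \<and> set w \<subseteq> {KG e i | e i. i \<in> S}" if "pkeys k \<subseteq> S" for S
    using that
  proof (induction k rule: pm_induct_on)
    case zero
    then show ?case by (intro exI[of _ "[]"]) simp
  next
    case (single i c)
    have "kexps (replicate n (KG e i)) = sgl i (int n * sgnv e) \<and> hexps (replicate n (KG e i)) = 0" for n e
      by (induction n) (auto simp: single_add[symmetric] distrib_right)
    from this[of "nat \<bar>c\<bar>" "if c \<ge> 0 then Plus else Minus"] show ?case using single
      by (intro exI[of _ "replicate (nat \<bar>c\<bar>) (KG (if c \<ge> 0 then Plus else Minus) i)"]) auto
  next
    case (add p r)
    then obtain v w where "kexps v = p" "hexps v = 0" "set v \<subseteq> {KG e i | e i. i \<in> S}"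
      "kexps w = r" "hexps w = 0" "set w \<subseteq> {KG e i | e i. i \<in> S}" by blast
    then show ?case by (intro exI[of _ "v @ w"]) (simp add: exps_append)
  qed
  then show ?thesis by blast
qed

lemma hword_ex: "\<exists>w. hexps w = h \<and> kexps w = 0 \<and> set w \<subseteq> {HG i s | i s. (i, s) \<in> pkeys h}"
proof -
  have "\<exists>w. hexps w = h \<and> kexps w = 0 \<and> set w \<subseteq> {HG i s | i s. (i, s) \<in> S}" if "pkeys h \<subseteq> S" for S
    using that
  proof (induction h rule: pm_induct_on)
    case zero
    then show ?case by (intro exI[of _ "[]"]) simp
  next
    case (single k c)
    obtain i s where k: "k = (i, s)" by (cases k)
    have "hexps (replicate n (HG i s)) = sgl (i, s) n \<and> kexps (replicate n (HG i s)) = 0" for n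
      by (induction n) (auto simp: single_add[symmetric])
    from this[of c] show ?case using single k by (intro exI[of _ "replicate c (HG i s)"]) auto
  next
    case (add p r)
    then obtain v w where "hexps v = p" "kexps v = 0" "set v \<subseteq> {HG i s | i s. (i, s) \<in> S}"
      "hexps w = r" "kexps w = 0" "set w \<subseteq> {HG i s | i s. (i, s) \<in> S}" by blast
    then show ?case by (intro exI[of _ "v @ w"]) (simp add: exps_append)
  qed
  then show ?thesis by blast
qed

lemma cword: "kexps (cword k h) = k" "hexps (cword k h) = h"
  "set (cword k h) \<subseteq> {KG e i | e i. i \<in> pkeys k} \<union> {HG i s | i s. (i, s) \<in> pkeys h}"
proof -
  obtain v w where "kexps v = k" "hexps v = 0" "set v \<subseteq> {KG e i | e i. i \<in> pkeys k}"
    "hexps w = h" "kexps w = 0" "set w \<subseteq> {HG i s | i s. (i, s) \<in> pkeys h}"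
    using kword_ex[of k] hword_ex[of h] by blast
  then have "\<exists>w. kexps w = k \<and> hexps w = h \<and>
     set w \<subseteq> {KG e i | e i. i \<in> pkeys k} \<union> {HG i s | i s. (i, s) \<in> pkeys h}"
    by (intro exI[of _ "v @ w"]) (simp add: exps_append, blast)
  from someI_ex[OF this] show "kexps (cword k h) = k" "hexps (cword k h) = h"
    "set (cword k h) \<subseteq> {KG e i | e i. i \<in> pkeys k} \<union> {HG i s | i s. (i, s) \<in> pkeys h}"
    unfolding cword_def by blast+
qed

text \<open>A complex-linear section of \<open>lam\<close> through the chosen words.\<close>

definition lift :: "laurent \<Rightarrow> lgen falg"
  where "lift l = (\<Sum>k\<in>pkeys l. lext pm_scale (\<lambda>h. wd (cword k h)) (lk l k))"

lemma lift_add: "lift (l + l') = lift l + lift l'"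
proof -
  let ?F = "\<lambda>l k. lext pm_scale (\<lambda>h. wd (cword k h)) (lk l k) :: lgen falg"
  have sup: "lift l = (\<Sum>k\<in>A. ?F l k)" if "finite A" "pkeys l \<subseteq> A" for l A
    unfolding lift_def using that by (intro sum.mono_neutral_left) (auto simp: in_keys_iff)
  have "lift (l + l') = (\<Sum>k\<in>pkeys l \<union> pkeys l'. ?F (l + l') k)"
    using Poly_Mapping.keys_add[of l l'] by (intro sup) auto
  also have "\<dots> = (\<Sum>k\<in>pkeys l \<union> pkeys l'. ?F l k) + (\<Sum>k\<in>pkeys l \<union> pkeys l'. ?F l' k)"
    by (simp add: lookup_add pmap.lext_add sum.distrib)
  also have "\<dots> = lift l + lift l'" using sup[of "pkeys l \<union> pkeys l'"] by simp
  finally show ?thesis .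
qed

lemma lift_zero [simp]: "lift 0 = 0"
  by (simp add: lift_def)

lemma lift_monom: "lift (sgl k (sgl h c)) = c \<star> wd (cword k h)"
proof (cases "c = 0")
  case False
  then have "sgl h c \<noteq> 0" by (metis lookup_single_eq lookup_zero)
  then show ?thesis by (simp add: lift_def)
qed (simp add: lift_def)

lemma laurent_induct [case_names zero monom add]:
  fixes l :: laurent
  assumes "P 0" "\<And>k h c. P (sgl k (sgl h c))" "\<And>l l'. P l \<Longrightarrow> P l' \<Longrightarrow> P (l + l')"
  shows "P l"
proof (induction l rule: pm_induct)
  case (single k m)
  show ?case
    by (induction m rule: pm_induct) (auto simp: single_add assms)
qed (auto simp: assms)

lemma lift_scale: "lift (lscale c l) = c \<star> lift l"
proof (induction l rule: laurent_induct)
  case (monom k h d)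
  have "lscale c (sgl k (sgl h d)) = sgl k (sgl h (c * d))" by (simp add: lscale_def lconst_def mult_single)
  then show ?case by (simp add: lift_monom)
qed (simp_all add: lift_add lcal.scale_right_distrib pmap.scale_right_distrib)

context sl_params
begin

lemma KHS_cartan: "g \<in> KHS \<Longrightarrow> is_cartan g"
  by auto

lemma loop_relI:
  "i \<in> nodes M N \<Longrightarrow> e \<noteq> e' \<Longrightarrow> Kg e i * Kg e' i - 1 \<in> loop_rels M N q"
  "i \<in> nodes M N \<Longrightarrow> j \<in> nodes M N \<Longrightarrow> sbr (gpar M) 1 (Kg Plus i) (Kg Plus j) \<in> loop_rels M N q"
  "i \<in> nodes M N \<Longrightarrow> j \<in> nodes M N \<Longrightarrow> s \<noteq> 0 \<Longrightarrow> sbr (gpar M) 1 (Kg Plus i) (Hg j s) \<in> loop_rels M N q"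
  "i \<in> nodes M N \<Longrightarrow> j \<in> nodes M N \<Longrightarrow> s \<noteq> 0 \<Longrightarrow> t \<noteq> 0 \<Longrightarrow> sbr (gpar M) 1 (Hg i s) (Hg j t) \<in> loop_rels M N q"
  "i \<in> nodes M N \<Longrightarrow> j \<in> nodes M N \<Longrightarrow>
     Kg Plus i * Xg e j n * Kg Minus i - (q powi (sgnv e * cartan M N i j)) \<star> Xg e j n \<in> loop_rels M N q"
  "i \<in> nodes M N \<Longrightarrow> j \<in> nodes M N \<Longrightarrow> s \<noteq> 0 \<Longrightarrow> sbr (gpar M) 1 (Hg i s) (Xg e j n)
       - (of_int (sgnv e) * qnum (qi M q i) (s * lsgn M i * cartan M N i j) / of_int s) \<star> Xg e j (n + s) \<in> loop_rels M N q"
  "i \<in> nodes M N \<Longrightarrow> j \<in> nodes M N \<Longrightarrow> sbr (gpar M) 1 (Xg Plus i m) (Xg Minus j n)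
       - (if i = j then (1 / (qi M q i - inverse (qi M q i)))
          \<star> (phi M q Plus i (m + n) - phi M q Minus i (m + n)) else 0) \<in> loop_rels M N q"
  unfolding loop_rels_def
  subgoal by (rule UnI1, rule UnI1, rule UnI1, rule UnI1, rule UnI1, rule UnI1, rule UnI1, rule CollectI, blast)
  subgoal by (rule UnI1, rule UnI1, rule UnI1, rule UnI1, rule UnI1, rule UnI1, rule UnI2, rule CollectI, blast)
  subgoal by (rule UnI1, rule UnI1, rule UnI1, rule UnI1, rule UnI1, rule UnI2, rule CollectI, blast)
  subgoal by (rule UnI1, rule UnI1, rule UnI1, rule UnI1, rule UnI2, rule CollectI, blast)
  subgoal by (rule UnI1, rule UnI1, rule UnI1, rule UnI2, rule CollectI, blast)
  subgoal by (rule UnI1, rule UnI1, rule UnI2, rule CollectI, blast)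
  subgoal by (rule UnI1, rule UnI2, rule CollectI, blast)
  done

lemmas rel_I = loop_relI[THEN subsetD[OF U.R_subset_I]]

text \<open>The commutation relations are imposed for \<open>Kg Plus i\<close> only; for the inverse
  they follow by multiplying a commutator with the inverse on both sides.\<close>

lemma KHS_commute:
  assumes "g \<in> KHS" "h \<in> KHS"
  shows "gen g * gen h - gen h * gen g \<in> U.I"
proof -
  have swap: "b * a - a * b \<in> U.I" if "a * b - b * a \<in> U.I" for a b
    using pmap.subspace_neg[OF U.I_subspace that] by simp
  have minus: "Kg Minus i * x - x * Kg Minus i \<in> U.I"
    if i: "i \<in> nodes M N" and x: "x \<in> fcar (gens M N)" and c: "Kg Plus i * x - x * Kg Plus i \<in> U.I" for i x
  proof -
    have K: "Kg e i \<in> fcar (gens M N)" for e using i by (rule gen_fcar)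
    have inv: "Kg Plus i * Kg Minus i - 1 \<in> U.I" "Kg Minus i * Kg Plus i - 1 \<in> U.I"
      by (rule rel_I(1)[OF i]; simp)+
    \<comment> \<open>This combination of elements of the ideal is identically the commutator of the
      inverse generator with \<open>x\<close>.\<close>
    have "(Kg Minus i * Kg Plus i - 1) * (x * Kg Minus i) - Kg Minus i * (Kg Plus i * x - x * Kg Plus i) * Kg Minus i
      - (Kg Minus i * x) * (Kg Plus i * Kg Minus i - 1) \<in> U.I"
      by (rule pmap.subspace_diff[OF U.I_subspace pmap.subspace_diff[OF U.I_subspace
            U.I_right[OF inv(2) fcar_mult[OF x K]] U.I_right[OF U.I_left[OF c K] K]] U.I_left[OF inv(1) fcar_mult[OF K x]]])
    then show ?thesis by (simp add: algebra_simps)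
  qed
  have KK: "Kg Plus i * Kg Plus j - Kg Plus j * Kg Plus i \<in> U.I" if "i \<in> nodes M N" "j \<in> nodes M N" for i j
    using rel_I(2)[OF that] by (simp add: sbr_gen)
  have KH: "Kg Plus i * Hg j s - Hg j s * Kg Plus i \<in> U.I" if "i \<in> nodes M N" "j \<in> nodes M N" "s \<noteq> 0" for i j s
    using rel_I(3)[OF that] by (simp add: sbr_gen)
  have HH: "Hg i s * Hg j t - Hg j t * Hg i s \<in> U.I" if "i \<in> nodes M N" "j \<in> nodes M N" "s \<noteq> 0" "t \<noteq> 0" for i j s t
    using rel_I(4)[OF that] by (simp add: sbr_gen)
  have K: "Kg e i * x - x * Kg e i \<in> U.I"
    if "i \<in> nodes M N" "x \<in> fcar (gens M N)" "Kg Plus i * x - x * Kg Plus i \<in> U.I" for e i x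
    using minus[OF that] that(3) by (cases e) (simp_all only:)
  have KKe: "Kg e i * Kg e' j - Kg e' j * Kg e i \<in> U.I" if i: "i \<in> nodes M N" and j: "j \<in> nodes M N" for e e' i j
    by (rule K[OF i gen_fcar(2)[OF j] swap[OF K[OF j gen_fcar(2)[OF i] KK[OF j i]]]])
  have KHe: "Kg e i * Hg j s - Hg j s * Kg e i \<in> U.I" if i: "i \<in> nodes M N" and j: "j \<in> nodes M N" "s \<noteq> 0" for e i j s
    by (rule K[OF i gen_fcar(3)[OF j] KH[OF i j]])
  from assms consider e i e' j where "g = KG e i" "h = KG e' j" "i \<in> nodes M N" "j \<in> nodes M N"
    | e i j s where "g = KG e i" "h = HG j s" "i \<in> nodes M N" "j \<in> nodes M N" "s \<noteq> 0"
    | e i j s where "h = KG e i" "g = HG j s" "i \<in> nodes M N" "j \<in> nodes M N" "s \<noteq> 0"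
    | i s j t where "g = HG i s" "h = HG j t" "i \<in> nodes M N" "j \<in> nodes M N" "s \<noteq> 0" "t \<noteq> 0"
    by blast
  then show ?thesis
  proof cases
    case 1
    show ?thesis unfolding 1(1,2) by (rule KKe[OF 1(3,4)])
  next
    case 2
    show ?thesis unfolding 2(1,2) by (rule KHe[OF 2(3-5)])
  next
    case 3
    show ?thesis unfolding 3(1,2) by (rule swap[OF KHe[OF 3(3-5)]])
  next
    case 4
    show ?thesis unfolding 4(1,2) by (rule HH[OF 4(3-6)])
  qed
qed

lemma cartan_words_I:
  assumes "set v \<subseteq> KHS" "set w \<subseteq> KHS" "kexps v = kexps w" "hexps v = hexps w"
  shows "wd v - wd w \<in> U.I"
proof (rule cartan_words_congruent[where rel = "\<lambda>v w. wd v - wd w \<in> U.I" and S = KHS])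
  show "wd (g # v) - wd (g # w) \<in> U.I" if "g \<in> KHS" "wd v - wd w \<in> U.I" for g v w
  proof -
    have "gen g * (wd v - wd w) \<in> U.I" by (rule U.I_left[OF that(2) fcar_gen[OF subsetD[OF gens_sub(2) that(1)]]])
    then show ?thesis by (simp only: right_diff_distrib gen_wd wd_Cons[of g v] wd_Cons[of g w])
  qed
  show "wd (g # h # w) - wd (h # g # w) \<in> U.I" if "g \<in> KHS" "h \<in> KHS" "set w \<subseteq> KHS" for g h w
  proof -
    have "(gen g * gen h - gen h * gen g) * wd w \<in> U.I"
      using that gens_sub(2) by (intro U.I_right KHS_commute fcar_wd) blast+
    then show ?thesis by (simp add: left_diff_distrib gen_wd wd_append[symmetric])
  qed
  show "wd (KG Plus i # KG Minus i # w) - wd w \<in> U.I" if "KG Plus i \<in> KHS" "set w \<subseteq> KHS" for i w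
  proof -
    have "i \<in> nodes M N" using that by auto
    then have "Kg Plus i * Kg Minus i - 1 \<in> U.I" by (rule rel_I(1)) simp
    then have "(Kg Plus i * Kg Minus i - 1) * wd w \<in> U.I"
      by (rule U.I_right) (rule fcar_wd[OF subset_trans[OF that(2) gens_sub(2)]])
    then show ?thesis by (simp add: left_diff_distrib gen_wd wd_append[symmetric])
  qed
  show "wd v - wd w \<in> U.I \<Longrightarrow> wd w - wd v \<in> U.I" for v w
    using pmap.subspace_neg[OF U.I_subspace, of "wd v - wd w"] by simp
  show "wd u - wd v \<in> U.I \<Longrightarrow> wd v - wd w \<in> U.I \<Longrightarrow> wd u - wd w \<in> U.I" for u v w
    using U.I.add[of "wd u - wd v" "wd v - wd w"] by simp
qed (use assms KHS_cartan U.I.zero in auto)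

lemma cword_KHS:
  assumes "set w \<subseteq> KHS"
  shows "set (cword (kexps w) (hexps w)) \<subseteq> KHS"
proof -
  have "pkeys (kexps w) \<subseteq> nodes M N \<and> pkeys (hexps w) \<subseteq> nodes M N \<times> (UNIV - {0})"
    using assms
  proof (induction w)
    case (Cons g w)
    have "pkeys (kexp g) \<subseteq> nodes M N" "pkeys (hexp g) \<subseteq> nodes M N \<times> (UNIV - {0})"
      using Cons.prems by (cases g; auto split: if_splits)+
    then show ?case using Cons Poly_Mapping.keys_add[of "kexp g" "kexps w"] Poly_Mapping.keys_add[of "hexp g" "hexps w"]
      by simp blast
  qed simp
  then show ?thesis using cword(3)[of "kexps w" "hexps w"] by blast
qed

text \<open>A word and the chosen word with the same exponents are congruent, so every Cartan
  polynomial is congruent to a normal form determined by \<open>lam\<close>.\<close>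

lemma lift_lam: "p \<in> fcar KHS \<Longrightarrow> p - lift (lam p) \<in> U.I"
proof (induction p rule: fcar_induct)
  case (wd xs c)
  have "lam (wd xs) = sgl (kexps xs) (sgl (hexps xs) 1)" using wd KHS_cartan by (intro lam_wd) blast
  then have "lift (lam (c \<star> wd xs)) = c \<star> wd (cword (kexps xs) (hexps xs))"
    by (simp add: lam_simps lift_scale lift_monom)
  moreover have "wd xs - wd (cword (kexps xs) (hexps xs)) \<in> U.I"
    by (rule cartan_words_I[OF wd cword_KHS[OF wd]]) (simp_all add: cword)
  ultimately show ?case using pmap.subspace_scale[OF U.I_subspace, of "wd xs - wd (cword (kexps xs) (hexps xs))" c]
    by (simp add: pmap.scale_right_diff_distrib)
next
  case (add p r)
  from U.I.add[OF add(3,4)] show ?case by (simp add: lam_simps lift_add algebra_simps)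
qed (simp add: U.I.zero)

lemma act_cartan:
  assumes "\<forall>g\<in>set xs. is_cartan g"
  shows "app (act (wd xs)) 1 = pscale (lam (wd xs)) 1"
  using assms
proof (induction xs)
  case (Cons g xs)
  have 1: "act (wd (g # xs)) = alet g * act (wd xs)"
    by (subst wd_Cons) (simp add: act_simps gen_wd[symmetric])
  have 2: "lam (wd (g # xs)) = llet g * lam (wd xs)"
    by (subst wd_Cons) (simp add: lam_simps gen_wd[symmetric])
  have "app (alet g) 1 = pscale (llet g) 1"
    using Cons.prems Hop_wd[of sgnv _ _ "[]"] Kop_wd[of sgnv _ _ "[]"] by (cases g) (auto simp: sigw_def)
  then show ?case using Cons by (simp add: 1 2 app_simps mult.commute)
qed (simp add: app_simps)

text \<open>Relations consist of nonempty words, and concatenation keeps them nonempty.\<close>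

lemma W_constant: "z \<in> W \<Longrightarrow> lk z 0 = 0"
proof (induction rule: W.induct)
  case (W_base R e l u v)
  have "lk (wd u * R * wd v) 0 = 0"
  proof (rule ccontr)
    assume "lk (wd u * R * wd v) 0 \<noteq> 0"
    then have "0 \<in> pkeys (wd u * R * wd v)" by (simp add: in_keys_iff)
    then obtain a b where ab: "a + b = 0" "a \<in> pkeys (wd u * R)" using keys_mult[of "wd u * R" "wd v"] by force
    then obtain a1 a2 where "a = a1 + a2" "a2 \<in> pkeys R" using keys_mult[of "wd u" R] by force
    moreover from this have "letters a2 \<noteq> []" using CR_wpos[of e] W_base by (auto simp: wpos_def)
    ultimately show False using ab by (simp add: plus_word_def zero_word_def)
  qed
  moreover have "wd u * emb R * wd v = emb (wd u * R * wd v)" by (simp add: emb_simps)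
  ultimately show ?case by (simp add: lookup_emb)
qed (simp_all add: lookup_add)

text \<open>Acting on the empty word, \<open>p\<close> produces \<open>lam p\<close> as coefficient
  of the empty word, and there elements of \<open>W\<close> vanish. The converse is the normal form
  of \<open>lift_lam\<close>.\<close>

lemma lam_I: "p \<in> fcar KHS \<Longrightarrow> p \<in> U.I \<longleftrightarrow> lam p = 0"
proof
  assume p: "p \<in> fcar KHS" and I: "p \<in> U.I"
  have "app (act p) 1 = pscale (lam p) 1"
    using p
  proof (induction p rule: fcar_induct)
    case (wd xs c)
    have "app (act (wd xs)) 1 = pscale (lam (wd xs)) 1" using wd KHS_cartan by (intro act_cartan) blast
    then show ?case by (simp add: act_simps lam_simps app_simps vscale_def lscale_def)
  qed (simp_all add: act_simps lam_simps app_simps pmod.scale_left_distrib)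
  moreover have "app (act p) 1 \<in> W" using act_I[OF I] unfolding J_def by blast
  ultimately have "pscale (lam p) 1 \<in> W" by (simp only:)
  from W_constant[OF this] show "lam p = 0" by simp
next
  assume "p \<in> fcar KHS" "lam p = 0"
  then show "p \<in> U.I" using lift_lam[of p] by simp
qed

lemma laurent_alg_simps:
  "add (laurent_alg M N) = (+)" "smult (laurent_alg M N) = lscale" "mult (laurent_alg M N) = (*)" "one (laurent_alg M N) = 1"
  by (simp_all add: laurent_alg_def lscale_def[abs_def] lconst_def)

lemma lam_carrier: "lam ` fcar KHS = carrier (laurent_alg M N)"
proof
  have C: "carrier (laurent_alg M N) = {l. \<forall>k\<in>pkeys l. pkeys k \<subseteq> nodes M N \<and> (\<forall>h\<in>pkeys (lk l k). pkeys h \<subseteq> nodes M N \<times> (UNIV - {0}))}"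
    by (simp add: laurent_alg_def)
  have Cadd: "l + l' \<in> carrier (laurent_alg M N)" if "l \<in> carrier (laurent_alg M N)" "l' \<in> carrier (laurent_alg M N)" for l l'
  proof -
    have "pkeys k \<subseteq> nodes M N \<and> (\<forall>h\<in>pkeys (lk (l + l') k). pkeys h \<subseteq> nodes M N \<times> (UNIV - {0}))"
      if k: "k \<in> pkeys (l + l')" for k
    proof
      show "pkeys k \<subseteq> nodes M N" using k Poly_Mapping.keys_add[of l l'] \<open>l \<in> _\<close> \<open>l' \<in> _\<close> unfolding C by blast
      show "\<forall>h\<in>pkeys (lk (l + l') k). pkeys h \<subseteq> nodes M N \<times> (UNIV - {0})"
      proof
        fix h assume "h \<in> pkeys (lk (l + l') k)"
        then have h: "h \<in> pkeys (lk l k) \<or> h \<in> pkeys (lk l' k)"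
          using Poly_Mapping.keys_add[of "lk l k" "lk l' k"] by (auto simp: lookup_add)
        have key: "k \<in> pkeys r" if "h \<in> pkeys (lk r k)" for r :: laurent
          using that by (cases "lk r k = 0") (simp_all add: in_keys_iff)
        from h show "pkeys h \<subseteq> nodes M N \<times> (UNIV - {0})"
        proof
          assume "h \<in> pkeys (lk l k)"
          from this key[OF this] show ?thesis using \<open>l \<in> _\<close> unfolding C by blast
        next
          assume "h \<in> pkeys (lk l' k)"
          from this key[OF this] show ?thesis using \<open>l' \<in> _\<close> unfolding C by blast
        qed
      qed
    qed
    then show ?thesis unfolding C by blast
  qed
  have "lam p \<in> carrier (laurent_alg M N)" if "p \<in> fcar KHS" for p
    using that
  proof (induction p rule: fcar_induct)
    case (wd xs c)
    have "pkeys (kexps xs) \<subseteq> nodes M N \<and> pkeys (hexps xs) \<subseteq> nodes M N \<times> (UNIV - {0})"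
      using wd
    proof (induction xs)
      case (Cons g w)
      have "pkeys (kexp g) \<subseteq> nodes M N" "pkeys (hexp g) \<subseteq> nodes M N \<times> (UNIV - {0})"
        using Cons.prems by (cases g; auto split: if_splits)+
      then show ?case using Cons Poly_Mapping.keys_add[of "kexp g" "kexps w"] Poly_Mapping.keys_add[of "hexp g" "hexps w"]
        by simp blast
    qed simp
    moreover have "lam (c \<star> wd xs) = sgl (kexps xs) (sgl (hexps xs) c)"
      using wd KHS_cartan by (simp only: lam_simps) (subst lam_wd; force simp: lscale_def lconst_def mult_single)
    ultimately show ?case unfolding C by (auto split: if_splits)
  next
    case (add p r)
    then show ?case by (simp add: lam_simps Cadd)
  qed (simp add: C)
  then show "lam ` fcar KHS \<subseteq> carrier (laurent_alg M N)" by blast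
  have "lam (lift l) = l \<and> lift l \<in> fcar KHS" if "l \<in> carrier (laurent_alg M N)" for l
  proof
    have "lam (lift l) = l"
    proof (induction l rule: laurent_induct)
      case (monom k h c)
      have "\<forall>g\<in>set (cword k h). is_cartan g" using cword(3)[of k h] by auto
      then show ?case by (simp add: lift_monom lam_simps lam_wd cword lscale_def lconst_def mult_single)
    qed (simp_all add: lift_add lam_simps)
    then show "lam (lift l) = l" .
    show "lift l \<in> fcar KHS"
      unfolding lift_def
    proof (rule pmap.subspace_sum[OF fcar_subspace])
      fix k assume k: "k \<in> pkeys l"
      have "wd (cword k h) \<in> fcar KHS" if "h \<in> pkeys (lk l k)" for h
        using cword(3)[of k h] that k \<open>l \<in> _\<close> unfolding C by (intro fcar_wd) blast
      then show "lext pm_scale (\<lambda>h. wd (cword k h)) (lk l k) \<in> fcar KHS"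
        unfolding lext_def by (intro pmap.subspace_sum[OF fcar_subspace] pmap.subspace_scale[OF fcar_subspace])
    qed
  qed
  then show "carrier (laurent_alg M N) \<subseteq> lam ` fcar KHS" by (auto intro!: image_eqI[where x = "lift _"])
qed

theorem cartan_iso:
  "\<exists>f \<in> algebra_iso (Uq_0 M N q) (laurent_alg M N).
     (\<forall>i\<in>nodes M N. \<forall>s. s \<noteq> 0 \<longrightarrow> f (Uq_gen M N q (HG i s)) = laurent_h i s) \<and>
     (\<forall>i\<in>nodes M N. \<forall>e. f (Uq_gen M N q (KG e i)) = laurent_K e i)"
proof -
  note Bs = U.generated_simps[OF gens_sub(2), folded Uq_0_eq]
  have eqiff: "U.cls p = U.cls p' \<longleftrightarrow> lam p = lam p'" if "p \<in> fcar KHS" "p' \<in> fcar KHS" for p p'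
    using lam_I[of "p - p'"] that by (simp add: U.cls_eq lam_simps fcar_intros)
  define f where "f X = lam (SOME p. p \<in> fcar KHS \<and> U.cls p = X)" for X
  have f: "f (U.cls p) = lam p" if p: "p \<in> fcar KHS" for p
  proof -
    have "\<exists>p'. p' \<in> fcar KHS \<and> U.cls p' = U.cls p" using p by blast
    from someI_ex[OF this] show ?thesis unfolding f_def using eqiff[OF _ p] by blast
  qed
  have bij: "bij_betw f (carrier (Uq_0 M N q)) (carrier (laurent_alg M N))"
    unfolding bij_betw_def Bs
  proof
    show "inj_on f (U.cls ` fcar KHS)"
    proof (rule inj_onI)
      fix X Y assume "X \<in> U.cls ` fcar KHS" "Y \<in> U.cls ` fcar KHS" "f X = f Y"
      then obtain p p' where pp: "p \<in> fcar KHS" "p' \<in> fcar KHS" "X = U.cls p" "Y = U.cls p'" "f X = f Y" by blast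
      then have "lam p = lam p'" using f[OF pp(1)] f[OF pp(2)] by (simp only:)
      then show "X = Y" using eqiff[OF pp(1,2)] pp(3,4) by (simp only:)
    qed
    show "f ` U.cls ` fcar KHS = carrier (laurent_alg M N)"
      unfolding lam_carrier[symmetric] image_image by (rule image_cong[OF refl f])
  qed
  have add: "f (x \<oplus>\<^bsub>Uq_0 M N q\<^esub> y) = f x \<oplus>\<^bsub>laurent_alg M N\<^esub> f y"
    and mul: "f (x \<otimes>\<^bsub>Uq_0 M N q\<^esub> y) = f x \<otimes>\<^bsub>laurent_alg M N\<^esub> f y"
    if x: "x \<in> carrier (Uq_0 M N q)" and y: "y \<in> carrier (Uq_0 M N q)" for x y
  proof -
    obtain p where p: "p \<in> fcar KHS" "x = U.cls p" using x unfolding Bs by (rule imageE)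
    obtain r where r: "r \<in> fcar KHS" "y = U.cls r" using y unfolding Bs by (rule imageE)
    have "f (U.cls p \<oplus>\<^bsub>Uq_0 M N q\<^esub> U.cls r) = lam (p + r)"
      using f[OF pmap.subspace_add[OF fcar_subspace p(1) r(1)]] by (simp only: Bs(6) U.add_Q)
    then show "f (x \<oplus>\<^bsub>Uq_0 M N q\<^esub> y) = f x \<oplus>\<^bsub>laurent_alg M N\<^esub> f y"
      by (simp only: p(2) r(2) f[OF p(1)] f[OF r(1)] laurent_alg_simps lam_simps(1))
    have "f (U.cls p \<otimes>\<^bsub>Uq_0 M N q\<^esub> U.cls r) = lam (p * r)"
      using f[OF fcar_mult[OF p(1) r(1)]]
      by (simp only: Bs(3) U.mult_pres[OF subsetD[OF fcar_sub(2) p(1)] subsetD[OF fcar_sub(2) r(1)]])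
    then show "f (x \<otimes>\<^bsub>Uq_0 M N q\<^esub> y) = f x \<otimes>\<^bsub>laurent_alg M N\<^esub> f y"
      by (simp only: p(2) r(2) f[OF p(1)] f[OF r(1)] laurent_alg_simps lam_simps(5))
  qed
  have scal: "f (c \<odot>\<^bsub>Uq_0 M N q\<^esub> x) = c \<odot>\<^bsub>laurent_alg M N\<^esub> f x" if x: "x \<in> carrier (Uq_0 M N q)" for c x
  proof -
    obtain p where p: "p \<in> fcar KHS" "x = U.cls p" using x unfolding Bs by (rule imageE)
    from f[OF pmap.subspace_scale[OF fcar_subspace p(1)], of c] show ?thesis
      by (simp only: p(2) f[OF p(1)] Bs(7) U.smult_Q lam_simps(4) laurent_alg_simps)
  qed
  have one: "f \<one>\<^bsub>Uq_0 M N q\<^esub> = \<one>\<^bsub>laurent_alg M N\<^esub>"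
    using f[OF fcar_one] by (simp only: Bs(4) U.one_pres laurent_alg_simps lam_one)
  have "f \<in> algebra_iso (Uq_0 M N q) (laurent_alg M N)"
    unfolding algebra_iso_def linear_iso_def ring_iso_def ring_hom_def
    using bij bij_betwE[OF bij] add mul scal one by (simp add: Pi_def)
  moreover have "f (U.cls (gen g)) = llet g" if "g \<in> KHS" for g
    using that by (simp add: f fcar_gen)
  ultimately show ?thesis unfolding Uq_eq by (intro bexI[of _ f]) auto
qed

end

subsection \<open>Moving the Cartan part to the middle\<close>

text \<open>Here the coefficient enters through an additive map instead of by scaling, as needed for
  \<open>Theta\<close> and \<open>to_tensor\<close>.\<close>

definition aext :: "('k \<Rightarrow> 'c::zero \<Rightarrow> 'b::comm_monoid_add) \<Rightarrow> ('k \<Rightarrow>\<^sub>0 'c) \<Rightarrow> 'b"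
  where "aext f p = (\<Sum>k\<in>pkeys p. f k (lk p k))"

lemma aext_zero [simp]: "aext f 0 = 0"
  by (simp add: aext_def)

lemma aext_single: "f k 0 = 0 \<Longrightarrow> aext f (sgl k c) = f k c"
  by (cases "c = 0") (simp_all add: aext_def)

lemma aext_add:
  fixes p r :: "'k \<Rightarrow>\<^sub>0 'c::comm_monoid_add"
  assumes f: "\<And>k a b. f k (a + b) = f k a + f k b" "\<And>k. f k 0 = 0"
  shows "aext f (p + r) = aext f p + aext f r"
proof -
  have sup: "aext f p = (\<Sum>k\<in>A. f k (lk p k))" if "finite A" "pkeys p \<subseteq> A" for p :: "'k \<Rightarrow>\<^sub>0 'c" and A
    unfolding aext_def using that by (intro sum.mono_neutral_left) (auto simp: in_keys_iff f)
  have "aext f (p + r) = (\<Sum>k\<in>pkeys p \<union> pkeys r. f k (lk (p + r) k))"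
    using Poly_Mapping.keys_add[of p r] by (intro sup) auto
  also have "\<dots> = (\<Sum>k\<in>pkeys p \<union> pkeys r. f k (lk p k)) + (\<Sum>k\<in>pkeys p \<union> pkeys r. f k (lk r k))"
    by (simp add: lookup_add f sum.distrib)
  also have "\<dots> = aext f p + aext f r" by (simp add: sup[of "pkeys p \<union> pkeys r"])
  finally show ?thesis .
qed

lemma lift_one: "lift 1 = 1"
proof -
  have "cword 0 0 = []" using cword(3)[of 0 0] by simp
  then show ?thesis using lift_monom[of 0 0 1] by simp
qed

lemma ecal_eval_commute:
  assumes "\<And>g. T * lt g = lt g * T"
  shows "T * eval escale lt p = eval escale lt p * T"
proof (induction p rule: falg_induct)
  case (wd xs c)
  have "T * prod_list (map lt xs) = prod_list (map lt xs) * T"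
  proof (induction xs)
    case (Cons g xs)
    have "T * (lt g * prod_list (map lt xs)) = lt g * (T * prod_list (map lt xs))"
      by (simp only: mult.assoc[symmetric] assms)
    then show ?case using Cons by (simp add: mult.assoc)
  qed simp
  then show ?case
    by (simp add: pm_scale_pscale[symmetric] ecal.eval_scale ecal.scale_mult_left ecal.scale_mult_right)
qed (simp_all add: ecal.eval_add distrib_left distrib_right)

text \<open>\<open>wp\<close> and \<open>wm\<close> are the parts of the adjoint weight
  \<open>sgnv\<close> on positive and on negative letters; \<open>wr\<close> is the negative of
  \<open>wp\<close> and serves to undo it.\<close>

definition wr :: "sign \<Rightarrow> int" where "wr e = (if e = Plus then - 1 else 0)"
definition wp :: "sign \<Rightarrow> int" where "wp e = (if e = Plus then 1 else 0)"
definition wm :: "sign \<Rightarrow> int" where "wm e = (if e = Plus then 0 else - 1)"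

context sl_params
begin

primrec olet :: "(sign \<Rightarrow> int) \<Rightarrow> lgen \<Rightarrow> lend"
  where "olet c (XG e i n) = 0" | "olet c (KG e i) = Kop c e i" | "olet c (HG i s) = Hop c i s"

lemma olet_commute: "olet c g * olet c' h = olet c' h * olet c g"
proof (cases g)
  case g: (KG e i)
  show ?thesis by (cases h) (simp_all only: g olet.simps mult_zero_left mult_zero_right cartan_ops_commute(2), rule cartan_ops_commute(3))
next
  case g: (HG i s)
  show ?thesis by (cases h) (simp_all only: g olet.simps mult_zero_left mult_zero_right cartan_ops_commute(2), rule cartan_ops_commute(1))
qed simp

lemma olet_words:
  assumes "\<forall>g\<in>set v. is_cartan g" "\<forall>g\<in>set w. is_cartan g" "kexps v = kexps w" "hexps v = hexps w"
  shows "prod_list (map (olet c) v) = prod_list (map (olet c) w)"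
proof (rule cartan_words_congruent[where rel = "\<lambda>v w. prod_list (map (olet c) v) = prod_list (map (olet c) w)"
      and S = "{g. is_cartan g}"])
  show "prod_list (map (olet c) (g # h # w)) = prod_list (map (olet c) (h # g # w))" for g h w
    by (simp only: list.map prod_list.Cons mult.assoc[symmetric] olet_commute[of c g c h])
  show "prod_list (map (olet c) (KG Plus i # KG Minus i # w)) = prod_list (map (olet c) w)" for i w
  proof -
    have "Kop c Plus i * Kop c Minus i = 1" by (rule Kop_inverse) simp
    then show ?thesis by (simp only: list.map prod_list.Cons mult.assoc[symmetric] olet.simps mult_1_left)
  qed
qed (use assms in auto)

text \<open>A Laurent polynomial turned into an operator whose weight on positive letters is
  reversed.\<close>

definition ev :: "laurent \<Rightarrow> lend"
  where "ev l = eval escale (olet wr) (lift l)"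

lemma ev_simps: "ev 0 = 0" "ev 1 = 1" "ev (l + l') = ev l + ev l'" "ev (lscale c l) = escale c (ev l)"
  by (simp_all add: ev_def lift_add lift_scale lift_one ecal.eval_add ecal.eval_scale)

lemma cword_cartan: "\<forall>g\<in>set (cword k h). is_cartan g"
  using cword(3)[of k h] by fastforce

text \<open>By \<open>olet_words\<close> the operator of a monomial does not depend on the word
  chosen by \<open>lift\<close>, which gives multiplicativity.\<close>

lemma ev_mult:
  assumes "is_cartan g"
  shows "ev (llet g * l) = olet wr g * ev l"
proof (induction l rule: laurent_induct)
  case (monom k h c)
  have m: "llet g * sgl k (sgl h c) = sgl (kexp g + k) (sgl (hexp g + h) c)"
    using assms by (cases g) (simp_all add: laurent_K_def laurent_h_def mult_single)
  have "prod_list (map (olet wr) (cword (kexp g + k) (hexp g + h))) = prod_list (map (olet wr) (g # cword k h))"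
    by (rule olet_words) (use assms cword_cartan in \<open>simp_all add: cword\<close>)
  then show ?case by (simp add: ev_def m lift_monom ecal.eval_scale ecal.scale_mult_right)
qed (simp_all add: ev_simps distrib_left)

text \<open>In \<open>vmod\<close> the coefficient stands to the right of the whole word. Acting
  through \<open>ev\<close> moves it back across the positive letters, to its place between the
  negative and the positive part.\<close>

definition Theta :: "vmod \<Rightarrow> vmod"
  where "Theta v = aext (\<lambda>w l. app (ev l) (sgl w 1)) v"

lemma Theta_zero: "Theta 0 = 0"
  by (simp add: Theta_def)

lemma Theta_add: "Theta (u + v) = Theta u + Theta v"
  unfolding Theta_def by (rule aext_add) (simp_all add: ev_simps app_simps)

lemma Theta_monom: "Theta (pscale l (wd xs)) = app (ev l) (wd xs)"
  unfolding Theta_def wd_def pscale_single mult_1_right by (rule aext_single) (simp add: ev_simps app_simps)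

lemma Theta_wd: "Theta (wd xs) = wd xs"
  using Theta_monom[of 1 xs] by (simp add: ev_simps app_simps)

lemma emb_zero: "emb 0 = 0"
  by (simp add: emb_def)

lemma Theta_emb: "Theta (pscale l (emb p)) = app (ev l) (emb p)"
proof (induction p rule: falg_induct)
  case (wd xs c)
  have "emb (pscale c (wd xs)) = vscale c (wd xs)" by (simp add: pm_scale_pscale[symmetric] emb_simps)
  moreover have "pscale l (vscale c (wd xs)) = pscale (lscale c l) (wd xs)"
    by (simp add: vscale_def lscale_def mult.commute)
  ultimately show ?case by (simp add: Theta_monom ev_simps app_simps)
qed (simp_all add: emb_simps emb_zero Theta_zero Theta_add pmod.scale_right_distrib app_simps)

lemma olet_Wst: "olet c g \<in> Wst"
  by (cases g) (simp_all add: Wst_Hop Wst_Kop ecal.subspace_0[OF Wst_subspace])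

lemma ev_Wst: "ev l \<in> Wst"
proof -
  have "eval escale (olet wr) p \<in> Wst" for p
  proof (induction p rule: falg_induct)
    case (wd xs c)
    have "prod_list (map (olet wr) xs) \<in> Wst"
      by (induction xs) (simp_all add: Wst_one Wst_mult olet_Wst)
    then show ?case by (simp add: pm_scale_pscale[symmetric] ecal.eval_scale ecal.subspace_scale[OF Wst_subspace])
  qed (simp_all add: ecal.eval_add ecal.subspace_0[OF Wst_subspace] ecal.subspace_add[OF Wst_subspace])
  then show ?thesis by (simp add: ev_def)
qed

lemma Theta_W: "z \<in> W \<Longrightarrow> Theta z \<in> W"
proof (induction rule: W.induct)
  case (W_base R e l u v)
  have eq: "wd u * emb R * wd v = emb (wd u * R * wd v)" by (simp add: emb_simps)
  have "emb (wd u * R * wd v) \<in> W"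
    unfolding eq[symmetric] by (rule W_mult_right[OF W_mult_left[OF W_rel[OF W_base]]])
  then show ?case using ev_Wst[of l] unfolding eq Theta_emb Wst_def by blast
qed (simp_all add: Theta_zero Theta_add W_zero W_add)

lemma Theta_llet: "is_cartan g \<Longrightarrow> Theta (pscale (llet g) v) = app (olet wr g) (Theta v)"
proof (induction v rule: falg_induct)
  case (wd xs c)
  then show ?case by (simp add: Theta_monom ev_mult app_ring)
qed (simp_all add: Theta_zero Theta_add pmod.scale_right_distrib app_add)

text \<open>Images of words must have complex coefficients, so that \<open>Theta\<close> sees no
  coefficient other than the one already present.\<close>

lemma Theta_commute:
  assumes "\<And>g. T * olet wr g = olet wr g * T" "\<And>xs. \<exists>p. app T (wd xs) = emb p"
  shows "Theta (app T v) = app T (Theta v)"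
proof (induction v rule: falg_induct)
  case (wd xs c)
  obtain p where p: "app T (wd xs) = emb p" using assms(2) by blast
  have "T * ev c = ev c * T" unfolding ev_def by (rule ecal_eval_commute[OF assms(1)])
  from arg_cong[OF this, of "\<lambda>S. app S (wd xs)"]
  have "app T (app (ev c) (wd xs)) = app (ev c) (app T (wd xs))" by (simp only: app_ring)
  then show ?case by (simp only: app_pscale p Theta_emb Theta_monom)
qed (simp_all add: Theta_zero Theta_add app_add)

lemma olet_commute_with:
  assumes "\<And>j s. T * Der c j s = Der c j s * T" "\<And>d j. T * Sig c d j = Sig c d j * T"
  shows "T * olet c g = olet c g * T"
proof (cases g)
  case (KG d j)
  have "T * (smul l * Sig c d j) = smul l * Sig c d j * T" for l
  proof -
    have "T * (smul l * Sig c d j) = smul l * (T * Sig c d j)"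
      by (simp only: mult.assoc[symmetric] smul_central[of l T])
    then show ?thesis by (simp only: assms(2) mult.assoc)
  qed
  then show ?thesis by (simp only: KG olet.simps Kop_def)
next
  case (HG j s)
  then show ?thesis by (simp only: olet.simps Hop_def distrib_left distrib_right assms(1) smul_central[of _ T])
qed simp

lemma Der_emb: "\<exists>p. app (Der c j s) (wd xs) = emb p"
proof (induction xs)
  case Nil
  then show ?case by (intro exI[of _ 0]) (simp add: emb_zero)
next
  case (Cons g xs)
  then obtain p where p: "app (Der c j s) (wd xs) = emb p" by blast
  have "\<exists>p. derl c j s g = emb p"
  proof (cases g)
    case (XG e i n)
    then show ?thesis by (intro exI[of _ "(of_int (c e) * hcoef j i s) \<star> wd [XG e i (n + s)]"]) (simp add: emb_simps)
  qed (intro exI[of _ 0]; simp add: emb_zero)+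
  then obtain p' where p': "derl c j s g = emb p'" by blast
  show ?case unfolding wd_Cons[of g xs] Der_mult Der_gen p p'
    by (intro exI[of _ "p' * wd xs + wd [g] * p"]) (simp add: emb_simps)
qed

lemma Sig_emb: "\<exists>p. app (Sig c d j) (wd xs) = emb p"
  unfolding Sig_wd by (intro exI[of _ "sigw c d j xs \<star> wd xs"]) (simp add: emb_simps)

lemma Der_weight: "Der c j s + Der c' j s = Der (\<lambda>e. c e + c' e) j s"
proof (rule lend_eqI)
  fix xs
  show "app (Der c j s + Der c' j s) (wd xs) = app (Der (\<lambda>e. c e + c' e) j s) (wd xs)"
  proof (induction xs)
    case (Cons g xs)
    have l: "derl (\<lambda>e. c e + c' e) j s g = derl c j s g + derl c' j s g"
      by (cases g) (simp_all add: distrib_right vcal.scale_left_distrib)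
    have IH: "app (Der (\<lambda>e. c e + c' e) j s) (wd xs) = app (Der c j s) (wd xs) + app (Der c' j s) (wd xs)"
      using Cons by (simp add: app_ring)
    show ?case unfolding wd_Cons[of g xs] app_ring Der_mult Der_gen IH l by (simp add: algebra_simps)
  qed (simp add: app_ring)
qed

lemma Der_zero: "Der (\<lambda>e. 0) j s = 0"
proof (rule lend_eqI)
  fix xs
  show "app (Der (\<lambda>e. 0) j s) (wd xs) = app 0 (wd xs)"
  proof (induction xs)
    case (Cons g xs)
    have "derl (\<lambda>e. 0) j s g = 0" by (cases g) simp_all
    then show ?case using Cons unfolding wd_Cons[of g xs] app_ring Der_mult Der_gen by simp
  qed (simp add: app_ring)
qed

lemma Sig_weight: "Sig c d j * Sig c' d j = Sig (\<lambda>e. c e + c' e) d j"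
proof (rule lend_eqI)
  fix xs
  have "sigl (\<lambda>e. c e + c' e) j g = sigl c j g + sigl c' j g" for g
    by (cases g) (simp_all add: distrib_right)
  then have "sum_list (map (sigl (\<lambda>e. c e + c' e) j) xs) = sum_list (map (sigl c j) xs) + sum_list (map (sigl c' j) xs)"
    by (induction xs) simp_all
  then have "sigw (\<lambda>e. c e + c' e) d j xs = sigw c d j xs * sigw c' d j xs"
    using q0 by (simp add: sigw_def distrib_left power_int_add)
  then show "app (Sig c d j * Sig c' d j) (wd xs) = app (Sig (\<lambda>e. c e + c' e) d j) (wd xs)"
    by (simp add: app_simps Sig_wd mult.commute)
qed

lemma Sig_zero: "Sig (\<lambda>e. 0) d j = 1"
proof (rule lend_eqI)
  fix xs
  have "sum_list (map (sigl (\<lambda>e. 0) j) xs) = 0"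
  proof (induction xs)
    case (Cons g xs)
    then show ?case by (cases g) simp_all
  qed simp
  then show "app (Sig (\<lambda>e. 0) d j) (wd xs) = app 1 (wd xs)" by (simp add: app_simps Sig_wd sigw_def)
qed

lemma weights: "(\<lambda>e. wr e + wp e) = (\<lambda>e. 0)" "(\<lambda>e. wp e + wm e) = sgnv"
proof -
  show "(\<lambda>e. wr e + wp e) = (\<lambda>e. 0)" by (rule ext) (simp add: wr_def wp_def)
  have "wp e + wm e = sgnv e" for e by (cases e) (simp_all add: wp_def wm_def)
  then show "(\<lambda>e. wp e + wm e) = sgnv" by (rule ext)
qed

text \<open>The weight \<open>wr\<close> used by \<open>Theta\<close> and the weight
  \<open>wp\<close> of the operator cancel, leaving plain multiplication.\<close>

lemma Theta_op: "is_cartan g \<Longrightarrow> Theta (app (olet wp g) v) = pscale (llet g) (Theta v)"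
proof (cases g)
  case (HG j s)
  have "Der wr j s + Der wp j s = 0" by (simp only: Der_weight weights Der_zero)
  from arg_cong[OF this, of "\<lambda>T. app T (Theta v)"]
  have D: "app (Der wr j s) (Theta v) + app (Der wp j s) (Theta v) = 0" by (simp add: app_ring)
  have "Theta (app (Der wp j s) v) = app (Der wp j s) (Theta v)"
    by (rule Theta_commute[OF olet_commute_with[OF Der_commute Der_Sig_commute] Der_emb])
  moreover have "Theta (pscale (llet g) v) = app (Hop wr j s) (Theta v)"
    using Theta_llet[of g v] HG by simp
  moreover have "app (olet wp g) v = pscale (llet g) v + app (Der wp j s) v"
    by (simp add: HG Hop_def app_ring app_smul)
  ultimately have "Theta (app (olet wp g) v) = app (Hop wr j s) (Theta v) + app (Der wp j s) (Theta v)"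
    by (simp add: Theta_add)
  also have "\<dots> = pscale (llet g) (Theta v) + (app (Der wr j s) (Theta v) + app (Der wp j s) (Theta v))"
    by (simp add: HG Hop_def app_ring app_smul add.assoc)
  finally show ?thesis by (simp add: D)
next
  case (KG d j)
  have S: "Sig wr d j * Sig wp d j = 1" by (simp only: Sig_weight weights Sig_zero)
  from arg_cong[OF this, of "\<lambda>T. app T (Theta v)"]
  have S: "app (Sig wr d j) (app (Sig wp d j) (Theta v)) = Theta v" by (simp add: app_ring)
  have "app (olet wp g) v = pscale (llet g) (app (Sig wp d j) v)"
    by (simp add: KG Kop_def app_ring app_smul)
  then have "Theta (app (olet wp g) v) = app (olet wr g) (Theta (app (Sig wp d j) v))"
    using Theta_llet[of g "app (Sig wp d j) v"] KG by simp
  also have "Theta (app (Sig wp d j) v) = app (Sig wp d j) (Theta v)"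
    by (rule Theta_commute[OF olet_commute_with[OF Der_Sig_commute[symmetric] Sig_commute] Sig_emb])
  also have "app (olet wr g) (app (Sig wp d j) (Theta v)) = pscale (llet g) (Theta v)"
    by (simp add: KG Kop_def app_ring app_smul S)
  finally show ?thesis .
qed simp

lemma weight_kill:
  assumes "set xs \<subseteq> XE e" "c e = 0"
  shows "app (Der c j s) (wd xs) = 0" "app (Sig c d j) (wd xs) = wd xs"
proof -
  show "app (Der c j s) (wd xs) = 0"
    using assms(1)
  proof (induction xs)
    case (Cons g xs)
    then have "derl c j s g = 0" using assms(2) by auto
    then show ?case using Cons unfolding wd_Cons[of g xs] Der_mult Der_gen by simp
  qed simp
  have "sum_list (map (sigl c j) xs) = 0"
    using assms(1)
  proof (induction xs)
    case (Cons g xs)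
    then have "sigl c j g = 0" using assms(2) by auto
    then show ?case using Cons by simp
  qed simp
  then show "app (Sig c d j) (wd xs) = wd xs" by (simp add: Sig_wd sigw_def)
qed

text \<open>The part of the adjoint action with weight \<open>wm\<close> is trivial on positive
  words and commutes with all Cartan operators, so it drops out.\<close>

lemma act_cartan_plus:
  assumes "set ys \<subseteq> KHS" "set zs \<subseteq> XE Plus"
  shows "app (act (wd ys)) (wd zs) = app (eval escale (olet wp) (wd ys)) (wd zs)"
  using assms(1)
proof (induction ys)
  case (Cons y ys)
  define E where "E = eval escale (olet wp) (wd ys)"
  define v where "v = app E (wd zs)"
  have IH: "app (act (wd ys)) (wd zs) = v" using Cons by (simp add: v_def E_def)
  have wm: "wm Plus = 0" by (simp add: wm_def)
  have com: "app T v = app E (app T (wd zs))" if "\<And>g. T * olet wp g = olet wp g * T" for T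
  proof -
    have "T * E = E * T" unfolding E_def by (rule ecal_eval_commute[OF that])
    from arg_cong[OF this, of "\<lambda>S. app S (wd zs)"] show ?thesis by (simp only: app_ring v_def)
  qed
  have D: "app (Der wm j s) v = 0" for j s
    using com[OF olet_commute_with[OF Der_commute Der_Sig_commute], of wm j s]
    by (simp only: weight_kill(1)[OF assms(2), of wm, OF wm] app_zero)
  have S: "app (Sig wm d j) v = v" for d j
    using com[OF olet_commute_with[OF Der_Sig_commute[symmetric] Sig_commute], of wm d j]
    by (simp only: weight_kill(2)[OF assms(2), of wm, OF wm] v_def)
  have "app (alet y) v = app (olet wp y) v"
  proof (cases y)
    case (KG d j)
    have "Kop sgnv d j = smul (laurent_K d j) * (Sig wp d j * Sig wm d j)"
      by (simp only: Kop_def Sig_weight weights)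
    then show ?thesis by (simp add: KG app_ring S Kop_def)
  next
    case (HG j s)
    have "Hop sgnv j s = smul (laurent_h j s) + (Der wp j s + Der wm j s)"
      by (simp only: Hop_def Der_weight weights)
    then show ?thesis by (simp add: HG app_ring D Hop_def)
  qed (use Cons.prems in auto)
  moreover have "app (act (wd (y # ys))) (wd zs) = app (alet y) v"
    unfolding IH[symmetric] by (simp add: act_def app_ring)
  ultimately show ?case by (simp add: v_def E_def app_ring)
qed simp

lemma act_minus_word: "set xs \<subseteq> XE Minus \<Longrightarrow> app (act (wd xs)) v = wd xs * v"
proof (induction xs)
  case (Cons g xs)
  then obtain i n where g: "g = XG Minus i n" by auto
  have "act (wd (g # xs)) = lmul (wd [g]) * act (wd xs)" by (simp add: act_def g Ym_def)
  then show ?case using Cons by (simp add: app_ring app_lmul wd_Cons[of g xs] mult.assoc)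
qed (simp add: app_ring)

text \<open>\<open>wp\<close> is zero on negative letters, so these operators commute with
  multiplication by negative words.\<close>

lemma cartan_minus:
  assumes "set xs \<subseteq> XE Minus"
  shows "app (eval escale (olet wp) p) (wd xs * v) = wd xs * app (eval escale (olet wp) p) v"
proof -
  have w: "wp Minus = 0" by (simp add: wp_def)
  have z: "lmul 0 = 0" by (rule lend_eqI) (simp add: app_lmul app_ring)
  have "lmul (wd xs) * olet wp g = olet wp g * lmul (wd xs)" for g
    by (cases g) (simp_all add: Hop_lmul Kop_lmul weight_kill[OF assms, of wp, OF w] z)
  from ecal_eval_commute[OF this, where p = p] have "app (lmul (wd xs) * eval escale (olet wp) p) v = app (eval escale (olet wp) p * lmul (wd xs)) v"
    by (rule arg_cong)
  then show ?thesis by (simp only: app_ring app_lmul)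
qed

text \<open>The bridge to the triangular decomposition: for a normally ordered word the Cartan part
  comes out as a coefficient and the two outer parts stay intact.\<close>

lemma Theta_normal:
  assumes "set xs \<subseteq> XE Minus" "set ys \<subseteq> KHS" "set zs \<subseteq> XE Plus"
  shows "Theta (app (act (wd (xs @ ys @ zs))) 1) = pscale (lam (wd ys)) (wd (xs @ zs))"
proof -
  have "app (act (wd zs)) 1 = wd zs"
    using act_plus_word[OF assms(3), of "[]"] by (simp add: is_minus_def)
  moreover have "act (wd (xs @ ys @ zs)) = act (wd xs) * (act (wd ys) * act (wd zs))"
    by (simp only: wd_append act_simps)
  ultimately have "app (act (wd (xs @ ys @ zs))) 1 = app (eval escale (olet wp) (wd ys)) (wd (xs @ zs))"
    by (simp only: app_ring act_cartan_plus[OF assms(2,3)] act_minus_word[OF assms(1)] cartan_minus[OF assms(1)] wd_append)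
  moreover have "Theta (app (eval escale (olet wp) (wd ys)) (wd (xs @ zs))) = pscale (lam (wd ys)) (wd (xs @ zs))"
    using assms(2)
  proof (induction ys)
    case (Cons y ys)
    then have "is_cartan y" using KHS_cartan by simp
    then show ?case using Cons by (simp add: app_ring Theta_op lam_def)
  qed (simp add: app_ring Theta_wd)
  ultimately show ?thesis by (simp only:)
qed

end

subsection \<open>Straightening\<close>

lemma gen_mult_wd: "gen g * wd w = wd (g # w)"
  by (simp add: gen_wd wd_append[symmetric])

context sl_params
begin

text \<open>One shape for all Cartan letters: \<open>a = 1\<close> for \<open>HG\<close>,
  \<open>b = 0\<close> for \<open>KG\<close>. Since \<open>a\<close> is nonzero, the rule can be
  used to move the letters past each other in either direction.\<close>

lemma cartan_current:
  assumes "g \<in> KHS" "j \<in> nodes M N"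
  shows "\<exists>a b n'. a \<noteq> 0 \<and> gen g * Xg e j n - a \<star> (Xg e j n * gen g) - b \<star> Xg e j n' \<in> U.I"
proof (cases g)
  case (XG e' i n')
  then show ?thesis using assms by auto
next
  case (HG i s)
  then have i: "i \<in> nodes M N" "s \<noteq> 0" using assms by auto
  from rel_I(6)[OF i(1) assms(2) i(2), of e n] show ?thesis
    unfolding HG by (intro exI[of _ 1] exI conjI) (simp, simp add: sbr_gen)
next
  case (KG d i)
  then have i: "i \<in> nodes M N" using assms by auto
  let ?K = "Kg Plus i" and ?K' = "Kg Minus i" and ?X = "Xg e j n"
  define c where "c = q powi (sgnv e * cartan M N i j)"
  have c0: "c \<noteq> 0" using q0 by (simp add: c_def)
  have car: "?K \<in> fcar (gens M N)" "?K' \<in> fcar (gens M N)" "?X \<in> fcar (gens M N)"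
    using gen_fcar(1)[OF assms(2)] gen_fcar(2)[OF i] by simp_all
  have inv: "?K * ?K' - 1 \<in> U.I" "?K' * ?K - 1 \<in> U.I" by (rule rel_I(1)[OF i]; simp)+
  have r: "?K * ?X * ?K' - c \<star> ?X \<in> U.I" unfolding c_def by (rule rel_I(5)[OF i assms(2)])
  have "(?K * ?X * ?K' - c \<star> ?X) * ?K - (?K * ?X) * (?K' * ?K - 1) \<in> U.I"
    by (rule pmap.subspace_diff[OF U.I_subspace U.I_right[OF r car(1)] U.I_left[OF inv(2) fcar_mult[OF car(1,3)]]])
  also have "(?K * ?X * ?K' - c \<star> ?X) * ?K - (?K * ?X) * (?K' * ?K - 1) = ?K * ?X - c \<star> (?X * ?K)"
    by (simp add: left_diff_distrib right_diff_distrib mult.assoc falg.scale_mult_left)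
  finally have P: "?K * ?X - c \<star> (?X * ?K) \<in> U.I" .
  show ?thesis
  proof (cases d)
    case Plus
    show ?thesis unfolding KG Plus using P c0 by (intro exI[of _ c] exI[of _ 0]) simp
  next
    case Minus
    \<comment> \<open>The rule for the inverse generator comes from \<open>P\<close> by multiplying
      with that inverse on both sides.\<close>
    have "(- 1 / c) \<star> (?K' * (?K * ?X - c \<star> (?X * ?K)) * ?K' - (?K' * ?K - 1) * (?X * ?K') + c \<star> ((?K' * ?X) * (?K * ?K' - 1))) \<in> U.I"
      by (rule pmap.subspace_scale[OF U.I_subspace U.I.add[OF pmap.subspace_diff[OF U.I_subspace
            U.I_right[OF U.I_left[OF P car(2)] car(2)] U.I_right[OF inv(2) fcar_mult[OF car(3,2)]]]
            pmap.subspace_scale[OF U.I_subspace U.I_left[OF inv(1) fcar_mult[OF car(2,3)]]]]])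
    also have "?K' * (?K * ?X - c \<star> (?X * ?K)) * ?K' - (?K' * ?K - 1) * (?X * ?K') + c \<star> ((?K' * ?X) * (?K * ?K' - 1))
      = ?X * ?K' - c \<star> (?K' * ?X)"
      by (simp add: left_diff_distrib right_diff_distrib mult.assoc falg.scale_mult_left falg.scale_mult_right
          pmap.scale_right_diff_distrib)
    also have "(- 1 / c) \<star> (?X * ?K' - c \<star> (?K' * ?X)) = ?K' * ?X - (1 / c) \<star> (?X * ?K')"
      using c0 by (simp add: pmap.scale_right_diff_distrib)
    finally show ?thesis unfolding KG Minus using c0 by (intro exI[of _ "1 / c"] exI[of _ 0]) simp
  qed
qed

lemma current_current:
  assumes "i \<in> nodes M N" "j \<in> nodes M N"
  shows "\<exists>s G. Xg Plus i m * Xg Minus j n - s \<star> (Xg Minus j n * Xg Plus i m) - G \<in> U.I \<and> G \<in> fcar KHS \<and> (i \<noteq> j \<longrightarrow> G = 0)"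
proof -
  let ?G = "if i = j then (1 / (qi M q i - inverse (qi M q i))) \<star> (phi M q Plus i (m + n) - phi M q Minus i (m + n)) else 0"
  have "?G \<in> fcar KHS"
    using phi_fcar(1)[OF assms(1)] by (auto intro!: fcar_intros)
  then show ?thesis using rel_I(7)[OF assms, of m n] unfolding sbr_gen
    by (intro exI conjI) (assumption, assumption, simp)
qed

text \<open>The total parity is fixed throughout, so that straightening gives surjectivity on each
  parity component.\<close>

inductive is_NS :: "bit \<Rightarrow> lgen falg \<Rightarrow> bool" for d
  where "p \<in> U.I \<Longrightarrow> is_NS d p"
  | "set xs \<subseteq> XE Minus \<Longrightarrow> set ys \<subseteq> KHS \<Longrightarrow> set zs \<subseteq> XE Plus \<Longrightarrow>
      sum_list (map (gpar M) (xs @ ys @ zs)) = d \<Longrightarrow> is_NS d (c \<star> wd (xs @ ys @ zs))"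
  | "is_NS d p \<Longrightarrow> is_NS d r \<Longrightarrow> is_NS d (p + r)"

definition NS :: "bit \<Rightarrow> lgen falg set"
  where "NS d = {p. is_NS d p}"

lemma NSI_I: "p \<in> U.I \<Longrightarrow> p \<in> NS d"
  and NSI_wd: "set xs \<subseteq> XE Minus \<Longrightarrow> set ys \<subseteq> KHS \<Longrightarrow> set zs \<subseteq> XE Plus \<Longrightarrow>
      sum_list (map (gpar M) (xs @ ys @ zs)) = d \<Longrightarrow> c \<star> wd (xs @ ys @ zs) \<in> NS d"
  and NSI_add: "p \<in> NS d \<Longrightarrow> r \<in> NS d \<Longrightarrow> p + r \<in> NS d"
  unfolding NS_def mem_Collect_eq by (rule is_NS.intros; assumption)+

lemma NS_induct [consumes 1, case_names NS_I NS_wd NS_add]: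
  assumes "p \<in> NS d" "\<And>p. p \<in> U.I \<Longrightarrow> P p"
    and "\<And>xs ys zs c. set xs \<subseteq> XE Minus \<Longrightarrow> set ys \<subseteq> KHS \<Longrightarrow> set zs \<subseteq> XE Plus \<Longrightarrow>
      sum_list (map (gpar M) (xs @ ys @ zs)) = d \<Longrightarrow> P (c \<star> wd (xs @ ys @ zs))"
    and "\<And>p r. P p \<Longrightarrow> P r \<Longrightarrow> P (p + r)"
  shows "P p"
proof -
  have "is_NS d p" using assms(1) by (simp only: NS_def mem_Collect_eq)
  then show ?thesis by (induction rule: is_NS.induct) (rule assms(2-4); assumption)+
qed

lemma NS_scale: "p \<in> NS d \<Longrightarrow> c \<star> p \<in> NS d"
proof (induction rule: NS_induct)
  case (NS_I p)
  then show ?case by (intro NSI_I pmap.subspace_scale[OF U.I_subspace])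
next
  case (NS_wd xs ys zs c')
  then show ?case using NSI_wd[OF NS_wd, of "c * c'"] by simp
next
  case (NS_add p r)
  then show ?case unfolding pmap.scale_right_distrib by (intro NSI_add)
qed

lemma NS_wd1: "set xs \<subseteq> XE Minus \<Longrightarrow> set ys \<subseteq> KHS \<Longrightarrow> set zs \<subseteq> XE Plus \<Longrightarrow>
  wd (xs @ ys @ zs) \<in> NS (sum_list (map (gpar M) (xs @ ys @ zs)))"
  using NSI_wd[of xs ys zs _ 1, OF _ _ _ refl] by (simp only: pmap.scale_one)

lemma NS_cong: "p - p' \<in> U.I \<Longrightarrow> p' \<in> NS d \<Longrightarrow> p \<in> NS d"
  using NSI_add[OF NSI_I[of "p - p'"], of p'] by (simp only: diff_add_cancel)

lemma NS_mult:
  assumes a: "a \<in> fcar (gens M N)"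
    and w: "\<And>xs ys zs. set xs \<subseteq> XE Minus \<Longrightarrow> set ys \<subseteq> KHS \<Longrightarrow> set zs \<subseteq> XE Plus \<Longrightarrow>
      a * wd (xs @ ys @ zs) \<in> NS (d' + sum_list (map (gpar M) (xs @ ys @ zs)))"
    and "p \<in> NS d"
  shows "a * p \<in> NS (d' + d)"
  using assms(3)
proof (induction rule: NS_induct)
  case (NS_I p)
  then show ?case by (intro NSI_I U.I_left a)
next
  case (NS_wd xs ys zs c)
  show ?case unfolding falg.scale_mult_right
    using NS_scale[OF w[OF NS_wd(1-3)]] by (simp only: NS_wd(4))
next
  case (NS_add p r)
  then show ?case unfolding distrib_left by (intro NSI_add)
qed

lemma NS_minus:
  assumes "i \<in> nodes M N" "p \<in> NS d"
  shows "Xg Minus i n * p \<in> NS (gpar M (XG Minus i n) + d)"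
proof (rule NS_mult[OF gen_fcar(1)[OF assms(1)] _ assms(2)])
  fix xs ys zs assume "set xs \<subseteq> XE Minus" "set ys \<subseteq> KHS" "set zs \<subseteq> XE Plus"
  moreover have "XG Minus i n \<in> XE Minus" using assms(1) by blast
  ultimately show "Xg Minus i n * wd (xs @ ys @ zs) \<in> NS (gpar M (XG Minus i n) + sum_list (map (gpar M) (xs @ ys @ zs)))"
    using NS_wd1[of "XG Minus i n # xs" ys zs] unfolding gen_mult_wd by simp
qed

text \<open>The Cartan letter travels right through the negative letters into the Cartan block; each
  step leaves besides a shifted negative letter in front of the shorter word.\<close>

lemma NS_cartan_word:
  assumes g: "g \<in> KHS" and "set xs \<subseteq> XE Minus" "set ys \<subseteq> KHS" "set zs \<subseteq> XE Plus"
  shows "gen g * wd (xs @ ys @ zs) \<in> NS (sum_list (map (gpar M) (xs @ ys @ zs)))"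
  using assms(2)
proof (induction xs)
  case Nil
  have "gpar M g = 0" using g by auto
  then show ?case using NS_wd1[of "[]" "g # ys" zs] assms unfolding gen_mult_wd by simp
next
  case (Cons x xs)
  then obtain j n where x: "x = XG Minus j n" and j: "j \<in> nodes M N" by auto
  let ?r = "xs @ ys @ zs"
  let ?d = "sum_list (map (gpar M) ?r)"
  have xs: "set xs \<subseteq> XE Minus" using Cons.prems by simp
  have r: "wd ?r \<in> fcar (gens M N)" "wd ?r \<in> NS ?d"
  proof -
    have "set ?r \<subseteq> gens M N" using xs assms(3,4) gens_sub(1)[of Minus] gens_sub(1)[of Plus] gens_sub(2) unfolding set_append by blast
    then show "wd ?r \<in> fcar (gens M N)" by (rule fcar_wd)
    show "wd ?r \<in> NS ?d" by (rule NS_wd1[OF xs assms(3,4)])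
  qed
  obtain a b n' where "gen g * Xg Minus j n - a \<star> (Xg Minus j n * gen g) - b \<star> Xg Minus j n' \<in> U.I"
    using cartan_current[OF g j, of Minus n] by blast
  from U.I_right[OF this r(1)]
  have 1: "gen g * wd (x # ?r) - (a \<star> (Xg Minus j n * (gen g * wd ?r)) + b \<star> (Xg Minus j n' * wd ?r)) \<in> U.I"
    by (simp add: left_diff_distrib x gen_mult_wd[symmetric] mult.assoc falg.scale_mult_left diff_diff_eq distrib_right)
  have "a \<star> (Xg Minus j n * (gen g * wd ?r)) + b \<star> (Xg Minus j n' * wd ?r) \<in> NS (gpar M (XG Minus j n) + ?d)"
    using NS_minus[OF j Cons.IH[OF xs], of n] NS_minus[OF j r(2), of n'] by (intro NSI_add NS_scale) simp_all
  from NS_cong[OF 1 this] show ?case by (simp add: x)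
qed

lemma NS_cartan:
  assumes "g \<in> KHS" "p \<in> NS d"
  shows "gen g * p \<in> NS d"
proof -
  have "gen g * p \<in> NS (0 + d)"
    by (rule NS_mult[OF fcar_gen[OF subsetD[OF gens_sub(2) assms(1)]] _ assms(2)])
      (simp only: add_0_left, rule NS_cartan_word[OF assms(1)])
  then show ?thesis by (simp only: add_0_left)
qed

lemma NS_fcar:
  assumes "G \<in> fcar KHS" "p \<in> NS d"
  shows "G * p \<in> NS d"
  using assms(1)
proof (induction G rule: fcar_induct)
  case zero
  show ?case using NSI_I[OF U.I.zero] by simp
next
  case (wd xs c)
  have "wd xs * p \<in> NS d" using wd
  proof (induction xs)
    case (Cons g xs)
    then have "gen g * (wd xs * p) \<in> NS d" by (intro NS_cartan) simp_all
    then show ?case by (simp only: mult.assoc[symmetric] gen_mult_wd)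
  qed (use assms(2) in simp)
  then show ?case unfolding falg.scale_mult_left by (rule NS_scale)
next
  case (add p r)
  then show ?case unfolding distrib_right by (intro NSI_add)
qed

text \<open>\<open>cartan_current\<close> is solved for the product with the current first, which
  needs \<open>a\<close> nonzero. The index \<open>n\<close> is generalised because passing an
  \<open>HG\<close> letter shifts it.\<close>

lemma NS_plus_word0:
  assumes i: "i \<in> nodes M N" and "set ys \<subseteq> KHS" and zs: "set zs \<subseteq> XE Plus"
  shows "Xg Plus i n * wd (ys @ zs) \<in> NS (gpar M (XG Plus i n) + sum_list (map (gpar M) (ys @ zs)))"
  using assms(2)
proof (induction ys arbitrary: n)
  case Nil
  have "XG Plus i n \<in> XE Plus" using i by blast
  then show ?case using NS_wd1[of "[]" "[]" "XG Plus i n # zs"] zs unfolding gen_mult_wd by simp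
next
  case (Cons y ys)
  let ?r = "ys @ zs"
  let ?d = "gpar M (XG Plus i n) + sum_list (map (gpar M) ?r)"
  have ys: "set ys \<subseteq> KHS" and y: "y \<in> KHS" using Cons.prems by simp_all
  have IH: "Xg Plus i m * wd ?r \<in> NS ?d" for m using Cons.IH[OF ys, of m] by simp
  have "set ?r \<subseteq> gens M N" using ys zs gens_sub(1)[of Plus] gens_sub(2) unfolding set_append by blast
  then have r: "wd ?r \<in> fcar (gens M N)" by (rule fcar_wd)
  obtain a b n' where a: "a \<noteq> 0" "gen y * Xg Plus i n - a \<star> (Xg Plus i n * gen y) - b \<star> Xg Plus i n' \<in> U.I"
    using cartan_current[OF y i, of Plus n] by blast
  from pmap.subspace_scale[OF U.I_subspace U.I_right[OF a(2) r], of "- 1 / a"]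
  have "Xg Plus i n * wd (y # ?r) - ((1 / a) \<star> (gen y * (Xg Plus i n * wd ?r)) + (- b / a) \<star> (Xg Plus i n' * wd ?r)) \<in> U.I"
    using a(1) by (simp add: left_diff_distrib gen_mult_wd[symmetric] mult.assoc falg.scale_mult_left
        pmap.scale_right_diff_distrib algebra_simps)
  moreover have "(1 / a) \<star> (gen y * (Xg Plus i n * wd ?r)) + (- b / a) \<star> (Xg Plus i n' * wd ?r) \<in> NS ?d"
    by (intro NSI_add NS_scale NS_cartan[OF y] IH)
  ultimately have "Xg Plus i n * wd (y # ?r) \<in> NS ?d" by (rule NS_cong)
  moreover have "gpar M y = 0" using y by auto
  ultimately show ?case by simp
qed

text \<open>Crossing a negative letter also puts a Cartan polynomial \<open>G\<close> in front of
  the shorter word. This happens only for equal nodes, where the parities of the two currents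
  cancel.\<close>

lemma NS_plus:
  assumes i: "i \<in> nodes M N" and "p \<in> NS d"
  shows "Xg Plus i n * p \<in> NS (gpar M (XG Plus i n) + d)"
proof (rule NS_mult[OF gen_fcar(1)[OF i] _ assms(2)])
  fix xs ys zs assume as: "set xs \<subseteq> XE Minus" and ys: "set ys \<subseteq> KHS" and zs: "set zs \<subseteq> XE Plus"
  show "Xg Plus i n * wd (xs @ ys @ zs) \<in> NS (gpar M (XG Plus i n) + sum_list (map (gpar M) (xs @ ys @ zs)))"
    using as
  proof (induction xs)
    case Nil
    show ?case using NS_plus_word0[OF i ys zs] by simp
  next
    case (Cons x xs)
    then obtain j m where x: "x = XG Minus j m" and j: "j \<in> nodes M N" by auto
    let ?r = "xs @ ys @ zs"
    let ?d = "sum_list (map (gpar M) ?r)"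
    let ?t = "gpar M (XG Plus i n) + (gpar M (XG Minus j m) + ?d)"
    have xs: "set xs \<subseteq> XE Minus" using Cons.prems by simp
    have "set ?r \<subseteq> gens M N" using xs ys zs gens_sub(1)[of Minus] gens_sub(1)[of Plus] gens_sub(2) unfolding set_append by blast
    then have r: "wd ?r \<in> fcar (gens M N)" by (rule fcar_wd)
    have rN: "wd ?r \<in> NS ?d" by (rule NS_wd1[OF xs ys zs])
    obtain s G where G: "Xg Plus i n * Xg Minus j m - s \<star> (Xg Minus j m * Xg Plus i n) - G \<in> U.I"
      "G \<in> fcar KHS" "i \<noteq> j \<longrightarrow> G = 0" using current_current[OF i j, of n m] by blast
    from U.I_right[OF G(1) r]
    have 1: "Xg Plus i n * wd (x # ?r) - (s \<star> (Xg Minus j m * (Xg Plus i n * wd ?r)) + G * wd ?r) \<in> U.I"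
      by (simp add: left_diff_distrib x gen_mult_wd[symmetric] mult.assoc falg.scale_mult_left diff_diff_eq distrib_right)
    have "Xg Minus j m * (Xg Plus i n * wd ?r) \<in> NS ?t"
      using NS_minus[OF j Cons.IH[OF xs], of m] by (simp only: add.left_commute)
    moreover have "G * wd ?r \<in> NS ?t"
    proof (cases "i = j")
      case True
      then have "gpar M (XG Plus i n) + gpar M (XG Minus j m) = 0" by simp
      then have "?t = ?d" by (simp only: add.assoc[symmetric] add_0_left)
      then show ?thesis using NS_fcar[OF G(2) rN] by (simp only:)
    next
      case False
      then show ?thesis using G(3) NSI_I[OF U.I.zero] by simp
    qed
    ultimately have "s \<star> (Xg Minus j m * (Xg Plus i n * wd ?r)) + G * wd ?r \<in> NS ?t"
      by (intro NSI_add NS_scale)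
    from NS_cong[OF 1 this] show ?case by (simp add: x)
  qed
qed

lemma NS_all: "set w \<subseteq> gens M N \<Longrightarrow> wd w \<in> NS (sum_list (map (gpar M) w))"
proof (induction w)
  case Nil
  then show ?case using NS_wd1[of "[]" "[]" "[]"] by simp
next
  case (Cons g w)
  then have IH: "wd w \<in> NS (sum_list (map (gpar M) w))" and "g \<in> XE Plus \<union> XE Minus \<union> KHS" unfolding gens_eq by simp_all
  then consider i n where "g = XG Plus i n" "i \<in> nodes M N" | i n where "g = XG Minus i n" "i \<in> nodes M N" | "g \<in> KHS" by blast
  then have "gen g * wd w \<in> NS (gpar M g + sum_list (map (gpar M) w))"
  proof cases
    case 1
    show ?thesis unfolding 1(1) by (rule NS_plus[OF 1(2) IH])
  next
    case 2
    show ?thesis unfolding 2(1) by (rule NS_minus[OF 2(2) IH])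
  next
    case 3
    then have "gpar M g = 0" by auto
    then show ?thesis using NS_cartan[OF 3 IH] by (simp only: add_0_left)
  qed
  then show ?case by (simp only: gen_mult_wd list.map sum_list.Cons)
qed

end

subsection \<open>Tensor products\<close>

locale tens =
  fixes V :: "'a superalg" and W :: "'b superalg"
begin

sublocale lin_quot "tensor_free V W" "pmap.span (tensor_relators V W)"
  by unfold_locales (simp_all add: tensor_free_def free_superspace_def)

lemma tensor_eq: "tensor V W = Q"
  by (simp add: tensor_def)

lemma pure_eq: "pure_tensor V W v w = cls (sgl (v, w) 1)"
  by (simp add: pure_tensor_def cls_def)

lemma carrier_tensor: "carrier Q = cls ` {p. pkeys p \<subseteq> carrier V \<times> carrier W}"
proof -
  have "carrier (tensor_free V W) = {p. pkeys p \<subseteq> carrier V \<times> carrier W}"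
    by (simp add: tensor_free_def free_superspace_def)
  then show ?thesis by (simp only: carrier_Q)
qed

lemma homog_tensor: "homog Q d = cls ` {p. pkeys p \<subseteq> \<Union>{homog V a \<times> homog W b | a b. a + b = d}}"
proof -
  have "homog (tensor_free V W) d = {p. pkeys p \<subseteq> \<Union>{homog V a \<times> homog W b | a b. a + b = d}}"
    unfolding tensor_free_def free_superspace_def superalg.select_convs by (rule refl)
  then show ?thesis by (simp only: homog_Q)
qed

lemma span_relators:
  "v \<in> carrier V \<Longrightarrow> v' \<in> carrier V \<Longrightarrow> w \<in> carrier W \<Longrightarrow>
     sgl (v \<oplus>\<^bsub>V\<^esub> v', w) 1 - sgl (v, w) 1 - sgl (v', w) 1 \<in> pmap.span (tensor_relators V W)"
  "v \<in> carrier V \<Longrightarrow> w \<in> carrier W \<Longrightarrow> w' \<in> carrier W \<Longrightarrow>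
     sgl (v, w \<oplus>\<^bsub>W\<^esub> w') 1 - sgl (v, w) 1 - sgl (v, w') 1 \<in> pmap.span (tensor_relators V W)"
  "v \<in> carrier V \<Longrightarrow> w \<in> carrier W \<Longrightarrow>
     sgl (c \<odot>\<^bsub>V\<^esub> v, w) 1 - c \<star> sgl (v, w) 1 \<in> pmap.span (tensor_relators V W)"
  "v \<in> carrier V \<Longrightarrow> w \<in> carrier W \<Longrightarrow>
     sgl (v, c \<odot>\<^bsub>W\<^esub> w) 1 - c \<star> sgl (v, w) 1 \<in> pmap.span (tensor_relators V W)"
  unfolding tensor_relators_def Let_def
  subgoal by (rule pmap.span_base, rule UnI1, rule UnI1, rule UnI1, rule CollectI, blast)
  subgoal by (rule pmap.span_base, rule UnI1, rule UnI1, rule UnI2, rule CollectI, blast)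
  subgoal by (rule pmap.span_base, rule UnI1, rule UnI2, rule CollectI, blast)
  subgoal by (rule pmap.span_base, rule UnI2, rule CollectI, blast)
  done

text \<open>The universal property of the tensor product, for a map that is bilinear only modulo
  \<open>J\<close>.\<close>

lemma lift_span:
  assumes J: "pmap.subspace J"
    and a: "\<And>v v' w. v \<in> carrier V \<Longrightarrow> v' \<in> carrier V \<Longrightarrow> w \<in> carrier W \<Longrightarrow> \<beta> (v \<oplus>\<^bsub>V\<^esub> v', w) - \<beta> (v, w) - \<beta> (v', w) \<in> J"
      "\<And>v w w'. v \<in> carrier V \<Longrightarrow> w \<in> carrier W \<Longrightarrow> w' \<in> carrier W \<Longrightarrow> \<beta> (v, w \<oplus>\<^bsub>W\<^esub> w') - \<beta> (v, w) - \<beta> (v, w') \<in> J"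
      "\<And>c v w. v \<in> carrier V \<Longrightarrow> w \<in> carrier W \<Longrightarrow> \<beta> (c \<odot>\<^bsub>V\<^esub> v, w) - c \<star> \<beta> (v, w) \<in> J"
      "\<And>c v w. v \<in> carrier V \<Longrightarrow> w \<in> carrier W \<Longrightarrow> \<beta> (v, c \<odot>\<^bsub>W\<^esub> w) - c \<star> \<beta> (v, w) \<in> J"
    and p: "p \<in> pmap.span (tensor_relators V W)"
  shows "lext pm_scale \<beta> p \<in> J"
proof (rule pmap.span_induct[OF p, where P = "\<lambda>p. lext pm_scale \<beta> p \<in> J"])
  note [simp] = pmap.lext_add pmap.lext_diff lext_pm_scale[OF pmap.module_scale]
  show "pmap.subspace {p. lext pm_scale \<beta> p \<in> J}"
    unfolding pmap.subspace_def
    by (simp add: pmap.subspace_0[OF J] pmap.subspace_add[OF J] pmap.subspace_scale[OF J])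
  show "lext pm_scale \<beta> x \<in> J" if "x \<in> tensor_relators V W" for x
    using that unfolding tensor_relators_def Let_def
    by (elim UnE CollectE exE conjE) (simp_all add: a)
qed

end

section \<open>The multiplication map on tensors\<close>

context sl_params
begin

lemma mult_span:
  assumes r: "\<And>v. v \<in> carrier V \<Longrightarrow> r v \<in> fcar (gens M N)" "\<And>w. w \<in> carrier W' \<Longrightarrow> r' w \<in> fcar (gens M N)"
    and lin: "\<And>v v'. v \<in> carrier V \<Longrightarrow> v' \<in> carrier V \<Longrightarrow> r (v \<oplus>\<^bsub>V\<^esub> v') - r v - r v' \<in> U.I"
      "\<And>c v. v \<in> carrier V \<Longrightarrow> r (c \<odot>\<^bsub>V\<^esub> v) - c \<star> r v \<in> U.I"
    and lin': "\<And>w w'. w \<in> carrier W' \<Longrightarrow> w' \<in> carrier W' \<Longrightarrow> r' (w \<oplus>\<^bsub>W'\<^esub> w') - r' w - r' w' \<in> U.I"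
      "\<And>c w. w \<in> carrier W' \<Longrightarrow> r' (c \<odot>\<^bsub>W'\<^esub> w) - c \<star> r' w \<in> U.I"
    and p: "p \<in> pmap.span (tensor_relators V W')"
  shows "lext pm_scale (\<lambda>x. r (fst x) * r' (snd x)) p \<in> U.I"
proof (rule tens.lift_span[OF U.I_subspace _ _ _ _ p])
  fix v w c assume v: "v \<in> carrier V" and w: "w \<in> carrier W'"
  show "r (fst (v \<oplus>\<^bsub>V\<^esub> v', w)) * r' (snd (v \<oplus>\<^bsub>V\<^esub> v', w)) - r (fst (v, w)) * r' (snd (v, w)) - r (fst (v', w)) * r' (snd (v', w)) \<in> U.I"
    if "v' \<in> carrier V" for v'
    using U.I_right[OF lin(1)[OF v that] r(2)[OF w]] by (simp add: left_diff_distrib)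
  show "r (fst (v, w \<oplus>\<^bsub>W'\<^esub> w')) * r' (snd (v, w \<oplus>\<^bsub>W'\<^esub> w')) - r (fst (v, w)) * r' (snd (v, w)) - r (fst (v, w')) * r' (snd (v, w')) \<in> U.I"
    if "w' \<in> carrier W'" for w'
    using U.I_left[OF lin'(1)[OF w that] r(1)[OF v]] by (simp add: right_diff_distrib)
  show "r (fst (c \<odot>\<^bsub>V\<^esub> v, w)) * r' (snd (c \<odot>\<^bsub>V\<^esub> v, w)) - c \<star> (r (fst (v, w)) * r' (snd (v, w))) \<in> U.I"
    using U.I_right[OF lin(2)[OF v] r(2)[OF w]] by (simp add: left_diff_distrib falg.scale_mult_left)
  show "r (fst (v, c \<odot>\<^bsub>W'\<^esub> w)) * r' (snd (v, c \<odot>\<^bsub>W'\<^esub> w)) - c \<star> (r (fst (v, w)) * r' (snd (v, w))) \<in> U.I"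
    using U.I_left[OF lin'(2)[OF w] r(1)[OF v]] by (simp add: right_diff_distrib falg.scale_mult_right)
qed

text \<open>Representatives are chosen without regard to linearity; they depend linearly on the
  class only modulo the ideal.\<close>

definition rep :: "lgen set \<Rightarrow> lgen falg set \<Rightarrow> lgen falg"
  where "rep S X = (SOME p. p \<in> fcar S \<and> U.cls p = X)"

lemma rep:
  assumes "X \<in> U.cls ` fcar S"
  shows "rep S X \<in> fcar S" "U.cls (rep S X) = X"
proof -
  have "\<exists>p. p \<in> fcar S \<and> U.cls p = X" using assms by blast
  from someI_ex[OF this] show "rep S X \<in> fcar S" "U.cls (rep S X) = X" unfolding rep_def by blast+
qed

lemma rep_lin:
  assumes X: "X \<in> U.cls ` fcar S" and Y: "Y \<in> U.cls ` fcar S"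
  shows "rep S (X \<oplus>\<^bsub>U.Q\<^esub> Y) - rep S X - rep S Y \<in> U.I" "rep S (c \<odot>\<^bsub>U.Q\<^esub> X) - c \<star> rep S X \<in> U.I"
proof -
  have eq: "X \<oplus>\<^bsub>U.Q\<^esub> Y = U.cls (rep S X + rep S Y)" "c \<odot>\<^bsub>U.Q\<^esub> X = U.cls (c \<star> rep S X)"
    by (simp_all only: U.add_Q[symmetric] U.smult_Q[symmetric] rep(2)[OF X] rep(2)[OF Y])
  have in1: "X \<oplus>\<^bsub>U.Q\<^esub> Y \<in> U.cls ` fcar S" unfolding eq
    by (rule imageI[OF pmap.subspace_add[OF fcar_subspace rep(1)[OF X] rep(1)[OF Y]]])
  have in2: "c \<odot>\<^bsub>U.Q\<^esub> X \<in> U.cls ` fcar S" unfolding eq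
    by (rule imageI[OF pmap.subspace_scale[OF fcar_subspace rep(1)[OF X]]])
  show "rep S (X \<oplus>\<^bsub>U.Q\<^esub> Y) - rep S X - rep S Y \<in> U.I"
    using trans[OF rep(2)[OF in1] eq(1)] unfolding U.cls_eq by (simp only: diff_diff_eq)
  show "rep S (c \<odot>\<^bsub>U.Q\<^esub> X) - c \<star> rep S X \<in> U.I"
    using trans[OF rep(2)[OF in2] eq(2)] unfolding U.cls_eq .
qed

lemma rep_fcar: "X \<in> carrier (Uq_pm M N q e) \<Longrightarrow> rep (XE e) X \<in> fcar (gens M N)"
  "X \<in> carrier (Uq_0 M N q) \<Longrightarrow> rep KHS X \<in> fcar (gens M N)"
  unfolding pm_simps zero_simps by (rule subsetD[OF fcar_sub(1) rep(1)], assumption, rule subsetD[OF fcar_sub(2) rep(1)], assumption)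

interpretation T1: tens "Uq_pm M N q Minus" "Uq_0 M N q" .
interpretation T2: tens T1.Q "Uq_pm M N q Plus" .

abbreviation "S1 \<equiv> pmap.span (tensor_relators (Uq_pm M N q Minus) (Uq_0 M N q))"
abbreviation "S2 \<equiv> pmap.span (tensor_relators T1.Q (Uq_pm M N q Plus))"

definition f1 where "f1 p = lext pm_scale (\<lambda>x. rep (XE Minus) (fst x) * rep KHS (snd x)) p"

lemma f1_lin: "f1 (p + p') = f1 p + f1 p'" "f1 (p - p') = f1 p - f1 p'" "f1 (c \<star> p) = c \<star> f1 p"
  by (simp_all add: f1_def pmap.lext_add pmap.lext_diff lext_pm_scale[OF pmap.module_scale])

lemma f1_span: "p \<in> S1 \<Longrightarrow> f1 p \<in> U.I"
  unfolding f1_def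
  by (rule mult_span[OF rep_fcar])
    (assumption | simp only: pm_simps zero_simps, rule rep_lin, assumption, assumption
      | simp only: pm_simps zero_simps, rule rep_lin(2), assumption, assumption)+

lemma f1_fcar: "pkeys p \<subseteq> carrier (Uq_pm M N q Minus) \<times> carrier (Uq_0 M N q) \<Longrightarrow> f1 p \<in> fcar (gens M N)"
  unfolding f1_def lext_def
  by (intro pmap.subspace_sum[OF fcar_subspace] pmap.subspace_scale[OF fcar_subspace] fcar_mult rep_fcar) auto

text \<open>The product of the first two factors, through a chosen preimage in the free superspace;
  another choice changes it by an element of the ideal.\<close>

definition r1 where "r1 \<tau> = f1 (SOME p. T1.cls p = \<tau>)"

lemma r1: "r1 (T1.cls p) - f1 p \<in> U.I"
proof -
  have "T1.cls (SOME p'. T1.cls p' = T1.cls p) = T1.cls p" by (rule someI[where x = p]) (rule refl)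
  then have "(SOME p'. T1.cls p' = T1.cls p) - p \<in> S1" unfolding T1.cls_eq .
  from f1_span[OF this] show ?thesis unfolding r1_def f1_lin .
qed

lemma r1_facts:
  assumes "\<tau> \<in> carrier T1.Q"
  shows "r1 \<tau> \<in> fcar (gens M N)" "\<tau>' \<in> carrier T1.Q \<Longrightarrow> r1 (\<tau> \<oplus>\<^bsub>T1.Q\<^esub> \<tau>') - r1 \<tau> - r1 \<tau>' \<in> U.I"
    "r1 (c \<odot>\<^bsub>T1.Q\<^esub> \<tau>) - c \<star> r1 \<tau> \<in> U.I"
proof -
  obtain p where p: "\<tau> = T1.cls p" "f1 p \<in> fcar (gens M N)"
    using assms f1_fcar unfolding T1.carrier_tensor by blast
  have "r1 (T1.cls p) - f1 p + f1 p \<in> fcar (gens M N)"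
    by (rule pmap.subspace_add[OF fcar_subspace U.I_fcar[OF r1] p(2)])
  then show "r1 \<tau> \<in> fcar (gens M N)" by (simp add: p(1))
  show "r1 (\<tau> \<oplus>\<^bsub>T1.Q\<^esub> \<tau>') - r1 \<tau> - r1 \<tau>' \<in> U.I" if \<tau>': "\<tau>' \<in> carrier T1.Q"
  proof -
    obtain p' where p': "\<tau>' = T1.cls p'" using \<tau>' unfolding T1.carrier_tensor by blast
    have "(r1 (T1.cls (p + p')) - f1 (p + p')) - (r1 (T1.cls p) - f1 p) - (r1 (T1.cls p') - f1 p') \<in> U.I"
      by (intro pmap.subspace_diff[OF U.I_subspace] r1)
    then show ?thesis unfolding p(1) p' T1.add_Q by (simp add: f1_lin algebra_simps)
  qed
  have "(r1 (T1.cls (c \<star> p)) - f1 (c \<star> p)) - c \<star> (r1 (T1.cls p) - f1 p) \<in> U.I"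
    by (intro pmap.subspace_diff[OF U.I_subspace] pmap.subspace_scale[OF U.I_subspace] r1)
  then show "r1 (c \<odot>\<^bsub>T1.Q\<^esub> \<tau>) - c \<star> r1 \<tau> \<in> U.I"
    unfolding p(1) T1.smult_Q by (simp add: f1_lin pmap.scale_right_diff_distrib)
qed

definition f2 where "f2 p = lext pm_scale (\<lambda>x. r1 (fst x) * rep (XE Plus) (snd x)) p"

lemma f2_lin: "f2 (p + p') = f2 p + f2 p'" "f2 (p - p') = f2 p - f2 p'" "f2 (c \<star> p) = c \<star> f2 p" "f2 0 = 0"
  by (simp_all add: f2_def pmap.lext_add pmap.lext_diff lext_pm_scale[OF pmap.module_scale])

lemma f2_span: "p \<in> S2 \<Longrightarrow> f2 p \<in> U.I"
  unfolding f2_def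
  by (rule mult_span[OF r1_facts(1) rep_fcar(1) r1_facts(2,3)])
    (assumption | simp only: pm_simps, rule rep_lin, assumption, assumption
      | simp only: pm_simps, rule rep_lin(2), assumption, assumption)+

lemma f2_fcar: "pkeys p \<subseteq> carrier T1.Q \<times> carrier (Uq_pm M N q Plus) \<Longrightarrow> f2 p \<in> fcar (gens M N)"
  unfolding f2_def lext_def
  by (intro pmap.subspace_sum[OF fcar_subspace] pmap.subspace_scale[OF fcar_subspace] fcar_mult rep_fcar(1) r1_facts(1)) auto

definition mult_map where "mult_map X = U.cls (f2 (SOME p. T2.cls p = X))"

lemma mult_map: "mult_map (T2.cls p) = U.cls (f2 p)"
proof -
  have "T2.cls (SOME p'. T2.cls p' = T2.cls p) = T2.cls p" by (rule someI[where x = p]) (rule refl)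
  then have "(SOME p'. T2.cls p' = T2.cls p) - p \<in> S2" unfolding T2.cls_eq .
  from f2_span[OF this] show ?thesis unfolding mult_map_def U.cls_eq f2_lin .
qed

lemma mult_map_pure:
  assumes a: "a \<in> carrier (Uq_pm M N q Minus)" and b: "b \<in> carrier (Uq_0 M N q)" and c: "c \<in> carrier (Uq_pm M N q Plus)"
  shows "mult_map (T2.cls (sgl (T1.cls (sgl (a, b) 1), c) 1)) = a \<otimes>\<^bsub>U.Q\<^esub> b \<otimes>\<^bsub>U.Q\<^esub> c"
proof -
  let ?a = "rep (XE Minus) a" and ?b = "rep KHS b" and ?c = "rep (XE Plus) c"
  have f: "?a \<in> fcar (gens M N)" "?b \<in> fcar (gens M N)" "?c \<in> fcar (gens M N)"
    by (rule rep_fcar(1)[OF a] rep_fcar(2)[OF b] rep_fcar(1)[OF c])+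
  have cl: "U.cls ?a = a" "U.cls ?b = b" "U.cls ?c = c"
    by (rule rep(2)[OF a[unfolded pm_simps]] rep(2)[OF b[unfolded zero_simps]] rep(2)[OF c[unfolded pm_simps]])+
  have "(r1 (T1.cls (sgl (a, b) 1)) - f1 (sgl (a, b) 1)) * ?c \<in> U.I" by (rule U.I_right[OF r1 f(3)])
  then have "f2 (sgl (T1.cls (sgl (a, b) 1), c) 1) - ?a * ?b * ?c \<in> U.I"
    by (simp add: f1_def f2_def left_diff_distrib)
  then have "mult_map (T2.cls (sgl (T1.cls (sgl (a, b) 1), c) 1)) = U.cls (?a * ?b * ?c)" unfolding mult_map U.cls_eq .
  also have "\<dots> = a \<otimes>\<^bsub>U.Q\<^esub> b \<otimes>\<^bsub>U.Q\<^esub> c"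
    by (simp only: U.mult_pres[OF fcar_mult[OF f(1,2)] f(3), symmetric] U.mult_pres[OF f(1,2), symmetric] cl)
  finally show ?thesis .
qed

text \<open>A basis symbol of the outer free superspace and not yet a class, so that congruences
  modulo \<open>S2\<close> can be stated.\<close>

definition pure3 :: "lgen falg \<Rightarrow> lgen falg \<Rightarrow> lgen falg \<Rightarrow> _"
  where "pure3 a b c = sgl (T1.cls (sgl (U.cls a, U.cls b) (1 :: complex)), U.cls c) (1 :: complex)"

abbreviation "FM \<equiv> fcar (XE Minus)"
abbreviation "F0 \<equiv> fcar KHS"
abbreviation "FP \<equiv> fcar (XE Plus)"

lemma carriers: "a \<in> FM \<Longrightarrow> U.cls a \<in> carrier (Uq_pm M N q Minus)" "b \<in> F0 \<Longrightarrow> U.cls b \<in> carrier (Uq_0 M N q)"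
  "c \<in> FP \<Longrightarrow> U.cls c \<in> carrier (Uq_pm M N q Plus)"
  unfolding pm_simps zero_simps by (rule imageI, assumption)+

lemma T1_single: "x \<in> carrier (Uq_pm M N q Minus) \<Longrightarrow> y \<in> carrier (Uq_0 M N q) \<Longrightarrow> T1.cls (sgl (x, y) c) \<in> carrier T1.Q"
  unfolding T1.carrier_tensor by (rule imageI) simp

lemma pure3_key: "a \<in> FM \<Longrightarrow> b \<in> F0 \<Longrightarrow> T1.cls (sgl (U.cls a, U.cls b) 1) \<in> carrier T1.Q"
  by (rule T1_single[OF carriers(1,2)])

lemma pure3_add1:
  assumes "a \<in> FM" "a' \<in> FM" "b \<in> F0" "c \<in> FP"
  shows "pure3 (a + a') b c - pure3 a b c - pure3 a' b c \<in> S2"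
proof -
  have "T1.cls (sgl (U.cls (a + a'), U.cls b) 1) = T1.cls (sgl (U.cls a, U.cls b) 1) \<oplus>\<^bsub>T1.Q\<^esub> T1.cls (sgl (U.cls a', U.cls b) 1)"
    using T1.span_relators(1)[OF carriers(1)[OF assms(1)] carriers(1)[OF assms(2)] carriers(2)[OF assms(3)]]
    unfolding T1.add_Q T1.cls_eq pm_simps U.add_Q by (simp only: diff_diff_eq)
  with T2.span_relators(1)[OF pure3_key[OF assms(1,3)] pure3_key[OF assms(2,3)] carriers(3)[OF assms(4)]]
  show ?thesis unfolding pure3_def by (simp only:)
qed

lemma pure3_add2:
  assumes "a \<in> FM" "b \<in> F0" "b' \<in> F0" "c \<in> FP"
  shows "pure3 a (b + b') c - pure3 a b c - pure3 a b' c \<in> S2"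
proof -
  have "T1.cls (sgl (U.cls a, U.cls (b + b')) 1) = T1.cls (sgl (U.cls a, U.cls b) 1) \<oplus>\<^bsub>T1.Q\<^esub> T1.cls (sgl (U.cls a, U.cls b') 1)"
    using T1.span_relators(2)[OF carriers(1)[OF assms(1)] carriers(2)[OF assms(2)] carriers(2)[OF assms(3)]]
    unfolding T1.add_Q T1.cls_eq zero_simps U.add_Q by (simp only: diff_diff_eq)
  with T2.span_relators(1)[OF pure3_key[OF assms(1,2)] pure3_key[OF assms(1,3)] carriers(3)[OF assms(4)]]
  show ?thesis unfolding pure3_def by (simp only:)
qed

lemma pure3_add3:
  assumes "a \<in> FM" "b \<in> F0" "c \<in> FP" "c' \<in> FP"
  shows "pure3 a b (c + c') - pure3 a b c - pure3 a b c' \<in> S2"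
  using T2.span_relators(2)[OF pure3_key[OF assms(1,2)] carriers(3)[OF assms(3)] carriers(3)[OF assms(4)]]
  unfolding pure3_def pm_simps U.add_Q .

lemma pure3_scale1:
  assumes "a \<in> FM" "b \<in> F0" "c \<in> FP"
  shows "pure3 (k \<star> a) b c - k \<star> pure3 a b c \<in> S2"
proof -
  have "T1.cls (sgl (U.cls (k \<star> a), U.cls b) 1) = k \<odot>\<^bsub>T1.Q\<^esub> T1.cls (sgl (U.cls a, U.cls b) 1)"
    using T1.span_relators(3)[OF carriers(1)[OF assms(1)] carriers(2)[OF assms(2)], of k]
    unfolding T1.smult_Q T1.cls_eq pm_simps U.smult_Q .
  with T2.span_relators(3)[OF pure3_key[OF assms(1,2)] carriers(3)[OF assms(3)], of k]
  show ?thesis unfolding pure3_def by (simp only:)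
qed

lemma pure3_scale2:
  assumes "a \<in> FM" "b \<in> F0" "c \<in> FP"
  shows "pure3 a (k \<star> b) c - k \<star> pure3 a b c \<in> S2"
proof -
  have "T1.cls (sgl (U.cls a, U.cls (k \<star> b)) 1) = k \<odot>\<^bsub>T1.Q\<^esub> T1.cls (sgl (U.cls a, U.cls b) 1)"
    using T1.span_relators(4)[OF carriers(1)[OF assms(1)] carriers(2)[OF assms(2)], of k]
    unfolding T1.smult_Q T1.cls_eq zero_simps U.smult_Q .
  with T2.span_relators(3)[OF pure3_key[OF assms(1,2)] carriers(3)[OF assms(3)], of k]
  show ?thesis unfolding pure3_def by (simp only:)
qed

lemma pure3_scale3:
  assumes "a \<in> FM" "b \<in> F0" "c \<in> FP"
  shows "pure3 a b (k \<star> c) - k \<star> pure3 a b c \<in> S2"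
  using T2.span_relators(4)[OF pure3_key[OF assms(1,2)] carriers(3)[OF assms(3)], of k]
  unfolding pure3_def pm_simps U.smult_Q .

text \<open>\<open>normal_pair D v t\<close> pairs a combination \<open>v\<close> of normally ordered words, with parities in \<open>D\<close>, with
  the corresponding combination \<open>t\<close> of pure tensors.\<close>

inductive normal_pair for D where
  normal_pair_zero: "normal_pair D 0 0"
| normal_pair_wd: "set xs \<subseteq> XE Minus \<Longrightarrow> set ys \<subseteq> KHS \<Longrightarrow> set zs \<subseteq> XE Plus \<Longrightarrow>
    sum_list (map (gpar M) (xs @ ys @ zs)) \<in> D \<Longrightarrow>
    normal_pair D (c \<star> wd (xs @ ys @ zs)) (c \<star> pure3 (wd xs) (wd ys) (wd zs))"
| normal_pair_add: "normal_pair D v t \<Longrightarrow> normal_pair D v' t' \<Longrightarrow> normal_pair D (v + v') (t + t')"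

lemma normal_pair_scale: "normal_pair D v t \<Longrightarrow> normal_pair D (k \<star> v) (k \<star> t)"
proof (induction rule: normal_pair.induct)
  case normal_pair_zero
  show ?case using normal_pair.normal_pair_zero by simp
next
  case (normal_pair_wd xs ys zs c)
  show ?case using normal_pair.normal_pair_wd[OF normal_pair_wd, of "k * c"] by simp
next
  case (normal_pair_add v t v' t')
  from normal_pair.normal_pair_add[OF normal_pair_add(3,4)] show ?case by (simp only: pmap.scale_right_distrib)
qed

lemma normal_pair_f2: "normal_pair D v t \<Longrightarrow> f2 t - v \<in> U.I"
proof (induction rule: normal_pair.induct)
  case normal_pair_zero
  show ?case by (simp add: f2_lin U.I.zero)
next
  case (normal_pair_wd xs ys zs c)
  have w: "wd xs \<in> FM" "wd ys \<in> F0" "wd zs \<in> FP" by (rule fcar_wd[OF normal_pair_wd(1)] fcar_wd[OF normal_pair_wd(2)] fcar_wd[OF normal_pair_wd(3)])+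
  have g: "wd xs \<in> fcar (gens M N)" "wd ys \<in> fcar (gens M N)" "wd zs \<in> fcar (gens M N)"
    using subsetD[OF fcar_sub(1) w(1)] subsetD[OF fcar_sub(2) w(2)] subsetD[OF fcar_sub(1) w(3)] .
  have "U.cls (f2 (pure3 (wd xs) (wd ys) (wd zs))) = U.cls (wd xs * wd ys * wd zs)"
    using mult_map_pure[OF carriers(1)[OF w(1)] carriers(2)[OF w(2)] carriers(3)[OF w(3)]]
    unfolding mult_map pure3_def U.mult_pres[OF g(1,2)] U.mult_pres[OF fcar_mult[OF g(1,2)] g(3)] .
  then have "f2 (pure3 (wd xs) (wd ys) (wd zs)) - wd (xs @ ys @ zs) \<in> U.I"
    unfolding U.cls_eq by (simp only: wd_append mult.assoc)
  from pmap.subspace_scale[OF U.I_subspace this, of c] show ?case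
    by (simp only: f2_lin pmap.scale_right_diff_distrib)
next
  case (normal_pair_add v t v' t')
  from U.I.add[OF normal_pair_add(3,4)] show ?case by (simp add: f2_lin algebra_simps)
qed

lemma normal_pair_carrier: "normal_pair D v t \<Longrightarrow> pkeys t \<subseteq> carrier T1.Q \<times> carrier (Uq_pm M N q Plus)"
proof (induction rule: normal_pair.induct)
  case (normal_pair_wd xs ys zs c)
  have w: "wd xs \<in> FM" "wd ys \<in> F0" "wd zs \<in> FP" by (rule fcar_wd[OF normal_pair_wd(1)] fcar_wd[OF normal_pair_wd(2)] fcar_wd[OF normal_pair_wd(3)])+
  show ?case using pure3_key[OF w(1,2)] carriers(3)[OF w(3)] by (simp add: pure3_def)
next
  case (normal_pair_add v t v' t')
  then show ?case using Poly_Mapping.keys_add[of t t'] by blast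
qed simp

lemma normal_pair_homog: "normal_pair {d} v t \<Longrightarrow> pkeys t \<subseteq> \<Union>{homog T1.Q a \<times> homog (Uq_pm M N q Plus) b | a b. a + b = d}"
proof (induction rule: normal_pair.induct)
  case (normal_pair_wd xs ys zs c)
  define p where "p w = sum_list (map (gpar M) w)" for w
  have w: "wd xs \<in> FM" "wd ys \<in> F0" "wd zs \<in> FP" by (rule fcar_wd[OF normal_pair_wd(1)] fcar_wd[OF normal_pair_wd(2)] fcar_wd[OF normal_pair_wd(3)])+
  have h: "wd w \<in> fhomog (gpar M) (p w)" for w unfolding p_def by (rule fhomog_wd)
  have "U.cls (wd xs) \<in> homog (Uq_pm M N q Minus) (p xs)" "U.cls (wd ys) \<in> homog (Uq_0 M N q) (p ys)"
    and z: "U.cls (wd zs) \<in> homog (Uq_pm M N q Plus) (p zs)"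
    unfolding pm_simps zero_simps using w h by blast+
  then have "T1.cls (sgl (U.cls (wd xs), U.cls (wd ys)) 1) \<in> homog T1.Q (p xs + p ys)"
    unfolding T1.homog_tensor by (intro imageI) auto
  moreover have "p xs + p ys + p zs = d" using normal_pair_wd(4) by (simp only: p_def map_append sum_list_append add.assoc singleton_iff)
  ultimately have "(T1.cls (sgl (U.cls (wd xs), U.cls (wd ys)) 1), U.cls (wd zs))
    \<in> \<Union>{homog T1.Q a \<times> homog (Uq_pm M N q Plus) b | a b. a + b = d}" using z by blast
  then show ?case by (simp add: pure3_def)
next
  case (normal_pair_add v t v' t')
  then show ?case using Poly_Mapping.keys_add[of t t'] by blast
qed simp

lemma NS_normal_pair: "p \<in> NS d \<Longrightarrow> d \<in> D \<Longrightarrow> \<exists>v t. normal_pair D v t \<and> p - v \<in> U.I"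
proof (induction rule: NS_induct)
  case (NS_I p)
  then show ?case by (intro exI[of _ 0] conjI normal_pair_zero) simp
next
  case (NS_wd xs ys zs c)
  show ?case
    by (rule exI, rule exI, rule conjI, rule normal_pair_wd[OF NS_wd(1-3), of D c]) (use NS_wd(4,5) U.I.zero in simp_all)
next
  case (NS_add p r)
  then obtain v t v' t' where "normal_pair D v t" "normal_pair D v' t'" and I: "p - v \<in> U.I" "r - v' \<in> U.I" by blast
  then have "normal_pair D (v + v') (t + t')" by (intro normal_pair_add)
  moreover have "p + r - (v + v') \<in> U.I" using U.I.add[OF I] by (simp add: algebra_simps)
  ultimately show ?case by blast
qed

lemma normal_pair_exists:
  assumes "p \<in> fcar (gens M N)" "\<forall>w\<in>pkeys p. sum_list (map (gpar M) (letters w)) \<in> D"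
  shows "\<exists>v t. normal_pair D v t \<and> p - v \<in> U.I"
proof -
  have "pkeys p \<subseteq> {w. set (letters w) \<subseteq> gens M N \<and> sum_list (map (gpar M) (letters w)) \<in> D}"
    using assms unfolding fcar_def by blast
  then show ?thesis
  proof (induction p rule: pm_induct_on)
    case zero
    show ?case by (intro exI[of _ 0] conjI normal_pair_zero) (simp add: U.I.zero)
  next
    case (single w c)
    then have "c \<star> wd (letters w) \<in> NS (sum_list (map (gpar M) (letters w)))" by (intro NS_scale NS_all) simp
    moreover have "c \<star> wd (letters w) = sgl w c" by (simp add: wd_def)
    ultimately show ?case using NS_normal_pair[of "sgl w c"] single by simp
  next
    case (add p r)
    then obtain v t v' t' where "normal_pair D v t" "normal_pair D v' t'" and I: "p - v \<in> U.I" "r - v' \<in> U.I" by blast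
    then have "normal_pair D (v + v') (t + t')" by (intro normal_pair_add)
    moreover have "p + r - (v + v') \<in> U.I" using U.I.add[OF I] by (simp add: algebra_simps)
    ultimately show ?case by blast
  qed
qed

text \<open>Every tensor turns out to be represented in this way by normally ordered words; with
  \<open>normal_pair_injective\<close> this gives injectivity of the multiplication.\<close>

definition spanned where "spanned p \<longleftrightarrow> (\<exists>v t. normal_pair UNIV v t \<and> p - t \<in> S2)"

lemma spanned_zero: "spanned 0"
  unfolding spanned_def by (intro exI[of _ 0] conjI normal_pair_zero) (simp add: pmap.span_zero)

lemma spanned_add: "spanned p \<Longrightarrow> spanned r \<Longrightarrow> spanned (p + r)"
proof -
  assume "spanned p" "spanned r"
  then obtain v t v' t' where "normal_pair UNIV v t" "normal_pair UNIV v' t'" and I: "p - t \<in> S2" "r - t' \<in> S2" unfolding spanned_def by blast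
  then have "normal_pair UNIV (v + v') (t + t')" by (intro normal_pair_add)
  moreover have "p + r - (t + t') \<in> S2" using pmap.span_add[OF I] by (simp add: algebra_simps)
  ultimately show "spanned (p + r)" unfolding spanned_def by blast
qed

lemma spanned_scale: "spanned p \<Longrightarrow> spanned (k \<star> p)"
proof -
  assume "spanned p"
  then obtain v t where "normal_pair UNIV v t" and I: "p - t \<in> S2" unfolding spanned_def by blast
  then have "normal_pair UNIV (k \<star> v) (k \<star> t)" by (intro normal_pair_scale)
  moreover have "k \<star> p - k \<star> t \<in> S2" using pmap.span_scale[OF I, of k] by (simp only: pmap.scale_right_diff_distrib)
  ultimately show "spanned (k \<star> p)" unfolding spanned_def by blast
qed

lemma spanned_cong: "p - r \<in> S2 \<Longrightarrow> spanned r \<Longrightarrow> spanned p"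
proof -
  assume pr: "p - r \<in> S2" and "spanned r"
  then obtain v t where N: "normal_pair UNIV v t" and I: "r - t \<in> S2" unfolding spanned_def by blast
  have "p - t \<in> S2" using pmap.span_add[OF pr I] by simp
  then show "spanned p" unfolding spanned_def using N by blast
qed

text \<open>For a map that is linear modulo \<open>S2\<close> words suffice; applied to each
  argument of \<open>pure3\<close> in turn.\<close>

lemma spanned_linear:
  assumes h: "\<And>a a'. a \<in> fcar S \<Longrightarrow> a' \<in> fcar S \<Longrightarrow> h (a + a') - h a - h a' \<in> S2"
      "\<And>a k. a \<in> fcar S \<Longrightarrow> h (k \<star> a) - k \<star> h a \<in> S2"
    and w: "\<And>xs. set xs \<subseteq> S \<Longrightarrow> spanned (h (wd xs))" and "a \<in> fcar S"
  shows "spanned (h a)"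
  using assms(4)
proof (induction a rule: fcar_induct)
  case zero
  have "h 0 \<in> S2" using h(2)[of 0 0] by (simp add: fcar_intros)
  then show ?case using spanned_cong[of "h 0" 0] spanned_zero by simp
next
  case (wd xs c)
  show ?case by (rule spanned_cong[OF h(2)[OF fcar_wd[OF wd]] spanned_scale[OF w[OF wd]]])
next
  case (add p r)
  show ?case by (rule spanned_cong[OF h(1)[OF add(1,2), unfolded diff_diff_eq] spanned_add[OF add(3,4)]])
qed

lemma spanned_pure3:
  assumes "a \<in> FM" "b \<in> F0" "c \<in> FP"
  shows "spanned (pure3 a b c)"
proof -
  have 1: "spanned (pure3 (wd xs) (wd ys) (wd zs))" if "set xs \<subseteq> XE Minus" "set ys \<subseteq> KHS" "set zs \<subseteq> XE Plus" for xs ys zs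
    unfolding spanned_def using normal_pair_wd[OF that, of UNIV 1] by (intro exI conjI) (simp, simp add: pmap.span_zero)
  have 2: "spanned (pure3 (wd xs) (wd ys) c)" if "set xs \<subseteq> XE Minus" "set ys \<subseteq> KHS" for xs ys
    by (rule spanned_linear[where h = "pure3 (wd xs) (wd ys)",
        OF pure3_add3[OF fcar_wd[OF that(1)] fcar_wd[OF that(2)]] pure3_scale3[OF fcar_wd[OF that(1)] fcar_wd[OF that(2)]] 1[OF that] assms(3)])
  have 3: "spanned (pure3 (wd xs) b c)" if "set xs \<subseteq> XE Minus" for xs
    by (rule spanned_linear[where h = "\<lambda>b. pure3 (wd xs) b c",
        OF pure3_add2[OF fcar_wd[OF that] _ _ assms(3)] pure3_scale2[OF fcar_wd[OF that] _ assms(3)] 2[OF that] assms(2)])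
  show ?thesis
    by (rule spanned_linear[where h = "\<lambda>a. pure3 a b c",
        OF pure3_add1[OF _ _ assms(2,3)] pure3_scale1[OF _ assms(2,3)] 3 assms(1)])
qed

lemma spanned_all:
  assumes "pkeys p \<subseteq> carrier T1.Q \<times> carrier (Uq_pm M N q Plus)"
  shows "spanned p"
  using assms
proof (induction p rule: pm_induct_on)
  case (single x k)
  obtain \<tau> C where x: "x = (\<tau>, C)" "\<tau> \<in> carrier T1.Q" "C \<in> carrier (Uq_pm M N q Plus)" using single by auto
  obtain p1 where p1: "\<tau> = T1.cls p1" "pkeys p1 \<subseteq> carrier (Uq_pm M N q Minus) \<times> carrier (Uq_0 M N q)"
    using x(2) unfolding T1.carrier_tensor by blast
  have car: "T1.cls p \<in> carrier T1.Q" if "pkeys p \<subseteq> carrier (Uq_pm M N q Minus) \<times> carrier (Uq_0 M N q)" for p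
    unfolding T1.carrier_tensor using that by blast
  \<comment> \<open>The first slot holds an arbitrary tensor, which a second induction
    decomposes.\<close>
  have "spanned (sgl (T1.cls p1, C) 1)"
    using p1(2)
  proof (induction p1 rule: pm_induct_on)
    case zero
    have "sgl (0 \<odot>\<^bsub>T1.Q\<^esub> T1.cls 0, C) 1 - 0 \<star> sgl (T1.cls 0, C) 1 \<in> S2"
      by (rule T2.span_relators(3)[OF car x(3)]) simp
    then show ?case unfolding T1.smult_Q using spanned_cong[of "sgl (T1.cls 0, C) 1" 0] spanned_zero by simp
  next
    case (single y l)
    then obtain A B where y: "y = (A, B)" "A \<in> carrier (Uq_pm M N q Minus)" "B \<in> carrier (Uq_0 M N q)" by auto
    obtain a where a: "a \<in> FM" "A = U.cls a" using y(2) unfolding pm_simps by blast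
    obtain b where b: "b \<in> F0" "B = U.cls b" using y(3) unfolding zero_simps by blast
    obtain c where c: "c \<in> FP" "C = U.cls c" using x(3) unfolding pm_simps by blast
    have "spanned (sgl (T1.cls (sgl (A, B) 1), C) 1)"
      using spanned_pure3[OF a(1) b(1) c(1)] unfolding pure3_def a(2) b(2) c(2) .
    from spanned_cong[OF T2.span_relators(3)[OF T1_single[OF y(2,3)] x(3), of l] spanned_scale[OF this]]
    show ?case unfolding T1.smult_Q y(1) by simp
  next
    case (add p r)
    from spanned_cong[OF T2.span_relators(1)[OF car[OF add(1)] car[OF add(2)] x(3), unfolded diff_diff_eq] spanned_add[OF add(3,4)]]
    show ?case unfolding T1.add_Q .
  qed
  from spanned_scale[OF this, of k] show ?case by (simp add: x(1) p1(1))
next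
  case (add p r)
  then show ?case by (intro spanned_add)
qed (rule spanned_zero)

subsection \<open>Injectivity of the multiplication map\<close>

definition opp :: "sign \<Rightarrow> sign" where "opp e = (case e of Plus \<Rightarrow> Minus | Minus \<Rightarrow> Plus)"
definition fil :: "lgen set \<Rightarrow> lgen list \<Rightarrow> lgen list" where "fil S w = filter (\<lambda>g. g \<in> S) w"
text \<open>\<open>x\<close> belongs to the half of sign \<open>e\<close> and \<open>y\<close> to
  the other one, so that relations of either sign are treated alike.\<close>

definition TT where "TT e b x y = (case e of Plus \<Rightarrow> pure3 y b x | Minus \<Rightarrow> pure3 x b y)"

lemma fil: "set (fil S w) \<subseteq> S" "fil S (v @ w) = fil S v @ fil S w" "set w \<subseteq> S \<Longrightarrow> fil S w = w"
  "set w \<inter> S = {} \<Longrightarrow> fil S w = []"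
  by (auto simp: fil_def filter_id_conv filter_empty_conv)

lemma TT_lin:
  assumes "b \<in> F0" "x \<in> fcar (XE e)" "y \<in> fcar (XE (opp e))"
  shows "x' \<in> fcar (XE e) \<Longrightarrow> TT e b (x + x') y - TT e b x y - TT e b x' y \<in> S2" "TT e b (k \<star> x) y - k \<star> TT e b x y \<in> S2"
proof -
  show "TT e b (x + x') y - TT e b x y - TT e b x' y \<in> S2" if "x' \<in> fcar (XE e)"
  proof (cases e)
    case Plus
    then show ?thesis using pure3_add3[of y b x x'] assms that by (simp add: TT_def opp_def)
  next
    case Minus
    then show ?thesis using pure3_add1[of x x' b y] assms that by (simp add: TT_def opp_def)
  qed
  show "TT e b (k \<star> x) y - k \<star> TT e b x y \<in> S2"
  proof (cases e)
    case Plus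
    then show ?thesis using pure3_scale3[of y b x k] assms by (simp add: TT_def opp_def)
  next
    case Minus
    then show ?thesis using pure3_scale1[of x b y k] assms by (simp add: TT_def opp_def)
  qed
qed

lemma TT_I:
  assumes "b \<in> F0" "y \<in> fcar (XE (opp e))" "x \<in> U.I"
  shows "TT e b x y \<in> S2"
proof -
  have "U.cls x = U.cls 0" using assms(3) by (simp add: U.cls_eq)
  then have "TT e b x y = TT e b 0 y" by (cases e) (simp_all add: TT_def pure3_def)
  moreover have "TT e b (0 \<star> 0) y - 0 \<star> TT e b 0 y \<in> S2"
    by (rule TT_lin(2)[OF assms(1) pmap.subspace_0[OF fcar_subspace] assms(2)])
  ultimately show ?thesis by simp
qed

text \<open>A word goes to its negative and its positive letters, forgetting how they interleave.
  This is defined on all words and is the intended tensor on words whose negative letters come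
  first. Filtering the Cartan word keeps that slot in \<open>F0\<close> for every
  coefficient.\<close>

definition GT where "GT w l = lext pm_scale (\<lambda>y. pure3 (wd (fil (XE Minus) (letters w))) (wd (fil KHS (letters y)))
    (wd (fil (XE Plus) (letters w)))) (lift l)"

definition to_tensor where "to_tensor v = aext GT v"

lemma GT_lin: "GT w 0 = 0" "GT w (l + l') = GT w l + GT w l'"
  by (simp_all add: GT_def lift_add pmap.lext_add)

lemma to_tensor_zero: "to_tensor 0 = 0"
  by (simp add: to_tensor_def)

lemma to_tensor_add: "to_tensor (u + v) = to_tensor u + to_tensor v"
  unfolding to_tensor_def by (rule aext_add) (simp_all add: GT_lin)

lemma to_tensor_monom: "to_tensor (pscale (sgl k (sgl h c)) (wd w))
  = c \<star> TT e (wd (fil KHS (cword k h))) (wd (fil (XE e) w)) (wd (fil (XE (opp e)) w))"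
proof -
  have "to_tensor (pscale l (wd w)) = GT (Word w) l" for l
    unfolding to_tensor_def wd_def pscale_single mult_1_right by (rule aext_single) (rule GT_lin)
  moreover have "GT (Word w) (sgl k (sgl h c)) = c \<star> pure3 (wd (fil (XE Minus) w)) (wd (fil KHS (cword k h))) (wd (fil (XE Plus) w))"
    unfolding GT_def lift_monom lext_pm_scale[OF pmap.module_scale]
    by (subst (3) wd_def) simp
  ultimately show ?thesis by (cases e) (simp_all add: TT_def opp_def)
qed

lemma vscale_monom: "vscale c' (pscale (sgl k (sgl h c)) v) = pscale (sgl k (sgl h (c' * c))) v"
  by (simp add: vscale_def lconst_def mult_single)

text \<open>Between \<open>u\<close> and \<open>v\<close> a relation of sign \<open>e\<close>
  survives filtering inside one slot, where its multiples lie in the ideal; the other slot sees only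
  \<open>u\<close> and \<open>v\<close>.\<close>

lemma to_tensor_W: "z \<in> W \<Longrightarrow> to_tensor z \<in> S2"
proof (induction rule: W.induct)
  case W_zero
  show ?case by (simp add: to_tensor_zero pmap.span_zero)
next
  case (W_add a b)
  then show ?case by (simp add: to_tensor_add pmap.span_add)
next
  case (W_base R e l u v)
  have R: "R \<in> fcar (XE e)" using CR_wpos wpos_fcar W_base by blast
  let ?x = "\<lambda>R. wd (fil (XE e) u) * R * wd (fil (XE e) v)" and ?y = "wd (fil (XE (opp e)) (u @ v)) :: lgen falg"
  have fw: "wd (fil S w) \<in> fcar S" for S w by (rule fcar_wd[OF fil(1)])
  have x: "?x p \<in> fcar (XE e)" if "p \<in> fcar (XE e)" for p by (intro fcar_mult fw that)
  show ?case
  proof (induction l rule: laurent_induct)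
    case zero
    show ?case by (simp add: to_tensor_zero pmap.span_zero)
  next
    case (add l l')
    then show ?case by (simp add: pmod.scale_left_distrib to_tensor_add pmap.span_add)
  next
    case (monom k h c)
    let ?m = "sgl k (sgl h c)" and ?b = "wd (fil KHS (cword k h)) :: lgen falg"
    have "to_tensor (pscale ?m (wd u * emb p * wd v)) - c \<star> TT e ?b (?x p) ?y \<in> S2" if "p \<in> fcar (XE e)" for p
      using that
    proof (induction p rule: fcar_induct)
      case zero
      have "TT e ?b 0 ?y \<in> S2" by (rule TT_I[OF fw fw U.I.zero])
      from pmap.span_neg[OF pmap.span_scale[OF this, of c]] show ?case by (simp add: emb_zero to_tensor_zero)
    next
      case (wd xs c')
      have "pscale ?m (wd u * emb (c' \<star> wd xs) * wd v) = vscale c' (pscale ?m (wd (u @ xs @ v)))"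
        by (simp add: emb_simps wd_append mult.assoc vcal.scale_mult_left vcal.scale_mult_right vscale_pscale)
      then have 1: "to_tensor (pscale ?m (wd u * emb (c' \<star> wd xs) * wd v))
          = (c' * c) \<star> TT e ?b (wd (fil (XE e) (u @ xs @ v))) (wd (fil (XE (opp e)) (u @ xs @ v)))"
        by (simp only: vscale_monom to_tensor_monom[of k h _ _ e])
      have "set xs \<inter> XE (opp e) = {}" using wd by (cases e) (auto simp: opp_def)
      then have 2: "fil (XE (opp e)) (u @ xs @ v) = fil (XE (opp e)) (u @ v)" by (simp only: fil append_Nil)
      have 3: "wd (fil (XE e) (u @ xs @ v)) = ?x (wd xs)" by (simp only: fil(2) fil(3)[OF wd] wd_append mult.assoc)
      have 4: "?x (c' \<star> wd xs) = c' \<star> ?x (wd xs)" by (simp add: falg.scale_mult_left falg.scale_mult_right)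
      have "TT e ?b (c' \<star> ?x (wd xs)) ?y - c' \<star> TT e ?b (?x (wd xs)) ?y \<in> S2"
        by (rule TT_lin(2)[OF fw x[OF fcar_wd[OF wd]] fw])
      from pmap.span_neg[OF pmap.span_scale[OF this, of c]] show ?case
        unfolding 1 2 3 4 by (simp add: pmap.scale_right_diff_distrib mult.commute)
    next
      case (add p r)
      have d: "?x (p + r) = ?x p + ?x r" by (simp only: distrib_left distrib_right)
      have "TT e ?b (?x p + ?x r) ?y - TT e ?b (?x p) ?y - TT e ?b (?x r) ?y \<in> S2"
        by (rule TT_lin(1)[OF fw x[OF add(1)] fw x[OF add(2)]])
      from pmap.span_diff[OF pmap.span_add[OF add(3,4)] pmap.span_scale[OF this, of c]]
      show ?case unfolding d
        by (simp add: emb_simps distrib_left distrib_right pmod.scale_right_distrib to_tensor_add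
            pmap.scale_right_diff_distrib algebra_simps)
    qed
    from this[OF R] have 1: "to_tensor (pscale ?m (wd u * emb R * wd v)) - c \<star> TT e ?b (?x R) ?y \<in> S2" .
    have "?x R \<in> U.I"
      by (rule U.I.base[OF subsetD[OF CR_loop_rels W_base] subsetD[OF fcar_sub(1) fw] subsetD[OF fcar_sub(1) fw]])
    then have "TT e ?b (?x R) ?y \<in> S2" by (rule TT_I[OF fw fw])
    from pmap.span_add[OF 1 pmap.span_scale[OF this, of c]] show ?case by simp
  qed
qed

lemma Theta_vscale: "Theta (vscale c v) = vscale c (Theta v)"
proof (induction v rule: falg_induct)
  case (wd xs l)
  have "vscale c (pscale l (wd xs)) = pscale (lscale c l) (wd xs)" by (simp add: vscale_def lscale_def)
  then show ?case by (simp add: Theta_monom ev_simps app_simps)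
qed (simp_all add: Theta_zero Theta_add vcal.scale_right_distrib)

text \<open>The tensor is recovered from the word combination alone. The Cartan word chosen by
  \<open>lift\<close> may differ from \<open>ys\<close>, but it has the same class.\<close>

lemma normal_pair_to_tensor: "normal_pair D v t \<Longrightarrow> to_tensor (Theta (app (act v) 1)) = t"
proof (induction rule: normal_pair.induct)
  case normal_pair_zero
  show ?case by (simp add: app_ring Theta_zero to_tensor_zero)
next
  case (normal_pair_add v t v' t')
  then show ?case by (simp add: act_simps app_ring Theta_add to_tensor_add)
next
  case (normal_pair_wd xs ys zs c)
  let ?k = "kexps ys" and ?h = "hexps ys"
  have "\<forall>g\<in>set ys. is_cartan g" using normal_pair_wd(2) KHS_cartan by blast
  then have l: "lam (wd ys) = sgl ?k (sgl ?h 1)" by (rule lam_wd)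
  have "Theta (app (act (c \<star> wd (xs @ ys @ zs))) 1) = pscale (sgl ?k (sgl ?h c)) (wd (xs @ zs))"
    by (simp only: act_simps app_simps Theta_vscale Theta_normal[OF normal_pair_wd(1-3)] l vscale_monom mult_1_right)
  then have 1: "to_tensor (Theta (app (act (c \<star> wd (xs @ ys @ zs))) 1))
    = c \<star> TT Plus (wd (fil KHS (cword ?k ?h))) (wd (fil (XE Plus) (xs @ zs))) (wd (fil (XE Minus) (xs @ zs)))"
    using to_tensor_monom[of ?k ?h c "xs @ zs" Plus] by (simp only: opp_def sign.case)
  have k: "set (cword ?k ?h) \<subseteq> KHS" by (rule cword_KHS[OF normal_pair_wd(2)])
  have "set xs \<inter> XE Plus = {}" "set zs \<inter> XE Minus = {}" using normal_pair_wd(1,3) by auto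
  then have 2: "fil (XE Plus) (xs @ zs) = zs" "fil (XE Minus) (xs @ zs) = xs" "fil KHS (cword ?k ?h) = cword ?k ?h"
    using fil(3)[OF k] normal_pair_wd(1,3) by (simp_all add: fil)
  have "wd (cword ?k ?h) - wd ys \<in> U.I"
    by (rule cartan_words_I[OF k normal_pair_wd(2)]) (simp_all only: cword)
  then have "U.cls (wd (cword ?k ?h)) = U.cls (wd ys)" by (simp only: U.cls_eq)
  then show ?case unfolding 1 2 TT_def pure3_def by simp
qed

text \<open>Acting on the empty word leads from the ideal into \<open>W\<close>,
  \<open>Theta\<close> stays in \<open>W\<close>, and \<open>to_tensor\<close> ends in
  \<open>S2\<close>; on \<open>v\<close> the composite gives back \<open>t\<close>.\<close>

lemma normal_pair_injective:
  assumes "normal_pair D v t" "v \<in> U.I"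
  shows "t \<in> S2"
proof -
  have "app (act v) 1 \<in> W" using act_I[OF assms(2)] unfolding J_def by blast
  from to_tensor_W[OF Theta_W[OF this]] show ?thesis unfolding normal_pair_to_tensor[OF assms(1)] .
qed

text \<open>Homogeneity of a class expressed on representatives, since a chosen representative need
  not be homogeneous itself.\<close>

definition mod_homog :: "bit \<Rightarrow> lgen falg set"
  where "mod_homog d = {p. \<exists>p'\<in>fhomog (gpar M) d \<inter> fcar (gens M N). p - p' \<in> U.I}"

lemma mod_homog_intro: "p' \<in> fhomog (gpar M) d \<Longrightarrow> p' \<in> fcar (gens M N) \<Longrightarrow> p - p' \<in> U.I \<Longrightarrow> p \<in> mod_homog d"
  unfolding mod_homog_def by blast

lemma mod_homog_elim:
  assumes "p \<in> mod_homog d"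
  obtains p' where "p' \<in> fhomog (gpar M) d" "p' \<in> fcar (gens M N)" "p - p' \<in> U.I"
  using assms unfolding mod_homog_def by blast

lemma mod_homog_zero: "0 \<in> mod_homog d"
  by (rule mod_homog_intro[of 0]) (simp_all add: fcar_intros U.I.zero)

lemma mod_homog_add:
  assumes "p \<in> mod_homog d" "r \<in> mod_homog d"
  shows "p + r \<in> mod_homog d"
proof -
  from assms(1) obtain p' where p: "p' \<in> fhomog (gpar M) d" "p' \<in> fcar (gens M N)" "p - p' \<in> U.I" by (rule mod_homog_elim)
  from assms(2) obtain r' where r: "r' \<in> fhomog (gpar M) d" "r' \<in> fcar (gens M N)" "r - r' \<in> U.I" by (rule mod_homog_elim)
  show ?thesis
    by (rule mod_homog_intro[OF fhomog_add[OF p(1) r(1)] pmap.subspace_add[OF fcar_subspace p(2) r(2)]])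
      (use U.I.add[OF p(3) r(3)] in \<open>simp add: algebra_simps\<close>)
qed

lemma mod_homog_scale:
  assumes "p \<in> mod_homog d"
  shows "c \<star> p \<in> mod_homog d"
proof -
  from assms obtain p' where p: "p' \<in> fhomog (gpar M) d" "p' \<in> fcar (gens M N)" "p - p' \<in> U.I" by (rule mod_homog_elim)
  show ?thesis
    by (rule mod_homog_intro[OF fhomog_scale[OF p(1)] pmap.subspace_scale[OF fcar_subspace p(2)]])
      (use pmap.subspace_scale[OF U.I_subspace p(3), of c] in \<open>simp only: pmap.scale_right_diff_distrib\<close>)
qed

lemma mod_homog_cong: "p - r \<in> U.I \<Longrightarrow> r \<in> mod_homog d \<Longrightarrow> p \<in> mod_homog d"
proof (erule mod_homog_elim)
  fix p' assume "p - r \<in> U.I" "p' \<in> fhomog (gpar M) d" "p' \<in> fcar (gens M N)" "r - p' \<in> U.I"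
  then show "p \<in> mod_homog d" using U.I.add[of "p - r" "r - p'"] by (intro mod_homog_intro[of p']) simp_all
qed

lemma mod_homog_mult:
  assumes "p \<in> mod_homog d" "r \<in> mod_homog d'"
  shows "p * r \<in> mod_homog (d + d')"
proof -
  from assms(1) obtain p' where p: "p' \<in> fhomog (gpar M) d" "p' \<in> fcar (gens M N)" "p - p' \<in> U.I" by (rule mod_homog_elim)
  from assms(2) obtain r' where r: "r' \<in> fhomog (gpar M) d'" "r' \<in> fcar (gens M N)" "r - r' \<in> U.I" by (rule mod_homog_elim)
  have "r - r' + r' \<in> fcar (gens M N)" by (rule pmap.subspace_add[OF fcar_subspace U.I_fcar[OF r(3)] r(2)])
  then have rf: "r \<in> fcar (gens M N)" by simp
  have "(p - p') * r + p' * (r - r') \<in> U.I" by (rule U.I.add[OF U.I_right[OF p(3) rf] U.I_left[OF r(3) p(2)]])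
  then have "p * r - p' * r' \<in> U.I" by (simp add: left_diff_distrib right_diff_distrib)
  then show ?thesis by (rule mod_homog_intro[OF fhomog_mult[OF p(1) r(1)] fcar_mult[OF p(2) r(2)]])
qed

lemma mod_homog_cls: "p \<in> mod_homog d \<Longrightarrow> U.cls p \<in> homog U.Q d"
proof (erule mod_homog_elim)
  fix p' assume p: "p' \<in> fhomog (gpar M) d" "p' \<in> fcar (gens M N)" "p - p' \<in> U.I"
  then have "U.cls p = U.cls p'" by (simp only: U.cls_eq)
  then show "U.cls p \<in> homog U.Q d" unfolding U.homog_pres using p by blast
qed

lemma mod_homog_rep:
  assumes "X \<in> U.cls ` (fhomog (gpar M) d \<inter> fcar S)" "S \<subseteq> gens M N"
  shows "rep S X \<in> mod_homog d"
proof -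
  obtain p where p: "p \<in> fhomog (gpar M) d" "p \<in> fcar S" "X = U.cls p" using assms(1) by blast
  then have "U.cls (rep S X) = U.cls p" using rep(2)[of X S] by blast
  then have "rep S X - p \<in> U.I" unfolding U.cls_eq .
  then show ?thesis by (rule mod_homog_intro[OF p(1) subsetD[OF fcar_mono[OF assms(2)] p(2)]])
qed

lemma mod_homog_f1: "pkeys p \<subseteq> \<Union>{homog (Uq_pm M N q Minus) a \<times> homog (Uq_0 M N q) b | a b. a + b = d} \<Longrightarrow> f1 p \<in> mod_homog d"
proof (induction p rule: pm_induct_on)
  case zero
  show ?case by (simp add: f1_def mod_homog_zero)
next
  case (single x c)
  then obtain a b A B where x: "x = (A, B)" "A \<in> homog (Uq_pm M N q Minus) a" "B \<in> homog (Uq_0 M N q) b" "a + b = d" by blast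
  have "rep (XE Minus) A * rep KHS B \<in> mod_homog (a + b)"
    using x(2,3) unfolding pm_simps zero_simps by (intro mod_homog_mult mod_homog_rep gens_sub)
  from mod_homog_scale[OF this, of c] show ?case unfolding x(4) by (simp add: f1_def x(1))
next
  case (add p r)
  then show ?case unfolding f1_lin by (intro mod_homog_add)
qed

lemma mod_homog_f2: "pkeys p \<subseteq> \<Union>{homog T1.Q a \<times> homog (Uq_pm M N q Plus) b | a b. a + b = d} \<Longrightarrow> f2 p \<in> mod_homog d"
proof (induction p rule: pm_induct_on)
  case zero
  show ?case by (simp add: f2_lin mod_homog_zero)
next
  case (single x c)
  then obtain a b A B where x: "x = (A, B)" "A \<in> homog T1.Q a" "B \<in> homog (Uq_pm M N q Plus) b" "a + b = d" by blast
  obtain p1 where p1: "A = T1.cls p1" "f1 p1 \<in> mod_homog a" using x(2) mod_homog_f1 unfolding T1.homog_tensor by blast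
  have "r1 A \<in> mod_homog a" unfolding p1(1) by (rule mod_homog_cong[OF r1 p1(2)])
  moreover have "rep (XE Plus) B \<in> mod_homog b" using x(3) unfolding pm_simps by (intro mod_homog_rep gens_sub)
  ultimately have "r1 A * rep (XE Plus) B \<in> mod_homog (a + b)" by (rule mod_homog_mult)
  from mod_homog_scale[OF this, of c] show ?case unfolding x(4) by (simp add: f2_def x(1))
next
  case (add p r)
  then show ?case unfolding f2_lin by (intro mod_homog_add)
qed

theorem tensor_iso:
  "\<exists>f \<in> superspace_iso (tensor (tensor (Uq_pm M N q Minus) (Uq_0 M N q)) (Uq_pm M N q Plus)) (Uq M N q).
     \<forall>a\<in>carrier (Uq_pm M N q Minus). \<forall>b\<in>carrier (Uq_0 M N q). \<forall>c\<in>carrier (Uq_pm M N q Plus).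
       f (pure_tensor (tensor (Uq_pm M N q Minus) (Uq_0 M N q)) (Uq_pm M N q Plus)
           (pure_tensor (Uq_pm M N q Minus) (Uq_0 M N q) a b) c) = a \<otimes>\<^bsub>Uq M N q\<^esub> b \<otimes>\<^bsub>Uq M N q\<^esub> c"
  unfolding T1.tensor_eq T1.pure_eq T2.tensor_eq T2.pure_eq Uq_eq
proof (intro bexI[of _ mult_map] ballI mult_map_pure)
  let ?C = "{p. pkeys p \<subseteq> carrier T1.Q \<times> carrier (Uq_pm M N q Plus)}"
  have normal_pair_mult_map: "mult_map (T2.cls t) = U.cls p" if "normal_pair D v t" "p - v \<in> U.I" for D v t p
    unfolding mult_map U.cls_eq using pmap.subspace_diff[OF U.I_subspace normal_pair_f2[OF that(1)] that(2)] by simp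
  have inj: "inj_on mult_map (T2.cls ` ?C)"
  proof (rule inj_onI)
    fix X Y assume "X \<in> T2.cls ` ?C" "Y \<in> T2.cls ` ?C" and XY: "mult_map X = mult_map Y"
    then obtain p r where p: "X = T2.cls p" "p \<in> ?C" and r: "Y = T2.cls r" "r \<in> ?C" by blast
    have d: "f2 (p - r) \<in> U.I" using XY unfolding p(1) r(1) mult_map U.cls_eq f2_lin .
    have "pkeys (p - r) \<subseteq> pkeys p \<union> pkeys r" by (auto simp: in_keys_iff lookup_minus)
    then have "pkeys (p - r) \<subseteq> carrier T1.Q \<times> carrier (Uq_pm M N q Plus)" using p(2) r(2) by blast
    \<comment> \<open>The difference is congruent to a normal tensor \<open>t\<close>; its word
      combination \<open>v\<close> then lies in the ideal, which forces \<open>t\<close> and hence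
      the difference into \<open>S2\<close>.\<close>
    from spanned_all[OF this] obtain v t where t: "normal_pair UNIV v t" "p - r - t \<in> S2" unfolding spanned_def by blast
    have "f2 (p - r) - f2 t \<in> U.I" using f2_span[OF t(2)] unfolding f2_lin .
    from pmap.subspace_diff[OF U.I_subspace pmap.subspace_diff[OF U.I_subspace d this] normal_pair_f2[OF t(1)]]
    have "v \<in> U.I" by simp
    from pmap.span_add[OF t(2) normal_pair_injective[OF t(1) this]] have "p - r \<in> S2" by simp
    then show "X = Y" unfolding p(1) r(1) T2.cls_eq .
  qed
  have surj: "mult_map ` T2.cls ` ?C = U.cls ` fcar (gens M N)"
  proof
    show "mult_map ` T2.cls ` ?C \<subseteq> U.cls ` fcar (gens M N)"
      unfolding image_image mult_map using f2_fcar by blast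
    show "U.cls ` fcar (gens M N) \<subseteq> mult_map ` T2.cls ` ?C"
    proof
      fix X assume "X \<in> U.cls ` fcar (gens M N)"
      then obtain p where p: "X = U.cls p" "p \<in> fcar (gens M N)" by blast
      from normal_pair_exists[OF p(2), of UNIV] obtain v t where t: "normal_pair UNIV v t" "p - v \<in> U.I" by blast
      have "X = mult_map (T2.cls t)" unfolding p(1) by (rule normal_pair_mult_map[OF t, symmetric])
      moreover have "t \<in> ?C" using normal_pair_carrier[OF t(1)] by simp
      ultimately show "X \<in> mult_map ` T2.cls ` ?C" by blast
    qed
  qed
  have bij: "bij_betw mult_map (carrier T2.Q) (carrier U.Q)"
    unfolding bij_betw_def T2.carrier_tensor U.carrier_pres using inj surj by blast
  have hom: "mult_map ` homog T2.Q d = homog U.Q d" for d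
  proof
    show "mult_map ` homog T2.Q d \<subseteq> homog U.Q d"
    proof
      fix X assume "X \<in> mult_map ` homog T2.Q d"
      then obtain p where "X = mult_map (T2.cls p)" "f2 p \<in> mod_homog d" using mod_homog_f2 unfolding T2.homog_tensor by blast
      then show "X \<in> homog U.Q d" unfolding mult_map using mod_homog_cls by blast
    qed
    show "homog U.Q d \<subseteq> mult_map ` homog T2.Q d"
    proof
      fix X assume "X \<in> homog U.Q d"
      then obtain p where p: "X = U.cls p" "p \<in> fhomog (gpar M) d" "p \<in> fcar (gens M N)" unfolding U.homog_pres by blast
      \<comment> \<open>Straightening preserves parity, so a homogeneous class has a preimage made
        of normal words of the same parity.\<close>
      have "\<forall>w\<in>pkeys p. sum_list (map (gpar M) (letters w)) \<in> {d}" using p(2) by (simp add: fhomog_def)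
      from normal_pair_exists[OF p(3) this] obtain v t where t: "normal_pair {d} v t" "p - v \<in> U.I" by blast
      have "X = mult_map (T2.cls t)" unfolding p(1) by (rule normal_pair_mult_map[OF t, symmetric])
      then show "X \<in> mult_map ` homog T2.Q d" unfolding T2.homog_tensor using normal_pair_homog[OF t(1)] by blast
    qed
  qed
  have add: "mult_map (X \<oplus>\<^bsub>T2.Q\<^esub> Y) = mult_map X \<oplus>\<^bsub>U.Q\<^esub> mult_map Y" if X: "X \<in> carrier T2.Q" and Y: "Y \<in> carrier T2.Q" for X Y
  proof -
    obtain p where p: "X = T2.cls p" using X unfolding T2.carrier_tensor by blast
    obtain r where r: "Y = T2.cls r" using Y unfolding T2.carrier_tensor by blast
    show ?thesis unfolding p r T2.add_Q mult_map U.add_Q f2_lin ..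
  qed
  have scal: "mult_map (c \<odot>\<^bsub>T2.Q\<^esub> X) = c \<odot>\<^bsub>U.Q\<^esub> mult_map X" if X: "X \<in> carrier T2.Q" for X c
  proof -
    obtain p where p: "X = T2.cls p" using X unfolding T2.carrier_tensor by blast
    show ?thesis unfolding p T2.smult_Q mult_map U.smult_Q f2_lin ..
  qed
  show "mult_map \<in> superspace_iso T2.Q U.Q"
    unfolding superspace_iso_def linear_iso_def using bij add scal hom by blast
qed

end

theorem theorem3p3:
  fixes M N :: nat and q :: complex
  assumes "M \<ge> 1" and "N \<ge> 1"
    and "q \<noteq> 0" and "\<forall>n::nat. n > 0 \<longrightarrow> q ^ n \<noteq> 1"
  shows
    "(let U = Uq M N q; Um = Uq_pm M N q Minus; U0 = Uq_0 M N q; Up = Uq_pm M N q Plus in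
       \<exists>f \<in> superspace_iso (tensor (tensor Um U0) Up) U.
         \<forall>a\<in>carrier Um. \<forall>b\<in>carrier U0. \<forall>c\<in>carrier Up.
           f (pure_tensor (tensor Um U0) Up (pure_tensor Um U0 a b) c) = a \<otimes>\<^bsub>U\<^esub> b \<otimes>\<^bsub>U\<^esub> c)
     \<and> (\<forall>e. \<exists>f \<in> superalgebra_iso (half_alg M N q e) (Uq_pm M N q e).
          \<forall>i\<in>nodes M N. \<forall>n. f (half_gen M N q e i n) = Uq_gen M N q (XG e i n))
     \<and> (\<exists>f \<in> algebra_iso (Uq_0 M N q) (laurent_alg M N).
          (\<forall>i\<in>nodes M N. \<forall>s. s \<noteq> 0 \<longrightarrow> f (Uq_gen M N q (HG i s)) = laurent_h i s) \<and>
          (\<forall>i\<in>nodes M N. \<forall>e. f (Uq_gen M N q (KG e i)) = laurent_K e i))"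
proof -
  interpret sl_params M N q
    by (rule sl_params.intro) (use assms in auto)
  show ?thesis unfolding Let_def by (intro conjI allI tensor_iso half_iso cartan_iso)
qed

end
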